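(* Let $\Omega\subset\mathbb{R}^N$ be a bounded Lipschitz domain, and let $W\colon\mathbb{R}^{d\times N}\to[0,+\infty)$ and $\psi\colon\mathbb{R}^d\times\mathbb{S}^{N-1}\to[0,+\infty)$ be continuous functions satisfying (W1)–(W3) and ($\psi$1)–($\psi$3). For $(g,G)\in SBV(\Omega;\mathbb{R}^d)\times L^1(\Omega;\mathbb{R}^{d\times N})$ and $R>0$ define $$\hat E_R(g,G;\Omega):=\int_\Omega\big(W(\nabla g)+R|\nabla g-G|\big)\,dx+\int_{S_g\cap\Omega}\psi([g],\nu_g)\,d\mathcal{H}^{N-1}(x),$$ and for $(g,G)\in BV(\Omega;\mathbb{R}^d)\times\mathcal{M}(\Omega;\mathbb{R}^{d\times N})$ define its relaxation $$\hat I_R(g,G;\Omega):=\inf\Big\{\liminf_{n\to\infty}\hat E_R(g_n,G_n;\Omega)\ \Big|\ (g_n,G_n)\in SBV(\Omega;\mathbb{R}^d)\times L^1(\Omega;\mathbb{R}^{d\times N}),\ (g_n,G_n)\stackrel{*}{\rightharpoonup}(g,G)\text{ in }BV\times\mathcal{M}\Big\}.$$ Then there exists $R_0=R_0(N,W,\psi)>0$ such that $$\hat I_R(g,G;\Omega)=I(g,G;\Omega)\quad\text{for all }R\ge R_0\text{ and all }(g,G)\in BV(\Omega;\mathbb{R}^d)\times\mathcal{M}(\Omega;\mathbb{R}^{d\times N}),$$ where $$I(g,G;\Omega):=\inf\Big\{\liminf_{n\to\infty}E(u_n;\Omega):\ \{u_n\}\subset SBV(\Omega;\mathbb{R}^d),\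 u_n\stackrel{*}{\rightharpoonup}g\text{ in }BV(\Omega;\mathbb{R}^d),\ \nabla u_n\stackrel{*}{\rightharpoonup}G\text{ in }\mathcal{M}(\Omega;\mathbb{R}^{d\times N})\Big\}$$ and $E(u;\Omega):=\int_\Omega W(\nabla u)\,dx+\int_{\Omega\cap S_u}\psi([u],\nu_u)\,d\mathcal{H}^{N-1}(x)$ for $u\in SBV(\Omega;\mathbb{R}^d)$.
   Context: Assumptions, for all $A\in\mathbb{R}^{d\times N}$, $\lambda,\lambda_1,\lambda_2\in\mathbb{R}^d$, $\nu\in\mathbb{S}^{N-1}$, with positive constants $c_W,C_W,c_\psi,C_\psi$: (W1) $c_W|A|\le W(A)\le C_W(1+|A|)$. (W2) $W$ is globally Lipschitz continuous. (W3) There exist $c>0$ and $0<\alpha<1$ such that $\big|W^\infty(A)-\frac{W(tA)}{t}\big|\le \frac{c|A|^{1-\alpha}}{t^\alpha}$ whenever $t>0$ and $t|A|\ge1$, where $W^\infty(A):=\limsup_{t\to+\infty}\frac{W(tA)}{t}$. ($\psi$1) $c_\psi|\lambda|\le\psi(\lambda,\nu)\le C_\psi|\lambda|$. ($\psi$2) $\psi(t\lambda,\nu)=t\psi(\lambda,\nu)$ for all $t>0$, and $\psi(-\lambda,-\nu)=\psi(\lambda,\nu)$. ($\psi$3) $\psi(\lambda_1+\lambda_2,\nu)\le\psi(\lambda_1,\nu)+\psi(\lambda_2,\nu)$. For $u\in SBV$, $\nabla u$ is the density of the absolutely continuous part of $Du$, $S_u$ the jump set, $[u]$ the jump and $\nu_u$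 the jump normal. $\mathcal{M}(\Omega;\mathbb{R}^{d\times N})$ is the space of finite $\mathbb{R}^{d\times N}$-valued Radon measures on $\Omega$ with weak* convergence in duality with $C_0(\Omega)$; $L^1$ functions are identified with the measures having them as Lebesgue densities. Weak* convergence $u_n\stackrel{*}{\rightharpoonup}g$ in $BV$ means $u_n\to g$ in $L^1$ and $Du_n\stackrel{*}{\rightharpoonup}Dg$ in $\mathcal{M}$; weak* convergence of pairs in $BV\times\mathcal{M}$ is componentwise. *)

theory Defs
  imports "HOL-Analysis.Analysis"
begin

subsection \<open>Lipschitz domains\<close>

text \<open>Near every boundary point the set is the strict epigraph, in some unit direction \<open>e\<close>, of a
  Lipschitz function \<open>\<gamma>\<close> of the component orthogonal to \<open>e\<close>.\<close>

definition bounded_lipschitz_domain :: "'a::euclidean_space set \<Rightarrow> bool" where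
  "bounded_lipschitz_domain \<Omega> \<longleftrightarrow>
     open \<Omega> \<and> connected \<Omega> \<and> \<Omega> \<noteq> {} \<and> bounded \<Omega> \<and>
     (\<forall>p\<in>frontier \<Omega>. \<exists>e r L. \<exists>\<gamma>::'a \<Rightarrow> real. norm e = 1 \<and> r > 0 \<and>
        L-lipschitz_on {z. z \<bullet> e = 0} \<gamma> \<and>
        \<Omega> \<inter> ball p r = {y \<in> ball p r. \<gamma> (y - (y \<bullet> e) *\<^sub>R e) < y \<bullet> e})"


subsection \<open>Hausdorff measure\<close>

text \<open>The \<open>k\<close>-dimensional Hausdorff measure, normalised so that it agrees with Lebesgue measure in
  dimension \<open>k\<close>. As \<open>0 ^ 0 = 1\<close>, empty covering sets need a separate case when \<open>k = 0\<close>; the library's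
  \<^const>\<open>diameter\<close> is meaningful for bounded sets only.\<close>

definition hausdorff_gauge :: "nat \<Rightarrow> 'a::metric_space set \<Rightarrow> ennreal" where
  "hausdorff_gauge k C =
     (if C = {} then 0 else ennreal (unit_ball_vol (real k) * (diameter C / 2) ^ k))"

definition hausdorff_outer :: "nat \<Rightarrow> 'a::metric_space set \<Rightarrow> ennreal" where
  "hausdorff_outer k E =
     (SUP \<delta>\<in>{0<..}. INF C\<in>{C::nat \<Rightarrow> 'a set. E \<subseteq> (\<Union>i. C i) \<and>
          (\<forall>i. bounded (C i) \<and> diameter (C i) \<le> \<delta>)}. \<Sum>i. hausdorff_gauge k (C i))"

definition hausdorff_measure :: "nat \<Rightarrow> 'a::metric_space measure" where
  "hausdorff_measure k = measure_of UNIV (sets borel) (hausdorff_outer k)"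


subsection \<open>Finite vector-valued Radon measures\<close>

abbreviation borel_on :: "'a::topological_space set \<Rightarrow> 'a set set" where
  "borel_on \<Omega> \<equiv> sets (restrict_space borel \<Omega>)"

text \<open>Finite vector measures on (the Borel subsets of) an open subset of a Euclidean space are
  automatically Radon. A measure is a function on all sets, fixed to be \<open>0\<close> off the
  \<open>\<sigma>\<close>-algebra so that measures are determined by their values on it.\<close>

definition radon_measures :: "'a::euclidean_space set \<Rightarrow> ('a set \<Rightarrow> 'b::euclidean_space) set" where
  "radon_measures \<Omega> =
     {\<mu>. (\<forall>B. B \<notin> borel_on \<Omega> \<longrightarrow> \<mu> B = 0) \<and>
         (\<forall>A::nat \<Rightarrow> 'a set. range A \<subseteq> borel_on \<Omega> \<longrightarrow> disjoint_family A \<longrightarrow>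
            (\<lambda>i. \<mu> (A i)) sums \<mu> (\<Union>i. A i))}"

definition total_variation ::
    "'a::euclidean_space set \<Rightarrow> ('a set \<Rightarrow> 'b::euclidean_space) \<Rightarrow> 'a measure" where
  "total_variation \<Omega> \<mu> = measure_of \<Omega> (borel_on \<Omega>)
     (\<lambda>E. SUP A\<in>{A::nat \<Rightarrow> 'a set. range A \<subseteq> borel_on \<Omega> \<and> disjoint_family A \<and> (\<Union>i. A i) = E}.
            \<Sum>i. ennreal (norm (\<mu> (A i))))"

text \<open>Jordan decomposition \<open>\<mu> = \<mu>\<^sup>+ - \<mu>\<^sup>-\<close> of a finite signed measure, and integration against it.\<close>

definition pos_part :: "'a::euclidean_space set \<Rightarrow> ('a set \<Rightarrow> real) \<Rightarrow> 'a measure" where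
  "pos_part \<Omega> \<mu> = measure_of \<Omega> (borel_on \<Omega>)
     (\<lambda>E. ennreal ((measure (total_variation \<Omega> \<mu>) E + \<mu> E) / 2))"

definition neg_part :: "'a::euclidean_space set \<Rightarrow> ('a set \<Rightarrow> real) \<Rightarrow> 'a measure" where
  "neg_part \<Omega> \<mu> = measure_of \<Omega> (borel_on \<Omega>)
     (\<lambda>E. ennreal ((measure (total_variation \<Omega> \<mu>) E - \<mu> E) / 2))"

definition signed_integral ::
    "'a::euclidean_space set \<Rightarrow> ('a set \<Rightarrow> real) \<Rightarrow> ('a \<Rightarrow> real) \<Rightarrow> real" where
  "signed_integral \<Omega> \<mu> \<phi> = (LINT x|pos_part \<Omega> \<mu>. \<phi> x) - (LINT x|neg_part \<Omega> \<mu>. \<phi> x)"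

definition vector_integral ::
    "'a::euclidean_space set \<Rightarrow> ('a set \<Rightarrow> 'b::euclidean_space) \<Rightarrow> ('a \<Rightarrow> real) \<Rightarrow> 'b" where
  "vector_integral \<Omega> \<mu> \<phi> = (\<Sum>b\<in>Basis. signed_integral \<Omega> (\<lambda>B. \<mu> B \<bullet> b) \<phi> *\<^sub>R b)"

text \<open>\<open>C\<^sub>0(\<Omega>)\<close>: continuous functions on \<open>\<Omega>\<close> vanishing at the boundary (and at infinity).\<close>

definition C0 :: "'a::euclidean_space set \<Rightarrow> ('a \<Rightarrow> real) set" where
  "C0 \<Omega> = {\<phi>. continuous_on \<Omega> \<phi> \<and> (\<forall>\<epsilon>>0. compact {x\<in>\<Omega>. \<bar>\<phi> x\<bar> \<ge> \<epsilon>})}"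

definition weak_star_M ::
    "'a::euclidean_space set \<Rightarrow> (nat \<Rightarrow> 'a set \<Rightarrow> 'b::euclidean_space) \<Rightarrow> ('a set \<Rightarrow> 'b) \<Rightarrow> bool" where
  "weak_star_M \<Omega> \<mu>s \<mu> \<longleftrightarrow>
     (\<forall>\<phi>\<in>C0 \<Omega>. (\<lambda>n. vector_integral \<Omega> (\<mu>s n) \<phi>) \<longlonglongrightarrow> vector_integral \<Omega> \<mu> \<phi>)"

definition L1 :: "'a::euclidean_space set \<Rightarrow> ('a \<Rightarrow> 'b::euclidean_space) set" where
  "L1 \<Omega> = {f. integrable (lebesgue_on \<Omega>) f}"

definition L1_measure ::
    "'a::euclidean_space set \<Rightarrow> ('a \<Rightarrow> 'b::euclidean_space) \<Rightarrow> 'a set \<Rightarrow> 'b" where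
  "L1_measure \<Omega> f B = (if B \<in> borel_on \<Omega> then LINT x:B|lebesgue. f x else 0)"

text \<open>Density of the absolutely continuous part of \<open>\<mu>\<close> in its Lebesgue decomposition: \<open>\<mu> - f dx\<close> is
  concentrated on the Lebesgue null set \<open>Z\<close>. It is unique up to a.e. equality.\<close>

definition ac_density ::
    "'a::euclidean_space set \<Rightarrow> ('a set \<Rightarrow> 'b::euclidean_space) \<Rightarrow> 'a \<Rightarrow> 'b" where
  "ac_density \<Omega> \<mu> = (SOME f. f \<in> L1 \<Omega> \<and>
     (\<exists>Z\<in>null_sets lborel. \<forall>B\<in>borel_on \<Omega>. \<mu> (B - Z) = L1_measure \<Omega> f B))"


subsection \<open>Functions of bounded variation\<close>

text \<open>\<open>\<mu>\<close> is the distributional derivative of \<open>u\<close>: entry \<open>(i, j)\<close> of \<open>\<mu>\<close> represents \<open>\<partial>\<^sub>j u\<^sub>i\<close>, tested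
  against \<open>C\<^sup>1\<close> functions \<open>\<phi>\<close> with gradient \<open>\<phi>'\<close> and compact support in \<open>\<Omega>\<close>.\<close>

definition is_deriv_measure ::
    "(real^'n) set \<Rightarrow> (real^'n \<Rightarrow> real^'d) \<Rightarrow> ((real^'n) set \<Rightarrow> real^'n^'d) \<Rightarrow> bool" where
  "is_deriv_measure \<Omega> u \<mu> \<longleftrightarrow> \<mu> \<in> radon_measures \<Omega> \<and>
     (\<forall>\<phi> \<phi>'. (\<forall>x. GDERIV \<phi> x :> \<phi>' x) \<longrightarrow> continuous_on UNIV \<phi>' \<longrightarrow>
        compact (closure {x. \<phi> x \<noteq> 0}) \<longrightarrow> closure {x. \<phi> x \<noteq> 0} \<subseteq> \<Omega> \<longrightarrow>
        (\<forall>i j. (LINT x:\<Omega>|lebesgue. u x $ i * \<phi>' x $ j) =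
               - signed_integral \<Omega> (\<lambda>B. \<mu> B $ i $ j) \<phi>))"

definition BV :: "(real^'n) set \<Rightarrow> (real^'n \<Rightarrow> real^'d) set" where
  "BV \<Omega> = {u \<in> L1 \<Omega>. \<exists>\<mu>. is_deriv_measure \<Omega> u \<mu>}"

definition deriv_measure ::
    "(real^'n) set \<Rightarrow> (real^'n \<Rightarrow> real^'d) \<Rightarrow> (real^'n) set \<Rightarrow> real^'n^'d" where
  "deriv_measure \<Omega> u = (THE \<mu>. is_deriv_measure \<Omega> u \<mu>)"

definition ac_grad ::
    "(real^'n) set \<Rightarrow> (real^'n \<Rightarrow> real^'d) \<Rightarrow> real^'n \<Rightarrow> real^'n^'d" where
  "ac_grad \<Omega> u = ac_density \<Omega> (deriv_measure \<Omega> u)"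

definition half_ball :: "'a::euclidean_space \<Rightarrow> real \<Rightarrow> 'a \<Rightarrow> 'a set" where
  "half_ball x r \<nu> = {y \<in> ball x r. (y - x) \<bullet> \<nu> > 0}"

text \<open>\<open>a\<close> and \<open>b\<close> are the distinct one-sided approximate limits of \<open>u\<close> at \<open>x\<close> on the sides of \<open>\<nu>\<close> and
  \<open>-\<nu>\<close>. The triple is unique up to exchanging \<open>(a, b, \<nu>)\<close> with \<open>(b, a, -\<nu>)\<close>.\<close>

definition approx_jump ::
    "('a::euclidean_space \<Rightarrow> 'b::euclidean_space) \<Rightarrow> 'a \<Rightarrow> 'b \<times> 'b \<times> 'a \<Rightarrow> bool" where
  "approx_jump u x = (\<lambda>(a, b, \<nu>). a \<noteq> b \<and> norm \<nu> = 1 \<and>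
     ((\<lambda>r. (LINT y:half_ball x r \<nu>|lebesgue. norm (u y - a)) / measure lebesgue (half_ball x r \<nu>))
        \<longlongrightarrow> 0) (at_right 0) \<and>
     ((\<lambda>r. (LINT y:half_ball x r (-\<nu>)|lebesgue. norm (u y - b)) / measure lebesgue (half_ball x r (-\<nu>)))
        \<longlongrightarrow> 0) (at_right 0))"

definition jump_set ::
    "'a::euclidean_space set \<Rightarrow> ('a \<Rightarrow> 'b::euclidean_space) \<Rightarrow> 'a set" where
  "jump_set \<Omega> u = {x\<in>\<Omega>. \<exists>T. approx_jump u x T}"

definition jump :: "('a::euclidean_space \<Rightarrow> 'b::euclidean_space) \<Rightarrow> 'a \<Rightarrow> 'b" where
  "jump u x = (case (SOME T. approx_jump u x T) of (a, b, \<nu>) \<Rightarrow> a - b)"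

definition jump_normal :: "('a::euclidean_space \<Rightarrow> 'b::euclidean_space) \<Rightarrow> 'a \<Rightarrow> 'a" where
  "jump_normal u x = (case (SOME T. approx_jump u x T) of (a, b, \<nu>) \<Rightarrow> \<nu>)"

text \<open>The Cantor part of \<open>Du\<close> is its singular part restricted to the complement of the jump set.\<close>

definition cantor_part ::
    "(real^'n) set \<Rightarrow> (real^'n \<Rightarrow> real^'d) \<Rightarrow> (real^'n) set \<Rightarrow> real^'n^'d" where
  "cantor_part \<Omega> u B =
     deriv_measure \<Omega> u (B - jump_set \<Omega> u) - L1_measure \<Omega> (ac_grad \<Omega> u) (B - jump_set \<Omega> u)"

definition SBV :: "(real^'n) set \<Rightarrow> (real^'n \<Rightarrow> real^'d) set" where
  "SBV \<Omega> = {u \<in> BV \<Omega>. \<forall>B\<in>borel_on \<Omega>. cantor_part \<Omega> u B = 0}"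

definition weak_star_BV ::
    "(real^'n) set \<Rightarrow> (nat \<Rightarrow> real^'n \<Rightarrow> real^'d) \<Rightarrow> (real^'n \<Rightarrow> real^'d) \<Rightarrow> bool" where
  "weak_star_BV \<Omega> us g \<longleftrightarrow>
     (\<lambda>n. LINT x:\<Omega>|lebesgue. norm (us n x - g x)) \<longlonglongrightarrow> 0 \<and>
     weak_star_M \<Omega> (\<lambda>n. deriv_measure \<Omega> (us n)) (deriv_measure \<Omega> g)"


subsection \<open>Energies and their relaxations\<close>

text \<open>The upper limit is taken in the extended reals; it is finite if \<open>W\<close> has linear growth.\<close>

definition recession :: "('a::real_vector \<Rightarrow> real) \<Rightarrow> 'a \<Rightarrow> real" where
  "recession W A = real_of_ereal (Limsup at_top (\<lambda>t::real. ereal (W (t *\<^sub>R A) / t)))"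

text \<open>All integrands are nonnegative, so energies take values in \<open>[0, \<infinity>]\<close>.\<close>

definition surface_energy ::
    "(real^'d \<Rightarrow> real^'n \<Rightarrow> real) \<Rightarrow> (real^'n) set \<Rightarrow> (real^'n \<Rightarrow> real^'d) \<Rightarrow> ennreal" where
  "surface_energy \<psi> \<Omega> u =
     (\<integral>\<^sup>+x\<in>jump_set \<Omega> u. ennreal (\<psi> (jump u x) (jump_normal u x)) \<partial>hausdorff_measure (CARD('n) - 1))"

definition energy ::
    "(real^'n^'d \<Rightarrow> real) \<Rightarrow> (real^'d \<Rightarrow> real^'n \<Rightarrow> real) \<Rightarrow> (real^'n) set \<Rightarrow>
     (real^'n \<Rightarrow> real^'d) \<Rightarrow> ennreal" where
  "energy W \<psi> \<Omega> u =
     (\<integral>\<^sup>+x\<in>\<Omega>. ennreal (W (ac_grad \<Omega> u x)) \<partial>lebesgue) + surface_energy \<psi> \<Omega> u"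

definition energy_hat ::
    "(real^'n^'d \<Rightarrow> real) \<Rightarrow> (real^'d \<Rightarrow> real^'n \<Rightarrow> real) \<Rightarrow> real \<Rightarrow> (real^'n) set \<Rightarrow>
     (real^'n \<Rightarrow> real^'d) \<Rightarrow> (real^'n \<Rightarrow> real^'n^'d) \<Rightarrow> ennreal" where
  "energy_hat W \<psi> R \<Omega> g G =
     (\<integral>\<^sup>+x\<in>\<Omega>. ennreal (W (ac_grad \<Omega> g x) + R * norm (ac_grad \<Omega> g x - G x)) \<partial>lebesgue)
       + surface_energy \<psi> \<Omega> g"

definition relaxed_energy ::
    "(real^'n^'d \<Rightarrow> real) \<Rightarrow> (real^'d \<Rightarrow> real^'n \<Rightarrow> real) \<Rightarrow> (real^'n) set \<Rightarrow>
     (real^'n \<Rightarrow> real^'d) \<Rightarrow> ((real^'n) set \<Rightarrow> real^'n^'d) \<Rightarrow> ennreal" where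
  "relaxed_energy W \<psi> \<Omega> g G =
     Inf {liminf (\<lambda>n. energy W \<psi> \<Omega> (us n)) | us.
            (\<forall>n. us n \<in> SBV \<Omega>) \<and> weak_star_BV \<Omega> us g \<and>
            weak_star_M \<Omega> (\<lambda>n. L1_measure \<Omega> (ac_grad \<Omega> (us n))) G}"

definition relaxed_energy_hat ::
    "(real^'n^'d \<Rightarrow> real) \<Rightarrow> (real^'d \<Rightarrow> real^'n \<Rightarrow> real) \<Rightarrow> real \<Rightarrow> (real^'n) set \<Rightarrow>
     (real^'n \<Rightarrow> real^'d) \<Rightarrow> ((real^'n) set \<Rightarrow> real^'n^'d) \<Rightarrow> ennreal" where
  "relaxed_energy_hat W \<psi> R \<Omega> g G =
     Inf {liminf (\<lambda>n. energy_hat W \<psi> R \<Omega> (gs n) (Gs n)) | gs Gs.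
            (\<forall>n. gs n \<in> SBV \<Omega> \<and> Gs n \<in> L1 \<Omega>) \<and> weak_star_BV \<Omega> gs g \<and>
            weak_star_M \<Omega> (\<lambda>n. L1_measure \<Omega> (Gs n)) G}"

end

theory Submission
  imports Defs
begin

text \<open>The constraint on the limit of the gradients can be traded for a penalty because the absolutely
  continuous gradient can be changed at will, at a cost proportional to the change: for \<open>g\<close> in \<open>SBV\<close> and
  \<open>F\<close> in \<open>L\<^sup>1\<close> there is a uniformly small \<open>v\<close> such that the gradient of \<open>g + v\<close> is that of \<open>g\<close> plus \<open>F\<close> and
  the jumps of \<open>v\<close> have total mass at most a constant times the norm of \<open>F\<close>. Such a \<open>v\<close> is a uniformly
  convergent series of functions that are affine on each cell of a dyadic grid, with slopes that sum to
  \<open>F\<close>; refining the grid makes a term small without changing its slopes. If the offset of the grid is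
  chosen generically, then \<open>Dg\<close> does not charge the grid hyperplanes and almost all their points, with
  respect to Hausdorff measure, are Lebesgue points of \<open>g\<close>; hence \<open>g + v\<close> has no Cantor part and its jumps
  are those of \<open>g\<close> together with those of \<open>v\<close>. Take \<open>g = g\<^sub>n\<close> and \<open>F = G\<^sub>n - \<nabla>g\<^sub>n\<close>. For large \<open>R\<close> the
  penalty absorbs both the added surface energy and, as \<open>W\<close> is Lipschitz, the change of the bulk energy.
  It also bounds the norms of the \<open>F\<^sub>n\<close>, so the derivatives of the correctors \<open>v\<^sub>n\<close> tend weakly* to zero.\<close>

section \<open>Signed measures\<close>

text \<open>Jumps occur in two roles that are kept apart. The distributional derivative of the
  corrector is computed by Fubini, hence with the product measures \<open>slices\<close> on the grid
  hyperplanes; the energy uses Hausdorff measure. The two are never compared: the jump mass is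
  estimated for each of them, cube by cube, and the exceptional points of the grid are null for
  both. For a cube of side h and slope 1 the jumps have size at most h on faces of area of order
  h^(N-1), so their mass is of the order of the volume h^N at every scale. This is why refining the
  grid does not raise the cost, and why the constant depends only on the dimensions and not on the
  domain. The surface energy of g is carried along unchanged as an integral of a density whose
  measurability is not established, so only bounds from above are used for it. The other inequality
  between the two relaxations is immediate: the gradient of u_n is itself admissible as second
  component, with zero penalty.\<close>

definition signed_measure :: "'a measure \<Rightarrow> ('a set \<Rightarrow> 'b::real_normed_vector) \<Rightarrow> bool" where
  "signed_measure M \<mu> \<longleftrightarrow>
     (\<forall>A::nat \<Rightarrow> 'a set. range A \<subseteq> sets M \<longrightarrow> disjoint_family A \<longrightarrow> (\<lambda>i. \<mu> (A i)) sums \<mu> (\<Union>i. A i))"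

lemma signed_measureD:
  assumes "signed_measure M \<mu>" "range A \<subseteq> sets M" "disjoint_family A"
  shows "(\<lambda>i. \<mu> (A i)) sums \<mu> (\<Union>i. A i)"
  using assms unfolding signed_measure_def by blast

lemma signed_measure_empty:
  fixes \<mu> :: "'a set \<Rightarrow> 'b::real_normed_vector"
  assumes "signed_measure M \<mu>" shows "\<mu> {} = 0"
proof -
  have "(\<lambda>i::nat. \<mu> {}) sums \<mu> (\<Union>i::nat. {})"
    using signed_measureD[OF assms, of "\<lambda>i. {}"] by (auto simp: disjoint_family_on_def)
  then show ?thesis using summable_const_iff sums_summable by blast
qed

lemma signed_measure_Un:
  assumes "signed_measure M \<mu>" "A \<in> sets M" "B \<in> sets M" "A \<inter> B = {}"
  shows "\<mu> (A \<union> B) = \<mu> A + \<mu> B"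
proof -
  have "(\<lambda>i. \<mu> (binaryset A B i)) sums \<mu> (\<Union>i. binaryset A B i)"
    using assms by (intro signed_measureD) (auto simp: binaryset_def disjoint_family_on_def)
  moreover have "(\<lambda>i. \<mu> (binaryset A B i)) sums (\<mu> A + \<mu> B)"
    by (rule binaryset_sums) (rule signed_measure_empty[OF assms(1)])
  ultimately show ?thesis using sums_unique2 UN_binaryset_eq by metis
qed

lemma signed_measure_split:
  assumes "signed_measure M \<mu>" "A \<in> sets M" "B \<in> sets M"
  shows "\<mu> A = \<mu> (A \<inter> B) + \<mu> (A - B)"
  using signed_measure_Un[OF assms(1), of "A \<inter> B" "A - B"] assms(2,3)
  by (metis Diff_disjoint Int_Diff_Un Int_commute inf_assoc sets.Diff sets.Int inf_bot_right)

definition positive_set :: "'a measure \<Rightarrow> ('a set \<Rightarrow> real) \<Rightarrow> 'a set \<Rightarrow> bool" where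
  "positive_set M \<mu> P \<longleftrightarrow> P \<in> sets M \<and> (\<forall>A\<in>sets M. A \<subseteq> P \<longrightarrow> \<mu> A \<ge> 0)"

text \<open>One greedy choice of the Hahn exhaustion. The least index m whose threshold -1/(m+1) can
  be undercut gives the most demanding threshold, so a set undercutting it undercuts every other
  attainable one. If none is attainable, the empty set qualifies.\<close>

lemma exists_large_negative_subset:
  fixes \<mu> :: "'a set \<Rightarrow> real"
  assumes "signed_measure M \<mu>"
  shows "\<exists>A\<in>sets M. A \<subseteq> X \<and> \<mu> A \<le> 0 \<and>
     (\<forall>m. (\<exists>B\<in>sets M. B \<subseteq> X \<and> \<mu> B < - inverse (real (Suc m))) \<longrightarrow> \<mu> A < - inverse (real (Suc m)))"
proof (cases "\<exists>m. \<exists>B\<in>sets M. B \<subseteq> X \<and> \<mu> B < - inverse (real (Suc m))")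
  case True
  define n where "n = (LEAST m. \<exists>B\<in>sets M. B \<subseteq> X \<and> \<mu> B < - inverse (real (Suc m)))"
  obtain A where A: "A \<in> sets M" "A \<subseteq> X" "\<mu> A < - inverse (real (Suc n))"
    using LeastI_ex[OF True] unfolding n_def by blast
  have "\<mu> A < - inverse (real (Suc m))" if "\<exists>B\<in>sets M. B \<subseteq> X \<and> \<mu> B < - inverse (real (Suc m))" for m
  proof -
    have "n \<le> m" unfolding n_def using that by (rule Least_le)
    then have "inverse (real (Suc m)) \<le> inverse (real (Suc n))"
      by (intro le_imp_inverse_le) auto
    then show ?thesis using A(3) by linarith
  qed
  moreover have "\<mu> A \<le> 0" using A(3) by (smt (verit) inverse_nonnegative_iff_nonnegative of_nat_0_le_iff)
  ultimately show ?thesis using A by blast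
next
  case False
  then show ?thesis using signed_measure_empty[OF assms]
    by (intro bexI[of _ "{}"]) auto
qed

text \<open>Greedily chosen negative pieces are removed from \<open>E\<close> one after another,
  which cannot lower the measure. Their measures are summable, hence tend to 0; a negative set left
  over would keep all of them below a fixed negative threshold.\<close>

lemma positive_subset_exists:
  fixes \<mu> :: "'a set \<Rightarrow> real"
  assumes \<mu>: "signed_measure M \<mu>" and E: "E \<in> sets M"
  shows "\<exists>P. P \<subseteq> E \<and> positive_set M \<mu> P \<and> \<mu> P \<ge> \<mu> E"
proof -
  define sel where "sel X = (SOME A. A \<in> sets M \<and> A \<subseteq> X \<and> \<mu> A \<le> 0 \<and>
     (\<forall>m. (\<exists>B\<in>sets M. B \<subseteq> X \<and> \<mu> B < - inverse (real (Suc m))) \<longrightarrow> \<mu> A < - inverse (real (Suc m))))" for X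
  have sel: "sel X \<in> sets M \<and> sel X \<subseteq> X \<and> \<mu> (sel X) \<le> 0 \<and>
     (\<forall>m. (\<exists>B\<in>sets M. B \<subseteq> X \<and> \<mu> B < - inverse (real (Suc m))) \<longrightarrow> \<mu> (sel X) < - inverse (real (Suc m)))" for X
    unfolding sel_def by (rule someI_ex) (use exists_large_negative_subset[OF \<mu>, of X] in blast)
  define X where "X = rec_nat E (\<lambda>k Y. Y - sel Y)"
  have X0: "X 0 = E" and XS: "X (Suc k) = X k - sel (X k)" for k by (simp_all add: X_def)
  define A where "A k = sel (X k)" for k
  have decr: "X j \<subseteq> X k" if "k \<le> j" for j k
    using that by (induction j rule: dec_induct) (auto simp: XS)
  have AX: "A k \<subseteq> X k" "A k \<in> sets M" for k using sel A_def by auto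
  have disj: "disjoint_family A"
  proof -
    have "A j \<inter> A k = {}" if "k < j" for j k
    proof -
      have "A j \<subseteq> X (Suc k)" using AX(1)[of j] decr[of "Suc k" j] that by auto
      then show ?thesis by (auto simp: XS A_def)
    qed
    then show ?thesis unfolding disjoint_family_on_def by (metis inf_commute linorder_neqE_nat)
  qed
  define P where "P = E - (\<Union>k. A k)"
  have sums: "(\<lambda>k. \<mu> (A k)) sums \<mu> (\<Union>k. A k)"
    using AX disj by (intro signed_measureD[OF \<mu>]) auto
  have Un: "(\<Union>k. A k) \<in> sets M" using AX by auto
  have UnE: "(\<Union>k. A k) \<subseteq> E" using AX(1) decr[of 0] X0 by fastforce
  have PX: "P \<subseteq> X k" for k
    by (induction k) (auto simp: P_def X0 XS A_def)
  have "\<mu> E = \<mu> (\<Union>k. A k) + \<mu> P"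
    using signed_measure_split[OF \<mu> E Un] UnE by (simp add: P_def Int_absorb1)
  moreover have "\<mu> (\<Union>k. A k) \<le> 0"
    using sums sel by (intro sums_le[OF _ sums sums_zero]) (auto simp: A_def)
  moreover have "positive_set M \<mu> P"
    unfolding positive_set_def
  proof (intro conjI ballI impI)
    show "P \<in> sets M" using E Un by (auto simp: P_def)
    fix B assume B: "B \<in> sets M" "B \<subseteq> P"
    show "\<mu> B \<ge> 0"
    proof (rule ccontr)
      assume "\<not> \<mu> B \<ge> 0"
      then obtain m where "inverse (real (Suc m)) < - \<mu> B"
        using reals_Archimedean[of "- \<mu> B"] by auto
      then have m: "\<mu> B < - inverse (real (Suc m))" by linarith
      have "\<mu> (A k) < - inverse (real (Suc m))" for k
        using sel[of "X k"] B PX[of k] m unfolding A_def by blast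
      then have "0 \<le> - inverse (real (Suc m))"
        by (intro LIMSEQ_le_const2[OF summable_LIMSEQ_zero[OF sums_summable[OF sums]]]) (auto intro: less_imp_le)
      moreover have "inverse (real (Suc m)) > 0" by simp
      ultimately show False by linarith
    qed
  qed
  ultimately show ?thesis by (intro exI[of _ P]) (auto simp: P_def)
qed

text \<open>Making the union disjoint splits the measure of a subset into a series of nonnegative
  terms.\<close>

lemma positive_set_UN:
  fixes P :: "nat \<Rightarrow> 'a set"
  assumes \<mu>: "signed_measure M \<mu>" and P: "\<And>n. positive_set M \<mu> (P n)"
  shows "positive_set M \<mu> (\<Union>n. P n)"
  unfolding positive_set_def
proof (intro conjI ballI impI)
  have Ps: "P n \<in> sets M" for n using P by (auto simp: positive_set_def)
  then show "(\<Union>n. P n) \<in> sets M" by auto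
  fix A assume A: "A \<in> sets M" "A \<subseteq> (\<Union>n. P n)"
  have ds: "range (disjointed P) \<subseteq> sets M"
    by (rule sets.range_disjointed_sets) (use Ps in auto)
  have "(\<lambda>n. \<mu> (A \<inter> disjointed P n)) sums \<mu> (\<Union>n. A \<inter> disjointed P n)"
    using A ds disjoint_family_disjointed[of P]
    by (intro signed_measureD[OF \<mu>]) (auto 0 0 simp: disjoint_family_on_def, blast)
  moreover have "(\<Union>n. A \<inter> disjointed P n) = A"
    using A UN_disjointed_eq[of P] by (metis Int_UN_distrib inf.absorb1)
  moreover have "\<mu> (A \<inter> disjointed P n) \<ge> 0" for n
  proof -
    have "A \<inter> disjointed P n \<in> sets M" "A \<inter> disjointed P n \<subseteq> P n" using A ds disjointed_subset[of P n] by auto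
    then show ?thesis using P[of n] by (auto simp: positive_set_def)
  qed
  ultimately show "\<mu> A \<ge> 0" using sums_le[OF _ sums_zero, of "\<lambda>n. \<mu> (A \<inter> disjointed P n)" "\<mu> A"] by simp
qed

lemma positive_set_mono:
  assumes "signed_measure M \<mu>" "positive_set M \<mu> P" "A \<in> sets M" "A \<subseteq> P"
  shows "\<mu> A \<le> \<mu> P"
  using signed_measure_split[OF assms(1) _ assms(3), of P] assms(2-4)
  by (auto simp: positive_set_def Int_absorb1)

text \<open>The measure of positive sets is bounded, since positive sets of measure above every n
  would have a positive union whose finite measure exceeds every n. A union of nearly maximal
  positive sets attains the supremum; a disjoint positive set of positive measure would push it
  beyond.\<close>

theorem Hahn_decomposition:
  fixes \<mu> :: "'a set \<Rightarrow> real"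
  assumes \<mu>: "signed_measure M \<mu>"
  obtains U where "U \<in> sets M" "\<And>A. A \<in> sets M \<Longrightarrow> \<mu> (A \<inter> U) \<ge> 0" "\<And>A. A \<in> sets M \<Longrightarrow> \<mu> (A - U) \<le> 0"
proof -
  define V where "V = \<mu> ` {P. positive_set M \<mu> P}"
  have e: "positive_set M \<mu> {}" using signed_measure_empty[OF \<mu>] by (auto simp: positive_set_def)
  have bdd: "bdd_above V"
  proof (rule ccontr)
    assume "\<not> bdd_above V"
    then have "\<exists>P. positive_set M \<mu> P \<and> \<mu> P > real n" for n
      unfolding bdd_above_def V_def by (metis imageE linorder_not_le mem_Collect_eq)
    then obtain P where P: "\<And>n. positive_set M \<mu> (P n)" "\<And>n. \<mu> (P n) > real n" by metis
    obtain n where "\<mu> (\<Union>n. P n) < real n" using reals_Archimedean2 by blast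
    moreover have "\<mu> (P n) \<le> \<mu> (\<Union>n. P n)"
      using P by (intro positive_set_mono[OF \<mu>] positive_set_UN[OF \<mu>]) (auto simp: positive_set_def)
    ultimately show False using P(2)[of n] by linarith
  qed
  define s where "s = Sup V"
  have "\<exists>P. positive_set M \<mu> P \<and> \<mu> P > s - inverse (real (Suc n))" for n
  proof -
    have "s - inverse (real (Suc n)) < Sup V" by (simp add: s_def)
    then obtain y where "y \<in> V" "s - inverse (real (Suc n)) < y"
      using less_cSup_iff[of V] bdd e unfolding V_def by blast
    then show ?thesis by (auto simp: V_def)
  qed
  then obtain P where P: "\<And>n. positive_set M \<mu> (P n)" "\<And>n. \<mu> (P n) > s - inverse (real (Suc n))" by metis
  define U where "U = (\<Union>n. P n)"
  have U: "positive_set M \<mu> U" unfolding U_def by (rule positive_set_UN[OF \<mu> P(1)])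
  have "\<mu> U \<ge> s - inverse (real (Suc n))" for n
  proof -
    have "\<mu> (P n) \<le> \<mu> U"
      using P U by (intro positive_set_mono[OF \<mu>]) (auto simp: positive_set_def U_def)
    then show ?thesis using P(2)[of n] by linarith
  qed
  moreover have "(\<lambda>n. s - inverse (real (Suc n))) \<longlonglongrightarrow> s - 0"
    by (intro tendsto_diff tendsto_const LIMSEQ_inverse_real_of_nat)
  ultimately have Us: "\<mu> U \<ge> s"
    using LIMSEQ_le_const2[of "\<lambda>n. s - inverse (real (Suc n))" "s - 0" "\<mu> U"] by auto
  have Um: "U \<in> sets M" using U by (auto simp: positive_set_def)
  show ?thesis
  proof (rule that[OF Um])
    fix A assume A: "A \<in> sets M"
    show "\<mu> (A \<inter> U) \<ge> 0" using U A Um by (auto simp: positive_set_def)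
    show "\<mu> (A - U) \<le> 0"
    proof (rule ccontr)
      assume neg: "\<not> \<mu> (A - U) \<le> 0"
      obtain Q where Q: "Q \<subseteq> A - U" "positive_set M \<mu> Q" "\<mu> Q \<ge> \<mu> (A - U)"
        using positive_subset_exists[OF \<mu>, of "A - U"] A Um by auto
      have "positive_set M \<mu> (\<Union>n::nat. if n = 0 then U else Q)"
        using U Q by (intro positive_set_UN[OF \<mu>]) auto
      moreover have "(\<Union>n::nat. if n = 0 then U else Q) = U \<union> Q" by (auto split: if_splits)
      ultimately have "positive_set M \<mu> (U \<union> Q)" by simp
      then have "\<mu> (U \<union> Q) \<le> s" unfolding s_def V_def using bdd[unfolded V_def] by (intro cSup_upper) auto
      moreover have "\<mu> (U \<union> Q) = \<mu> U + \<mu> Q"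
        using Q Um by (intro signed_measure_Un[OF \<mu>]) (auto simp: positive_set_def)
      ultimately show False using Us Q(3) neg by linarith
    qed
  qed
qed

text \<open>\<open>measure_of\<close> has the intended values only for countably additive set
  functions. The parts of a signed measure are defined through it, and here additivity is inherited
  from a real-valued signed measure \<open>t\<close>.\<close>

lemma emeasure_measure_of_sums:
  assumes nonneg: "\<And>E. E \<in> sets M \<Longrightarrow> t E \<ge> 0" and t: "signed_measure M t"
    and f: "\<And>E. E \<in> sets M \<Longrightarrow> f E = ennreal (t E)" and E: "E \<in> sets M"
  shows "emeasure (measure_of (space M) (sets M) f) E = ennreal (t E)"
proof -
  have "emeasure (measure_of (space M) (sets M) f) E = f E"
  proof (rule emeasure_measure_of_sigma)
    show "sigma_algebra (space M) (sets M)" by (rule sets.sigma_algebra_axioms)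
    show "positive (sets M) f" using f[of "{}"] signed_measure_empty[OF t] by (auto simp: positive_def)
    show "countably_additive (sets M) f"
    proof (rule countably_additiveI)
      fix A :: "nat \<Rightarrow> 'a set" assume A: "range A \<subseteq> sets M" "disjoint_family A" "(\<Union>i. A i) \<in> sets M"
      have "(\<Sum>i. f (A i)) = (\<Sum>i. ennreal (t (A i)))" using A f by (intro arg_cong[where f=suminf]) auto
      also have "\<dots> = ennreal (\<Sum>i. t (A i))"
        using A nonneg signed_measureD[OF t A(1,2)]
        by (intro suminf_ennreal2) (auto simp: sums_iff)
      also have "(\<Sum>i. t (A i)) = t (\<Union>i. A i)" using signed_measureD[OF t A(1,2)] by (simp add: sums_iff)
      finally show "(\<Sum>i. f (A i)) = f (\<Union>i. A i)" using f[OF A(3)] by simp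
    qed
    show "E \<in> sets M" by fact
  qed
  then show ?thesis using f[OF E] by simp
qed

section \<open>Jordan decomposition of a finite signed measure\<close>

lemma radon_measures_signed:
  "\<mu> \<in> radon_measures \<Omega> \<longleftrightarrow> signed_measure (restrict_space borel \<Omega>) \<mu> \<and> (\<forall>B. B \<notin> borel_on \<Omega> \<longrightarrow> \<mu> B = 0)"
  by (auto simp: radon_measures_def signed_measure_def)

text \<open>For a Hahn set \<open>U\<close> the supremum defining the total variation is attained by
  the two-piece partition cut out by \<open>U\<close>. The total variation of E is then \<mu>(E
  \<inter> U) - \<mu>(E - U), and halving its sum and difference with \<mu> leaves the two
  terms.\<close>

lemma Jordan_decomposition:
  fixes \<mu> :: "'a::euclidean_space set \<Rightarrow> real"
  assumes \<mu>: "\<mu> \<in> radon_measures \<Omega>"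
  shows "sets (pos_part \<Omega> \<mu>) = borel_on \<Omega>" "sets (neg_part \<Omega> \<mu>) = borel_on \<Omega>"
    "finite_measure (pos_part \<Omega> \<mu>)" "finite_measure (neg_part \<Omega> \<mu>)"
    "\<And>E. E \<in> borel_on \<Omega> \<Longrightarrow> \<mu> E = measure (pos_part \<Omega> \<mu>) E - measure (neg_part \<Omega> \<mu>) E"
proof -
  define M where "M = restrict_space (borel::'a measure) \<Omega>"
  have sM: "sets M = borel_on \<Omega>" and spM: "space M = \<Omega>" by (auto simp: M_def space_restrict_space)
  have sm: "signed_measure M \<mu>" using \<mu> by (simp add: radon_measures_signed M_def)
  obtain U where U: "U \<in> sets M" "\<And>A. A \<in> sets M \<Longrightarrow> \<mu> (A \<inter> U) \<ge> 0" "\<And>A. A \<in> sets M \<Longrightarrow> \<mu> (A - U) \<le> 0"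
    using Hahn_decomposition[OF sm] by metis
  have s1: "signed_measure M (\<lambda>E. \<mu> (E \<inter> U))"
    unfolding signed_measure_def
  proof (intro allI impI)
    fix A :: "nat \<Rightarrow> 'a set" assume A: "range A \<subseteq> sets M" "disjoint_family A"
    have "(\<lambda>i. \<mu> (A i \<inter> U)) sums \<mu> (\<Union>i. A i \<inter> U)"
      using A U(1) by (intro signed_measureD[OF sm]) (auto simp: disjoint_family_on_def)
    then show "(\<lambda>i. \<mu> (A i \<inter> U)) sums \<mu> ((\<Union>i. A i) \<inter> U)" by (simp add: Int_UN_distrib2)
  qed
  have s2: "signed_measure M (\<lambda>E. - \<mu> (E - U))"
    unfolding signed_measure_def
  proof (intro allI impI)
    fix A :: "nat \<Rightarrow> 'a set" assume A: "range A \<subseteq> sets M" "disjoint_family A"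
    have "(\<lambda>i. \<mu> (A i - U)) sums \<mu> (\<Union>i. A i - U)"
      using A U(1) by (intro signed_measureD[OF sm]) (auto simp: disjoint_family_on_def)
    then have "(\<lambda>i. - \<mu> (A i - U)) sums - \<mu> (\<Union>i. A i - U)" by (rule sums_minus)
    then show "(\<lambda>i. - \<mu> (A i - U)) sums - \<mu> ((\<Union>i. A i) - U)" by simp
  qed
  have s3: "signed_measure M (\<lambda>E. \<mu> (E \<inter> U) + - \<mu> (E - U))"
    unfolding signed_measure_def using s1 s2
    by (intro allI impI sums_add) (auto intro: signed_measureD)
  have TV: "(SUP A\<in>{A::nat \<Rightarrow> 'a set. range A \<subseteq> sets M \<and> disjoint_family A \<and> (\<Union>i. A i) = E}.
            \<Sum>i. ennreal (norm (\<mu> (A i)))) = ennreal (\<mu> (E \<inter> U) + - \<mu> (E - U))" if E: "E \<in> sets M" for E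
  proof (rule antisym[OF SUP_least SUP_upper2])
    fix A :: "nat \<Rightarrow> 'a set" assume A: "A \<in> {A. range A \<subseteq> sets M \<and> disjoint_family A \<and> (\<Union>i. A i) = E}"
    have "(\<Sum>i. ennreal (norm (\<mu> (A i)))) \<le> (\<Sum>i. ennreal (\<mu> (A i \<inter> U) + - \<mu> (A i - U)))"
    proof (intro suminf_le ennreal_leI)
      fix i
      have "A i \<in> sets M" using A by auto
      then show "norm (\<mu> (A i)) \<le> \<mu> (A i \<inter> U) + - \<mu> (A i - U)"
        using signed_measure_split[OF sm _ U(1), of "A i"] U(2,3)[of "A i"] by auto
    qed auto
    also have "\<dots> = ennreal (\<mu> (E \<inter> U) + - \<mu> (E - U))"
    proof -
      have "(\<lambda>i. \<mu> (A i \<inter> U) + - \<mu> (A i - U)) sums (\<mu> (E \<inter> U) + - \<mu> (E - U))"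
        using signed_measureD[OF s3, of A] A by auto
      moreover have "\<mu> (A i \<inter> U) + - \<mu> (A i - U) \<ge> 0" for i
        using U(2,3)[of "A i"] A by (auto simp: image_subset_iff)
      ultimately show ?thesis by (intro suminf_ennreal_eq)
    qed
    finally show "(\<Sum>i. ennreal (norm (\<mu> (A i)))) \<le> ennreal (\<mu> (E \<inter> U) + - \<mu> (E - U))" .
  next
    show "binaryset (E \<inter> U) (E - U) \<in> {A. range A \<subseteq> sets M \<and> disjoint_family A \<and> (\<Union>i. A i) = E}"
      using E U(1) by (auto simp: binaryset_def disjoint_family_on_def split: if_splits)
    have "(\<lambda>i. ennreal (norm (\<mu> (binaryset (E \<inter> U) (E - U) i)))) sums
       (ennreal (norm (\<mu> (E \<inter> U))) + ennreal (norm (\<mu> (E - U))))"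
      by (rule binaryset_sums) (simp add: signed_measure_empty[OF sm])
    then have "(\<Sum>i. ennreal (norm (\<mu> (binaryset (E \<inter> U) (E - U) i)))) =
        ennreal (norm (\<mu> (E \<inter> U))) + ennreal (norm (\<mu> (E - U)))" by (simp add: sums_iff)
    also have "\<dots> = ennreal (\<mu> (E \<inter> U) + - \<mu> (E - U))"
      using U(2,3)[OF E] by (simp add: ennreal_plus[symmetric] del: ennreal_plus)
    finally show "ennreal (\<mu> (E \<inter> U) + - \<mu> (E - U)) \<le> (\<Sum>i. ennreal (norm (\<mu> (binaryset (E \<inter> U) (E - U) i))))"
      by simp
  qed
  have tv: "measure (total_variation \<Omega> \<mu>) E = \<mu> (E \<inter> U) + - \<mu> (E - U)" if E: "E \<in> sets M" for E
  proof -
    have "emeasure (total_variation \<Omega> \<mu>) E = ennreal (\<mu> (E \<inter> U) + - \<mu> (E - U))"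
      unfolding total_variation_def unfolding sM[symmetric] unfolding spM[symmetric]
    proof (rule emeasure_measure_of_sums[OF _ s3 TV E])
      show "0 \<le> \<mu> (E \<inter> U) + - \<mu> (E - U)" if "E \<in> sets M" for E using U(2,3)[OF that] by linarith
    qed
    then show ?thesis using U(2,3)[OF E] by (simp add: measure_def)
  qed
  have P: "emeasure (pos_part \<Omega> \<mu>) E = ennreal (\<mu> (E \<inter> U))" if E: "E \<in> sets M" for E
    unfolding pos_part_def unfolding sM[symmetric] unfolding spM[symmetric]
    by (rule emeasure_measure_of_sums[OF U(2) s1 _ E], assumption, rule arg_cong[where f=ennreal])
      (use tv signed_measure_split[OF sm _ U(1)] in \<open>simp add: spM\<close>)
  have N: "emeasure (neg_part \<Omega> \<mu>) E = ennreal (- \<mu> (E - U))" if E: "E \<in> sets M" for E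
    unfolding neg_part_def unfolding sM[symmetric] unfolding spM[symmetric]
    by (rule emeasure_measure_of_sums[OF _ s2 _ E]) (use U(3) tv signed_measure_split[OF sm _ U(1)] in \<open>auto simp: spM\<close>)
  show sp: "sets (pos_part \<Omega> \<mu>) = borel_on \<Omega>" and sn: "sets (neg_part \<Omega> \<mu>) = borel_on \<Omega>"
    unfolding pos_part_def neg_part_def using sets.space_closed[of M] by (auto simp: sM spM sigma_algebra.sets_measure_of_eq[OF sets.sigma_algebra_axioms[of M], unfolded sM spM])
  have "space (pos_part \<Omega> \<mu>) = \<Omega>" "space (neg_part \<Omega> \<mu>) = \<Omega>"
    using sets_eq_imp_space_eq[of _ M] sp sn sM spM by metis+
  then show "finite_measure (pos_part \<Omega> \<mu>)" "finite_measure (neg_part \<Omega> \<mu>)"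
    using P[OF sets.top] N[OF sets.top] spM by (auto intro!: finite_measureI)
  fix E assume "E \<in> borel_on \<Omega>"
  then have E: "E \<in> sets M" by (simp add: sM)
  show "\<mu> E = measure (pos_part \<Omega> \<mu>) E - measure (neg_part \<Omega> \<mu>) E"
    using P[OF E] N[OF E] U(2,3)[OF E] signed_measure_split[OF sm E U(1)] by (simp add: measure_def)
qed

section \<open>Integration against signed measures\<close>

text \<open>A linear relation between finite measures passes to integrals of bounded functions.
  Stated for a finite family so that all identities for signed integrals below become instances. The
  bound is quantified inside the induction because each constituent of a function has its
  own.\<close>

lemma sum_integral_measures_eq_0_nonneg:
  fixes \<phi> :: "'a \<Rightarrow> real"
  assumes fin: "finite I" and s: "\<And>i. i \<in> I \<Longrightarrow> sets (\<alpha> i) = sets M" and f: "\<And>i. i \<in> I \<Longrightarrow> finite_measure (\<alpha> i)"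
    and eq: "\<And>E. E \<in> sets M \<Longrightarrow> (\<Sum>i\<in>I. c i * measure (\<alpha> i) E) = 0"
    and \<phi>: "\<phi> \<in> borel_measurable M" "\<And>x. 0 \<le> \<phi> x" "\<And>x. x \<in> space M \<Longrightarrow> \<phi> x \<le> K"
  shows "(\<Sum>i\<in>I. c i * integral\<^sup>L (\<alpha> i) \<phi>) = 0"
proof -
  have sp: "space (\<alpha> i) = space M" if "i \<in> I" for i using s[OF that] by (rule sets_eq_imp_space_eq)
  have ms: "u \<in> borel_measurable (\<alpha> i) \<longleftrightarrow> u \<in> borel_measurable M" if "i \<in> I" for i and u :: "'a \<Rightarrow> real"
    using s[OF that] by (simp cong: measurable_cong_sets)
  have intg: "integrable (\<alpha> i) u" if "i \<in> I" "u \<in> borel_measurable M" "\<And>x. 0 \<le> u x" "\<And>x. x \<in> space M \<Longrightarrow> u x \<le> K" for i and u :: "'a \<Rightarrow> real" and K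
    using that sp ms by (intro finite_measure.integrable_const_bound[OF f, of _ _ K]) auto
  have "\<forall>K. (\<forall>x\<in>space M. \<phi> x \<le> K) \<longrightarrow> (\<Sum>i\<in>I. c i * integral\<^sup>L (\<alpha> i) \<phi>) = 0"
    using \<phi>(1,2)
  proof (induction rule: borel_measurable_induct_real)
    case (set A)
    have "(\<Sum>i\<in>I. c i * integral\<^sup>L (\<alpha> i) (indicator A)) = (\<Sum>i\<in>I. c i * measure (\<alpha> i) A)"
      using set s by (intro sum.cong refl) auto
    then show ?case using eq[OF set] by simp
  next
    case (mult u a)
    show ?case
    proof (intro allI impI)
      fix K assume K: "\<forall>x\<in>space M. a * u x \<le> K"
      show "(\<Sum>i\<in>I. c i * integral\<^sup>L (\<alpha> i) (\<lambda>x. a * u x)) = 0"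
      proof (cases "a = 0")
        case False
        then have "\<forall>x\<in>space M. u x \<le> K / a" using K mult(1) by (auto simp: field_simps)
        then have "(\<Sum>i\<in>I. c i * integral\<^sup>L (\<alpha> i) u) = 0" using mult by blast
        then have "a * (\<Sum>i\<in>I. c i * integral\<^sup>L (\<alpha> i) u) = 0" by simp
        then show ?thesis by (simp add: sum_distrib_left mult_ac)
      qed auto
    qed
  next
    case (add u v)
    show ?case
    proof (intro allI impI)
      fix K assume K: "\<forall>x\<in>space M. v x + u x \<le> K"
      have uK: "\<forall>x\<in>space M. u x \<le> K" and vK: "\<forall>x\<in>space M. v x \<le> K"
      proof -
        show "\<forall>x\<in>space M. u x \<le> K"
        proof
          fix x assume "x \<in> space M" then show "u x \<le> K" using K add.hyps(4)[of x] by (smt (verit))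
        qed
        show "\<forall>x\<in>space M. v x \<le> K"
        proof
          fix x assume "x \<in> space M" then show "v x \<le> K" using K add.hyps(2)[of x] by (smt (verit))
        qed
      qed
      have "(\<Sum>i\<in>I. c i * integral\<^sup>L (\<alpha> i) (\<lambda>x. v x + u x)) =
        (\<Sum>i\<in>I. c i * integral\<^sup>L (\<alpha> i) v + c i * integral\<^sup>L (\<alpha> i) u)"
      proof (intro sum.cong refl)
        fix i assume "i \<in> I"
        then have "integrable (\<alpha> i) u" "integrable (\<alpha> i) v"
          using intg[of i u K] intg[of i v K] add.hyps uK vK by blast+
        then show "c i * integral\<^sup>L (\<alpha> i) (\<lambda>x. v x + u x) = c i * integral\<^sup>L (\<alpha> i) v + c i * integral\<^sup>L (\<alpha> i) u"
          by (simp add: distrib_left)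
      qed
      also have "\<dots> = 0" using add uK vK by (auto simp: sum.distrib)
      finally show "(\<Sum>i\<in>I. c i * integral\<^sup>L (\<alpha> i) (\<lambda>x. v x + u x)) = 0" .
    qed
  next
    case (seq U)
    show ?case
    proof (intro allI impI)
      fix K assume K: "\<forall>x\<in>space M. \<phi> x \<le> K"
      have UK: "U n x \<le> K" if "x \<in> space M" for n x
      proof -
        have "incseq (\<lambda>n. U n x)" using seq.hyps(3) by (auto simp: incseq_def le_fun_def)
        then have "U n x \<le> \<phi> x" using seq.hyps(4)[OF that] by (rule incseq_le)
        then show ?thesis using K that by force
      qed
      have um: "\<phi> \<in> borel_measurable M" using seq.hyps(1,4) by (rule borel_measurable_LIMSEQ_real[rotated])
      have "(\<lambda>n. \<Sum>i\<in>I. c i * integral\<^sup>L (\<alpha> i) (U n)) \<longlonglongrightarrow> (\<Sum>i\<in>I. c i * integral\<^sup>L (\<alpha> i) \<phi>)"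
      proof (intro tendsto_sum tendsto_mult tendsto_const)
        fix i assume i: "i \<in> I"
        interpret finite_measure "\<alpha> i" by (rule f[OF i])
        show "(\<lambda>n. integral\<^sup>L (\<alpha> i) (U n)) \<longlonglongrightarrow> integral\<^sup>L (\<alpha> i) \<phi>"
        proof (rule integral_dominated_convergence[where w="\<lambda>_. K"])
          show "\<phi> \<in> borel_measurable (\<alpha> i)" using ms[OF i] um by simp
          show "U n \<in> borel_measurable (\<alpha> i)" for n using ms[OF i] seq.hyps(1) by simp
          show "AE x in \<alpha> i. (\<lambda>n. U n x) \<longlonglongrightarrow> \<phi> x" using seq.hyps(4) sp[OF i] by (intro AE_I2) simp
          show "AE x in \<alpha> i. norm (U n x) \<le> K" for n using UK seq.hyps(2)[of n] sp[OF i] by (intro AE_I2) simp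
        qed simp
      qed
      moreover have "(\<Sum>i\<in>I. c i * integral\<^sup>L (\<alpha> i) (U n)) = 0" for n
        using seq.IH[of n] UK by blast
      ultimately show "(\<Sum>i\<in>I. c i * integral\<^sup>L (\<alpha> i) \<phi>) = 0"
        by (simp add: LIMSEQ_const_iff)
    qed
  qed
  then show ?thesis using \<phi>(3) by blast
qed

lemma sum_integral_measures_eq_0:
  fixes \<phi> :: "'a \<Rightarrow> real"
  assumes fin: "finite I" and s: "\<And>i. i \<in> I \<Longrightarrow> sets (\<alpha> i) = sets M" and f: "\<And>i. i \<in> I \<Longrightarrow> finite_measure (\<alpha> i)"
    and eq: "\<And>E. E \<in> sets M \<Longrightarrow> (\<Sum>i\<in>I. c i * measure (\<alpha> i) E) = 0"
    and \<phi>: "\<phi> \<in> borel_measurable M" "\<And>x. x \<in> space M \<Longrightarrow> \<bar>\<phi> x\<bar> \<le> K"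
  shows "(\<Sum>i\<in>I. c i * integral\<^sup>L (\<alpha> i) \<phi>) = 0"
proof -
  have ms: "u \<in> borel_measurable (\<alpha> i) \<longleftrightarrow> u \<in> borel_measurable M" if "i \<in> I" for i and u :: "'a \<Rightarrow> real"
    using s[OF that] by (simp cong: measurable_cong_sets)
  have sp: "space (\<alpha> i) = space M" if "i \<in> I" for i using s[OF that] by (rule sets_eq_imp_space_eq)
  have K: "0 \<le> K" "\<phi> x \<le> K" "- \<phi> x \<le> K" if "x \<in> space M" for x using \<phi>(2)[OF that] by linarith+
  have *: "(\<Sum>i\<in>I. c i * integral\<^sup>L (\<alpha> i) (\<lambda>x. max 0 (\<phi> x))) = 0"
    by (rule sum_integral_measures_eq_0_nonneg[OF fin s f eq, where K=K]) (use \<phi>(1) K in auto)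
  have **: "(\<Sum>i\<in>I. c i * integral\<^sup>L (\<alpha> i) (\<lambda>x. max 0 (- \<phi> x))) = 0"
    by (rule sum_integral_measures_eq_0_nonneg[OF fin s f eq, where K=K]) (use \<phi>(1) K in auto)
  have "integral\<^sup>L (\<alpha> i) \<phi> = integral\<^sup>L (\<alpha> i) (\<lambda>x. max 0 (\<phi> x)) - integral\<^sup>L (\<alpha> i) (\<lambda>x. max 0 (- \<phi> x))" if i: "i \<in> I" for i
  proof -
    have "\<phi> \<in> borel_measurable (\<alpha> i)" using ms[OF i] \<phi>(1) by simp
    moreover have "AE x in \<alpha> i. norm (\<phi> x) \<le> K" using \<phi>(2) sp[OF i] by (intro AE_I2) simp
    ultimately have "integrable (\<alpha> i) \<phi>" by (intro finite_measure.integrable_const_bound[OF f[OF i]])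
    then have "integral\<^sup>L (\<alpha> i) (\<lambda>x. max 0 (\<phi> x)) - integral\<^sup>L (\<alpha> i) (\<lambda>x. max 0 (- \<phi> x)) =
      integral\<^sup>L (\<alpha> i) (\<lambda>x. max 0 (\<phi> x) - max 0 (- \<phi> x))"
      by (intro Bochner_Integration.integral_diff[symmetric]) auto
    also have "(\<lambda>x. max 0 (\<phi> x) - max 0 (- \<phi> x)) = \<phi>" by (auto simp: max_def)
    finally show ?thesis by simp
  qed
  then have "(\<Sum>i\<in>I. c i * integral\<^sup>L (\<alpha> i) \<phi>) = (\<Sum>i\<in>I. c i * integral\<^sup>L (\<alpha> i) (\<lambda>x. max 0 (\<phi> x))) -
     (\<Sum>i\<in>I. c i * integral\<^sup>L (\<alpha> i) (\<lambda>x. max 0 (- \<phi> x)))"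
    by (simp add: sum_subtractf[symmetric] right_diff_distrib)
  then show ?thesis using * ** by simp
qed

definition bdd_borel :: "'a::euclidean_space set \<Rightarrow> ('a \<Rightarrow> real) set" where
  "bdd_borel \<Omega> = {\<phi>. \<phi> \<in> borel_measurable (restrict_space borel \<Omega>) \<and> (\<exists>K. \<forall>x\<in>\<Omega>. \<bar>\<phi> x\<bar> \<le> K)}"

text \<open>Any representation as a difference of finite measures gives the same integral: together
  with the Jordan parts it forms a relation with coefficients 1, -1, -1, 1.\<close>

lemma signed_integral_eq:
  assumes \<mu>: "\<mu> \<in> radon_measures \<Omega>" and s: "sets \<alpha> = borel_on \<Omega>" "sets \<beta> = borel_on \<Omega>"
    and f: "finite_measure \<alpha>" "finite_measure \<beta>"
    and eq: "\<And>E. E \<in> borel_on \<Omega> \<Longrightarrow> \<mu> E = measure \<alpha> E - measure \<beta> E" and \<phi>: "\<phi> \<in> bdd_borel \<Omega>"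
  shows "signed_integral \<Omega> \<mu> \<phi> = integral\<^sup>L \<alpha> \<phi> - integral\<^sup>L \<beta> \<phi>"
proof -
  note J = Jordan_decomposition[OF \<mu>]
  obtain K where K: "\<forall>x\<in>\<Omega>. \<bar>\<phi> x\<bar> \<le> K" using \<phi> by (auto simp: bdd_borel_def)
  define A where "A = (!) [pos_part \<Omega> \<mu>, neg_part \<Omega> \<mu>, \<alpha>, \<beta>]"
  define c where "c = (!) [1, -1, -1, 1::real]"
  have "(\<Sum>i\<in>{..<4::nat}. c i * integral\<^sup>L (A i) \<phi>) = 0"
  proof (rule sum_integral_measures_eq_0[where M="restrict_space borel \<Omega>" and K=K])
    fix E assume E: "E \<in> borel_on \<Omega>"
    show "(\<Sum>i<4. c i * Sigma_Algebra.measure (A i) E) = 0"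
      using J(5)[OF E] eq[OF E] by (simp add: A_def c_def lessThan_nat_numeral)
  qed (use J s f \<phi> K in \<open>auto simp: A_def lessThan_nat_numeral bdd_borel_def space_restrict_space\<close>)
  then show ?thesis by (simp add: A_def c_def lessThan_nat_numeral signed_integral_def)
qed

section \<open>Operations on Radon measures and measures with a density\<close>

lemma radon_measuresI:
  assumes "\<And>B. B \<notin> borel_on \<Omega> \<Longrightarrow> \<mu> B = 0"
    and "\<And>A. range A \<subseteq> borel_on \<Omega> \<Longrightarrow> disjoint_family A \<Longrightarrow> (\<lambda>i. \<mu> (A i)) sums \<mu> (\<Union>i. A i)"
  shows "\<mu> \<in> radon_measures \<Omega>"
  unfolding radon_measures_signed signed_measure_def by (intro conjI allI impI, rule assms(2), assumption, assumption, rule assms(1))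

lemma radon_measuresD:
  assumes "\<mu> \<in> radon_measures \<Omega>"
  shows "B \<notin> borel_on \<Omega> \<Longrightarrow> \<mu> B = 0"
    and "range A \<subseteq> borel_on \<Omega> \<Longrightarrow> disjoint_family A \<Longrightarrow> (\<lambda>i. \<mu> (A i)) sums \<mu> (\<Union>i. A i)"
  using assms signed_measureD[of "restrict_space borel \<Omega>" \<mu> A] unfolding radon_measures_signed
  by (metis, metis)

lemma radon_measures_add:
  "\<mu> \<in> radon_measures \<Omega> \<Longrightarrow> \<nu> \<in> radon_measures \<Omega> \<Longrightarrow> (\<lambda>B. \<mu> B + \<nu> B) \<in> radon_measures \<Omega>"
  by (rule radon_measuresI, simp add: radon_measuresD(1), rule sums_add) (erule radon_measuresD(2), assumption+)+

text \<open>Jordan parts are not additive, but the six parts of the two measures and of their sum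
  satisfy a linear relation.\<close>

lemma signed_integral_add:
  assumes \<mu>: "\<mu> \<in> radon_measures \<Omega>" and \<nu>: "\<nu> \<in> radon_measures \<Omega>" and \<phi>: "\<phi> \<in> bdd_borel \<Omega>"
  shows "signed_integral \<Omega> (\<lambda>B. \<mu> B + \<nu> B) \<phi> = signed_integral \<Omega> \<mu> \<phi> + signed_integral \<Omega> \<nu> \<phi>"
proof -
  note J = Jordan_decomposition[OF \<mu>] and J' = Jordan_decomposition[OF \<nu>]
    and J'' = Jordan_decomposition[OF radon_measures_add[OF \<mu> \<nu>]]
  obtain K where K: "\<forall>x\<in>\<Omega>. \<bar>\<phi> x\<bar> \<le> K" using \<phi> by (auto simp: bdd_borel_def)
  define A where "A = (!) [pos_part \<Omega> \<mu>, neg_part \<Omega> \<mu>, pos_part \<Omega> \<nu>, neg_part \<Omega> \<nu>,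
    pos_part \<Omega> (\<lambda>B. \<mu> B + \<nu> B), neg_part \<Omega> (\<lambda>B. \<mu> B + \<nu> B)]"
  define c where "c = (!) [1, -1, 1, -1, -1, 1::real]"
  have "(\<Sum>i\<in>{..<6::nat}. c i * integral\<^sup>L (A i) \<phi>) = 0"
  proof (rule sum_integral_measures_eq_0[where M="restrict_space borel \<Omega>" and K=K])
    fix E assume E: "E \<in> borel_on \<Omega>"
    show "(\<Sum>i<6. c i * Sigma_Algebra.measure (A i) E) = 0"
      using J(5)[OF E] J'(5)[OF E] J''(5)[OF E] by (simp add: A_def c_def lessThan_nat_numeral)
  qed (use J J' J'' \<phi> K in \<open>auto simp: A_def lessThan_nat_numeral bdd_borel_def space_restrict_space\<close>)
  moreover have "(\<Sum>i<6::nat. h i) = h 0 + h 1 + h 2 + h 3 + h 4 + h 5" for h :: "nat \<Rightarrow> real"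
    by (simp add: numeral_eq_Suc)
  ultimately have "c 0 * integral\<^sup>L (A 0) \<phi> + c 1 * integral\<^sup>L (A 1) \<phi> + c 2 * integral\<^sup>L (A 2) \<phi> +
    c 3 * integral\<^sup>L (A 3) \<phi> + c 4 * integral\<^sup>L (A 4) \<phi> + c 5 * integral\<^sup>L (A 5) \<phi> = 0" by simp
  then show ?thesis unfolding signed_integral_def A_def c_def nth_Cons_0 nth_Cons_numeral One_nat_def nth_Cons_Suc
    by (simp del: integral_minus)
qed

lemma signed_integral_diff_fun:
  assumes \<mu>: "\<mu> \<in> radon_measures \<Omega>" and \<phi>: "\<phi> \<in> bdd_borel \<Omega>" and \<psi>: "\<psi> \<in> bdd_borel \<Omega>"
  shows "signed_integral \<Omega> \<mu> (\<lambda>x. \<phi> x - \<psi> x) = signed_integral \<Omega> \<mu> \<phi> - signed_integral \<Omega> \<mu> \<psi>"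
proof -
  note J = Jordan_decomposition[OF \<mu>]
  have i: "integrable M \<eta>" if M: "sets M = borel_on \<Omega>" "finite_measure M" and \<eta>: "\<eta> \<in> bdd_borel \<Omega>" for M \<eta>
  proof -
    obtain K where "\<forall>x\<in>\<Omega>. \<bar>\<eta> x\<bar> \<le> K" using \<eta> by (auto simp: bdd_borel_def)
    then show ?thesis using \<eta> sets_eq_imp_space_eq[OF M(1)]
      by (intro finite_measure.integrable_const_bound[OF M(2), of _ K])
        (auto simp: bdd_borel_def space_restrict_space cong: measurable_cong_sets[OF M(1) refl])
  qed
  show ?thesis using i[OF J(1,3) \<phi>] i[OF J(1,3) \<psi>] i[OF J(2,4) \<phi>] i[OF J(2,4) \<psi>]
    by (simp add: signed_integral_def)
qed

lemma radon_measures_linear: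
  assumes "\<mu> \<in> radon_measures \<Omega>" "bounded_linear T"
  shows "(\<lambda>B. T (\<mu> B)) \<in> radon_measures \<Omega>"
  by (rule radon_measuresI, simp add: radon_measuresD(1)[OF assms(1)] linear_0[OF bounded_linear.linear[OF assms(2)]],
      rule bounded_linear.sums[OF assms(2)], rule radon_measuresD(2)[OF assms(1)])

lemma borel_on_iff: "\<Omega> \<in> sets borel \<Longrightarrow> B \<in> borel_on \<Omega> \<longleftrightarrow> B \<in> sets borel \<and> B \<subseteq> \<Omega>"
  by (subst sets_restrict_space_iff) auto

lemma sums_set_integral:
  fixes f :: "'a \<Rightarrow> 'b::{banach, second_countable_topology}"
  assumes A: "\<And>i::nat. A i \<in> sets M" "disjoint_family A" and f: "integrable M f"
  shows "(\<lambda>i. LINT x:A i|M. f x) sums (LINT x:(\<Union>i. A i)|M. f x)"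
proof -
  have f': "set_integrable M B f" if "B \<in> sets M" for B
    using f that by (simp add: set_integrable_def integrable_mult_indicator)
  have "(\<lambda>n. LINT x:(\<Union>i<n. A i)|M. f x) \<longlonglongrightarrow> (LINT x:(\<Union>n. \<Union>i<n. A i)|M. f x)"
    by (rule set_integral_cont_up) (use A f' in \<open>auto simp: incseq_def intro!: f' bexI[rotated] intro: less_le_trans\<close>)
  moreover have "(\<Union>n. \<Union>i<n. A i) = (\<Union>i. A i)" by auto
  moreover have "(LINT x:(\<Union>i<n. A i)|M. f x) = (\<Sum>i<n. LINT x:A i|M. f x)" for n
    by (rule set_integral_finite_Union) (use A f' in \<open>auto simp: disjoint_family_on_def\<close>)
  ultimately show ?thesis unfolding sums_def by simp
qed

lemma radon_measures_density:
  fixes f :: "'a::euclidean_space \<Rightarrow> 'b::euclidean_space"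
  assumes M: "sets borel \<subseteq> sets M" and \<Omega>: "\<Omega> \<in> sets borel" and f: "integrable M f"
  shows "(\<lambda>B. if B \<in> borel_on \<Omega> then LINT x:B|M. f x else 0) \<in> radon_measures \<Omega>"
  unfolding radon_measures_def
proof (safe, goal_cases)
  case (2 A)
  have A: "A i \<in> sets M" for i using 2 M borel_on_iff[OF \<Omega>] by blast
  have "(\<Union>i. A i) \<in> borel_on \<Omega>" using 2(1) by blast
  moreover have "(\<lambda>i. LINT x:A i|M. f x) sums (LINT x:(\<Union>i. A i)|M. f x)"
    using A 2(2) f by (rule sums_set_integral)
  ultimately show ?case using 2(1) by (auto simp: range_subsetD)
qed auto

text \<open>The positive and negative parts of the density give finite measures with the right
  difference; by \<open>signed_integral_eq\<close> they may replace the Jordan parts.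
  \<open>M\<close> will be Lebesgue measure for the diffuse part of a derivative and
  \<open>slices\<close> for its jumps.\<close>

lemma signed_integral_density:
  fixes f :: "'a::euclidean_space \<Rightarrow> real"
  assumes M: "sets borel \<subseteq> sets M" "space M = UNIV" and \<Omega>: "\<Omega> \<in> sets borel" and f: "integrable M f"
    and \<phi>: "\<phi> \<in> bdd_borel \<Omega>"
  shows "signed_integral \<Omega> (\<lambda>B. if B \<in> borel_on \<Omega> then LINT x:B|M. f x else 0) \<phi> = (LINT x:\<Omega>|M. \<phi> x * f x)"
    "set_integrable M \<Omega> (\<lambda>x. \<phi> x * f x)"
proof -
  have \<Omega>M: "\<Omega> \<in> sets M" using M \<Omega> by auto
  \<comment> \<open>The image under the identity only reduces the sigma-algebra to the Borel subsets
    of \<open>\<Omega>\<close>.\<close>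
  define N where "N g = distr (density (restrict_space M \<Omega>) (\<lambda>x. ennreal (max 0 (g x)))) (restrict_space borel \<Omega>) (\<lambda>x. x)" for g :: "'a \<Rightarrow> real"
  obtain K where K: "\<forall>x\<in>\<Omega>. \<bar>\<phi> x\<bar> \<le> K" using \<phi> by (auto simp: bdd_borel_def)
  have id: "(\<lambda>x. x) \<in> measurable (restrict_space M \<Omega>) (restrict_space borel \<Omega>)"
    by (rule measurable_restrict_space3) (use M in \<open>auto simp: measurable_def\<close>)
  have \<phi>m: "\<phi> \<in> borel_measurable (restrict_space borel \<Omega>)" using \<phi> by (auto simp: bdd_borel_def)
  have \<phi>r: "\<phi> \<in> borel_measurable (restrict_space M \<Omega>)"
    using measurable_compose[OF id \<phi>m] by simp
  have \<phi>M: "(\<lambda>x. indicator \<Omega> x * \<phi> x) \<in> borel_measurable M"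
    using \<phi>r \<Omega>M by (subst (asm) borel_measurable_restrict_space_iff) auto
  have \<phi>f: "integrable M (\<lambda>x. indicator \<Omega> x * \<phi> x * g x)" if g: "integrable M g" for g :: "'a \<Rightarrow> real"
    by (rule Bochner_Integration.integrable_bound[where f="\<lambda>x. K * g x"])
      (use g K \<phi>M in \<open>auto simp: indicator_def abs_mult intro!: mult_right_mono AE_I2 intro: order_trans[OF _ abs_ge_self]\<close>)
  show "set_integrable M \<Omega> (\<lambda>x. \<phi> x * f x)" using \<phi>f[OF f] by (simp add: set_integrable_def mult.assoc)
  have Ns: "sets (N g) = borel_on \<Omega>" for g by (simp add: N_def)
  have Ne: "measure (N g) E = (LINT x:E|M. max 0 (g x))" "emeasure (N g) E < \<infinity>"
    if E: "E \<in> borel_on \<Omega>" and g: "integrable M g" for g E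
  proof -
    have EM: "E \<in> sets M" and E\<Omega>: "E \<subseteq> \<Omega>" using E M borel_on_iff[OF \<Omega>] by auto
    have Er: "E \<in> sets (restrict_space M \<Omega>)" using EM E\<Omega> \<Omega>M by (subst sets_restrict_space_iff) auto
    have gm: "g \<in> borel_measurable (restrict_space M \<Omega>)" using g by (auto intro: measurable_restrict_space1)
    have "emeasure (N g) E = (\<integral>\<^sup>+x. ennreal (max 0 (g x)) * indicator E x \<partial>restrict_space M \<Omega>)"
      unfolding N_def using id gm E Er E\<Omega>
      by (subst emeasure_distr) (auto simp: emeasure_density space_restrict_space Int_absorb2 \<open>space M = UNIV\<close>)
    also have "\<dots> = (\<integral>\<^sup>+x. ennreal (indicator E x * max 0 (g x)) \<partial>M)"
      using \<Omega>M E\<Omega> by (subst nn_integral_restrict_space) (auto intro!: nn_integral_cong simp: indicator_def)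
    also have "\<dots> = ennreal (LINT x:E|M. max 0 (g x))"
      unfolding set_lebesgue_integral_def using g EM
      using integrable_mult_indicator[of E M "\<lambda>x. max 0 (g x)"]
      by (subst nn_integral_eq_integral) (auto simp: integrable_max)
    finally have *: "emeasure (N g) E = ennreal (LINT x:E|M. max 0 (g x))" .
    then show "measure (N g) E = (LINT x:E|M. max 0 (g x))" "emeasure (N g) E < \<infinity>"
      by (auto simp: measure_def set_lebesgue_integral_def intro!: integral_nonneg_AE)
  qed
  have Nf: "finite_measure (N g)" if g: "integrable M g" for g
  proof (rule finite_measureI)
    have "space (N g) = \<Omega>" by (simp add: N_def space_restrict_space)
    then show "emeasure (N g) (space (N g)) \<noteq> \<infinity>" using Ne(2)[of \<Omega> g] g \<Omega> by (auto simp: borel_on_iff)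
  qed
  have Ni: "integral\<^sup>L (N g) \<phi> = (LINT x|M. indicator \<Omega> x * \<phi> x * max 0 (g x))" if g: "integrable M g" for g
  proof -
    have gm: "g \<in> borel_measurable (restrict_space M \<Omega>)" using g by (auto intro: measurable_restrict_space1)
    have "integral\<^sup>L (N g) \<phi> = (LINT x|restrict_space M \<Omega>. max 0 (g x) *\<^sub>R \<phi> x)"
      unfolding N_def using id gm \<phi>m \<phi>r by (subst integral_distr) (auto simp: integral_density)
    then show ?thesis using \<Omega>M by (subst (asm) integral_restrict_space) (auto simp: mult_ac)
  qed
  have mf: "integrable M (\<lambda>x. - f x)" using f by simp
  have "signed_integral \<Omega> (\<lambda>B. if B \<in> borel_on \<Omega> then LINT x:B|M. f x else 0) \<phi> =
     integral\<^sup>L (N f) \<phi> - integral\<^sup>L (N (\<lambda>x. - f x)) \<phi>"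
  proof (rule signed_integral_eq[OF radon_measures_density[OF M(1) \<Omega> f] Ns Ns Nf[OF f] Nf[OF mf] _ \<phi>])
    fix E assume E: "E \<in> borel_on \<Omega>"
    have EM: "E \<in> sets M" using E M borel_on_iff[OF \<Omega>] by auto
    have "(LINT x:E|M. f x) = (LINT x:E|M. max 0 (f x) - max 0 (- f x))"
      unfolding set_lebesgue_integral_def by (intro Bochner_Integration.integral_cong) (auto simp: max_def)
    also have "\<dots> = (LINT x:E|M. max 0 (f x)) - (LINT x:E|M. max 0 (- f x))"
      by (rule set_integral_diff(2)) (use f integrable_mult_indicator[OF EM, of "\<lambda>x. max 0 (f x)"] integrable_mult_indicator[OF EM, of "\<lambda>x. max 0 (- f x)"] in \<open>auto simp: set_integrable_def\<close>)
    finally show "(if E \<in> borel_on \<Omega> then LINT x:E|M. f x else 0) = measure (N f) E - measure (N (\<lambda>x. - f x)) E"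
      using E Ne(1)[OF E f] Ne(1)[OF E mf] by simp
  qed
  also have "\<dots> = (LINT x|M. indicator \<Omega> x * \<phi> x * max 0 (f x) - indicator \<Omega> x * \<phi> x * max 0 (- f x))"
    using \<phi>f f by (simp add: Ni[OF f] Ni[OF mf])
  also have "\<dots> = (LINT x:\<Omega>|M. \<phi> x * f x)"
    unfolding set_lebesgue_integral_def by (intro Bochner_Integration.integral_cong) (auto simp: max_def)
  finally show "signed_integral \<Omega> (\<lambda>B. if B \<in> borel_on \<Omega> then LINT x:B|M. f x else 0) \<phi> = (LINT x:\<Omega>|M. \<phi> x * f x)" .
qed

section \<open>Continuously differentiable test functions\<close>

definition C1 :: "('a::euclidean_space \<Rightarrow> real) set" where
  "C1 = {\<phi>. \<exists>\<phi>'. (\<forall>x. GDERIV \<phi> x :> \<phi>' x) \<and> continuous_on UNIV \<phi>'}"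

definition C1_compact :: "'a::euclidean_space set \<Rightarrow> ('a \<Rightarrow> real) set" where
  "C1_compact \<Omega> = {\<phi>\<in>C1. compact (closure {x. \<phi> x \<noteq> 0}) \<and> closure {x. \<phi> x \<noteq> 0} \<subseteq> \<Omega>}"

lemma C1I: "(\<And>x. GDERIV \<phi> x :> \<phi>' x) \<Longrightarrow> continuous_on UNIV \<phi>' \<Longrightarrow> \<phi> \<in> C1"
  unfolding C1_def mem_Collect_eq by (intro exI conjI allI)

lemma C1_continuous: "\<phi> \<in> C1 \<Longrightarrow> continuous_on S \<phi>"
  unfolding C1_def gderiv_def by (blast intro: continuous_at_imp_continuous_on has_derivative_continuous)

lemma C1_const: "(\<lambda>x. c) \<in> C1"
  by (rule C1I[where \<phi>'="\<lambda>_. 0"]) (auto intro: GDERIV_const)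

lemma C1_add:
  assumes "f \<in> C1" "g \<in> C1" shows "(\<lambda>x. f x + g x) \<in> C1"
proof -
  obtain f' g' where "\<And>x. GDERIV f x :> f' x" "continuous_on UNIV f'" "\<And>x. GDERIV g x :> g' x" "continuous_on UNIV g'"
    using assms by (auto simp: C1_def)
  then show ?thesis by (intro C1I[where \<phi>'="\<lambda>x. f' x + g' x"] GDERIV_add continuous_intros)
qed

lemma C1_mult:
  assumes "f \<in> C1" "g \<in> C1" shows "(\<lambda>x. f x * g x) \<in> C1"
proof -
  obtain f' g' where "\<And>x. GDERIV f x :> f' x" "continuous_on UNIV f'" "\<And>x. GDERIV g x :> g' x" "continuous_on UNIV g'"
    using assms by (auto simp: C1_def)
  then show ?thesis
    by (intro C1I[where \<phi>'="\<lambda>x. f x *\<^sub>R g' x + g x *\<^sub>R f' x"] GDERIV_mult continuous_on_add continuous_on_scaleR C1_continuous[OF assms(1)] C1_continuous[OF assms(2)])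
qed

lemma C1_sum: "finite I \<Longrightarrow> (\<And>i. i \<in> I \<Longrightarrow> f i \<in> C1) \<Longrightarrow> (\<lambda>x. \<Sum>i\<in>I. f i x) \<in> C1"
  by (induction I rule: finite_induct) (simp_all add: C1_add C1_const)

lemma C1_compose:
  assumes "f \<in> C1" "\<And>t. DERIV h t :> h' t" "continuous_on UNIV h'" shows "(\<lambda>x. h (f x)) \<in> C1"
proof -
  obtain f' where f: "\<And>x. GDERIV f x :> f' x" "continuous_on UNIV f'"
    using assms(1) by (auto simp: C1_def)
  have "continuous_on UNIV (\<lambda>x. h' (f x))"
    using continuous_on_compose[OF C1_continuous[OF assms(1)] continuous_on_subset[OF assms(3)]] by (simp add: o_def)
  then show ?thesis
    by (intro C1I[where \<phi>'="\<lambda>x. h' (f x) *\<^sub>R f' x"] GDERIV_DERIV_compose f assms continuous_intros)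
qed

lemma C1_inner: "(\<lambda>x. x \<bullet> w) \<in> C1"
  by (rule C1I[where \<phi>'="\<lambda>_. w"]) (auto simp: gderiv_def intro: bounded_linear_imp_has_derivative bounded_linear_inner_left)

lemma real_polynomial_function_C1:
  fixes p :: "'a::euclidean_space \<Rightarrow> real"
  assumes "real_polynomial_function p" shows "p \<in> C1"
  using assms
proof induction
  case (linear f)
  have "f x = x \<bullet> (\<Sum>b\<in>Basis. f b *\<^sub>R b)" for x
  proof -
    have "f x = f (\<Sum>b\<in>Basis. (x \<bullet> b) *\<^sub>R b)" by (simp add: euclidean_representation)
    also have "\<dots> = (\<Sum>b\<in>Basis. (x \<bullet> b) * f b)"
      using linear by (simp add: linear_sum[OF bounded_linear.linear] linear_scale[OF bounded_linear.linear])
    also have "\<dots> = x \<bullet> (\<Sum>b\<in>Basis. f b *\<^sub>R b)" by (simp add: inner_sum_right mult.commute)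
    finally show ?thesis .
  qed
  then have "f = (\<lambda>x. x \<bullet> (\<Sum>b\<in>Basis. f b *\<^sub>R b))" by (rule ext)
  then show ?case using C1_inner by metis
qed (auto intro: C1_const C1_add C1_mult)

text \<open>Squaring makes the positive part continuously differentiable; this supplies both the
  bumps and the truncation in \<open>C1_cutoff\<close>.\<close>

lemma DERIV_max_square: "DERIV (\<lambda>s::real. (max 0 s)\<^sup>2) s :> 2 * max 0 s"
proof -
  consider "s < 0" | "s > 0" | "s = 0" by linarith
  then show ?thesis
  proof cases
    case 1
    have "DERIV (\<lambda>s::real. 0) s :> 2 * max 0 s" using 1 by simp
    moreover have "eventually (\<lambda>x. (max 0 x)\<^sup>2 = 0) (nhds s)"
      using eventually_nhds_in_open[of "{..<0}" s] 1 by (auto elim!: eventually_mono)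
    ultimately show ?thesis by (subst DERIV_cong_ev[OF refl _ refl]) auto
  next
    case 2
    have "DERIV (\<lambda>s::real. s\<^sup>2) s :> 2 * max 0 s" using 2 by (auto intro!: derivative_eq_intros)
    moreover have "eventually (\<lambda>x. (max 0 x)\<^sup>2 = x\<^sup>2) (nhds s)"
      using eventually_nhds_in_open[of "{0<..}" s] 2 by (auto elim!: eventually_mono)
    ultimately show ?thesis by (subst DERIV_cong_ev[OF refl _ refl]) auto
  next
    case 3
    have "((\<lambda>h. (max 0 (s + h))\<^sup>2 / h) \<longlongrightarrow> 0) (at 0)"
    proof (rule Lim_null_comparison[where g="\<lambda>h. \<bar>h\<bar>"])
      show "eventually (\<lambda>h. norm ((max 0 (s + h))\<^sup>2 / h) \<le> \<bar>h\<bar>) (at 0)"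
        using 3 by (intro always_eventually) (auto simp: max_def power2_eq_square)
      show "((\<lambda>h::real. \<bar>h\<bar>) \<longlongrightarrow> 0) (at 0)" by (auto intro!: tendsto_eq_intros)
    qed
    then show ?thesis using 3 by (simp add: DERIV_def)
  qed
qed

lemma C1_max_square: "f \<in> C1 \<Longrightarrow> (\<lambda>x. (max 0 (f x))\<^sup>2) \<in> C1"
  by (rule C1_compose[OF _ DERIV_max_square]) (auto intro!: continuous_intros)

lemma C1_dist_square: "(\<lambda>x. (x - a) \<bullet> (x - a)) \<in> C1"
proof -
  have "(\<lambda>x. (\<Sum>b\<in>Basis. (x \<bullet> b) * (x \<bullet> b)) + (x \<bullet> ((-2) *\<^sub>R a) + a \<bullet> a)) \<in> C1"
    by (intro C1_add C1_sum C1_mult C1_inner C1_const) auto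
  moreover have "(\<lambda>x. (\<Sum>b\<in>Basis. (x \<bullet> b) * (x \<bullet> b)) + (x \<bullet> ((-2) *\<^sub>R a) + a \<bullet> a)) = (\<lambda>x. (x - a) \<bullet> (x - a))"
    by (auto simp: inner_diff inner_commute euclidean_inner[symmetric])
  ultimately show ?thesis by simp
qed

text \<open>\<open>S\<close> is a sum of bumps, positive exactly on finitely many balls that cover
  \<open>K\<close>, and at least \<open>m\<close> on \<open>K\<close>. The square of the positive
  part of 1 - S/m, subtracted from 1, equals 1 where \<open>S\<close> is at least \<open>m\<close>
  and 0 where \<open>S\<close> vanishes.\<close>

lemma C1_cutoff:
  fixes K :: "'a::euclidean_space set"
  assumes K: "compact K" and U: "open U" "K \<subseteq> U"
  obtains ct where "ct \<in> C1_compact U" "\<forall>x. 0 \<le> ct x" "\<forall>x. ct x \<le> 1" "\<forall>x\<in>K. ct x = 1"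
proof (cases "K = {}")
  case True
  show ?thesis by (rule that[of "\<lambda>_. 0"]) (use True C1_const in \<open>auto simp: C1_compact_def\<close>)
next
  case False
  have "\<exists>r>0. cball a r \<subseteq> U" if "a \<in> K" for a
    using U that open_contains_cball by blast
  then obtain r where r: "\<And>a. a \<in> K \<Longrightarrow> r a > 0 \<and> cball a (r a) \<subseteq> U" by metis
  have "K \<subseteq> \<Union> ((\<lambda>a. ball a (r a)) ` K)" using r by force
  then obtain F where F: "F \<subseteq> K" "finite F" "K \<subseteq> \<Union> ((\<lambda>a. ball a (r a)) ` F)"
    using compactE_image[OF K, of K "\<lambda>a. ball a (r a)"] by auto
  define b where "b a x = (max 0 ((r a)\<^sup>2 + (-1) * ((x - a) \<bullet> (x - a))))\<^sup>2" for a x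
  define S where "S x = (\<Sum>a\<in>F. b a x)" for x
  have S: "S \<in> C1" unfolding S_def b_def
    by (intro C1_sum F C1_max_square C1_add C1_const C1_mult C1_dist_square)
  have b0: "b a x \<ge> 0" for a x by (simp add: b_def)
  have S0: "S x \<ge> 0" for x unfolding S_def by (intro sum_nonneg b0)
  have bpos: "b a x > 0 \<longleftrightarrow> x \<in> ball a (r a)" if "a \<in> F" for a x
  proof -
    have "b a x > 0 \<longleftrightarrow> (x - a) \<bullet> (x - a) < (r a)\<^sup>2" by (auto simp: b_def max_def)
    also have "\<dots> \<longleftrightarrow> norm (x - a) < r a"
      unfolding power2_norm_eq_inner[symmetric] using r[of a] F(1) that
      by (auto intro: power_strict_mono power2_less_imp_less less_imp_le)
    finally show ?thesis by (simp add: dist_norm norm_minus_commute)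
  qed
  have "S x > 0" if xK: "x \<in> K" for x
  proof -
    obtain a where a: "a \<in> F" "x \<in> ball a (r a)" using F(3) xK by blast
    then have "0 < b a x" using bpos by auto
    also have "b a x \<le> S x" unfolding S_def using a F(2) b0 by (intro member_le_sum) auto
    finally show ?thesis .
  qed
  then obtain m where m: "m > 0" "\<And>x. x \<in> K \<Longrightarrow> S x \<ge> m"
    using continuous_attains_inf[OF K False C1_continuous[OF S]] by metis
  define ct where "ct x = 1 + (-1) * (max 0 (1 + (-1/m) * S x))\<^sup>2" for x
  have "ct \<in> C1" unfolding ct_def by (intro C1_add C1_mult C1_const C1_max_square S)
  moreover have sub: "{x. ct x \<noteq> 0} \<subseteq> (\<Union>a\<in>F. cball a (r a))"
  proof
    fix x assume x: "x \<in> {x. ct x \<noteq> 0}"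
    have "S x \<noteq> 0" using x by (auto simp: ct_def)
    then obtain a where "a \<in> F" "b a x \<noteq> 0" unfolding S_def using sum.not_neutral_contains_not_neutral by blast
    then show "x \<in> (\<Union>a\<in>F. cball a (r a))" using bpos[of a x] b0[of a x] by force
  qed
  moreover have "compact (\<Union>a\<in>F. cball a (r a))" using F by auto
  moreover have "(\<Union>a\<in>F. cball a (r a)) \<subseteq> U" using r F by blast
  moreover have "closure {x. ct x \<noteq> 0} \<subseteq> (\<Union>a\<in>F. cball a (r a))"
    using F(2) by (intro closure_minimal[OF sub] closed_UN) auto
  moreover have "compact (closure {x. ct x \<noteq> 0})"
    using calculation by (metis Int_absorb1 closed_closure compact_Int_closed)
  ultimately have "ct \<in> C1_compact U" unfolding C1_compact_def by blast
  moreover have "0 \<le> ct x" "ct x \<le> 1" for x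
  proof -
    have "max 0 (1 + (-1/m) * S x) \<le> 1" using S0[of x] m(1) by auto
    then have "(max 0 (1 + (-1/m) * S x))\<^sup>2 \<le> 1" by (intro power_le_one) auto
    then show "0 \<le> ct x" "ct x \<le> 1" unfolding ct_def by auto
  qed
  moreover have "ct x = 1" if "x \<in> K" for x
    using m(2)[OF that] m(1) by (simp add: ct_def max_def field_simps)
  ultimately show ?thesis using that by blast
qed

section \<open>Density of test functions in \<open>C0\<close> and uniqueness of derivative
  measures\<close>

lemma C0_bdd_borel:
  assumes "open \<Omega>" "\<phi> \<in> C0 \<Omega>" shows "\<phi> \<in> bdd_borel \<Omega>"
proof -
  have c: "continuous_on \<Omega> \<phi>" and k: "compact {x\<in>\<Omega>. \<bar>\<phi> x\<bar> \<ge> 1}" using assms(2) by (auto simp: C0_def)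
  have "bounded (\<phi> ` {x\<in>\<Omega>. \<bar>\<phi> x\<bar> \<ge> 1})"
    by (intro compact_imp_bounded compact_continuous_image k continuous_on_subset[OF c]) auto
  then obtain K where K: "\<And>x. x \<in> \<Omega> \<Longrightarrow> \<bar>\<phi> x\<bar> \<ge> 1 \<Longrightarrow> \<bar>\<phi> x\<bar> \<le> K" by (auto simp: bounded_iff)
  have "\<forall>x\<in>\<Omega>. \<bar>\<phi> x\<bar> \<le> max 1 K" using K by force
  then show ?thesis using borel_measurable_continuous_on_restrict[OF c] by (auto simp: bdd_borel_def)
qed

lemma C1_compact_bdd_borel:
  assumes "\<phi> \<in> C1_compact \<Omega>" shows "\<phi> \<in> bdd_borel \<Omega>"
proof -
  have c: "continuous_on S \<phi>" for S using assms by (auto simp: C1_compact_def intro: C1_continuous)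
  have k: "compact (closure {x. \<phi> x \<noteq> 0})" using assms by (auto simp: C1_compact_def)
  have "bounded (\<phi> ` closure {x. \<phi> x \<noteq> 0})"
    by (intro compact_imp_bounded compact_continuous_image k c)
  then obtain K where K: "\<And>x. x \<in> closure {x. \<phi> x \<noteq> 0} \<Longrightarrow> \<bar>\<phi> x\<bar> \<le> K" by (auto simp: bounded_iff)
  have "\<bar>\<phi> x\<bar> \<le> max 0 K" for x
  proof (cases "\<phi> x = 0")
    case False then show ?thesis using K[of x] closure_subset[of "{x. \<phi> x \<noteq> 0}"] by auto
  qed auto
  then show ?thesis using borel_measurable_continuous_on_restrict[OF c] by (auto simp: bdd_borel_def)
qed

text \<open>A polynomial approximates \<phi> on the support of a cutoff that is 1 where the modulus
  of \<phi> is at least \<epsilon>/2. Elsewhere on that support the error is a convex combination of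
  the polynomial error and of \<phi> itself, both below \<epsilon>/2.\<close>

lemma C1_compact_dense:
  assumes \<Omega>: "open \<Omega>" and \<phi>: "\<phi> \<in> C0 \<Omega>" and e: "\<epsilon> > 0"
  obtains q where "q \<in> C1_compact \<Omega>" "\<And>x. x \<in> \<Omega> \<Longrightarrow> \<bar>\<phi> x - q x\<bar> \<le> \<epsilon>"
proof -
  have c: "continuous_on \<Omega> \<phi>" using \<phi> by (auto simp: C0_def)
  have "\<epsilon>/2 > 0" using e by simp
  then have k: "compact {x\<in>\<Omega>. \<bar>\<phi> x\<bar> \<ge> \<epsilon>/2}" using \<phi> unfolding C0_def by blast
  obtain ct where ct: "ct \<in> C1_compact \<Omega>" "\<forall>x. 0 \<le> ct x" "\<forall>x. ct x \<le> 1" "\<forall>x\<in>{x\<in>\<Omega>. \<bar>\<phi> x\<bar> \<ge> \<epsilon>/2}. ct x = 1"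
    by (rule C1_cutoff[OF k \<Omega> Collect_restrict])
  define S where "S = closure {x. ct x \<noteq> 0}"
  have S: "compact S" "S \<subseteq> \<Omega>" and ct1: "ct \<in> C1" using ct(1) by (auto simp: C1_compact_def S_def)
  obtain p where p: "real_polynomial_function p" "\<And>x. x \<in> S \<Longrightarrow> \<bar>\<phi> x - p x\<bar> < \<epsilon>/2"
    using Stone_Weierstrass_real_polynomial_function[OF S(1) continuous_on_subset[OF c S(2)], of "\<epsilon>/2"] e by auto
  show ?thesis
  proof (rule that[of "\<lambda>x. ct x * p x"])
    have sub: "closure {x. ct x * p x \<noteq> 0} \<subseteq> S" unfolding S_def by (intro closure_mono) auto
    moreover have "compact (closure {x. ct x * p x \<noteq> 0})"
      using compact_Int_closed[OF S(1), of "closure {x. ct x * p x \<noteq> 0}"] sub by (simp add: Int_absorb1)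
    ultimately show "(\<lambda>x. ct x * p x) \<in> C1_compact \<Omega>"
      using C1_mult[OF ct1 real_polynomial_function_C1[OF p(1)]] S(2) by (auto simp: C1_compact_def)
    fix x assume x: "x \<in> \<Omega>"
    consider "\<bar>\<phi> x\<bar> \<ge> \<epsilon>/2" | "\<bar>\<phi> x\<bar> < \<epsilon>/2" "x \<notin> S" | "\<bar>\<phi> x\<bar> < \<epsilon>/2" "x \<in> S" by linarith
    then show "\<bar>\<phi> x - ct x * p x\<bar> \<le> \<epsilon>"
    proof cases
      case 1
      then have "ct x = 1" using ct(4) x by auto
      moreover have "x \<in> S" using calculation closure_subset[of "{x. ct x \<noteq> 0}"] unfolding S_def by auto
      ultimately show ?thesis using p(2)[of x] e by simp
    next
      case 2
      then have "ct x = 0" using closure_subset[of "{x. ct x \<noteq> 0}"] unfolding S_def by blast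
      then show ?thesis using 2 e by simp
    next
      case 3
      have "\<phi> x - ct x * p x = ct x * (\<phi> x - p x) + (1 - ct x) * \<phi> x" by (simp add: algebra_simps)
      then have "\<bar>\<phi> x - ct x * p x\<bar> \<le> \<bar>ct x * (\<phi> x - p x)\<bar> + \<bar>(1 - ct x) * \<phi> x\<bar>" by linarith
      also have "\<dots> \<le> 1 * \<bar>\<phi> x - p x\<bar> + 1 * \<bar>\<phi> x\<bar>"
        unfolding abs_mult using ct(2,3) by (intro add_mono mult_right_mono) auto
      also have "\<dots> \<le> \<epsilon> / 2 + \<epsilon> / 2" using p(2)[OF 3(2)] 3(1) by (intro add_mono) auto
      finally show ?thesis by simp
    qed
  qed
qed

lemma radon_measures_restrict_inner:
  "\<mu> \<in> radon_measures \<Omega> \<Longrightarrow> (\<lambda>B. \<mu> B \<bullet> b) \<in> radon_measures \<Omega>"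
  by (rule radon_measures_linear[OF _ bounded_linear_inner_left])

text \<open>Cutoffs along a compact exhaustion converge to the indicator of an open set, so the
  measures agree on open sets; these form a generator stable under intersections.\<close>

lemma radon_measures_eqI:
  fixes \<mu> \<nu> :: "'a::euclidean_space set \<Rightarrow> real"
  assumes \<Omega>: "open \<Omega>" and \<mu>: "\<mu> \<in> radon_measures \<Omega>" and \<nu>: "\<nu> \<in> radon_measures \<Omega>"
    and eq: "\<And>\<phi>. \<phi> \<in> C1_compact \<Omega> \<Longrightarrow> signed_integral \<Omega> \<mu> \<phi> = signed_integral \<Omega> \<nu> \<phi>"
  shows "\<mu> = \<nu>"
proof -
  have op: "(\<lambda>n. signed_integral \<Omega> \<mu> (X n)) \<longlonglongrightarrow> \<mu> U"
    if \<mu>: "\<mu> \<in> radon_measures \<Omega>" and X: "\<And>n::nat. X n \<in> C1_compact \<Omega>" "\<And>n x. 0 \<le> X n x" "\<And>n x. X n x \<le> 1"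
      "\<And>x. (\<lambda>n. X n x) \<longlonglongrightarrow> indicator U x" and U: "U \<in> borel_on \<Omega>" for X U and \<mu> :: "'a set \<Rightarrow> real"
  proof -
    note J = Jordan_decomposition[OF \<mu>]
    have *: "(\<lambda>n. integral\<^sup>L N (X n)) \<longlonglongrightarrow> measure N U" if N: "sets N = borel_on \<Omega>" "finite_measure N" for N
    proof -
      interpret finite_measure N by fact
      have "(\<lambda>n. integral\<^sup>L N (X n)) \<longlonglongrightarrow> integral\<^sup>L N (indicator U)"
      proof (rule integral_dominated_convergence[where w="\<lambda>_. 1"])
        show "indicator U \<in> borel_measurable N" using U N(1) by (intro borel_measurable_indicator) auto
        show "X n \<in> borel_measurable N" for n
          using C1_compact_bdd_borel[OF X(1)[of n]] by (simp add: bdd_borel_def cong: measurable_cong_sets[OF N(1) refl])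
      qed (use X in auto)
      moreover have "U \<subseteq> space N" using U N(1) sets.sets_into_space by metis
      ultimately show ?thesis using U N(1) by (simp add: Int_absorb2)
    qed
    show ?thesis unfolding signed_integral_def J(5)[OF U]
      by (intro tendsto_diff * J)
  qed
  have opn: "\<mu> U = \<nu> U" if U: "open U" "U \<subseteq> \<Omega>" for U
  proof -
    obtain C where C: "\<And>n. compact (C n)" "\<And>n. C n \<subseteq> U" "\<And>n. C n \<subseteq> interior (C (Suc n))" "\<Union>(range C) = U"
      "\<And>K. \<lbrakk>compact K; K \<subseteq> U\<rbrakk> \<Longrightarrow> \<exists>N. \<forall>n\<ge>N. K \<subseteq> C n"
      using open_Union_compact_subsets[OF U(1)] by blast
    have "\<exists>ct. ct \<in> C1_compact U \<and> (\<forall>x. 0 \<le> ct x) \<and> (\<forall>x. ct x \<le> 1) \<and> (\<forall>x\<in>C n. ct x = 1)" for n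
      using C1_cutoff[OF C(1)[of n] U(1) C(2)] by metis
    then obtain X where X: "\<And>n. X n \<in> C1_compact U" "\<And>n x. 0 \<le> X n x" "\<And>n x. X n x \<le> 1" "\<And>n x. x \<in> C n \<Longrightarrow> X n x = 1"
      by metis
    have X\<Omega>: "X n \<in> C1_compact \<Omega>" for n using X(1)[of n] U(2) by (auto simp: C1_compact_def)
    have lim: "(\<lambda>n. X n x) \<longlonglongrightarrow> indicator U x" for x
    proof (rule tendsto_eventually)
      show "\<forall>\<^sub>F n in sequentially. X n x = indicator U x"
      proof (cases "x \<in> U")
        case True
        then obtain N where "\<forall>n\<ge>N. {x} \<subseteq> C n" using C(5)[of "{x}"] by auto
        then show ?thesis using X(4) True by (auto simp: eventually_sequentially)
      next
        case False
        have "X n x = 0" for n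
          using X(1)[of n] False closure_subset[of "{x. X n x \<noteq> 0}"] by (auto simp: C1_compact_def)
        then show ?thesis using False by auto
      qed
    qed
    have Ub: "U \<in> borel_on \<Omega>" using U \<Omega> by (simp add: borel_on_iff)
    show ?thesis
      using op[OF \<mu> X\<Omega> X(2,3) lim Ub] op[OF \<nu> X\<Omega> X(2,3) lim Ub] eq[OF X\<Omega>] LIMSEQ_unique by fastforce
  qed
  have \<mu>s: "signed_measure (restrict_space borel \<Omega>) \<mu>" and \<nu>s: "signed_measure (restrict_space borel \<Omega>) \<nu>"
    using \<mu> \<nu> by (auto simp: radon_measures_signed)
  have \<Omega>b: "\<Omega> \<in> sets borel" using \<Omega> by simp
  have bo: "B \<inter> \<Omega> \<in> borel_on \<Omega>" if "B \<in> sets borel" for B using that \<Omega>b by (auto simp: borel_on_iff)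
  have main: "\<mu> (B \<inter> \<Omega>) = \<nu> (B \<inter> \<Omega>)" if "B \<in> sigma_sets UNIV {S. open S}" for B
  proof (rule sigma_sets_induct_disjoint[OF _ _ that])
    fix A :: "'a set" assume "A \<in> {S. open S}"
    then show "\<mu> (A \<inter> \<Omega>) = \<nu> (A \<inter> \<Omega>)" using opn[of "A \<inter> \<Omega>"] \<Omega> by auto
  next
    show "\<mu> ({} \<inter> \<Omega>) = \<nu> ({} \<inter> \<Omega>)" using signed_measure_empty[OF \<mu>s] signed_measure_empty[OF \<nu>s] by simp
  next
    fix A :: "'a set" assume compl: "A \<in> sigma_sets UNIV {S. open S}" "\<mu> (A \<inter> \<Omega>) = \<nu> (A \<inter> \<Omega>)"
    have A: "A \<in> sets borel" using compl(1) by (simp add: borel_def)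
    have "(UNIV - A) \<inter> \<Omega> = \<Omega> - A \<inter> \<Omega>" by auto
    moreover have "\<Omega> \<in> borel_on \<Omega>" using \<Omega>b by (simp add: borel_on_iff)
    moreover have "\<Omega> \<inter> (A \<inter> \<Omega>) = A \<inter> \<Omega>" by auto
    ultimately show "\<mu> ((UNIV - A) \<inter> \<Omega>) = \<nu> ((UNIV - A) \<inter> \<Omega>)"
      using signed_measure_split[OF \<mu>s, of \<Omega> "A \<inter> \<Omega>"] signed_measure_split[OF \<nu>s, of \<Omega> "A \<inter> \<Omega>"] opn[OF \<Omega>] compl bo[OF A]
      by simp
  next
    fix A :: "nat \<Rightarrow> 'a set"
    assume union: "disjoint_family A" "range A \<subseteq> sigma_sets UNIV {S. open S}" "\<And>i. \<mu> (A i \<inter> \<Omega>) = \<nu> (A i \<inter> \<Omega>)"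
    have A: "A i \<in> sets borel" for i using union(2) by (auto simp: borel_def)
    have d: "range (\<lambda>i. A i \<inter> \<Omega>) \<subseteq> borel_on \<Omega>" "disjoint_family (\<lambda>i. A i \<inter> \<Omega>)"
      using bo[OF A] union(1) by (auto simp: disjoint_family_on_def)
    have "(\<Union>i. A i) \<inter> \<Omega> = (\<Union>i. A i \<inter> \<Omega>)" by auto
    then show "\<mu> ((\<Union>i. A i) \<inter> \<Omega>) = \<nu> ((\<Union>i. A i) \<inter> \<Omega>)"
      using radon_measuresD(2)[OF \<mu> d] radon_measuresD(2)[OF \<nu> d] union(3) by (simp add: sums_unique2)
  qed (auto simp: Int_stable_def)
  show ?thesis
  proof
    fix B
    show "\<mu> B = \<nu> B"
    proof (cases "B \<in> borel_on \<Omega>")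
      case True
      then have "B \<in> sigma_sets UNIV {S. open S}" "B \<inter> \<Omega> = B" using borel_on_iff[OF \<Omega>b] by (auto simp: borel_def)
      then show ?thesis using main by metis
    next
      case False then show ?thesis using radon_measuresD(1)[OF \<mu>] radon_measuresD(1)[OF \<nu>] by simp
    qed
  qed
qed

text \<open>Makes the \<open>THE\<close> in \<open>deriv_measure\<close> legitimate: its test
  functions are those of \<open>C1_compact\<close>, which determine every entry.\<close>

lemma is_deriv_measure_unique:
  assumes \<Omega>: "open \<Omega>" and \<mu>: "is_deriv_measure \<Omega> u \<mu>" and \<nu>: "is_deriv_measure \<Omega> u \<nu>"
  shows "\<mu> = \<nu>"
proof -
  have "(\<lambda>B. \<mu> B $ i $ j) = (\<lambda>B. \<nu> B $ i $ j)" for i j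
  proof (rule radon_measures_eqI[OF \<Omega>])
    show "(\<lambda>B. \<mu> B $ i $ j) \<in> radon_measures \<Omega>" "(\<lambda>B. \<nu> B $ i $ j) \<in> radon_measures \<Omega>"
      using \<mu> \<nu> unfolding is_deriv_measure_def
      by (auto intro!: radon_measures_linear[where T="\<lambda>x. x $ i $ j"] bounded_linear_compose[OF bounded_linear_vec_nth bounded_linear_vec_nth])
    fix \<phi> assume "\<phi> \<in> C1_compact \<Omega>"
    then obtain \<phi>' where \<phi>: "\<forall>x. GDERIV \<phi> x :> \<phi>' x" "continuous_on UNIV \<phi>'" "compact (closure {x. \<phi> x \<noteq> 0})"
      "closure {x. \<phi> x \<noteq> 0} \<subseteq> \<Omega>"
      unfolding C1_compact_def C1_def by blast
    have "(LINT x:\<Omega>|lebesgue. u x $ i * \<phi>' x $ j) = - signed_integral \<Omega> (\<lambda>B. \<mu> B $ i $ j) \<phi>"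
      using \<mu> \<phi> unfolding is_deriv_measure_def by blast
    moreover have "(LINT x:\<Omega>|lebesgue. u x $ i * \<phi>' x $ j) = - signed_integral \<Omega> (\<lambda>B. \<nu> B $ i $ j) \<phi>"
      using \<nu> \<phi> unfolding is_deriv_measure_def by blast
    ultimately show "signed_integral \<Omega> (\<lambda>B. \<mu> B $ i $ j) \<phi> = signed_integral \<Omega> (\<lambda>B. \<nu> B $ i $ j) \<phi>" by simp
  qed
  then have "\<mu> B $ i $ j = \<nu> B $ i $ j" for B i j by metis
  then show ?thesis by (intro ext) (simp add: vec_eq_iff)
qed

lemma deriv_measure_eq: "open \<Omega> \<Longrightarrow> is_deriv_measure \<Omega> u \<mu> \<Longrightarrow> deriv_measure \<Omega> u = \<mu>"
  unfolding deriv_measure_def by (rule the_equality, assumption, rule is_deriv_measure_unique)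

text \<open>The functionals are uniformly bounded by \<open>C\<close>, so convergence on the dense
  class \<open>C1_compact\<close> extends to \<open>C0\<close>.\<close>

lemma signed_integral_null:
  fixes D :: "nat \<Rightarrow> 'a::euclidean_space set \<Rightarrow> real"
  assumes \<Omega>: "open \<Omega>" and D: "\<And>n. D n \<in> radon_measures \<Omega>"
    and bound: "\<And>n \<phi> K. \<phi> \<in> bdd_borel \<Omega> \<Longrightarrow> (\<And>x. x \<in> \<Omega> \<Longrightarrow> \<bar>\<phi> x\<bar> \<le> K) \<Longrightarrow> K \<ge> 0 \<Longrightarrow> \<bar>signed_integral \<Omega> (D n) \<phi>\<bar> \<le> C * K"
    and lim: "\<And>\<phi>. \<phi> \<in> C1_compact \<Omega> \<Longrightarrow> (\<lambda>n. signed_integral \<Omega> (D n) \<phi>) \<longlonglongrightarrow> 0"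
    and \<phi>: "\<phi> \<in> C0 \<Omega>"
  shows "(\<lambda>n. signed_integral \<Omega> (D n) \<phi>) \<longlonglongrightarrow> 0"
proof (rule LIMSEQ_I)
  fix r :: real assume r: "r > 0"
  \<comment> \<open>The denominator makes the approximation error \<open>C * \<epsilon>\<close> less
    than r/2; adding 1 keeps it nonzero.\<close>
  define \<epsilon> where "\<epsilon> = r / (2 * (\<bar>C\<bar> + 1))"
  have e: "\<epsilon> > 0" using r by (simp add: \<epsilon>_def)
  obtain q where q: "q \<in> C1_compact \<Omega>" "\<And>x. x \<in> \<Omega> \<Longrightarrow> \<bar>\<phi> x - q x\<bar> \<le> \<epsilon>"
    using C1_compact_dense[OF \<Omega> \<phi> e] by metis
  obtain N where N: "\<And>n. n \<ge> N \<Longrightarrow> \<bar>signed_integral \<Omega> (D n) q\<bar> < r/2"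
    using LIMSEQ_D[OF lim[OF q(1)], of "r/2"] r by auto
  have b\<phi>: "\<phi> \<in> bdd_borel \<Omega>" and bq: "q \<in> bdd_borel \<Omega>"
    using C0_bdd_borel[OF \<Omega> \<phi>] C1_compact_bdd_borel[OF q(1)] by auto
  have bd: "(\<lambda>x. \<phi> x - q x) \<in> bdd_borel \<Omega>"
    using b\<phi> bq q(2) by (auto simp: bdd_borel_def)
  have C: "C * \<epsilon> < r/2"
  proof -
    have "C * \<epsilon> < (\<bar>C\<bar> + 1) * \<epsilon>" using e by (intro mult_strict_right_mono) auto
    also have "\<dots> = r/2" by (simp add: \<epsilon>_def field_simps add_pos_pos add_nonneg_eq_0_iff)
    finally show ?thesis .
  qed
  have "\<bar>signed_integral \<Omega> (D n) \<phi>\<bar> < r" if n: "n \<ge> N" for n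
  proof -
    have "signed_integral \<Omega> (D n) (\<lambda>x. \<phi> x - q x) = signed_integral \<Omega> (D n) \<phi> - signed_integral \<Omega> (D n) q"
      by (rule signed_integral_diff_fun[OF D b\<phi> bq])
    moreover have "\<bar>signed_integral \<Omega> (D n) (\<lambda>x. \<phi> x - q x)\<bar> \<le> C * \<epsilon>"
      by (rule bound[OF bd q(2)]) (use e in auto)
    ultimately show ?thesis using N[OF n] C by linarith
  qed
  then show "\<exists>N. \<forall>n\<ge>N. norm (signed_integral \<Omega> (D n) \<phi> - 0) < r" by auto
qed

section \<open>Lebesgue decomposition\<close>

text \<open>Null sets are closed under countable unions, so the supremum of \<open>N\<close> over
  them is attained; whatever part of a null set lies outside a maximiser must be negligible for
  \<open>N\<close>. The maximiser carries the singular part.\<close>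

lemma exists_maximal_null_set:
  assumes fin: "finite_measure N" and s: "sets N = sets M"
  obtains Z where "Z \<in> null_sets M" "\<And>A. A \<in> null_sets M \<Longrightarrow> emeasure N (A - Z) = 0"
proof -
  interpret finite_measure N by fact
  define V where "V = measure N ` null_sets M"
  have V0: "V \<noteq> {}" unfolding V_def by blast
  have bdd: "bdd_above V" unfolding V_def by (rule bdd_aboveI[of _ "measure N (space N)"]) (auto intro: bounded_measure)
  have "\<exists>Z\<in>null_sets M. measure N Z > Sup V - inverse (real (Suc n))" for n
  proof -
    have "Sup V - inverse (real (Suc n)) < Sup V" by simp
    then show ?thesis using less_cSup_iff[OF V0 bdd] unfolding V_def by blast
  qed
  then obtain Z where Z: "\<And>n. Z n \<in> null_sets M" "\<And>n. measure N (Z n) > Sup V - inverse (real (Suc n))" by metis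
  define U where "U = (\<Union>n. Z n)"
  have U: "U \<in> null_sets M" unfolding U_def using Z(1) by (rule null_sets_UN)
  have sm: "A \<in> sets N" if "A \<in> null_sets M" for A using that s by auto
  have "measure N U \<ge> Sup V - inverse (real (Suc n))" for n
  proof -
    have "measure N (Z n) \<le> measure N U" using sm[OF U] by (intro finite_measure_mono) (auto simp: U_def)
    then show ?thesis using Z(2)[of n] by linarith
  qed
  moreover have "(\<lambda>n. Sup V - inverse (real (Suc n))) \<longlonglongrightarrow> Sup V - 0"
    by (intro tendsto_diff tendsto_const LIMSEQ_inverse_real_of_nat)
  ultimately have Us: "measure N U \<ge> Sup V"
    using LIMSEQ_le_const2[of "\<lambda>n. Sup V - inverse (real (Suc n))" "Sup V - 0" "measure N U"] by auto
  show ?thesis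
  proof (rule that[OF U])
    fix A assume A: "A \<in> null_sets M"
    have AU: "U \<union> A \<in> null_sets M" using A U by (rule null_sets.Un[rotated])
    then have "measure N (U \<union> A) \<le> Sup V" unfolding V_def using bdd[unfolded V_def] by (intro cSup_upper) auto
    moreover have "measure N (U \<union> A) = measure N U + measure N (A - U)"
      using sm[OF U] sm[OF A] finite_measure_Union[of U "A - U"] by auto
    ultimately have "measure N (A - U) \<le> 0" using Us by linarith
    then show "emeasure N (A - U) = 0"
      by (simp add: emeasure_eq_measure measure_le_0_iff)
  qed
qed

lemma integrable_lborel_lebesgue_on:
  fixes f :: "'a::euclidean_space \<Rightarrow> 'b::euclidean_space"
  assumes "integrable lborel f" "\<Omega> \<in> sets borel" shows "integrable lebesgue f" "f \<in> L1 \<Omega>"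
proof -
  show *: "integrable lebesgue f" using assms(1) by (simp add: integrable_completion)
  show "f \<in> L1 \<Omega>" unfolding L1_def mem_Collect_eq
    using * assms(2) by (subst integrable_restrict_space) (auto intro!: integrable_mult_indicator)
qed

text \<open>Restricted to the complement of a maximal null set, \<open>N\<close> is absolutely
  continuous, and Radon-Nikodym applies.\<close>

lemma Lebesgue_decomposition_finite:
  fixes N :: "'a::euclidean_space measure"
  assumes fin: "finite_measure N" and s: "sets N = borel_on \<Omega>" and \<Omega>: "\<Omega> \<in> sets borel"
  obtains Z f where "Z \<in> null_sets lborel" "integrable lborel f"
    "\<And>B. B \<in> borel_on \<Omega> \<Longrightarrow> measure N (B - Z) = (LINT x:B|lborel. (f x::real))"
proof -
  interpret finite_measure N by fact
  define M where "M = restrict_space (lborel::'a measure) \<Omega>"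
  have sM: "sets M = borel_on \<Omega>" unfolding M_def by (intro sets_restrict_space_cong) simp
  have spM: "space M = \<Omega>" by (simp add: M_def space_restrict_space)
  have \<Omega>l: "\<Omega> \<inter> space lborel \<in> sets lborel" using \<Omega> by simp
  interpret M: sigma_finite_measure M unfolding M_def
    by (rule sigma_finite_measure_restrict_space) (use \<Omega> in \<open>auto simp: lborel.sigma_finite_measure_axioms\<close>)
  obtain Z where Z: "Z \<in> null_sets M" "\<And>A. A \<in> null_sets M \<Longrightarrow> emeasure N (A - Z) = 0"
    using exists_maximal_null_set[OF fin, of M] s sM by metis
  have ZN: "Z \<in> sets N" using Z(1) s sM by auto
  define N' where "N' = density N (indicator (space N - Z))"
  have N'e: "emeasure N' B = emeasure N (B - Z)" if B: "B \<in> sets N" for B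
  proof -
    have "emeasure N' B = (\<integral>\<^sup>+x. indicator (space N - Z) x * indicator B x \<partial>N)"
      unfolding N'_def using ZN B by (subst emeasure_density) auto
    also have "\<dots> = (\<integral>\<^sup>+x. indicator (B - Z) x \<partial>N)"
      using sets.sets_into_space[OF B] by (intro nn_integral_cong) (auto simp: indicator_def)
    also have "\<dots> = emeasure N (B - Z)" using ZN B by simp
    finally show ?thesis .
  qed
  have "absolutely_continuous M N'"
    unfolding absolutely_continuous_def
  proof
    fix A assume A: "A \<in> null_sets M"
    then have AN: "A \<in> sets N" using s sM by auto
    then show "A \<in> null_sets N'" using N'e[OF AN] Z(2)[OF A] by (auto simp: N'_def intro!: null_setsI)
  qed
  moreover have "sets N' = sets M" using s sM by (simp add: N'_def)
  ultimately obtain h where h: "h \<in> borel_measurable M" "density M h = N'"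
    using M.Radon_Nikodym by blast
  \<comment> \<open>Radon-Nikodym yields an extended-valued density on the restricted space. It is
    finite almost everywhere because \<open>N\<close> is finite, so passing to real values changes
    no integral.\<close>
  define f where "f x = indicator \<Omega> x * enn2real (h x)" for x
  have he: "(\<integral>\<^sup>+x\<in>B. h x \<partial>M) = emeasure N (B - Z)" if B: "B \<in> borel_on \<Omega>" for B
    using emeasure_density[OF h(1), of B] h(2) N'e[of B] B s sM by simp
  have \<Omega>s: "\<Omega> \<in> borel_on \<Omega>" using \<Omega> by (simp add: borel_on_iff)
  have "(\<integral>\<^sup>+x. h x \<partial>M) = (\<integral>\<^sup>+x\<in>\<Omega>. h x \<partial>M)" by (intro nn_integral_cong) (simp add: spM)
  then have "(\<integral>\<^sup>+x. h x \<partial>M) \<noteq> \<infinity>" using he[OF \<Omega>s] by simp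
  then have fin: "AE x in M. h x \<noteq> \<infinity>" using h(1) by (intro nn_integral_noteq_infinite) auto
  have "(\<lambda>x. enn2real (h x)) \<in> borel_measurable M" using h(1) by measurable
  then have fm: "f \<in> borel_measurable lborel" unfolding f_def M_def
    using \<Omega>l by (subst (asm) borel_measurable_restrict_space_iff) auto
  have fe: "(\<integral>\<^sup>+x. ennreal (indicator B x * f x) \<partial>lborel) = emeasure N (B - Z)" if B: "B \<in> borel_on \<Omega>" for B
  proof -
    have "(\<integral>\<^sup>+x. ennreal (indicator B x * f x) \<partial>lborel) = (\<integral>\<^sup>+x. ennreal (indicator B x * f x) * indicator \<Omega> x \<partial>lborel)"
      by (intro nn_integral_cong) (auto simp: f_def indicator_def)
    also have "\<dots> = (\<integral>\<^sup>+x. ennreal (indicator B x * f x) \<partial>M)"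
      unfolding M_def using \<Omega>l by (subst nn_integral_restrict_space) auto
    also have "\<dots> = (\<integral>\<^sup>+x\<in>B. h x \<partial>M)"
      by (intro nn_integral_cong_AE) (use fin AE_space in eventually_elim, auto simp: f_def indicator_def spM less_top)
    finally show ?thesis using he[OF B] by simp
  qed
  have f0: "f x \<ge> 0" for x by (auto simp: f_def)
  have fi: "integrable lborel f"
  proof (rule integrableI_nonneg[OF fm])
    have "(\<integral>\<^sup>+x. ennreal (f x) \<partial>lborel) = (\<integral>\<^sup>+x. ennreal (indicator \<Omega> x * f x) \<partial>lborel)"
      by (intro nn_integral_cong) (auto simp: f_def indicator_def)
    then show "(\<integral>\<^sup>+x. ennreal (f x) \<partial>lborel) < \<infinity>" using fe[OF \<Omega>s] by (simp add: less_top[symmetric])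
  qed (use f0 in auto)
  have "Z \<in> null_sets lborel" using Z(1) \<Omega>l unfolding M_def by (subst (asm) null_sets_restrict_space) auto
  then show ?thesis
  proof (rule that[OF _ fi])
    fix B assume B: "B \<in> borel_on \<Omega>"
    have Bb: "B \<in> sets borel" using B \<Omega> by (simp add: borel_on_iff)
    have "ennreal (LINT x:B|lborel. f x) = (\<integral>\<^sup>+x. ennreal (indicator B x * f x) \<partial>lborel)"
      unfolding set_lebesgue_integral_def real_scaleR_def using Bb integrable_mult_indicator[OF _ fi, of B]
      by (intro nn_integral_eq_integral[symmetric] AE_I2 mult_nonneg_nonneg f0 indicator_pos_le) auto
    then have "ennreal (LINT x:B|lborel. f x) = ennreal (measure N (B - Z))"
      using fe[OF B] by (simp add: emeasure_eq_measure)
    then show "measure N (B - Z) = (LINT x:B|lborel. f x)"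
      by (subst (asm) ennreal_inj) (auto simp: set_lebesgue_integral_def f0 intro!: Bochner_Integration.integral_nonneg)
  qed
qed

lemma L1_measure_lborel:
  fixes f :: "'a::euclidean_space \<Rightarrow> 'b::euclidean_space"
  assumes "f \<in> borel_measurable lborel" "B \<in> borel_on \<Omega>" "\<Omega> \<in> sets borel"
  shows "L1_measure \<Omega> f B = (LINT x:B|lborel. f x)"
  using assms unfolding L1_measure_def set_lebesgue_integral_def
  by (simp add: borel_on_iff) (subst integral_completion, auto)

text \<open>Applied to the Jordan parts of all components. The null sets found there can be enlarged
  to their union, since the integral of a density does not see the difference.\<close>

lemma Lebesgue_decomposition:
  fixes \<mu> :: "'a::euclidean_space set \<Rightarrow> 'b::euclidean_space"
  assumes \<Omega>: "\<Omega> \<in> sets borel" and \<mu>: "\<mu> \<in> radon_measures \<Omega>"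
  shows "\<exists>f. f \<in> L1 \<Omega> \<and> (\<exists>Z\<in>null_sets lborel. \<forall>B\<in>borel_on \<Omega>. \<mu> (B - Z) = L1_measure \<Omega> f B)"
proof -
  have "\<exists>Z f. Z \<in> null_sets lborel \<and> integrable lborel f \<and>
     (\<forall>B\<in>borel_on \<Omega>. \<mu> (B - Z) \<bullet> b = (LINT x:B|lborel. (f x::real)))" for b
  proof -
    have \<mu>b: "(\<lambda>B. \<mu> B \<bullet> b) \<in> radon_measures \<Omega>" by (rule radon_measures_restrict_inner[OF \<mu>])
    note J = Jordan_decomposition[OF \<mu>b]
    obtain Z1 f1 where 1: "Z1 \<in> null_sets lborel" "integrable lborel f1"
      "\<And>B. B \<in> borel_on \<Omega> \<Longrightarrow> measure (pos_part \<Omega> (\<lambda>B. \<mu> B \<bullet> b)) (B - Z1) = (LINT x:B|lborel. (f1 x::real))"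
      using Lebesgue_decomposition_finite[OF J(3,1) \<Omega>] by metis
    obtain Z2 f2 where 2: "Z2 \<in> null_sets lborel" "integrable lborel f2"
      "\<And>B. B \<in> borel_on \<Omega> \<Longrightarrow> measure (neg_part \<Omega> (\<lambda>B. \<mu> B \<bullet> b)) (B - Z2) = (LINT x:B|lborel. (f2 x::real))"
      using Lebesgue_decomposition_finite[OF J(4,2) \<Omega>] by metis
    have Z: "Z1 \<union> Z2 \<in> null_sets lborel" using 1 2 by auto
    have nul: "(LINT x:B - Z|lborel. f x) = (LINT x:B|lborel. f x)" if "B \<in> borel_on \<Omega>" "Z \<in> null_sets lborel"
      "integrable lborel f" for B Z and f :: "'a \<Rightarrow> real"
    proof -
      have "AE x in lborel. x \<notin> Z" using that(2) by (rule AE_not_in)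
      then show ?thesis unfolding set_lebesgue_integral_def using that \<Omega>
        by (intro integral_cong_AE) (auto simp: borel_on_iff indicator_def elim!: eventually_mono)
    qed
    have "\<mu> (B - (Z1 \<union> Z2)) \<bullet> b = (LINT x:B|lborel. f1 x - f2 x)" if B: "B \<in> borel_on \<Omega>" for B
    proof -
      have B': "B - Z2 \<in> borel_on \<Omega>" "B - Z1 \<in> borel_on \<Omega>" "B - (Z1 \<union> Z2) \<in> borel_on \<Omega>"
        using B null_setsD2[OF 1(1)] null_setsD2[OF 2(1)] \<Omega> by (auto simp: borel_on_iff)
      have e: "B - (Z1 \<union> Z2) = (B - Z2) - Z1" "B - (Z1 \<union> Z2) = (B - Z1) - Z2" by auto
      have "\<mu> (B - (Z1 \<union> Z2)) \<bullet> b = measure (pos_part \<Omega> (\<lambda>B. \<mu> B \<bullet> b)) ((B - Z2) - Z1) - measure (neg_part \<Omega> (\<lambda>B. \<mu> B \<bullet> b)) ((B - Z1) - Z2)"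
        using J(5)[OF B'(3)] e by simp
      also have "\<dots> = (LINT x:B|lborel. f1 x) - (LINT x:B|lborel. f2 x)"
        using 1(3)[OF B'(1)] 2(3)[OF B'(2)] nul[OF B 2(1) 1(2)] nul[OF B 1(1) 2(2)] by simp
      also have "\<dots> = (LINT x:B|lborel. f1 x - f2 x)"
        unfolding set_lebesgue_integral_def
        using B \<Omega> integrable_mult_indicator[OF _ 1(2), of B] integrable_mult_indicator[OF _ 2(2), of B]
        by (subst Bochner_Integration.integral_diff[symmetric]) (auto simp: borel_on_iff right_diff_distrib)
      finally show ?thesis .
    qed
    moreover have "integrable lborel (\<lambda>x. f1 x - f2 x)" using 1 2 by auto
    ultimately show ?thesis using Z by blast
  qed
  then obtain Z f where Zf: "\<And>b. Z b \<in> null_sets lborel" "\<And>b. integrable lborel (f b)"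
     "\<And>b B. B\<in>borel_on \<Omega> \<Longrightarrow> \<mu> (B - Z b) \<bullet> b = (LINT x:B|lborel. (f b x::real))" by metis
  define F where "F x = (\<Sum>b\<in>Basis. f b x *\<^sub>R b)" for x
  define U where "U = (\<Union>b\<in>Basis. Z b)"
  have Fi: "integrable lborel F" unfolding F_def using Zf(2) by auto
  have U: "U \<in> null_sets lborel" unfolding U_def using Zf(1) by (intro null_sets_UN') (auto intro: countable_finite)
  have "\<mu> (B - U) = L1_measure \<Omega> F B" if B: "B \<in> borel_on \<Omega>" for B
  proof (rule euclidean_eqI)
    fix b :: 'b assume b: "b \<in> Basis"
    have BU: "B - U \<in> borel_on \<Omega>" and Bb: "B \<in> sets borel" using B U \<Omega> by (auto simp: borel_on_iff)
    have "(B - U) - Z b = B - U" using b by (auto simp: U_def)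
    then have "\<mu> (B - U) \<bullet> b = (LINT x:B - U|lborel. f b x)" using Zf(3)[OF BU, of b] by simp
    also have "\<dots> = (LINT x:B|lborel. f b x)"
    proof -
      have "AE x in lborel. x \<notin> U" using U by (rule AE_not_in)
      then show ?thesis unfolding set_lebesgue_integral_def using Zf(2)[of b] Bb U
        by (intro integral_cong_AE) (auto simp: indicator_def elim!: eventually_mono)
    qed
    also have "\<dots> = (LINT x:B|lborel. F x \<bullet> b)" using b by (simp add: F_def inner_sum_left inner_Basis if_distrib cong: if_cong)
    also have "\<dots> = (LINT x:B|lborel. F x) \<bullet> b"
      unfolding set_lebesgue_integral_def using integrable_mult_indicator[OF _ Fi, of B] Bb
      by (subst integral_inner_left[symmetric]) auto
    also have "(LINT x:B|lborel. F x) = L1_measure \<Omega> F B" using L1_measure_lborel[OF borel_measurable_integrable[OF Fi] B \<Omega>] by simp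
    finally show "\<mu> (B - U) \<bullet> b = L1_measure \<Omega> F B \<bullet> b" .
  qed
  then show ?thesis using integrable_lborel_lebesgue_on(2)[OF Fi \<Omega>] U by blast
qed

section \<open>The absolutely continuous density and its uniqueness\<close>

lemma ac_density:
  fixes \<mu> :: "'a::euclidean_space set \<Rightarrow> 'b::euclidean_space"
  assumes \<Omega>: "\<Omega> \<in> sets borel" and \<mu>: "\<mu> \<in> radon_measures \<Omega>"
  shows "ac_density \<Omega> \<mu> \<in> L1 \<Omega>"
    "\<exists>Z\<in>null_sets lborel. \<forall>B\<in>borel_on \<Omega>. \<mu> (B - Z) = L1_measure \<Omega> (ac_density \<Omega> \<mu>) B"
  using someI_ex[OF Lebesgue_decomposition[OF \<Omega> \<mu>]] unfolding ac_density_def by blast+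

lemma L1_lebesgue:
  assumes "\<Omega> \<in> sets borel"
  shows "f \<in> L1 \<Omega> \<longleftrightarrow> integrable lebesgue (\<lambda>x. indicator \<Omega> x *\<^sub>R f x)"
  using assms unfolding L1_def mem_Collect_eq by (subst integrable_restrict_space) auto

lemma L1_measure_diff_null:
  fixes f :: "'a::euclidean_space \<Rightarrow> 'b::euclidean_space"
  assumes f: "f \<in> L1 \<Omega>" and B: "B \<in> borel_on \<Omega>" and Z: "Z \<in> null_sets lborel" and \<Omega>: "\<Omega> \<in> sets borel"
  shows "L1_measure \<Omega> f (B - Z) = L1_measure \<Omega> f B"
proof -
  have Bl: "B \<in> sets lebesgue" "B \<subseteq> \<Omega>" "B - Z \<in> borel_on \<Omega>" "Z \<in> sets lebesgue" using B Z \<Omega> by (auto simp: borel_on_iff)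
  have fi: "integrable lebesgue (\<lambda>x. indicator \<Omega> x *\<^sub>R f x)" using f L1_lebesgue[OF \<Omega>] by blast
  have "AE x in lebesgue. x \<notin> Z" using Z by (intro AE_completion AE_not_in)
  moreover have "integrable lebesgue (\<lambda>x. indicator A x *\<^sub>R f x)" if "A \<in> sets lebesgue" "A \<subseteq> \<Omega>" for A
  proof -
    have "(\<lambda>x. indicator A x *\<^sub>R indicator \<Omega> x *\<^sub>R f x) = (\<lambda>x. indicator A x *\<^sub>R f x)"
      using that(2) by (intro ext) (auto simp: indicator_def)
    then show ?thesis using integrable_mult_indicator[OF that(1) fi] by simp
  qed
  ultimately show ?thesis unfolding L1_measure_def set_lebesgue_integral_def using B Bl
    by simp (intro integral_cong_AE borel_measurable_integrable, auto elim!: eventually_mono, auto simp: indicator_def)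
qed

lemma sigma_finite_lebesgue: "sigma_finite_measure (lebesgue :: 'a::euclidean_space measure)"
proof
  obtain A :: "'a set set" where A: "countable A" "A \<subseteq> sets lborel" "\<Union>A = space lborel" "\<forall>a\<in>A. emeasure lborel a \<noteq> \<infinity>"
    using lborel.sigma_finite_countable by blast
  then show "\<exists>A::'a set set. countable A \<and> A \<subseteq> sets lebesgue \<and> \<Union>A = space lebesgue \<and> (\<forall>a\<in>A. emeasure lebesgue a \<noteq> \<infinity>)"
    by (intro exI[of _ A]) (auto simp: subset_eq)
qed

text \<open>Every Lebesgue measurable set differs from a Borel set by a null set, so equality of the
  integrals over Borel sets is enough.\<close>

lemma L1_measure_unique:
  fixes f1 f2 :: "'a::euclidean_space \<Rightarrow> 'b::euclidean_space"
  assumes \<Omega>: "\<Omega> \<in> sets borel" and f: "f1 \<in> L1 \<Omega>" "f2 \<in> L1 \<Omega>"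
    and eq: "\<And>B. B \<in> borel_on \<Omega> \<Longrightarrow> L1_measure \<Omega> f1 B = L1_measure \<Omega> f2 B"
  shows "AE x in lebesgue. x \<in> \<Omega> \<longrightarrow> f1 x = f2 x"
proof -
  define g where "g f x = indicator \<Omega> x *\<^sub>R f x" for f :: "'a \<Rightarrow> 'b" and x
  have gi: "integrable lebesgue (g f1)" "integrable lebesgue (g f2)" using f L1_lebesgue[OF \<Omega>, of f1] L1_lebesgue[OF \<Omega>, of f2] by (auto simp: g_def[abs_def])
  have gA: "(LINT x:A|lebesgue. g f1 x) = (LINT x:A|lebesgue. g f2 x)" if A: "A \<in> sets lebesgue" for A
  proof -
    obtain S T where ST: "S \<in> sets borel" "T \<in> null_sets lborel" "A = S \<union> (A - S)" "A - S \<subseteq> T" "S \<subseteq> A"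
      using A by (auto simp: sets_completion main_part_null_part_Un)
    have *: "(LINT x:A|lebesgue. g f x) = L1_measure \<Omega> f (S \<inter> \<Omega>)" if "integrable lebesgue (g f)" for f
    proof -
      have "AE x in lebesgue. x \<notin> T" using ST by (intro AE_completion AE_not_in)
      moreover have "S \<in> sets lebesgue" using ST by auto
      ultimately have "(LINT x:A|lebesgue. g f x) = (LINT x:S|lebesgue. g f x)"
        unfolding set_lebesgue_integral_def using that A ST(3-5)
        by (intro integral_cong_AE borel_measurable_scaleR borel_measurable_indicator borel_measurable_integrable) (auto simp: indicator_def elim!: eventually_mono)
      also have "\<dots> = L1_measure \<Omega> f (S \<inter> \<Omega>)" using ST(1) \<Omega>
        unfolding L1_measure_def set_lebesgue_integral_def
        by (auto simp: borel_on_iff g_def indicator_def intro!: Bochner_Integration.integral_cong)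
      finally show ?thesis .
    qed
    show ?thesis using *[OF gi(1)] *[OF gi(2)] eq[of "S \<inter> \<Omega>"] ST(1) \<Omega> by (simp add: borel_on_iff)
  qed
  have "AE x in lebesgue. g f1 x = g f2 x"
    using gi gA by (rule sigma_finite_measure.density_unique_banach[OF sigma_finite_lebesgue])
  then show ?thesis by eventually_elim (auto simp: g_def)
qed

text \<open>Removing both exceptional sets from \<open>B\<close> leaves one set on which both
  densities represent \<mu>.\<close>

lemma ac_density_unique:
  fixes \<mu> :: "'a::euclidean_space set \<Rightarrow> 'b::euclidean_space"
  assumes \<Omega>: "\<Omega> \<in> sets borel" and \<mu>: "\<mu> \<in> radon_measures \<Omega>"
    and f: "f \<in> L1 \<Omega>" "Z \<in> null_sets lborel" "\<And>B. B \<in> borel_on \<Omega> \<Longrightarrow> \<mu> (B - Z) = L1_measure \<Omega> f B"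
  shows "AE x in lebesgue. x \<in> \<Omega> \<longrightarrow> ac_density \<Omega> \<mu> x = f x"
proof -
  obtain Z' where Z': "Z' \<in> null_sets lborel" "\<And>B. B \<in> borel_on \<Omega> \<Longrightarrow> \<mu> (B - Z') = L1_measure \<Omega> (ac_density \<Omega> \<mu>) B"
    using ac_density(2)[OF \<Omega> \<mu>] by blast
  show ?thesis
  proof (rule L1_measure_unique[OF \<Omega> ac_density(1)[OF \<Omega> \<mu>] f(1)])
    fix B assume B: "B \<in> borel_on \<Omega>"
    have B': "B - Z \<in> borel_on \<Omega>" "B - Z' \<in> borel_on \<Omega>" using B \<Omega> f(2) Z'(1) by (auto simp: borel_on_iff)
    have "L1_measure \<Omega> (ac_density \<Omega> \<mu>) B = \<mu> (B - Z - Z')"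
      using L1_measure_diff_null[OF ac_density(1)[OF \<Omega> \<mu>] B f(2) \<Omega>] Z'(2)[OF B'(1)] by simp
    also have "B - Z - Z' = B - Z' - Z" by auto
    also have "\<mu> (B - Z' - Z) = L1_measure \<Omega> f B"
      using L1_measure_diff_null[OF f(1) B Z'(1) \<Omega>] f(3)[OF B'(2)] by simp
    finally show "L1_measure \<Omega> (ac_density \<Omega> \<mu>) B = L1_measure \<Omega> f B" .
  qed
qed

lemma vec_nth_measurable [measurable]: "(\<lambda>x::real^'n. x $ i) \<in> borel_measurable borel"
  by (intro borel_measurable_continuous_onI continuous_intros)

section \<open>Slicing by coordinate hyperplanes\<close>

definition upd :: "real^'n \<Rightarrow> 'n \<Rightarrow> real \<Rightarrow> real^'n" where
  "upd x m c = (\<chi> i. if i = m then c else x $ i)"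

lemma upd_nth: "upd x m c $ i = (if i = m then c else x $ i)"
  by (simp add: upd_def)

lemma upd_measurable_pair:
  fixes m :: "'n::finite"
  shows "(\<lambda>p. upd (fst p) m (snd p)) \<in> borel_measurable (borel \<Otimes>\<^sub>M borel)"
proof -
  have "continuous_on UNIV (\<lambda>p::(real^'n) \<times> real. if i = m then snd p else fst p $ i)" for i
    by (cases "i = m") (auto intro!: continuous_intros)
  then have "continuous_on UNIV (\<lambda>p::(real^'n) \<times> real. upd (fst p) m (snd p))"
    unfolding upd_def by (intro continuous_on_vec_lambda)
  then show ?thesis unfolding borel_prod by (rule borel_measurable_continuous_onI)
qed

lemma upd_measurable [measurable (raw)]:
  assumes "f \<in> borel_measurable M" "g \<in> borel_measurable M"
  shows "(\<lambda>x. upd (f x) m (g x)) \<in> borel_measurable M"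
  using measurable_compose[OF measurable_Pair[OF assms] upd_measurable_pair, of m] by simp

lemma prod_Basis_cart: "(\<Prod>b\<in>Basis. f ((x::real^'n) \<bullet> b)) = (\<Prod>i\<in>UNIV. f (x $ i))"
proof -
  have "(Basis :: (real^'n) set) = range (\<lambda>i. axis i 1)" by (auto simp: Basis_vec_def)
  moreover have "inj (\<lambda>i::'n. axis i (1::real))" by (auto simp: inj_def axis_eq_axis)
  ultimately have "(\<Prod>b\<in>Basis. f (x \<bullet> b)) = (\<Prod>i\<in>UNIV. f (x \<bullet> axis i 1))"
    by (metis (mono_tags, lifting) prod.reindex_cong)
  then show ?thesis by (simp add: inner_axis)
qed

lemma emeasure_lborel_box_cart:
  assumes "\<And>i. l $ i \<le> u $ i" shows "emeasure lborel (box l (u::real^'n)) = ennreal (\<Prod>i\<in>UNIV. u $ i - l $ i)"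
proof -
  have "\<And>b. b \<in> Basis \<Longrightarrow> l \<bullet> b \<le> u \<bullet> b" using assms by (auto simp: Basis_vec_def inner_axis)
  then have "emeasure lborel (box l u) = ennreal (\<Prod>b\<in>Basis. (u - l) \<bullet> b)" by (rule emeasure_lborel_box)
  then show ?thesis using prod_Basis_cart[of "\<lambda>x. x" "u - l"] by simp
qed

text \<open>Lebesgue measure on the slab \<open>0 < x\<^sub>m < 1\<close>; its image under \<^term>\<open>\<lambda>x. upd x m c\<close> is
  \<open>(N - 1)\<close>-dimensional Lebesgue measure on the hyperplane \<open>x\<^sub>m = c\<close>.\<close>

definition slab :: "'n \<Rightarrow> (real^'n) measure" where
  "slab m = density lborel (indicator {x. 0 < x $ m \<and> x $ m < 1})"

lemma slab_set: "{x. 0 < x $ m \<and> x $ m < 1} \<in> sets (borel::(real^'n) measure)"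
  by measurable

lemma sets_slab [simp, measurable_cong]: "sets (slab m) = sets borel"
  by (simp add: slab_def)

lemma space_slab [simp]: "space (slab m) = UNIV"
  by (simp add: slab_def)

lemma sigma_finite_slab: "sigma_finite_measure (slab m)"
  unfolding slab_def using slab_set[of m]
  by (subst sigma_finite_measure.sigma_finite_iff_density_finite[OF lborel.sigma_finite_measure_axioms]) (auto simp: indicator_def)

lemma emeasure_slab: "A \<in> sets borel \<Longrightarrow> emeasure (slab m) A = emeasure lborel ({x. 0 < x $ m \<and> x $ m < 1} \<inter> A)"
  unfolding slab_def using slab_set[of m] by (subst emeasure_density) (auto simp: indicator_inter_arith[symmetric])

lemma emeasure_slab_cylinder:
  fixes l u :: "real^'n"
  assumes "\<And>i. l $ i \<le> u $ i"
  shows "emeasure (slab m) {x. \<forall>i. i \<noteq> m \<longrightarrow> l $ i < x $ i \<and> x $ i < u $ i} = ennreal (\<Prod>i\<in>UNIV - {m}. u $ i - l $ i)"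
proof -
  have "{x. \<forall>i. i \<noteq> m \<longrightarrow> l $ i < x $ i \<and> x $ i < u $ i} \<in> sets borel" by measurable
  then have "emeasure (slab m) {x. \<forall>i. i \<noteq> m \<longrightarrow> l $ i < x $ i \<and> x $ i < u $ i} =
    emeasure lborel ({x. 0 < x $ m \<and> x $ m < 1} \<inter> {x. \<forall>i. i \<noteq> m \<longrightarrow> l $ i < x $ i \<and> x $ i < u $ i})"
    by (rule emeasure_slab)
  also have "{x. 0 < x $ m \<and> x $ m < 1} \<inter> {x. \<forall>i. i \<noteq> m \<longrightarrow> l $ i < x $ i \<and> x $ i < u $ i} = box (upd l m 0) (upd u m 1)"
  proof -
    have "(\<forall>i. P i) \<longleftrightarrow> P m \<and> (\<forall>i. i \<noteq> m \<longrightarrow> P i)" for P by metis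
    note * = this[of "\<lambda>i. upd l m 0 $ i < x $ i \<and> x $ i < upd u m 1 $ i" for x]
    show ?thesis by (intro set_eqI, unfold mem_box_cart * Int_iff mem_Collect_eq) (auto simp: upd_nth)
  qed
  also have "emeasure lborel \<dots> = ennreal (\<Prod>i\<in>UNIV. upd u m 1 $ i - upd l m 0 $ i)"
    using assms by (intro emeasure_lborel_box_cart) (auto simp: upd_nth)
  also have "(\<Prod>i\<in>UNIV. upd u m 1 $ i - upd l m 0 $ i) = (\<Prod>i\<in>UNIV - {m}. u $ i - l $ i)"
    by (subst prod.remove[of _ m]) (auto simp: upd_nth intro!: prod.cong)
  finally show ?thesis .
qed

text \<open>Fubini in coordinate \<open>m\<close> without leaving the type of vectors: the
  \<open>m\<close>-th coordinate of a slab point is overwritten by \<open>c\<close>, and the slab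
  has thickness 1, so no factor arises. It suffices to compare boxes.\<close>

lemma lborel_slices:
  fixes m :: "'n::finite"
  shows "lborel = distr (slab m \<Otimes>\<^sub>M lborel) borel (\<lambda>p. upd (fst p) m (snd p))"
proof (rule lborel_eqI)
  fix l u :: "real^'n" assume lu: "\<And>b. b \<in> Basis \<Longrightarrow> l \<bullet> b \<le> u \<bullet> b"
  have le: "l $ i \<le> u $ i" for i using lu[of "axis i 1"] by (simp add: inner_axis)
  interpret sigma_finite_measure "slab m" by (rule sigma_finite_slab)
  let ?A = "{x. \<forall>i. i \<noteq> m \<longrightarrow> l $ i < x $ i \<and> x $ i < u $ i}"
  have "(\<lambda>p. upd (fst p) m (snd p)) -` box l u \<inter> space (slab m \<Otimes>\<^sub>M lborel) = ?A \<times> {l $ m <..< u $ m}"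
    by (auto simp: mem_box_cart upd_nth space_pair_measure) metis+
  then have "emeasure (distr (slab m \<Otimes>\<^sub>M lborel) borel (\<lambda>p. upd (fst p) m (snd p))) (box l u) =
    emeasure (slab m \<Otimes>\<^sub>M lborel) (?A \<times> {l $ m <..< u $ m})"
    by (subst emeasure_distr) auto
  also have "\<dots> = emeasure (slab m) ?A * emeasure lborel {l $ m <..< u $ m}"
    by (rule lborel.emeasure_pair_measure_Times) auto
  also have "\<dots> = ennreal ((\<Prod>i\<in>UNIV - {m}. u $ i - l $ i) * (u $ m - l $ m))"
    using le emeasure_slab_cylinder[of l u m] by (simp add: ennreal_mult prod_nonneg)
  also have "(\<Prod>i\<in>UNIV - {m}. u $ i - l $ i) * (u $ m - l $ m) = (\<Prod>i\<in>UNIV. u $ i - l $ i)"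
    by (subst prod.remove[of UNIV m]) (auto simp: mult.commute)
  also have "\<dots> = (\<Prod>b\<in>Basis. (u - l) \<bullet> b)" using prod_Basis_cart[of "\<lambda>x. x" "u - l"] by simp
  finally show "emeasure (distr (slab m \<Otimes>\<^sub>M lborel) borel (\<lambda>p. upd (fst p) m (snd p))) (box l u) = (\<Prod>b\<in>Basis. (u - l) \<bullet> b)" .
qed simp

lemma pair_sigma_finite_slab: "pair_sigma_finite (slab m) lborel"
  by (simp add: pair_sigma_finite_def sigma_finite_slab lborel.sigma_finite_measure_axioms)

lemma integral_slices:
  fixes f :: "real^'n \<Rightarrow> real"
  assumes f: "integrable lborel f"
  shows "integral\<^sup>L lborel f = (LINT x|slab m. LINT c|lborel. f (upd x m c))"
proof -
  interpret pair_sigma_finite "slab m" lborel by (rule pair_sigma_finite_slab)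
  have fm: "f \<in> borel_measurable borel" using f by auto
  have u: "(\<lambda>p. upd (fst p) m (snd p)) \<in> measurable (slab m \<Otimes>\<^sub>M lborel) borel" by measurable
  have "integrable (slab m \<Otimes>\<^sub>M lborel) (\<lambda>p. f (upd (fst p) m (snd p)))"
    using f lborel_slices[of m] integrable_distr_eq[OF u fm] by simp
  then have "(LINT x|slab m. LINT c|lborel. f (upd x m c)) = integral\<^sup>L (slab m \<Otimes>\<^sub>M lborel) (\<lambda>p. f (upd (fst p) m (snd p)))"
    using integral_fst'[of "\<lambda>p. f (upd (fst p) m (snd p))"] by simp
  also have "\<dots> = integral\<^sup>L lborel f"
    using lborel_slices[of m] integral_distr[OF u fm] by simp
  finally show ?thesis by simp
qed

text \<open>Fubini for a null set, with the roles of the variables exchanged so that the level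
  \<open>c\<close> can be chosen first.\<close>

lemma AE_slices:
  fixes E :: "(real^'n) set"
  assumes E: "E \<in> null_sets lborel"
  shows "AE c in lborel. AE x in slab m. upd x m c \<notin> E"
proof -
  interpret pair_sigma_finite "slab m" lborel by (rule pair_sigma_finite_slab)
  have Em: "E \<in> sets borel" using E by auto
  have u: "(\<lambda>p. upd (fst p) m (snd p)) \<in> measurable (slab m \<Otimes>\<^sub>M lborel) borel" by measurable
  have "AE x in distr (slab m \<Otimes>\<^sub>M lborel) borel (\<lambda>p. upd (fst p) m (snd p)). x \<notin> E"
    unfolding lborel_slices[symmetric] by (rule AE_not_in[OF E])
  then have "AE p in slab m \<Otimes>\<^sub>M lborel. upd (fst p) m (snd p) \<notin> E"
    using Em by (subst (asm) AE_distr_iff[OF u]) auto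
  moreover have "{p \<in> space (slab m \<Otimes>\<^sub>M lborel). upd (fst p) m (snd p) \<notin> E} \<in> sets (slab m \<Otimes>\<^sub>M lborel)"
    using measurable_sets[OF u, of "- E"] Em by (simp add: vimage_def Int_def conj_commute)
  ultimately have "AE x in slab m. AE c in lborel. upd x m c \<notin> E"
    using AE_pair_iff[of "\<lambda>x c. upd x m c \<notin> E"] by simp
  moreover have "{p \<in> space (slab m \<Otimes>\<^sub>M lborel). upd (fst p) m (snd p) \<notin> E} \<in> sets (slab m \<Otimes>\<^sub>M lborel)" by fact
  ultimately show ?thesis using AE_commute[of "\<lambda>x c. upd x m c \<notin> E"] by simp
qed

text \<open>The sum over \<open>c \<in> C\<close> of \<open>(N - 1)\<close>-dimensional Lebesgue measure on the hyperplanes \<open>x\<^sub>m = c\<close>.\<close>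

definition slices :: "'n \<Rightarrow> real set \<Rightarrow> (real^'n) measure" where
  "slices m C = distr (slab m \<Otimes>\<^sub>M count_space C) borel (\<lambda>p. upd (fst p) m (snd p))"

lemma sets_slices [simp, measurable_cong]: "sets (slices m C) = sets borel"
  by (simp add: slices_def)

lemma space_slices [simp]: "space (slices m C) = UNIV"
  by (simp add: slices_def)

lemma upd_measurable_slices: "(\<lambda>p. upd (fst p) m (snd p)) \<in> measurable (slab m \<Otimes>\<^sub>M count_space C) borel"
proof -
  have "snd \<in> borel_measurable (slab m \<Otimes>\<^sub>M count_space C)"
    by (rule measurable_compose[OF measurable_snd]) auto
  moreover have "fst \<in> borel_measurable (slab m \<Otimes>\<^sub>M count_space C)"
    by (rule measurable_compose[OF measurable_fst]) auto
  ultimately show ?thesis by (rule upd_measurable[rotated])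
qed

lemma pair_sigma_finite_slices: "countable C \<Longrightarrow> pair_sigma_finite (slab m) (count_space C)"
  by (simp add: pair_sigma_finite_def sigma_finite_slab sigma_finite_measure_count_space_countable)

lemma AE_slices_iff:
  assumes C: "countable C" and P: "{x. P x} \<in> sets borel"
  shows "(AE x in slices m C. P x) \<longleftrightarrow> (AE x in slab m. \<forall>c\<in>C. P (upd x m c))"
proof -
  interpret pair_sigma_finite "slab m" "count_space C" using C by (rule pair_sigma_finite_slices)
  have "(AE x in slices m C. P x) \<longleftrightarrow> (AE p in slab m \<Otimes>\<^sub>M count_space C. P (upd (fst p) m (snd p)))"
    unfolding slices_def using P by (subst AE_distr_iff[OF upd_measurable_slices]) auto
  also have "\<dots> \<longleftrightarrow> (AE x in slab m. AE c in count_space C. P (upd x m c))"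
    using measurable_sets[OF upd_measurable_slices[of m C] P]
    by (subst AE_pair_iff[symmetric]) (auto simp: vimage_def Int_def conj_commute)
  finally show ?thesis by (simp add: AE_count_space)
qed

lemma slices_AE_mem: "countable C \<Longrightarrow> AE x in slices m C. x $ m \<in> C"
proof (subst AE_slices_iff)
  assume "countable C"
  then have "C \<in> sets borel" by (rule sets.countable[rotated]) simp
  then show "{x. x $ m \<in> C} \<in> sets borel"
    using measurable_sets[OF vec_nth_measurable[of m], of C] by (simp add: vimage_def)
qed (auto simp: upd_nth)

lemma nn_integral_slices:
  assumes C: "countable C" and f: "f \<in> borel_measurable borel"
  shows "integral\<^sup>N (slices m C) f = (\<integral>\<^sup>+x. (\<integral>\<^sup>+c. f (upd x m c) \<partial>count_space C) \<partial>slab m)"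
proof -
  interpret pair_sigma_finite "slab m" "count_space C" using C by (rule pair_sigma_finite_slices)
  show ?thesis unfolding slices_def
    using f measurable_compose[OF upd_measurable_slices f]
    by (subst nn_integral_distr[OF upd_measurable_slices], simp, subst M2.nn_integral_fst[symmetric]) auto
qed

lemma slices_null:
  assumes C: "countable C" and E: "E \<in> sets borel" and "\<And>c. c \<in> C \<Longrightarrow> AE x in slab m. upd x m c \<notin> E"
  shows "E \<in> null_sets (slices m C)"
proof -
  have "AE x in slab m. \<forall>c\<in>C. upd x m c \<notin> E" using assms by (subst AE_ball_countable) auto
  then have "AE x in slices m C. x \<notin> E" using E by (subst AE_slices_iff[OF C]) (auto simp: Collect_neg_eq)
  then show ?thesis using E by (subst AE_iff_null_sets) auto
qed

lemma null_sets_hyperplane: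
  fixes a :: "'a::euclidean_space"
  assumes "a \<noteq> 0" shows "{x. a \<bullet> x = c} \<in> null_sets lborel"
proof -
  have "{x. a \<bullet> x = c} \<in> null_sets lebesgue"
    using negligible_hyperplane[of a c] assms by (simp add: negligible_iff_null_sets)
  moreover have "{x. a \<bullet> x = c} \<in> sets borel" by (intro borel_closed closed_hyperplane)
  ultimately show ?thesis by (simp add: null_sets_completion_iff)
qed

lemma null_sets_coordinate: "{x::real^'n. x $ i = c} \<in> null_sets lborel"
  using null_sets_hyperplane[of "axis i (1::real)" c] by (simp add: inner_axis' axis_eq_0_iff)

lemma slab_hyperplane_null: "AE x in slab m. x $ i \<noteq> c"
proof -
  have "AE x::real^'a in lborel. x \<notin> {x. x $ i = c}" by (rule AE_not_in[OF null_sets_coordinate])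
  then show ?thesis unfolding slab_def using slab_set[of m]
    by (subst AE_density) (auto elim!: eventually_mono)
qed

section \<open>The building block: an affine function on a cube\<close>

text \<open>Closed, in contrast to the half-open grid cells used later: the traces from inside on
  two opposite faces are then values of \<open>ramp\<close> itself, and \<open>ramp_jump\<close>
  only has to attach signs.\<close>

definition cube :: "real^'n \<Rightarrow> real \<Rightarrow> (real^'n) set" where
  "cube l h = {x. \<forall>i. l $ i \<le> x $ i \<and> x $ i \<le> l $ i + h}"

definition ramp :: "real^'n \<Rightarrow> real \<Rightarrow> 'n \<Rightarrow> real^'n \<Rightarrow> real" where
  "ramp l h j x = indicator (cube l h) x * (x $ j - l $ j)"

text \<open>The jump of \<^const>\<open>ramp\<close> across its faces orthogonal to the \<open>m\<close>-th axis.\<close>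

definition ramp_jump :: "real^'n \<Rightarrow> real \<Rightarrow> 'n \<Rightarrow> 'n \<Rightarrow> real^'n \<Rightarrow> real" where
  "ramp_jump l h j m x = ramp l h j x * (of_bool (x $ m = l $ m) - of_bool (x $ m = l $ m + h))"

lemma cube_cbox: "cube l h = cbox l (l + vec h)"
  by (auto simp: cube_def mem_box_cart)

lemma cube_borel [measurable]: "cube l h \<in> sets borel"
  by (simp add: cube_cbox)

lemma ramp_measurable [measurable]: "ramp l h j \<in> borel_measurable borel"
  unfolding ramp_def[abs_def] by measurable

lemma ramp_jump_measurable [measurable]: "ramp_jump l h j m \<in> borel_measurable borel"
  unfolding ramp_jump_def[abs_def] by measurable

lemma ramp_bounds: "h \<ge> 0 \<Longrightarrow> 0 \<le> ramp l h j x" "h \<ge> 0 \<Longrightarrow> ramp l h j x \<le> h"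
  by (auto simp: ramp_def cube_def indicator_def algebra_simps)

lemma emeasure_cube: "h \<ge> 0 \<Longrightarrow> emeasure lborel (cube l h :: (real^'n) set) = ennreal (h ^ CARD('n))"
proof -
  assume h: "h \<ge> 0"
  have "\<And>b. b \<in> Basis \<Longrightarrow> l \<bullet> b \<le> (l + vec h) \<bullet> b" using h by (auto simp: Basis_vec_def inner_axis)
  then have "emeasure lborel (cube l h) = ennreal (\<Prod>b\<in>Basis. (l + vec h - l) \<bullet> b)"
    unfolding cube_cbox by (subst emeasure_lborel_cbox) auto
  then show ?thesis using prod_Basis_cart[of "\<lambda>x. x" "vec h::real^'n"] by simp
qed

lemma emeasure_slab_cube_face:
  fixes l :: "real^'n"
  assumes h: "h \<ge> 0"
  shows "emeasure (slab m) {x. \<forall>i. i \<noteq> m \<longrightarrow> l $ i \<le> x $ i \<and> x $ i \<le> l $ i + h} = ennreal (h ^ (CARD('n) - 1))"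
proof -
  let ?B = "{x. \<forall>i. i \<noteq> m \<longrightarrow> l $ i \<le> x $ i \<and> x $ i \<le> l $ i + h}"
  let ?A = "{x. \<forall>i. i \<noteq> m \<longrightarrow> l $ i < x $ i \<and> x $ i < (l + vec h) $ i}"
  have "AE x in slab m. \<forall>i\<in>UNIV - {m}. x $ i \<noteq> l $ i \<and> l $ i \<noteq> x $ i \<and> x $ i \<noteq> l $ i + h \<and> l $ i + h \<noteq> x $ i"
  proof (subst AE_ball_countable)
    show "\<forall>i\<in>UNIV - {m}. AE x in slab m. x $ i \<noteq> l $ i \<and> l $ i \<noteq> x $ i \<and> x $ i \<noteq> l $ i + h \<and> l $ i + h \<noteq> x $ i"
    proof
    fix i assume "i \<in> UNIV - {m}"
    then have "AE x in slab m. x $ i \<noteq> l $ i" "AE x in slab m. x $ i \<noteq> l $ i + h"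
      by (auto intro: slab_hyperplane_null)
    then show "AE x in slab m. x $ i \<noteq> l $ i \<and> l $ i \<noteq> x $ i \<and> x $ i \<noteq> l $ i + h \<and> l $ i + h \<noteq> x $ i"
      by eventually_elim auto
    qed
  qed (auto intro: countable_finite)
  then have "AE x in slab m. x \<in> ?B \<longleftrightarrow> x \<in> ?A"
    by eventually_elim (auto simp: less_le)
  moreover have "?A \<in> sets (slab m)" "?B \<in> sets (slab m)" by measurable
  ultimately have "emeasure (slab m) ?B = emeasure (slab m) ?A" by (intro emeasure_eq_AE) auto
  also have "\<dots> = ennreal (\<Prod>i\<in>UNIV - {m}. (l + vec h) $ i - l $ i)"
    using h by (intro emeasure_slab_cylinder) auto
  finally show ?thesis by simp
qed

text \<open>Two faces of area h^(N-1) carry jumps of size at most h, which gives twice the volume of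
  the cube. Summed over cubes, this bound does not depend on the scale. Only faces at levels in
  \<open>C\<close> are counted, hence an inequality.\<close>

lemma nn_integral_ramp_jump:
  fixes l :: "real^'n"
  assumes h: "h \<ge> 0" and C: "countable C"
  shows "(\<integral>\<^sup>+x. ennreal \<bar>ramp_jump l h j m x\<bar> \<partial>slices m C) \<le> ennreal (2 * h ^ CARD('n))"
proof -
  let ?B = "{x::real^'n. \<forall>i. i \<noteq> m \<longrightarrow> l $ i \<le> x $ i \<and> x $ i \<le> l $ i + h}"
  have Bm: "?B \<in> sets (slab m)" by measurable
  have fin: "(\<integral>\<^sup>+c. ennreal h * indicator {l $ m, l $ m + h} c \<partial>count_space C) \<le> ennreal (2 * h)"
  proof -
    have "(\<integral>\<^sup>+c. ennreal h * indicator {l $ m, l $ m + h} c \<partial>count_space C) \<le>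
      (\<integral>\<^sup>+c. ennreal h * indicator {l $ m, l $ m + h} c \<partial>count_space UNIV)"
      by (subst nn_integral_count_space_indicator[of C]) (auto intro!: nn_integral_mono simp: indicator_def)
    also have "\<dots> = ennreal h * emeasure (count_space UNIV) {l $ m, l $ m + h}"
      by (rule nn_integral_cmult_indicator) auto
    also have "\<dots> = ennreal h * of_nat (card {l $ m, l $ m + h})" by (simp add: emeasure_count_space_finite)
    also have "\<dots> \<le> ennreal h * 2"
      by (intro mult_left_mono) (auto simp: card_insert_if)
    finally show ?thesis using h by (simp add: ennreal_mult mult.commute)
  qed
  have "(\<integral>\<^sup>+x. ennreal \<bar>ramp_jump l h j m x\<bar> \<partial>slices m C) =
     (\<integral>\<^sup>+x. (\<integral>\<^sup>+c. ennreal \<bar>ramp_jump l h j m (upd x m c)\<bar> \<partial>count_space C) \<partial>slab m)"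
    by (rule nn_integral_slices[OF C]) measurable
  also have "\<dots> \<le> (\<integral>\<^sup>+x. (\<integral>\<^sup>+c. indicator ?B x * (ennreal h * indicator {l $ m, l $ m + h} c) \<partial>count_space C) \<partial>slab m)"
  proof (intro nn_integral_mono)
    fix x :: "real^'n" and c
    show "ennreal \<bar>ramp_jump l h j m (upd x m c)\<bar> \<le> indicator ?B x * (ennreal h * indicator {l $ m, l $ m + h} c)"
    proof (cases "upd x m c \<in> cube l h \<and> c \<in> {l $ m, l $ m + h}")
      case True
      then have "x \<in> ?B" by (auto simp: cube_def upd_nth) metis+
      moreover have "\<bar>ramp_jump l h j m (upd x m c)\<bar> \<le> h * 1"
        unfolding ramp_jump_def abs_mult using ramp_bounds[OF h, of l j "upd x m c"] h
        by (intro mult_mono) auto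
      ultimately show ?thesis using True by (simp add: ennreal_leI)
    qed (auto simp: ramp_jump_def ramp_def upd_nth)
  qed
  also have "\<dots> \<le> (\<integral>\<^sup>+x. indicator ?B x * ennreal (2 * h) \<partial>slab m)"
    by (intro nn_integral_mono) (use fin in \<open>simp add: nn_integral_cmult mult_left_mono\<close>)
  also have "\<dots> = emeasure (slab m) ?B * ennreal (2 * h)"
    using Bm by (simp add: nn_integral_multc)
  also have "\<dots> = ennreal (h ^ (CARD('n) - 1) * (2 * h))"
    using h emeasure_slab_cube_face[OF h, where m=m and l=l] by (simp add: ennreal_mult)
  also have "h ^ (CARD('n) - 1) * (2 * h) = 2 * h ^ CARD('n)"
    using power_minus_mult[of "CARD('n)" h] by (simp add: mult.commute)
  finally show ?thesis .
qed

lemma integrable_ramp_jump: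
  fixes l :: "real^'n"
  assumes h: "h \<ge> 0" and C: "countable C"
  shows "integrable (slices m C) (ramp_jump l h j m)" "(LINT x|slices m C. \<bar>ramp_jump l h j m x\<bar>) \<le> 2 * h ^ CARD('n)"
proof -
  have m: "ramp_jump l h j m \<in> borel_measurable (slices m C)" by measurable
  show i: "integrable (slices m C) (ramp_jump l h j m)"
    using nn_integral_ramp_jump[OF h C, where l=l and j=j and m=m] m
    by (intro integrableI_bounded) (auto intro: le_less_trans)
  have "ennreal (LINT x|slices m C. \<bar>ramp_jump l h j m x\<bar>) = (\<integral>\<^sup>+x. ennreal \<bar>ramp_jump l h j m x\<bar> \<partial>slices m C)"
    using i by (intro nn_integral_eq_integral[symmetric]) auto
  then show "(LINT x|slices m C. \<bar>ramp_jump l h j m x\<bar>) \<le> 2 * h ^ CARD('n)"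
    using nn_integral_ramp_jump[OF h C, where l=l and j=j and m=m] h
    by (metis ennreal_le_iff mult_nonneg_nonneg zero_le_numeral zero_le_power)
qed

lemma upd_affine: "upd x m c = upd x m 0 + c *\<^sub>R axis m 1"
  by (simp add: vec_eq_iff upd_nth axis_def)

text \<open>The fundamental theorem of calculus on each line in direction m, integrated over the
  slab. The boundary terms are the values on the two faces; the sign of \<open>ramp_jump\<close> is
  that of the value after minus the value before crossing a face in the positive direction.\<close>

lemma ramp_integration_by_parts:
  fixes l :: "real^'n"
  assumes h: "h > 0" and C: "countable C" "l $ m \<in> C" "l $ m + h \<in> C"
    and \<phi>: "\<And>x. GDERIV \<phi> x :> \<phi>' x" "continuous_on UNIV \<phi>'"
  shows "(LINT x|lborel. ramp l h j x * \<phi>' x $ m) =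
    - (of_bool (j = m) * (LINT x|lborel. indicator (cube l h) x * \<phi> x) + (LINT x|slices m C. \<phi> x * ramp_jump l h j m x))"
proof -
  have \<phi>c: "continuous_on S \<phi>" for S
    using \<phi> by (intro C1_continuous) (auto simp: C1_def)
  have \<phi>m [measurable]: "\<phi> \<in> borel_measurable borel" using \<phi>c by (rule borel_measurable_continuous_onI)
  have icube: "integrable lborel (\<lambda>x. indicator (cube l h) x * f x)" if "continuous_on UNIV f" for f :: "real^'n \<Rightarrow> real"
    using borel_integrable_compact[of "cube l h" f] that
    by (auto simp: cube_cbox intro: continuous_on_subset)
  have \<phi>'c: "continuous_on UNIV (\<lambda>x. \<phi>' x $ m)" using \<phi>(2) by (intro continuous_intros)
  \<comment> \<open>\<open>?G\<close> is the partial derivative of \<open>?F\<close> in direction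
    m.\<close>
  let ?G = "\<lambda>x. of_bool (j = m) * \<phi> x + (x $ j - l $ j) * \<phi>' x $ m"
  let ?F = "\<lambda>x. (x $ j - l $ j) * \<phi> x"
  have i1: "integrable lborel (\<lambda>x. indicator (cube l h) x * \<phi> x)" by (rule icube[OF \<phi>c])
  have i2: "integrable lborel (\<lambda>x. ramp l h j x * \<phi>' x $ m)"
    using icube[of "\<lambda>x. (x $ j - l $ j) * \<phi>' x $ m"] \<phi>'c by (simp add: ramp_def mult.assoc continuous_intros)
  have iG: "integrable lborel (\<lambda>x. indicator (cube l h) x * ?G x)"
    by (rule icube) (intro continuous_intros \<phi>c \<phi>'c)
  have inner: "(LINT c|lborel. indicator (cube l h) (upd x m c) * ?G (upd x m c)) =
      (ramp l h j (upd x m (l $ m + h)) * \<phi> (upd x m (l $ m + h)) - ramp l h j (upd x m (l $ m)) * \<phi> (upd x m (l $ m)))" for x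
  proof -
    let ?b = "\<forall>i. i \<noteq> m \<longrightarrow> l $ i \<le> x $ i \<and> x $ i \<le> l $ i + h"
    have ind: "indicator (cube l h) (upd x m c) = (of_bool ?b * indicator {l $ m..l $ m + h} c :: real)" for c
      by (auto simp: cube_def upd_nth indicator_def)
    have "(LINT c|lborel. indicator {l $ m..l $ m + h} c *\<^sub>R ?G (upd x m c)) = ?F (upd x m (l $ m + h)) - ?F (upd x m (l $ m))"
    proof (rule integral_FTC_atLeastAtMost)
      have cu: "continuous_on UNIV (\<lambda>c. upd x m c)" by (subst upd_affine) (intro continuous_intros)
      show "continuous_on {l $ m..l $ m + h} (\<lambda>c. ?G (upd x m c))"
        by (intro continuous_intros continuous_on_compose2[OF \<phi>c[of UNIV] continuous_on_subset[OF cu]]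
             continuous_on_compose2[OF \<phi>'c continuous_on_subset[OF cu]] continuous_on_subset[OF cu]) auto
      fix c
      have d1: "((\<lambda>c. upd x m c) has_derivative (\<lambda>t. t *\<^sub>R axis m 1)) (at c)"
        by (subst upd_affine[abs_def]) (auto intro!: derivative_eq_intros)
      have "((\<lambda>c. \<phi> (upd x m c)) has_derivative (\<lambda>t. (t *\<^sub>R axis m 1) \<bullet> \<phi>' (upd x m c))) (at c)"
        using has_derivative_compose[OF d1 \<phi>(1)[unfolded gderiv_def]] by simp
      then have d2: "((\<lambda>c. \<phi> (upd x m c)) has_real_derivative \<phi>' (upd x m c) $ m) (at c)"
        by (simp add: has_field_derivative_def inner_axis' mult_commute_abs)
      have d3: "((\<lambda>c. upd x m c $ j - l $ j) has_real_derivative of_bool (j = m)) (at c)"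
        by (auto simp: upd_nth intro!: derivative_eq_intros)
      have "((\<lambda>c. ?F (upd x m c)) has_real_derivative ?G (upd x m c)) (at c)"
        using DERIV_mult[OF d3 d2] by (simp add: algebra_simps)
      then show "((\<lambda>c. ?F (upd x m c)) has_vector_derivative ?G (upd x m c)) (at c within {l $ m..l $ m + h})"
        by (simp add: has_real_derivative_iff_has_vector_derivative has_vector_derivative_at_within)
    qed (use h in simp)
    then have e1: "(LINT c|lborel. indicator (cube l h) (upd x m c) * ?G (upd x m c)) =
        of_bool ?b * (?F (upd x m (l $ m + h)) - ?F (upd x m (l $ m)))"
      unfolding ind mult.assoc integral_mult_right_zero by simp
    have e2: "of_bool ?b * ?F (upd x m d) = ramp l h j (upd x m d) * \<phi> (upd x m d)" if "d = l $ m \<or> d = l $ m + h" for d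
      using that h unfolding ramp_def ind by auto
    show ?thesis by (simp only: e1 right_diff_distrib e2 simp_thms)
  qed
  \<comment> \<open>Both face levels lie in \<open>C\<close>, so the sum over \<open>C\<close>
    reduces to them.\<close>
  have J: "(LINT c|count_space C. \<phi> (upd x m c) * ramp_jump l h j m (upd x m c)) =
    ramp l h j (upd x m (l $ m)) * \<phi> (upd x m (l $ m)) - ramp l h j (upd x m (l $ m + h)) * \<phi> (upd x m (l $ m + h))" for x
  proof -
    have "(LINT c|count_space C. \<phi> (upd x m c) * ramp_jump l h j m (upd x m c)) =
      (\<Sum>c\<in>{l $ m, l $ m + h}. \<phi> (upd x m c) * ramp_jump l h j m (upd x m c))"
    proof -
      let ?f = "\<lambda>c. \<phi> (upd x m c) * ramp_jump l h j m (upd x m c)"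
      have sub: "{c \<in> C. ?f c \<noteq> 0} \<subseteq> {l $ m, l $ m + h}" by (auto simp: ramp_jump_def upd_nth)
      have "(LINT c|count_space C. ?f c) = (\<Sum>c | c \<in> C \<and> ?f c \<noteq> 0. ?f c)"
        by (rule lebesgue_integral_count_space_finite_support) (rule finite_subset[OF sub], simp)
      also have "\<dots> = (\<Sum>c\<in>{l $ m, l $ m + h}. ?f c)"
        using sub C by (intro sum.mono_neutral_left) auto
      finally show ?thesis .
    qed
    then show ?thesis using h by (simp add: ramp_jump_def upd_nth)
  qed
  have "(LINT x|slices m C. \<phi> x * ramp_jump l h j m x) =
    (LINT x|slab m. LINT c|count_space C. \<phi> (upd x m c) * ramp_jump l h j m (upd x m c))"
  proof -
    interpret pair_sigma_finite "slab m" "count_space C" using C(1) by (rule pair_sigma_finite_slices)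
    have "compact (\<phi> ` cube l h)" by (intro compact_continuous_image \<phi>c) (simp add: cube_cbox)
    then obtain K where K: "\<And>x. x \<in> cube l h \<Longrightarrow> \<bar>\<phi> x\<bar> \<le> K" using compact_imp_bounded bounded_iff by (metis imageI real_norm_def)
    have ij: "integrable (slices m C) (\<lambda>x. \<phi> x * ramp_jump l h j m x)"
    proof (rule Bochner_Integration.integrable_bound[where f="\<lambda>x. K * ramp_jump l h j m x"])
      show "integrable (slices m C) (\<lambda>x. K * ramp_jump l h j m x)" using integrable_ramp_jump(1)[where h=h and C=C and m=m and l=l and j=j] h C by simp
      show "AE x in slices m C. norm (\<phi> x * ramp_jump l h j m x) \<le> norm (K * ramp_jump l h j m x)"
      proof (intro AE_I2)
        fix x
        show "norm (\<phi> x * ramp_jump l h j m x) \<le> norm (K * ramp_jump l h j m x)"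
        proof (cases "x \<in> cube l h")
          case True
          then show ?thesis using K[OF True] by (auto simp: abs_mult intro!: mult_right_mono)
        qed (simp add: ramp_jump_def ramp_def)
      qed
    qed measurable
    have fm: "(\<lambda>x. \<phi> x * ramp_jump l h j m x) \<in> borel_measurable borel" by measurable
    have "integrable (slab m \<Otimes>\<^sub>M count_space C) (\<lambda>p. \<phi> (upd (fst p) m (snd p)) * ramp_jump l h j m (upd (fst p) m (snd p)))"
      using ij integrable_distr_eq[OF upd_measurable_slices fm, of m C] unfolding slices_def by simp
    then show ?thesis
      using integral_fst'[of "\<lambda>p. \<phi> (upd (fst p) m (snd p)) * ramp_jump l h j m (upd (fst p) m (snd p))"]
        integral_distr[OF upd_measurable_slices fm, of m C] unfolding slices_def by simp
  qed
  also have "\<dots> = - (LINT x|slab m. LINT c|lborel. indicator (cube l h) (upd x m c) * ?G (upd x m c))"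
    unfolding J inner by (subst Bochner_Integration.integral_minus[symmetric]) (simp add: algebra_simps)
  also have "\<dots> = - (LINT x|lborel. indicator (cube l h) x * ?G x)"
    using integral_slices[OF iG, of m] by simp
  also have "(LINT x|lborel. indicator (cube l h) x * ?G x) =
     (LINT x|lborel. of_bool (j = m) * (indicator (cube l h) x * \<phi> x) + ramp l h j x * \<phi>' x $ m)"
    by (intro Bochner_Integration.integral_cong) (auto simp: ramp_def algebra_simps)
  also have "\<dots> = of_bool (j = m) * (LINT x|lborel. indicator (cube l h) x * \<phi> x) + (LINT x|lborel. ramp l h j x * \<phi>' x $ m)"
    using i1 i2 by (subst Bochner_Integration.integral_add) auto
  finally show ?thesis by simp
qed

section \<open>Vitali coverings and Hausdorff measure\<close>

lemma countable_set_option_enum: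
  assumes "countable C"
  obtains e :: "nat \<Rightarrow> 'a option" where "\<And>x. x \<in> C \<Longrightarrow> \<exists>n. e n = Some x" "\<And>n x. e n = Some x \<Longrightarrow> x \<in> C"
    "\<And>m n x. e m = Some x \<Longrightarrow> e n = Some x \<Longrightarrow> m = n"
proof -
  define e where "e n = (if n \<in> to_nat_on C ` C then Some (from_nat_into C n) else None)" for n
  have *: "from_nat_into C (to_nat_on C x) = x" if "x \<in> C" for x using assms that by simp
  show ?thesis
  proof (rule that[of e])
    show "\<exists>n. e n = Some x" if "x \<in> C" for x
      using that * by (intro exI[of _ "to_nat_on C x"]) (auto simp: e_def)
    show "x \<in> C" if "e n = Some x" for n x
      using that * by (auto simp: e_def split: if_splits)
    show "m = n" if "e m = Some x" "e n = Some x" for m n x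
      using that * by (auto simp: e_def split: if_splits)
  qed
qed

text \<open>Vitali's covering lemma with a family indexed by all natural numbers. Padding terms have
  radius 0, so their balls are empty and affect neither disjointness nor the covering.\<close>

lemma Vitali_sequence:
  fixes S :: "'a::euclidean_space set"
  assumes r: "\<And>x. x \<in> S \<Longrightarrow> 0 < r x \<and> r x \<le> B"
  shows "\<exists>(a :: nat \<Rightarrow> 'a) (\<rho> :: nat \<Rightarrow> real). (\<forall>n. \<rho> n = 0 \<or> a n \<in> S \<and> \<rho> n = r (a n)) \<and>
    disjoint_family (\<lambda>n. ball (a n) (\<rho> n)) \<and> S \<subseteq> (\<Union>n. ball (a n) (5 * \<rho> n))"
proof -
  have S: "S \<subseteq> (\<Union>x\<in>S. ball x (r x))" using r by force
  obtain C where C: "countable C" "C \<subseteq> S" "pairwise (\<lambda>x y. disjnt (ball x (r x)) (ball y (r y))) C"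
    "S \<subseteq> (\<Union>x\<in>C. ball x (5 * r x))"
    using Vitali_covering_lemma_balls[of S "\<lambda>x. x" r S B] S r by (metis (no_types, lifting))
  obtain e where e: "\<And>x. x \<in> C \<Longrightarrow> \<exists>n. e n = Some x" "\<And>n x. e n = Some x \<Longrightarrow> x \<in> C"
    "\<And>m n x. e m = Some x \<Longrightarrow> e n = Some x \<Longrightarrow> m = (n::nat)"
    using countable_set_option_enum[OF C(1)] by blast
  define a where "a n = (case e n of None \<Rightarrow> 0 | Some x \<Rightarrow> x)" for n
  define \<rho> where "\<rho> n = (case e n of None \<Rightarrow> 0 | Some x \<Rightarrow> r x)" for n
  show ?thesis
  proof (intro exI[of _ a] exI[of _ \<rho>] conjI allI)
    show "\<rho> n = 0 \<or> a n \<in> S \<and> \<rho> n = r (a n)" for n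
      using e(2)[of n] C(2) by (auto simp: a_def \<rho>_def split: option.splits)
    show "disjoint_family (\<lambda>n. ball (a n) (\<rho> n))"
      unfolding disjoint_family_on_def
    proof (intro ballI impI)
      fix m n :: nat assume "m \<noteq> n"
      show "ball (a m) (\<rho> m) \<inter> ball (a n) (\<rho> n) = {}"
      proof (cases "e m = None \<or> e n = None")
        case True then show ?thesis by (auto simp: \<rho>_def)
      next
        case False
        then obtain x y where xy: "e m = Some x" "e n = Some y" by auto
        then have "x \<noteq> y" using e(3) \<open>m \<noteq> n\<close> by blast
        then show ?thesis using C(3) e(2) xy by (auto simp: pairwise_def disjnt_def a_def \<rho>_def)
      qed
    qed
    show "S \<subseteq> (\<Union>n. ball (a n) (5 * \<rho> n))"
    proof
      fix y assume "y \<in> S"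
      then obtain x where x: "x \<in> C" "y \<in> ball x (5 * r x)" using C(4) by auto
      then obtain n where "e n = Some x" using e(1) by blast
      then show "y \<in> (\<Union>n. ball (a n) (5 * \<rho> n))" using x(2) by (intro UN_I[of n]) (auto simp: a_def \<rho>_def)
    qed
  qed
qed

text \<open>\<open>measure_of\<close> returns its set function or zero. All later estimates of
  Hausdorff measure are bounds from above and therefore reduce to exhibiting coverings.\<close>

lemma emeasure_hausdorff_le: "emeasure (hausdorff_measure k) A \<le> hausdorff_outer k A"
  unfolding hausdorff_measure_def by (simp add: emeasure_measure_of_conv)

lemma sets_hausdorff [simp]: "sets (hausdorff_measure k) = sets (borel :: 'a::metric_space measure)"
  using sets.sigma_sets_eq[of "borel :: 'a measure"] by (simp add: hausdorff_measure_def sets_measure_of_conv)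

lemma space_hausdorff [simp]: "space (hausdorff_measure k) = UNIV"
  by (simp add: hausdorff_measure_def space_measure_of_conv)

lemma hausdorff_null: "A \<in> sets borel \<Longrightarrow> hausdorff_outer k A = 0 \<Longrightarrow> A \<in> null_sets (hausdorff_measure k)"
  using emeasure_hausdorff_le[of k A] by (auto intro: null_setsI)

text \<open>The radius \<open>5 * \<rho>\<close> is that of an enlarged Vitali ball. The indicator
  of nonempty sets matters for slices, where only the balls that meet a given hyperplane may be
  counted.\<close>

lemma hausdorff_gauge_ball:
  fixes a :: "'a::euclidean_space"
  assumes "\<rho> \<ge> 0" "C \<subseteq> ball a (5 * \<rho>)"
  shows "hausdorff_gauge k C \<le> ennreal (unit_ball_vol (real k) * 5 ^ k * \<rho> ^ k) * indicator {C. C \<noteq> {}} C"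
    "bounded C" "diameter C \<le> 10 * \<rho>"
proof -
  show b: "bounded C" using assms(2) bounded_subset bounded_ball by blast
  show d: "diameter C \<le> 10 * \<rho>" using diameter_subset[OF assms(2)] assms(1) by simp
  have "(diameter C / 2) ^ k \<le> (5 * \<rho>) ^ k" using d diameter_ge_0[OF b] by (intro power_mono) auto
  then have "unit_ball_vol (real k) * (diameter C / 2) ^ k \<le> unit_ball_vol (real k) * (5 * \<rho>) ^ k"
    by (intro mult_left_mono) auto
  then show "hausdorff_gauge k C \<le> ennreal (unit_ball_vol (real k) * 5 ^ k * \<rho> ^ k) * indicator {C. C \<noteq> {}} C"
    by (auto simp: hausdorff_gauge_def power_mult_distrib mult.assoc intro!: ennreal_leI)
qed

lemma hausdorff_outer_le:
  fixes E :: "'a::metric_space set"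
  assumes "\<And>\<delta>. \<delta> > 0 \<Longrightarrow> \<exists>C::nat \<Rightarrow> 'a set. E \<subseteq> (\<Union>i. C i) \<and> (\<forall>i. bounded (C i) \<and> diameter (C i) \<le> \<delta>) \<and>
     (\<Sum>i. hausdorff_gauge k (C i)) \<le> K"
  shows "hausdorff_outer k E \<le> K"
  unfolding hausdorff_outer_def
proof (rule SUP_least)
  fix \<delta> :: real assume "\<delta> \<in> {0<..}"
  then obtain C :: "nat \<Rightarrow> 'a set" where C: "E \<subseteq> (\<Union>i. C i)" "\<forall>i. bounded (C i) \<and> diameter (C i) \<le> \<delta>"
     "(\<Sum>i. hausdorff_gauge k (C i)) \<le> K" using assms[of \<delta>] by auto
  show "(INF C\<in>{C::nat \<Rightarrow> 'a set. E \<subseteq> (\<Union>i. C i) \<and> (\<forall>i. bounded (C i) \<and> diameter (C i) \<le> \<delta>)}. \<Sum>i. hausdorff_gauge k (C i)) \<le> K"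
    by (rule INF_lower2[where i=C]) (use C in auto)
qed

text \<open>Up to a power of the radius, \<open>unit_ball_vol (real k) * 5 ^ k\<close> is the gauge
  of an enlarged Vitali ball. Dividing by the volume of the unit ball in dimension k + 1 counts
  disjoint balls, and \<open>2 * 3 ^ k\<close> comes from the box around a face that contains
  them.\<close>

definition hausdorff_const :: "nat \<Rightarrow> real" where
  "hausdorff_const k = unit_ball_vol (real k) * 5 ^ k / unit_ball_vol (real (Suc k)) * 2 * 3 ^ k"

lemma hausdorff_const_nonneg: "hausdorff_const k \<ge> 0"
  by (simp add: hausdorff_const_def)

text \<open>Disjoint balls of radius r centred on the face lie in a box of thickness 2 r, so their
  number is at most of order (h/r)^k; the enlarged balls cover the face and have gauge of order r^k.
  The powers of r cancel.\<close>

lemma hausdorff_outer_face: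
  fixes l :: "real^'n" and m :: 'n
  assumes h: "h > 0"
  shows "hausdorff_outer (CARD('n) - 1) {x \<in> cube l h. x $ m = c} \<le> ennreal (hausdorff_const (CARD('n) - 1) * h ^ (CARD('n) - 1))"
proof (rule hausdorff_outer_le)
  fix \<delta> :: real assume \<delta>: "\<delta> > 0"
  define k where "k = CARD('n) - 1"
  have N: "CARD('n) = Suc k" by (simp add: k_def)
  \<comment> \<open>With r at most h the surrounding box is at most 3 h wide, and 10 r is the
    diameter of an enlarged ball.\<close>
  define r where "r = min h (\<delta> / 10)"
  have r: "r > 0" "r \<le> h" "10 * r \<le> \<delta>" using h \<delta> by (auto simp: r_def)
  let ?S = "{x \<in> cube l h. x $ m = c}"
  have "\<exists>(a :: nat \<Rightarrow> real^'n) \<rho>. (\<forall>n. \<rho> n = 0 \<or> a n \<in> ?S \<and> \<rho> n = r) \<and> disjoint_family (\<lambda>n. ball (a n) (\<rho> n)) \<and>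
    ?S \<subseteq> (\<Union>n. ball (a n) (5 * \<rho> n))" (is "\<exists>a \<rho>. ?V a \<rho>")
    by (rule Vitali_sequence[of ?S "\<lambda>_. r" r]) (use r in auto)
  then obtain a \<rho> where V: "?V a \<rho>" by (elim exE) (rule that)
  have a: "\<rho> n = 0 \<or> a n \<in> ?S \<and> \<rho> n = r" "disjoint_family (\<lambda>n. ball (a n) (\<rho> n))" "?S \<subseteq> (\<Union>n. ball (a n) (5 * \<rho> n))" for n
    using V[THEN conjunct1] V[THEN conjunct2] by simp_all
  define C where "C n = ?S \<inter> ball (a n) (5 * \<rho> n)" for n
  have \<rho>0: "\<rho> n \<ge> 0" "\<rho> n \<le> r" for n using a(1)[of n] r by auto
  define \<kappa> where "\<kappa> = unit_ball_vol (real k) * 5 ^ k"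
  have \<kappa>: "\<kappa> \<ge> 0" by (simp add: \<kappa>_def)
  \<comment> \<open>The face thickened by r in all directions.\<close>
  define U where "U = box (upd (l - vec r) m (c - r)) (upd (l + vec (h + r)) m (c + r))"
  have v: "unit_ball_vol (real (Suc k)) > 0" by simp
  have v': "unit_ball_vol (1 + real k) \<noteq> 0" using unit_ball_vol_pos[of "1 + real k"] by linarith
  have sub: "ball (a n) (\<rho> n) \<subseteq> U" for n
  proof
    fix y assume y: "y \<in> ball (a n) (\<rho> n)"
    then have an: "a n \<in> ?S" "\<rho> n = r" using a(1)[of n] by (auto simp: mem_ball dest: le_less_trans[OF zero_le_dist])
    have "\<bar>y $ i - a n $ i\<bar> < r" for i
      using component_le_norm_cart[of "y - a n" i] y an(2) by (auto simp: dist_norm norm_minus_commute)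
    then have "a n $ i - r < y $ i \<and> y $ i < a n $ i + r" for i by (smt (verit))
    note c1 = this
    have c2: "l $ i \<le> a n $ i" "a n $ i \<le> l $ i + h" "a n $ m = c" for i using an by (auto simp: cube_def)
    have "upd (l - vec r) m (c - r) $ i < y $ i \<and> y $ i < upd (l + vec (h + r)) m (c + r) $ i" for i
    proof (cases "i = m")
      case True
      then show ?thesis using c1[of m] c2(3) by (simp add: upd_nth)
    next
      case False
      then show ?thesis using c1[of i] c2(1,2)[of i] by (simp add: upd_nth)
    qed
    then show "y \<in> U" by (simp add: U_def mem_box_cart)
  qed
  have gauge: "hausdorff_gauge k (C n) \<le> ennreal (\<kappa> / (r * unit_ball_vol (real (Suc k)))) * emeasure lborel (ball (a n) (\<rho> n))" for n
  proof (cases "\<rho> n = 0")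
    case True then show ?thesis by (simp add: C_def hausdorff_gauge_def)
  next
    case False
    then have e: "\<rho> n = r" using a(1) by blast
    have "hausdorff_gauge k (C n) \<le> ennreal (\<kappa> * \<rho> n ^ k) * indicator {C. C \<noteq> {}} (C n)"
      unfolding \<kappa>_def by (rule hausdorff_gauge_ball(1)[OF \<rho>0(1)]) (auto simp: C_def)
    also have "\<dots> \<le> ennreal (\<kappa> * r ^ k)" using e by (auto simp: indicator_def)
    also have "\<kappa> * r ^ k = \<kappa> / (r * unit_ball_vol (real (Suc k))) * (unit_ball_vol (real (Suc k)) * r ^ Suc k)"
      using r v' by (simp add: field_simps)
    also have "ennreal \<dots> = ennreal (\<kappa> / (r * unit_ball_vol (real (Suc k)))) * ennreal (unit_ball_vol (real (Suc k)) * r ^ Suc k)"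
      using r \<kappa> v by (intro ennreal_mult) auto
    also have "ennreal (unit_ball_vol (real (Suc k)) * r ^ Suc k) = emeasure lborel (ball (a n) (\<rho> n))"
      using r by (simp add: e emeasure_ball N)
    finally show ?thesis .
  qed
  have "(\<Sum>n. hausdorff_gauge k (C n)) \<le> (\<Sum>n. ennreal (\<kappa> / (r * unit_ball_vol (real (Suc k)))) * emeasure lborel (ball (a n) (\<rho> n)))"
    by (intro suminf_le gauge) auto
  also have "\<dots> = ennreal (\<kappa> / (r * unit_ball_vol (real (Suc k)))) * emeasure lborel (\<Union>n. ball (a n) (\<rho> n))"
    using a(2) by (simp add: suminf_emeasure image_subset_iff)
  also have "\<dots> \<le> ennreal (\<kappa> / (r * unit_ball_vol (real (Suc k)))) * emeasure lborel U"
    using sub by (intro mult_left_mono emeasure_mono) (auto simp: U_def)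
  also have "emeasure lborel U = ennreal (2 * r * (h + 2 * r) ^ k)"
  proof -
    have "emeasure lborel U = ennreal (\<Prod>i\<in>UNIV. upd (l + vec (h + r)) m (c + r) $ i - upd (l - vec r) m (c - r) $ i)"
      unfolding U_def using r h by (intro emeasure_lborel_box_cart) (auto simp: upd_nth)
    also have "(\<Prod>i\<in>UNIV. upd (l + vec (h + r)) m (c + r) $ i - upd (l - vec r) m (c - r) $ i) =
       2 * r * (\<Prod>i\<in>UNIV - {m}. h + 2 * r)"
      by (subst prod.remove[of _ m]) (auto simp: upd_nth algebra_simps intro!: prod.cong)
    finally show ?thesis by (simp add: k_def)
  qed
  also have "ennreal (\<kappa> / (r * unit_ball_vol (real (Suc k)))) * ennreal (2 * r * (h + 2 * r) ^ k) =
     ennreal (\<kappa> / unit_ball_vol (real (Suc k)) * 2 * (h + 2 * r) ^ k)"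
    using r h \<kappa> v v' by (subst ennreal_mult[symmetric]) (auto simp: field_simps)
  also have "\<dots> \<le> ennreal (\<kappa> / unit_ball_vol (real (Suc k)) * 2 * (3 * h) ^ k)"
    using r h \<kappa> v by (intro ennreal_leI mult_left_mono power_mono) auto
  also have "\<kappa> / unit_ball_vol (real (Suc k)) * 2 * (3 * h) ^ k = hausdorff_const k * h ^ k"
    by (simp add: hausdorff_const_def \<kappa>_def power_mult_distrib)
  finally have "(\<Sum>n. hausdorff_gauge k (C n)) \<le> ennreal (hausdorff_const k * h ^ k)" .
  moreover have "?S \<subseteq> (\<Union>n. C n)" using a(3) by (auto simp: C_def)
  moreover have "bounded (C n) \<and> diameter (C n) \<le> \<delta>" for n
    using hausdorff_gauge_ball(2,3)[OF \<rho>0(1), of "C n" "a n" n] \<rho>0(2)[of n] r(3) by (auto simp: C_def)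
  ultimately show "\<exists>C. ?S \<subseteq> (\<Union>i::nat. C i) \<and> (\<forall>i. bounded (C i) \<and> diameter (C i) \<le> \<delta>) \<and>
     (\<Sum>i. hausdorff_gauge (CARD('n) - 1) (C i)) \<le> ennreal (hausdorff_const (CARD('n) - 1) * h ^ (CARD('n) - 1))"
    unfolding k_def by blast
qed

text \<open>An Eilenberg-type estimate. An enlarged Vitali ball of original radius \<rho> meets a
  set of levels c of length 10 \<rho>, and its slices have gauge of order \<rho>^k. Integrated over
  c this is of order \<rho>^(k+1), the volume of the original ball; these balls are disjoint and lie
  in an open set of small measure around \<open>E\<close>.\<close>

lemma null_set_slices_cover:
  fixes E :: "(real^'n) set" and m :: 'n
  assumes E: "E \<in> null_sets lborel" and \<epsilon>: "\<epsilon> > 0" and \<delta>: "\<delta> > 0"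
  shows "\<exists>f\<in>borel_measurable borel. (\<integral>\<^sup>+c. f c \<partial>lborel) \<le> ennreal \<epsilon> \<and>
    (\<forall>c. \<exists>C::nat \<Rightarrow> (real^'n) set. {x\<in>E. x $ m = c} \<subseteq> (\<Union>i. C i) \<and>
       (\<forall>i. bounded (C i) \<and> diameter (C i) \<le> \<delta>) \<and> (\<Sum>i. hausdorff_gauge (CARD('n) - 1) (C i)) \<le> f c)"
proof -
  define k where "k = CARD('n) - 1"
  have N: "CARD('n) = Suc k" by (simp add: k_def)
  define v where "v = unit_ball_vol (real (Suc k))"
  have v: "v > 0" by (simp add: v_def)
  define \<kappa> where "\<kappa> = unit_ball_vol (real k) * 5 ^ k"
  have \<kappa>: "\<kappa> > 0" by (simp add: \<kappa>_def)
  \<comment> \<open>Cancels the factor \<open>10 * \<kappa> / v\<close> between slice gauges and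
    volumes.\<close>
  define \<epsilon>' where "\<epsilon>' = \<epsilon> * v / (10 * \<kappa>)"
  have \<epsilon>': "\<epsilon>' > 0" using \<epsilon> v \<kappa> by (simp add: \<epsilon>'_def)
  obtain U where U: "open U" "E \<subseteq> U" "emeasure lborel (U - E) < ennreal \<epsilon>'"
    using outer_regular_lborel[of E \<epsilon>'] null_setsD2[OF E] \<epsilon>' by auto
  have "emeasure lborel U \<le> emeasure lborel (E \<union> (U - E))" using U E by (intro emeasure_mono) auto
  also have "\<dots> \<le> emeasure lborel E + emeasure lborel (U - E)" using U E by (intro emeasure_subadditive) auto
  finally have Ue: "emeasure lborel U \<le> ennreal \<epsilon>'" using E U(3) by (auto simp: null_sets_def intro: less_imp_le order_trans)
  have "\<exists>r>0. ball x r \<subseteq> U" if "x \<in> E" for x using U that by (meson open_contains_ball subsetD)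
  then obtain r0 where r0: "\<And>x. x \<in> E \<Longrightarrow> r0 x > 0 \<and> ball x (r0 x) \<subseteq> U" by metis
  define r where "r x = min (r0 x) (\<delta> / 10)" for x
  have r: "0 < r x \<and> r x \<le> \<delta> / 10" "ball x (r x) \<subseteq> U" if "x \<in> E" for x using r0[OF that] \<delta> by (auto simp: r_def)
  have "\<exists>(a :: nat \<Rightarrow> real^'n) \<rho>. (\<forall>n. \<rho> n = 0 \<or> a n \<in> E \<and> \<rho> n = r (a n)) \<and> disjoint_family (\<lambda>n. ball (a n) (\<rho> n)) \<and>
    E \<subseteq> (\<Union>n. ball (a n) (5 * \<rho> n))" (is "\<exists>a \<rho>. ?V a \<rho>")
    by (rule Vitali_sequence[of E r "\<delta> / 10"]) (use r(1) in auto)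
  then obtain a \<rho> where V: "?V a \<rho>" by (elim exE) (rule that)
  have a: "\<rho> n = 0 \<or> a n \<in> E \<and> \<rho> n = r (a n)" "disjoint_family (\<lambda>n. ball (a n) (\<rho> n))" "E \<subseteq> (\<Union>n. ball (a n) (5 * \<rho> n))" for n
    using V[THEN conjunct1] V[THEN conjunct2] by simp_all
  have \<rho>0: "0 \<le> \<rho> n" "\<rho> n \<le> \<delta> / 10" "ball (a n) (\<rho> n) \<subseteq> U" for n
    using a(1)[of n] r[of "a n"] \<delta> by (cases "\<rho> n = 0"; simp)+
  \<comment> \<open>The total gauge allowed for those enlarged balls whose range of levels contains
    c.\<close>
  define f where "f c = (\<Sum>n. ennreal (\<kappa> * \<rho> n ^ k) * indicator {a n $ m - 5 * \<rho> n <..< a n $ m + 5 * \<rho> n} c)" for c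
  have fm: "f \<in> borel_measurable borel" unfolding f_def
    by (intro borel_measurable_suminf_order borel_measurable_times_ennreal borel_measurable_const borel_measurable_indicator) simp
  have "(\<integral>\<^sup>+c. f c \<partial>lborel) = (\<Sum>n. \<integral>\<^sup>+c. ennreal (\<kappa> * \<rho> n ^ k) * indicator {a n $ m - 5 * \<rho> n <..< a n $ m + 5 * \<rho> n} c \<partial>lborel)"
    unfolding f_def by (rule nn_integral_suminf) measurable
  also have "\<dots> = (\<Sum>n. ennreal (\<kappa> * \<rho> n ^ k) * ennreal (10 * \<rho> n))"
    using \<rho>0 by (intro suminf_cong) (simp add: nn_integral_cmult_indicator)
  also have "\<dots> = (\<Sum>n. ennreal (10 * \<kappa> / v) * emeasure lborel (ball (a n) (\<rho> n)))"
  proof (intro suminf_cong)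
    fix n
    have "ennreal (\<kappa> * \<rho> n ^ k) * ennreal (10 * \<rho> n) = ennreal (10 * \<kappa> / v * (v * \<rho> n ^ Suc k))"
      using \<rho>0 \<kappa> v by (subst ennreal_mult[symmetric]) (auto simp: field_simps)
    also have "\<dots> = ennreal (10 * \<kappa> / v) * ennreal (v * \<rho> n ^ Suc k)"
      using \<rho>0 \<kappa> v by (intro ennreal_mult) auto
    also have "ennreal (v * \<rho> n ^ Suc k) = emeasure lborel (ball (a n) (\<rho> n))"
      using \<rho>0 by (simp add: emeasure_ball N v_def)
    finally show "ennreal (\<kappa> * \<rho> n ^ k) * ennreal (10 * \<rho> n) = ennreal (10 * \<kappa> / v) * emeasure lborel (ball (a n) (\<rho> n))" .
  qed
  also have "\<dots> = ennreal (10 * \<kappa> / v) * emeasure lborel (\<Union>n. ball (a n) (\<rho> n))"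
    using a(2) by (simp add: suminf_emeasure image_subset_iff)
  also have "\<dots> \<le> ennreal (10 * \<kappa> / v) * ennreal \<epsilon>'"
    using \<rho>0(3) U(1) by (intro mult_left_mono order_trans[OF emeasure_mono Ue]) auto
  also have "\<dots> = ennreal \<epsilon>" using \<kappa> v \<epsilon> by (subst ennreal_mult[symmetric]) (auto simp: \<epsilon>'_def)
  finally have fi: "(\<integral>\<^sup>+c. f c \<partial>lborel) \<le> ennreal \<epsilon>" .
  have "\<exists>C::nat \<Rightarrow> (real^'n) set. {x\<in>E. x $ m = c} \<subseteq> (\<Union>i. C i) \<and>
       (\<forall>i. bounded (C i) \<and> diameter (C i) \<le> \<delta>) \<and> (\<Sum>i. hausdorff_gauge k (C i)) \<le> f c" for c
  proof (intro exI[of _ "\<lambda>n. {x \<in> ball (a n) (5 * \<rho> n). x $ m = c}"] conjI allI)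
    let ?C = "\<lambda>n. {x \<in> ball (a n) (5 * \<rho> n). x $ m = c}"
    show "{x\<in>E. x $ m = c} \<subseteq> (\<Union>n. ?C n)" using a(3) by blast
    have sub: "?C n \<subseteq> ball (a n) (5 * \<rho> n)" for n by auto
    show "bounded (?C n)" for n by (rule hausdorff_gauge_ball(2)[OF \<rho>0(1) sub])
    have "diameter (?C n) \<le> 10 * \<rho> n" for n by (rule hausdorff_gauge_ball(3)[OF \<rho>0(1) sub])
    moreover have "10 * \<rho> n \<le> \<delta>" for n using \<rho>0(2)[of n] by simp
    ultimately show "diameter (?C n) \<le> \<delta>" for n using order_trans by blast
    have "hausdorff_gauge k (?C n) \<le> ennreal (\<kappa> * \<rho> n ^ k) * indicator {a n $ m - 5 * \<rho> n <..< a n $ m + 5 * \<rho> n} c" for n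
    proof -
      have "hausdorff_gauge k (?C n) \<le> ennreal (\<kappa> * \<rho> n ^ k) * indicator {C. C \<noteq> {}} (?C n)"
        unfolding \<kappa>_def by (rule hausdorff_gauge_ball(1)[OF \<rho>0(1) sub])
      also have "\<dots> \<le> ennreal (\<kappa> * \<rho> n ^ k) * indicator {a n $ m - 5 * \<rho> n <..< a n $ m + 5 * \<rho> n} c"
      proof (cases "?C n = {}")
        case False
        then obtain x where x: "dist (a n) x < 5 * \<rho> n" "x $ m = c" by auto
        then have "\<bar>a n $ m - c\<bar> < 5 * \<rho> n"
          using component_le_norm_cart[of "a n - x" m] by (auto simp: dist_norm)
        then have "c \<in> {a n $ m - 5 * \<rho> n <..< a n $ m + 5 * \<rho> n}" by (auto simp: abs_less_iff)
        then show ?thesis by (auto simp: indicator_def)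
      qed simp
      finally show ?thesis .
    qed
    then show "(\<Sum>n. hausdorff_gauge k (?C n)) \<le> f c" unfolding f_def by (intro suminf_le) auto
  qed
  then show ?thesis using fm fi unfolding k_def by blast
qed

text \<open>Fubini for null sets with Hausdorff measure on the slices. The covers at scale 1/(n+1)
  have gauge sums bounded by functions of c with integrals at most 2^-n; the series of these
  functions is finite almost everywhere, so its terms tend to 0.\<close>

lemma hausdorff_null_slices:
  fixes E :: "(real^'n) set" and m :: 'n
  assumes E: "E \<in> null_sets lborel"
  shows "AE c in lborel. {x\<in>E. x $ m = c} \<in> null_sets (hausdorff_measure (CARD('n) - 1))"
proof -
  have ex: "\<exists>f. f \<in> borel_measurable borel \<and> (\<integral>\<^sup>+c. f c \<partial>lborel) \<le> ennreal ((1/2)^n) \<and>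
    (\<forall>c. \<exists>C::nat \<Rightarrow> (real^'n) set. {x\<in>E. x $ m = c} \<subseteq> (\<Union>i. C i) \<and>
       (\<forall>i. bounded (C i) \<and> diameter (C i) \<le> 1 / (real n + 1)) \<and> (\<Sum>i. hausdorff_gauge (CARD('n) - 1) (C i)) \<le> f c)"
    (is "\<exists>f. ?P n f") for n
    using null_set_slices_cover[OF E, of "(1/2)^n" "1 / (real n + 1)" m] by auto
  obtain f where P: "\<forall>n. ?P n (f n)" 
  proof -
    have "\<forall>n. \<exists>f. ?P n f" by (rule allI) (rule ex)
    then have "\<exists>f. \<forall>n. ?P n (f n)" by (rule choice)
    then show ?thesis by (elim exE) (rule that)
  qed
  have f: "f n \<in> borel_measurable borel" "(\<integral>\<^sup>+c. f n c \<partial>lborel) \<le> ennreal ((1/2)^n)" "\<exists>C::nat \<Rightarrow> (real^'n) set. {x\<in>E. x $ m = c} \<subseteq> (\<Union>i. C i) \<and>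
       (\<forall>i. bounded (C i) \<and> diameter (C i) \<le> 1 / (real n + 1)) \<and> (\<Sum>i. hausdorff_gauge (CARD('n) - 1) (C i)) \<le> f n c" for n :: nat and c :: real
    by (rule spec[OF P, THEN conjunct1], rule spec[OF P, THEN conjunct2, THEN conjunct1],
        rule spec[OF P, THEN conjunct2, THEN conjunct2, THEN spec])
  have "(\<integral>\<^sup>+c. (\<Sum>n. f n c) \<partial>lborel) = (\<Sum>n. \<integral>\<^sup>+c. f n c \<partial>lborel)"
    using f(1) by (intro nn_integral_suminf) auto
  also have "\<dots> \<le> (\<Sum>n. ennreal ((1/2)^n))" by (intro suminf_le f(2)) auto
  also have "\<dots> < \<infinity>" by (subst suminf_ennreal2) (auto simp: summable_geometric)
  finally have "AE c in lborel. (\<Sum>n. f n c) \<noteq> \<infinity>"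
    using f(1) by (intro nn_integral_PInf_AE) auto
  then show ?thesis
  proof eventually_elim
    case (elim c)
    have lim: "(\<lambda>n. f n c) \<longlonglongrightarrow> 0"
    proof -
      have fin: "f n c \<noteq> \<infinity>" for n
        using elim sum_le_suminf[of "\<lambda>n. f n c" "{n}"] by (auto simp: top_unique)
      define g where "g n = enn2real (f n c)" for n
      have g: "f n c = ennreal (g n)" for n using fin[of n] by (simp add: g_def less_top)
      have "summable g" using elim unfolding g by (intro summable_suminf_not_top) (auto simp: g_def)
      then have "g \<longlonglongrightarrow> 0" by (rule summable_LIMSEQ_zero)
      then show ?thesis unfolding g by (metis ennreal_0 tendsto_ennrealI)
    qed
    have "hausdorff_outer (CARD('n) - 1) {x\<in>E. x $ m = c} \<le> \<epsilon>" if "\<epsilon> > 0" for \<epsilon>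
    proof (rule hausdorff_outer_le)
      fix \<delta> :: real assume \<delta>: "\<delta> > 0"
      have "eventually (\<lambda>n. f n c < \<epsilon>) sequentially" using lim that by (rule order_tendstoD)
      moreover have "eventually (\<lambda>n. 1 / (real n + 1) < \<delta>) sequentially"
      proof (rule order_tendstoD(2)[OF _ \<delta>])
        show "(\<lambda>n. 1 / (real n + 1)) \<longlonglongrightarrow> 0"
          using LIMSEQ_inverse_real_of_nat by (simp add: inverse_eq_divide add.commute)
      qed
      ultimately have "eventually (\<lambda>n. f n c < \<epsilon> \<and> 1 / (real n + 1) < \<delta>) sequentially" by eventually_elim auto
      then obtain n where n: "f n c < \<epsilon>" "1 / (real n + 1) < \<delta>"
        using eventually_happens trivial_limit_sequentially by blast
      obtain C :: "nat \<Rightarrow> (real^'n) set" where "{x\<in>E. x $ m = c} \<subseteq> (\<Union>i. C i)"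
       "\<forall>i. bounded (C i) \<and> diameter (C i) \<le> 1 / (real n + 1)" "(\<Sum>i. hausdorff_gauge (CARD('n) - 1) (C i)) \<le> f n c"
        using f(3)[of c n] by blast
      then show "\<exists>C::nat \<Rightarrow> (real^'n) set. {x\<in>E. x $ m = c} \<subseteq> (\<Union>i. C i) \<and> (\<forall>i. bounded (C i) \<and> diameter (C i) \<le> \<delta>) \<and>
        (\<Sum>i. hausdorff_gauge (CARD('n) - 1) (C i)) \<le> \<epsilon>"
        using n by (intro exI[of _ C]) (auto intro: order_trans less_imp_le)
    qed
    then have "hausdorff_outer (CARD('n) - 1) {x\<in>E. x $ m = c} \<le> 0" by (rule dense_ge)
    then have "hausdorff_outer (CARD('n) - 1) {x\<in>E. x $ m = c} = 0" by simp
    moreover have "{x\<in>E. x $ m = c} \<in> sets borel"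
    proof -
      have "{x\<in>E. x $ m = c} = E \<inter> {x. x $ m = c}" by auto
      moreover have "{x::real^'n. x $ m = c} \<in> sets borel" by measurable
      ultimately show ?thesis using E by auto
    qed
    ultimately show ?case by (intro hausdorff_null)
  qed
qed

section \<open>Dyadic step functions\<close>

definition cell_index :: "real^'n \<Rightarrow> nat \<Rightarrow> real^'n \<Rightarrow> int^'n" where
  "cell_index o' m x = (\<chi> i. \<lfloor>2 ^ m * (x $ i - o' $ i)\<rfloor>)"

definition cell_corner :: "real^'n \<Rightarrow> nat \<Rightarrow> int^'n \<Rightarrow> real^'n" where
  "cell_corner o' m z = (\<chi> i. o' $ i + of_int (z $ i) / 2 ^ m)"

lemma cell_index_iff:
  "cell_index o' m x = z \<longleftrightarrow> (\<forall>i. cell_corner o' m z $ i \<le> x $ i \<and> x $ i < cell_corner o' m z $ i + 1 / 2 ^ m)"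
proof -
  have "\<lfloor>2 ^ m * (x $ i - o' $ i)\<rfloor> = z $ i \<longleftrightarrow>
     o' $ i + of_int (z $ i) / 2 ^ m \<le> x $ i \<and> x $ i < o' $ i + of_int (z $ i) / 2 ^ m + 1 / 2 ^ m" for i
    unfolding floor_eq_iff by (simp add: field_simps)
  then show ?thesis by (simp add: cell_index_def cell_corner_def vec_eq_iff)
qed

definition cell :: "real^'n \<Rightarrow> nat \<Rightarrow> int^'n \<Rightarrow> (real^'n) set" where
  "cell o' m z = {x. cell_index o' m x = z}"

lemma cell_cube: "cell o' m z \<subseteq> cube (cell_corner o' m z) (1 / 2 ^ m)"
  by (auto simp: cell_def cell_index_iff cube_def less_imp_le)

lemma box_cell: "box (cell_corner o' m z) (cell_corner o' m z + vec (1 / 2 ^ m)) \<subseteq> cell o' m z"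
  by (auto simp: cell_def cell_index_iff mem_box_cart less_imp_le)

lemma cell_borel [measurable]: "cell o' m z \<in> sets borel"
  unfolding cell_def cell_index_iff by measurable

text \<open>A half-open cell lies between an open box and a closed cube of the same volume.\<close>

lemma emeasure_cell: "emeasure lborel (cell o' m z :: (real^'n) set) = ennreal ((1 / 2 ^ m) ^ CARD('n))"
proof (rule antisym)
  show "emeasure lborel (cell o' m z) \<le> ennreal ((1 / 2 ^ m) ^ CARD('n))"
  proof -
    have "emeasure lborel (cell o' m z) \<le> emeasure lborel (cube (cell_corner o' m z) (1 / 2 ^ m))"
      by (intro emeasure_mono cell_cube) simp
    then show ?thesis by (simp add: emeasure_cube)
  qed
  have "emeasure lborel (box (cell_corner o' m z) (cell_corner o' m z + vec (1 / 2 ^ m))) = ennreal ((1 / 2 ^ m) ^ CARD('n))"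
    by (subst emeasure_lborel_box_cart) auto
  moreover have "emeasure lborel (box (cell_corner o' m z) (cell_corner o' m z + vec (1 / 2 ^ m))) \<le> emeasure lborel (cell o' m z)"
    by (intro emeasure_mono box_cell) simp
  ultimately show "ennreal ((1 / 2 ^ m) ^ CARD('n)) \<le> emeasure lborel (cell o' m z)" by simp
qed

lemma cell_diam: "x \<in> cell o' m z \<Longrightarrow> y \<in> cell o' m z \<Longrightarrow> dist x (y::real^'n) \<le> CARD('n) / 2 ^ m"
proof -
  assume xy: "x \<in> cell o' m z" "y \<in> cell o' m z"
  have "\<bar>(x - y) $ i\<bar> \<le> 1 / 2 ^ m" for i
    using xy unfolding cell_def cell_index_iff mem_Collect_eq vector_minus_component by (smt (verit))
  then have "(\<Sum>i\<in>UNIV. \<bar>(x - y) $ i\<bar>) \<le> (\<Sum>i\<in>(UNIV::'n set). 1 / 2 ^ m)" by (rule sum_mono)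
  then show ?thesis using norm_le_l1_cart[of "x - y"] by (simp add: dist_norm)
qed

lemma finite_vec_set: "(\<And>i. finite (A i)) \<Longrightarrow> finite {z::'a^'n. \<forall>i. z $ i \<in> A i}"
proof -
  assume "\<And>i. finite (A i)"
  then have "finite (vec_lambda ` (Pi\<^sub>E (UNIV::'n set) A))" by (intro finite_imageI finite_PiE) auto
  moreover have "{z::'a^'n. \<forall>i. z $ i \<in> A i} \<subseteq> vec_lambda ` (Pi\<^sub>E (UNIV::'n set) A)"
    by (auto intro!: image_eqI[of _ _ "vec_nth _"])
  ultimately show ?thesis by (rule finite_subset[rotated])
qed

lemma finite_cells_bounded:
  assumes "bounded (U :: (real^'n) set)" shows "finite {z. cell o' m z \<inter> U \<noteq> {}}"
proof -
  obtain K where K: "\<And>x. x \<in> U \<Longrightarrow> norm x \<le> K" using assms by (auto simp: bounded_iff)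
  have "{z. cell o' m z \<inter> U \<noteq> {}} \<subseteq> {z. \<forall>i. z $ i \<in> {\<lfloor>2 ^ m * (- K - o' $ i)\<rfloor>..\<lfloor>2 ^ m * (K - o' $ i)\<rfloor>}}"
  proof (intro subsetI CollectI allI)
    fix z i assume "z \<in> {z. cell o' m z \<inter> U \<noteq> {}}"
    then obtain x where x: "x \<in> cell o' m z" "x \<in> U" by auto
    have "\<bar>x $ i\<bar> \<le> K" using component_le_norm_cart[of x i] K[OF x(2)] by linarith
    moreover have "z $ i = \<lfloor>2 ^ m * (x $ i - o' $ i)\<rfloor>" using x(1) by (auto simp: cell_def cell_index_def)
    ultimately show "z $ i \<in> {\<lfloor>2 ^ m * (- K - o' $ i)\<rfloor>..\<lfloor>2 ^ m * (K - o' $ i)\<rfloor>}"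
      by (auto intro!: floor_mono)
  qed
  then show ?thesis using finite_subset finite_vec_set[of "\<lambda>i. {\<lfloor>2 ^ m * (- K - o' $ i)\<rfloor>..\<lfloor>2 ^ m * (K - o' $ i)\<rfloor>}"] by auto
qed

definition step :: "real^'n \<Rightarrow> nat \<Rightarrow> (int^'n \<Rightarrow> real) \<Rightarrow> real^'n \<Rightarrow> real" where
  "step o' m h x = h (cell_index o' m x)"

lemma step_sum:
  assumes "finite Z" "\<And>z. z \<notin> Z \<Longrightarrow> h z = 0"
  shows "step o' m h x = (\<Sum>z\<in>Z. h z * indicator (cell o' m z) x)"
proof -
  have "(\<Sum>z\<in>Z. h z * indicator (cell o' m z) x) = (\<Sum>z\<in>Z. if z = cell_index o' m x then h z else 0)"
    by (intro sum.cong) (auto simp: cell_def indicator_def)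
  also have "\<dots> = step o' m h x" using assms by (auto simp: step_def sum.delta)
  finally show ?thesis by simp
qed

lemma integrable_step:
  assumes "finite {z. h z \<noteq> 0}" shows "integrable lborel (step o' m h)"
proof -
  have "step o' m h = (\<lambda>x. \<Sum>z\<in>{z. h z \<noteq> 0}. h z * indicator (cell o' m z) x)"
    using step_sum[OF assms] by auto
  then show ?thesis by (auto intro!: Bochner_Integration.integrable_sum simp: emeasure_cell)
qed

lemma integral_abs_step:
  assumes "finite {z. h z \<noteq> 0}"
  shows "(LINT x|lborel. \<bar>step o' m h (x::real^'n)\<bar>) = (\<Sum>z | h z \<noteq> 0. \<bar>h z\<bar> * (1 / 2 ^ m) ^ CARD('n))"
proof -
  have "\<bar>step o' m h x\<bar> = (\<Sum>z\<in>{z. h z \<noteq> 0}. \<bar>h z\<bar> * indicator (cell o' m z) x)" for x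
    using step_sum[OF assms, of "\<lambda>z. \<bar>h z\<bar>"] by (simp add: step_def)
  then have "(LINT x|lborel. \<bar>step o' m h x\<bar>) = (\<Sum>z | h z \<noteq> 0. LINT x|lborel. \<bar>h z\<bar> * indicator (cell o' m z) x)"
    by (simp add: integral_sum emeasure_cell)
  then show ?thesis by (simp add: measure_def emeasure_cell)
qed

text \<open>The approximation is required at all sufficiently fine levels, so that approximants of
  two functions can be added on a common grid.\<close>

definition step_approximable :: "real^'n \<Rightarrow> (real^'n \<Rightarrow> real) \<Rightarrow> bool" where
  "step_approximable o' f \<longleftrightarrow> integrable lborel f \<and> (\<forall>\<epsilon>>0. \<exists>m0. \<forall>m\<ge>m0. \<exists>h. finite {z. h z \<noteq> 0} \<and>
     (LINT x|lborel. \<bar>f x - step o' m h x\<bar>) < \<epsilon>)"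

lemma step_approximable_closed:
  assumes f: "integrable lborel f" and app: "\<And>\<epsilon>. \<epsilon> > 0 \<Longrightarrow> \<exists>g. step_approximable o' g \<and> (LINT x|lborel. \<bar>f x - g x\<bar>) < \<epsilon>"
  shows "step_approximable o' f"
  unfolding step_approximable_def
proof (intro conjI allI impI f)
  fix \<epsilon> :: real assume "\<epsilon> > 0"
  then have e: "\<epsilon> / 2 > 0" by simp
  obtain g where g: "step_approximable o' g" "(LINT x|lborel. \<bar>f x - g x\<bar>) < \<epsilon> / 2" using app[OF e] by blast
  have gi: "integrable lborel g" using g(1) by (simp add: step_approximable_def)
  obtain m0 where m0: "\<forall>m\<ge>m0. \<exists>h. finite {z. h z \<noteq> 0} \<and> (LINT x|lborel. \<bar>g x - step o' m h x\<bar>) < \<epsilon> / 2"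
    using g(1) e unfolding step_approximable_def by blast
  show "\<exists>m0. \<forall>m\<ge>m0. \<exists>h. finite {z. h z \<noteq> 0} \<and> (LINT x|lborel. \<bar>f x - step o' m h x\<bar>) < \<epsilon>"
  proof (intro exI[of _ m0] allI impI)
    fix m assume "m \<ge> m0"
    then obtain h where h: "finite {z. h z \<noteq> 0}" "(LINT x|lborel. \<bar>g x - step o' m h x\<bar>) < \<epsilon> / 2" using m0 by blast
    note hi = integrable_step[OF h(1), of o' m]
    have "(LINT x|lborel. \<bar>f x - step o' m h x\<bar>) \<le> (LINT x|lborel. \<bar>f x - g x\<bar> + \<bar>g x - step o' m h x\<bar>)"
      using f gi hi by (intro integral_mono) auto
    also have "\<dots> = (LINT x|lborel. \<bar>f x - g x\<bar>) + (LINT x|lborel. \<bar>g x - step o' m h x\<bar>)"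
      using f gi hi by (intro Bochner_Integration.integral_add) auto
    finally have "(LINT x|lborel. \<bar>f x - step o' m h x\<bar>) < \<epsilon>" using g(2) h(2) by linarith
    then show "\<exists>h. finite {z. h z \<noteq> 0} \<and> (LINT x|lborel. \<bar>f x - step o' m h x\<bar>) < \<epsilon>" using h(1) by (intro exI conjI)
  qed
qed

lemma step_approximable_add:
  assumes f: "step_approximable o' f" and g: "step_approximable o' g"
  shows "step_approximable o' (\<lambda>x. f x + g x)"
  unfolding step_approximable_def
proof (intro conjI allI impI)
  have fi: "integrable lborel f" and gi: "integrable lborel g" using f g by (auto simp: step_approximable_def)
  then show "integrable lborel (\<lambda>x. f x + g x)" by simp
  fix \<epsilon> :: real assume "\<epsilon> > 0"
  then have e: "\<epsilon> / 2 > 0" by simp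
  obtain m1 where m1: "\<forall>m\<ge>m1. \<exists>h. finite {z. h z \<noteq> 0} \<and> (LINT x|lborel. \<bar>f x - step o' m h x\<bar>) < \<epsilon> / 2"
    using f e unfolding step_approximable_def by blast
  obtain m2 where m2: "\<forall>m\<ge>m2. \<exists>h. finite {z. h z \<noteq> 0} \<and> (LINT x|lborel. \<bar>g x - step o' m h x\<bar>) < \<epsilon> / 2"
    using g e unfolding step_approximable_def by blast
  show "\<exists>m0. \<forall>m\<ge>m0. \<exists>h. finite {z. h z \<noteq> 0} \<and> (LINT x|lborel. \<bar>f x + g x - step o' m h x\<bar>) < \<epsilon>"
  proof (intro exI[of _ "max m1 m2"] allI impI)
    fix m assume m: "m \<ge> max m1 m2"
    obtain h1 where h1: "finite {z. h1 z \<noteq> 0}" "(LINT x|lborel. \<bar>f x - step o' m h1 x\<bar>) < \<epsilon> / 2" using m1 m by auto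
    obtain h2 where h2: "finite {z. h2 z \<noteq> 0}" "(LINT x|lborel. \<bar>g x - step o' m h2 x\<bar>) < \<epsilon> / 2" using m2 m by auto
    note hi = integrable_step[OF h1(1), of o' m] integrable_step[OF h2(1), of o' m]
    have fin: "finite {z. h1 z + h2 z \<noteq> 0}"
      by (rule finite_subset[of _ "{z. h1 z \<noteq> 0} \<union> {z. h2 z \<noteq> 0}"]) (use h1(1) h2(1) in auto)
    note hi' = integrable_step[OF fin, of o' m]
    have pw: "\<bar>f x + g x - step o' m (\<lambda>z. h1 z + h2 z) x\<bar> \<le> \<bar>f x - step o' m h1 x\<bar> + \<bar>g x - step o' m h2 x\<bar>" for x
      by (simp add: step_def)
    have "(LINT x|lborel. \<bar>f x + g x - step o' m (\<lambda>z. h1 z + h2 z) x\<bar>) \<le>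
       (LINT x|lborel. \<bar>f x - step o' m h1 x\<bar> + \<bar>g x - step o' m h2 x\<bar>)"
      using fi gi hi hi' by (intro integral_mono pw) auto
    also have "\<dots> = (LINT x|lborel. \<bar>f x - step o' m h1 x\<bar>) + (LINT x|lborel. \<bar>g x - step o' m h2 x\<bar>)"
      using fi gi hi by (intro Bochner_Integration.integral_add) auto
    finally have "(LINT x|lborel. \<bar>f x + g x - step o' m (\<lambda>z. h1 z + h2 z) x\<bar>) < \<epsilon>" using h1(2) h2(2) by linarith
    then show "\<exists>h. finite {z. h z \<noteq> 0} \<and> (LINT x|lborel. \<bar>f x + g x - step o' m h x\<bar>) < \<epsilon>" using fin by (intro exI conjI)
  qed
qed

lemma step_approximable_scale:
  assumes f: "step_approximable o' f" shows "step_approximable o' (\<lambda>x. c * f x)"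
  unfolding step_approximable_def
proof (intro conjI allI impI)
  have fi: "integrable lborel f" using f by (auto simp: step_approximable_def)
  then show "integrable lborel (\<lambda>x. c * f x)" by simp
  fix \<epsilon> :: real assume e0: "\<epsilon> > 0"
  then have e: "\<epsilon> / (\<bar>c\<bar> + 1) > 0" by (simp add: add_nonneg_pos)
  obtain m0 where m0: "\<forall>m\<ge>m0. \<exists>h. finite {z. h z \<noteq> 0} \<and> (LINT x|lborel. \<bar>f x - step o' m h x\<bar>) < \<epsilon> / (\<bar>c\<bar> + 1)"
    using f e unfolding step_approximable_def by blast
  show "\<exists>m0. \<forall>m\<ge>m0. \<exists>h. finite {z. h z \<noteq> 0} \<and> (LINT x|lborel. \<bar>c * f x - step o' m h x\<bar>) < \<epsilon>"
  proof (intro exI[of _ m0] allI impI)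
    fix m assume "m \<ge> m0"
    then obtain h where h: "finite {z. h z \<noteq> 0}" "(LINT x|lborel. \<bar>f x - step o' m h x\<bar>) < \<epsilon> / (\<bar>c\<bar> + 1)" using m0 by blast
    have "finite {z. c * h z \<noteq> 0}" by (rule finite_subset[OF _ h(1)]) auto
    moreover have "(LINT x|lborel. \<bar>c * f x - step o' m (\<lambda>z. c * h z) x\<bar>) < \<epsilon>"
    proof -
      have "\<bar>c * f x - step o' m (\<lambda>z. c * h z) x\<bar> = \<bar>c\<bar> * \<bar>f x - step o' m h x\<bar>" for x
        by (simp add: step_def abs_mult[symmetric] right_diff_distrib)
      then have "(LINT x|lborel. \<bar>c * f x - step o' m (\<lambda>z. c * h z) x\<bar>) = \<bar>c\<bar> * (LINT x|lborel. \<bar>f x - step o' m h x\<bar>)" by simp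
      also have "\<dots> \<le> (\<bar>c\<bar> + 1) * (LINT x|lborel. \<bar>f x - step o' m h x\<bar>)"
        by (intro mult_right_mono) auto
      also have "\<dots> < (\<bar>c\<bar> + 1) * (\<epsilon> / (\<bar>c\<bar> + 1))" using h(2) by (intro mult_strict_left_mono) auto
      also have "\<dots> = \<epsilon>" by (simp add: add_nonneg_eq_0_iff)
      finally show ?thesis .
    qed
    ultimately show "\<exists>h. finite {z. h z \<noteq> 0} \<and> (LINT x|lborel. \<bar>c * f x - step o' m h x\<bar>) < \<epsilon>" by (intro exI conjI)
  qed
qed

text \<open>Uses the cells contained in \<open>U\<close>. Cell diameters tend to 0, so these cells
  exhaust \<open>U\<close>; boundedness makes them finite in number.\<close>

lemma step_approximable_open:
  fixes U :: "(real^'n) set"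
  assumes U: "open U" "bounded U" shows "step_approximable o' (indicator U)"
  unfolding step_approximable_def
proof (intro conjI allI impI)
  have Uf: "emeasure lborel U < \<infinity>" using U(2) by (rule emeasure_bounded_finite)
  have Ub: "U \<in> sets borel" using U by simp
  show i: "integrable lborel (indicat_real U)" using Uf Ub by simp
  define h where "h m z = (of_bool (cell o' m z \<subseteq> U) :: real)" for m z
  have ne: "x \<in> cell o' m (cell_index o' m x)" for m x by (simp add: cell_def)
  have cne: "cell o' m z \<noteq> {}" for m z using emeasure_cell[of o' m z] by (metis emeasure_empty ennreal_eq_0_iff less_irrefl not_le zero_less_divide_1_iff zero_less_numeral zero_less_power)
  have fin: "finite {z. h m z \<noteq> 0}" for m
    by (rule finite_subset[OF _ finite_cells_bounded[OF U(2), of o' m]]) (use cne in \<open>auto simp: h_def\<close>)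
  have "(\<lambda>m. LINT x|lborel. \<bar>indicat_real U x - step o' m (h m) x\<bar>) \<longlonglongrightarrow> (LINT x|(lborel::(real^'n) measure). 0)"
  proof (rule integral_dominated_convergence[where w="indicator U"])
    show "(\<lambda>x. \<bar>indicat_real U x - step o' m (h m) x\<bar>) \<in> borel_measurable lborel" for m
      using borel_measurable_integrable[OF integrable_step[OF fin[of m], of o' m]] Ub by simp
    show "AE x in lborel. norm \<bar>indicat_real U x - step o' m (h m) x\<bar> \<le> indicator U x" for m
      using ne[of _ m] by (intro AE_I2) (auto simp: step_def h_def indicator_def)
    show "AE x in lborel. (\<lambda>m. \<bar>indicat_real U x - step o' m (h m) x\<bar>) \<longlonglongrightarrow> 0"
    proof (intro AE_I2 tendsto_eventually)
      fix x :: "real^'n"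
      show "\<forall>\<^sub>F m in sequentially. \<bar>indicat_real U x - step o' m (h m) x\<bar> = 0"
      proof (cases "x \<in> U")
        case False
        then show ?thesis using ne[of x] by (intro always_eventually) (auto simp: step_def h_def)
      next
        case True
        then obtain e where e: "e > 0" "cball x e \<subseteq> U" using U(1) open_contains_cball by blast
        have "(\<lambda>m. real CARD('n) * (1/2) ^ m) \<longlonglongrightarrow> real CARD('n) * 0" by (intro tendsto_mult tendsto_const LIMSEQ_power_zero) simp
        then have "\<forall>\<^sub>F m in sequentially. real CARD('n) * (1/2) ^ m < e" using e(1) by (intro order_tendstoD(2)) auto
        then show ?thesis
        proof eventually_elim
          case (elim m)
          have "cell o' m (cell_index o' m x) \<subseteq> cball x e"
            using cell_diam[OF ne[of x m]] elim by (force simp: power_one_over)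
          then show ?case using e True by (simp add: step_def h_def)
        qed
      qed
    qed
  qed (use i Ub in auto)
  then have lim: "(\<lambda>m. LINT x|lborel. \<bar>indicat_real U x - step o' m (h m) x\<bar>) \<longlonglongrightarrow> 0" by simp
  fix \<epsilon> :: real assume "\<epsilon> > 0"
  then have "\<forall>\<^sub>F m in sequentially. (LINT x|lborel. \<bar>indicat_real U x - step o' m (h m) x\<bar>) < \<epsilon>" using lim by (rule order_tendstoD(2)[rotated])
  then show "\<exists>m0. \<forall>m\<ge>m0. \<exists>h. finite {z. h z \<noteq> 0} \<and> (LINT x|lborel. \<bar>indicat_real U x - step o' m h x\<bar>) < \<epsilon>"
    using fin unfolding eventually_sequentially by meson
qed

text \<open>Outer regularity for bounded sets, with the open set cut off by a ball to keep it
  bounded; other sets of finite measure are exhausted by balls.\<close>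

lemma step_approximable_indicator:
  fixes A :: "(real^'n) set"
  assumes A: "A \<in> sets borel" "emeasure lborel A < \<infinity>" shows "step_approximable o' (indicator A)"
proof -
  have bdd: "step_approximable o' (indicator A)" if A: "A \<in> sets borel" "bounded A" for A :: "(real^'n) set"
  proof (rule step_approximable_closed)
    have Af: "emeasure lborel A < \<infinity>" using A(2) by (rule emeasure_bounded_finite)
    then show i: "integrable lborel (indicat_real A)" using A(1) by simp
    fix \<epsilon> :: real assume e: "\<epsilon> > 0"
    obtain R where R: "A \<subseteq> ball 0 R" using A(2) bounded_subset_ballD by blast
    obtain U where U: "open U" "A \<subseteq> U" "emeasure lborel (U - A) < ennreal \<epsilon>"
      using outer_regular_lborel[OF A(1), of \<epsilon>] e by auto
    define V where "V = U \<inter> ball 0 R"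
    have V: "open V" "bounded V" "A \<subseteq> V" using U R by (auto simp: V_def bounded_Int)
    have Vb: "V \<in> sets borel" using V(1) by simp
    have "(LINT x|lborel. \<bar>indicat_real A x - indicat_real V x\<bar>) = (LINT x|lborel. indicat_real (V - A) x)"
      using V(3) by (intro Bochner_Integration.integral_cong) (auto simp: indicator_def)
    also have "\<dots> = measure lborel (V - A)" using A(1) Vb by simp
    also have "\<dots> < \<epsilon>"
    proof -
      have "emeasure lborel (V - A) \<le> emeasure lborel (U - A)" using U A by (intro emeasure_mono) (auto simp: V_def)
      then have "emeasure lborel (V - A) < ennreal \<epsilon>" using U(3) by (rule le_less_trans)
      then have "ennreal (measure lborel (V - A)) < ennreal \<epsilon>"
        by (subst emeasure_eq_ennreal_measure[symmetric]) (auto simp: less_top[symmetric] dest: less_trans)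
      then show ?thesis by (simp add: ennreal_less_iff)
    qed
    finally show "\<exists>g. step_approximable o' g \<and> (LINT x|lborel. \<bar>indicat_real A x - g x\<bar>) < \<epsilon>"
      using step_approximable_open[OF V(1,2)] by blast
  qed
  show ?thesis
  proof (rule step_approximable_closed)
    show i: "integrable lborel (indicat_real A)" using A by simp
    fix \<epsilon> :: real assume e: "\<epsilon> > 0"
    have "(\<lambda>n. LINT x|lborel. \<bar>indicat_real A x - indicat_real (A \<inter> ball 0 (real n)) x\<bar>) \<longlonglongrightarrow> (LINT x|(lborel::(real^'n) measure). 0)"
    proof (rule integral_dominated_convergence[where w="indicator A"])
      show "AE x in lborel. (\<lambda>n. \<bar>indicat_real A x - indicat_real (A \<inter> ball 0 (real n)) x\<bar>) \<longlonglongrightarrow> 0"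
      proof (intro AE_I2 tendsto_eventually)
        fix x :: "real^'n"
        obtain n0 where n0: "norm x < real n0" using reals_Archimedean2 by blast
        show "\<forall>\<^sub>F n in sequentially. \<bar>indicat_real A x - indicat_real (A \<inter> ball 0 (real n)) x\<bar> = 0"
          using eventually_ge_at_top[of n0] by eventually_elim (use n0 in \<open>auto simp: indicator_def\<close>)
      qed
    qed (use i A in \<open>auto simp: indicator_def\<close>)
    then have "\<forall>\<^sub>F n in sequentially. (LINT x|lborel. \<bar>indicat_real A x - indicat_real (A \<inter> ball 0 (real n)) x\<bar>) < \<epsilon>"
      using e by (intro order_tendstoD(2)) auto
    then obtain n where "(LINT x|lborel. \<bar>indicat_real A x - indicat_real (A \<inter> ball 0 (real n)) x\<bar>) < \<epsilon>"
      using eventually_happens trivial_limit_sequentially by blast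
    moreover have "step_approximable o' (indicator (A \<inter> ball 0 (real n)))" using A by (intro bdd) auto
    ultimately show "\<exists>g. step_approximable o' g \<and> (LINT x|lborel. \<bar>indicat_real A x - g x\<bar>) < \<epsilon>" by blast
  qed
qed

theorem step_approximable:
  fixes f :: "real^'n \<Rightarrow> real"
  assumes "integrable lborel f" shows "step_approximable o' f"
  using assms
proof (induction rule: integrable_induct)
  case (base A c)
  then show ?case using step_approximable_scale[OF step_approximable_indicator[of A o'], of c] by (simp add: mult.commute)
next
  case (add f g)
  from add.IH show ?case by (rule step_approximable_add)
next
  case (lim f s)
  show ?case
  proof (rule step_approximable_closed)
    show "integrable lborel f" using lim by simp
    fix \<epsilon> :: real assume e: "\<epsilon> > 0"
    have "(\<lambda>n. LINT x|lborel. \<bar>f x - s n x\<bar>) \<longlonglongrightarrow> (LINT x|(lborel::(real^'n) measure). 0)"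
    proof (rule integral_dominated_convergence[where w="\<lambda>x. 3 * \<bar>f x\<bar>"])
      show "AE x in lborel. (\<lambda>n. \<bar>f x - s n x\<bar>) \<longlonglongrightarrow> 0"
      proof (intro AE_I2)
        fix x :: "real^'n"
        have "(\<lambda>n. s n x) \<longlonglongrightarrow> f x" using lim by simp
        then have "(\<lambda>n. \<bar>f x - s n x\<bar>) \<longlonglongrightarrow> \<bar>f x - f x\<bar>" by (intro tendsto_intros)
        then show "(\<lambda>n. \<bar>f x - s n x\<bar>) \<longlonglongrightarrow> 0" by simp
      qed
      show "AE x in lborel. norm \<bar>f x - s n x\<bar> \<le> 3 * \<bar>f x\<bar>" for n
      proof (intro AE_I2)
        fix x :: "real^'n"
        have "norm (s n x) \<le> 2 * norm (f x)" using lim by simp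
        then show "norm \<bar>f x - s n x\<bar> \<le> 3 * \<bar>f x\<bar>" by simp
      qed
    qed (use lim in auto)
    then have "\<forall>\<^sub>F n in sequentially. (LINT x|lborel. \<bar>f x - s n x\<bar>) < \<epsilon>"
      using e by (intro order_tendstoD(2)) auto
    then obtain n where "(LINT x|lborel. \<bar>f x - s n x\<bar>) < \<epsilon>"
      using eventually_happens trivial_limit_sequentially by blast
    then show "\<exists>g. step_approximable o' g \<and> (LINT x|lborel. \<bar>f x - g x\<bar>) < \<epsilon>" using lim by blast
  qed
qed

section \<open>Lebesgue points\<close>

text \<open>The power \<open>r ^ N\<close> replaces the measure of \<open>D r\<close>, to which it is comparable in all uses.\<close>

definition mean_limit :: "('a::euclidean_space \<Rightarrow> 'b::euclidean_space) \<Rightarrow> 'b \<Rightarrow> (real \<Rightarrow> 'a set) \<Rightarrow> bool" where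
  "mean_limit u a D \<longleftrightarrow> (\<forall>\<epsilon>>0. \<exists>\<delta>>0. \<forall>r. 0 < r \<and> r < \<delta> \<longrightarrow>
     (\<integral>\<^sup>+y\<in>D r. ennreal (norm (u y - a)) \<partial>lebesgue) \<le> ennreal (\<epsilon> * r ^ DIM('a)))"

text \<open>The weak-type bound for the maximal function. Disjoint Vitali balls with mean above t
  have total volume at most the integral divided by t, and enlarging them costs 5^N. The measurable
  set \<open>T\<close> is the union of the enlarged balls; restricting to radii up to 1 gives the
  bounded radii that the Vitali lemma asks for.\<close>

lemma maximal_inequality:
  fixes h :: "real^'n \<Rightarrow> real"
  assumes h: "h \<in> borel_measurable borel" and t: "t > 0"
  shows "\<exists>T\<in>sets borel. {x. \<exists>r. 0 < r \<and> r \<le> 1 \<and>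
      (\<integral>\<^sup>+y\<in>ball x r. ennreal \<bar>h y\<bar> \<partial>lborel) > ennreal t * emeasure lborel (ball x r)} \<subseteq> T \<and>
    ennreal t * emeasure lborel T \<le> 5 ^ CARD('n) * (\<integral>\<^sup>+y. ennreal \<bar>h y\<bar> \<partial>lborel)"
proof -
  define M where "M = density lborel (\<lambda>y. ennreal \<bar>h y\<bar>)"
  have Me: "(\<integral>\<^sup>+y\<in>B. ennreal \<bar>h y\<bar> \<partial>lborel) = emeasure M B" if "B \<in> sets borel" for B
    unfolding M_def using that h by (subst emeasure_density) auto
  let ?S = "{x. \<exists>r. 0 < r \<and> r \<le> 1 \<and> (\<integral>\<^sup>+y\<in>ball x r. ennreal \<bar>h y\<bar> \<partial>lborel) > ennreal t * emeasure lborel (ball x r)}"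
  define r where "r x = (SOME r. 0 < r \<and> r \<le> 1 \<and> emeasure M (ball x r) > ennreal t * emeasure lborel (ball x r))" for x
  have r: "0 < r x \<and> r x \<le> 1 \<and> emeasure M (ball x (r x)) > ennreal t * emeasure lborel (ball x (r x))" if "x \<in> ?S" for x
  proof -
    have "\<exists>r. 0 < r \<and> r \<le> 1 \<and> emeasure M (ball x r) > ennreal t * emeasure lborel (ball x r)"
      using that by (simp add: Me)
    then show ?thesis unfolding r_def by (rule someI_ex)
  qed
  have "\<exists>(a :: nat \<Rightarrow> real^'n) \<rho>. (\<forall>n. \<rho> n = 0 \<or> a n \<in> ?S \<and> \<rho> n = r (a n)) \<and> disjoint_family (\<lambda>n. ball (a n) (\<rho> n)) \<and>
    ?S \<subseteq> (\<Union>n. ball (a n) (5 * \<rho> n))" (is "\<exists>a \<rho>. ?V a \<rho>")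
    by (rule Vitali_sequence[of ?S r 1]) (use r in blast)
  then obtain a \<rho> where V: "?V a \<rho>" by (elim exE) (rule that)
  have a: "\<rho> n = 0 \<or> a n \<in> ?S \<and> \<rho> n = r (a n)" for n using V[THEN conjunct1] by (rule spec)
  have dis: "disjoint_family (\<lambda>n. ball (a n) (\<rho> n))" and cov: "?S \<subseteq> (\<Union>n. ball (a n) (5 * \<rho> n))"
    using V[THEN conjunct2] by (rule conjunct1, rule conjunct2)
  have b: "ennreal t * emeasure lborel (ball (a n) (5 * \<rho> n)) \<le> 5 ^ CARD('n) * emeasure M (ball (a n) (\<rho> n))" for n
  proof (cases "\<rho> n = 0")
    case False
    then have n: "a n \<in> ?S" "\<rho> n = r (a n)" using a[of n] by blast+
    note rn = r[OF n(1)]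
    have "emeasure lborel (ball (a n) (5 * \<rho> n)) = 5 ^ CARD('n) * emeasure lborel (ball (a n) (\<rho> n))"
      using rn n(2) by (simp add: emeasure_ball power_mult_distrib ennreal_mult mult_ac ennreal_power[symmetric])
    then have "ennreal t * emeasure lborel (ball (a n) (5 * \<rho> n)) = 5 ^ CARD('n) * (ennreal t * emeasure lborel (ball (a n) (\<rho> n)))"
      by (simp add: mult_ac)
    also have "\<dots> \<le> 5 ^ CARD('n) * emeasure M (ball (a n) (\<rho> n))"
      using rn n(2) by (intro mult_left_mono) auto
    finally show ?thesis .
  qed simp
  show ?thesis
  proof (intro bexI conjI)
    show "?S \<subseteq> (\<Union>n. ball (a n) (5 * \<rho> n))" by (rule cov)
    have "ennreal t * emeasure lborel (\<Union>n. ball (a n) (5 * \<rho> n)) \<le> ennreal t * (\<Sum>n. emeasure lborel (ball (a n) (5 * \<rho> n)))"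
      by (intro mult_left_mono emeasure_subadditive_countably) auto
    also have "\<dots> = (\<Sum>n. ennreal t * emeasure lborel (ball (a n) (5 * \<rho> n)))" by simp
    also have "\<dots> \<le> (\<Sum>n. 5 ^ CARD('n) * emeasure M (ball (a n) (\<rho> n)))" by (intro suminf_le b) auto
    also have "\<dots> = 5 ^ CARD('n) * emeasure M (\<Union>n. ball (a n) (\<rho> n))"
      using dis by (simp add: suminf_emeasure image_subset_iff M_def)
    also have "\<dots> \<le> 5 ^ CARD('n) * emeasure M UNIV" by (intro mult_left_mono emeasure_mono) (auto simp: M_def)
    also have "emeasure M UNIV = (\<integral>\<^sup>+y. ennreal \<bar>h y\<bar> \<partial>lborel)" using Me[of UNIV] by simp
    finally show "ennreal t * emeasure lborel (\<Union>n. ball (a n) (5 * \<rho> n)) \<le> 5 ^ CARD('n) * (\<integral>\<^sup>+y. ennreal \<bar>h y\<bar> \<partial>lborel)" .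
  qed auto
qed

lemma countable_grid_hyperplanes_null:
  "AE x in lborel. \<forall>m. \<forall>i. \<forall>z::int. 2 ^ m * ((x::real^'n) $ i - o' $ i) \<noteq> of_int z"
proof -
  have "AE x in (lborel :: (real^'n) measure). 2 ^ m * (x $ i - o' $ i) \<noteq> of_int z" for m :: nat and i and z :: int
  proof -
    have "AE x in lborel. x \<notin> {x::real^'n. x $ i = o' $ i + of_int z / 2 ^ m}"
      by (rule AE_not_in[OF null_sets_coordinate])
    then show ?thesis by eventually_elim (auto simp: field_simps)
  qed
  then show ?thesis unfolding AE_all_countable by blast
qed

lemma cell_index_locally_constant:
  fixes x :: "real^'n"
  assumes x: "\<And>i z. 2 ^ m * (x $ i - o' $ i) \<noteq> of_int z"
  shows "\<exists>\<delta>>0. \<forall>y. dist x y < \<delta> \<longrightarrow> cell_index o' m y = cell_index o' m x"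
proof -
  let ?B = "box (cell_corner o' m (cell_index o' m x)) (cell_corner o' m (cell_index o' m x) + vec (1 / 2 ^ m))"
  have "x \<in> ?B" unfolding mem_box_cart
  proof (intro allI conjI)
    fix i
    have c: "cell_corner o' m (cell_index o' m x) $ i \<le> x $ i \<and> x $ i < cell_corner o' m (cell_index o' m x) $ i + 1 / 2 ^ m"
      using cell_index_iff[of o' m x "cell_index o' m x"] by simp
    have "x $ i \<noteq> cell_corner o' m (cell_index o' m x) $ i"
      using x[of i "cell_index o' m x $ i"] by (auto simp: cell_corner_def field_simps)
    then show "cell_corner o' m (cell_index o' m x) $ i < x $ i" using c by simp
    show "x $ i < (cell_corner o' m (cell_index o' m x) + vec (1 / 2 ^ m)) $ i" using c by simp
  qed
  then obtain \<delta> where "\<delta> > 0" "ball x \<delta> \<subseteq> ?B" using open_contains_ball[of ?B] open_box by blast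
  then have "cell_index o' m y = cell_index o' m x" if "dist x y < \<delta>" for y
    using subsetD[OF box_cell, of y o' m "cell_index o' m x"] that by (auto simp: cell_def)
  then show ?thesis using \<open>\<delta> > 0\<close> by blast
qed

text \<open>Step functions are locally constant off the grid hyperplanes, so only the error f - s_n
  matters. As its L^1 norm is below 4^-n, the sets where its maximal function or its modulus reaches
  2^-n have measure of order 2^-n, and by Borel-Cantelli almost every point lies in only finitely
  many of them.\<close>

lemma Lebesgue_points_real:
  fixes f :: "real^'n \<Rightarrow> real"
  assumes f: "integrable lborel f"
  shows "AE x in lborel. \<forall>\<epsilon>>0. \<exists>\<delta>>0. \<forall>r. 0 < r \<and> r < \<delta> \<longrightarrow>
    (\<integral>\<^sup>+y\<in>ball x r. ennreal \<bar>f y - f x\<bar> \<partial>lborel) \<le> ennreal \<epsilon> * emeasure lborel (ball x r)"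
proof -
  define N where "N = CARD('n)"
  have fm [measurable]: "f \<in> borel_measurable borel" using f by auto
  have "\<exists>m h. finite {z. h z \<noteq> 0} \<and> (LINT x|lborel. \<bar>f x - step 0 m h x\<bar>) < (1/4)^n" for n :: nat
  proof -
    have "(1/4::real)^n > 0" by simp
    then show ?thesis using step_approximable[OF f, of 0] unfolding step_approximable_def by (meson order_refl)
  qed
  then obtain m h where mh: "\<And>n. finite {z. h n z \<noteq> 0}" "\<And>n::nat. (LINT x|lborel. \<bar>f x - step 0 (m n) (h n) x\<bar>) < (1/4)^n"
    by metis
  define s where "s n = step 0 (m n) (h n)" for n
  have si: "integrable lborel (s n)" for n unfolding s_def by (rule integrable_step[OF mh(1)])
  have sm [measurable]: "s n \<in> borel_measurable borel" for n using si[of n] by auto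
  have nn: "(\<integral>\<^sup>+x. ennreal \<bar>f x - s n x\<bar> \<partial>lborel) \<le> ennreal ((1/4)^n)" for n
    using mh(2)[of n] f si[of n] unfolding s_def by (subst nn_integral_eq_integral) (auto intro!: ennreal_leI)
  have "\<exists>T\<in>sets borel. {x. \<exists>r. 0 < r \<and> r \<le> 1 \<and>
      (\<integral>\<^sup>+y\<in>ball x r. ennreal \<bar>f y - s n y\<bar> \<partial>lborel) > ennreal ((1/2)^n) * emeasure lborel (ball x r)} \<subseteq> T \<and>
    ennreal ((1/2)^n) * emeasure lborel T \<le> 5 ^ N * (\<integral>\<^sup>+y. ennreal \<bar>f y - s n y\<bar> \<partial>lborel)"
    (is "\<exists>T\<in>sets borel. ?P n T") for n
    unfolding N_def by (rule maximal_inequality) auto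
  then have "\<forall>n. \<exists>T. T \<in> sets borel \<and> ?P n T" unfolding Bex_def by (rule allI)
  then have "\<exists>T. \<forall>n. T n \<in> sets borel \<and> ?P n (T n)" by (rule choice)
  then obtain T where T0: "\<forall>n. T n \<in> sets borel \<and> ?P n (T n)" by (elim exE) (rule that)
  have T: "T n \<in> sets borel"
    "{x. \<exists>r. 0 < r \<and> r \<le> 1 \<and>
      (\<integral>\<^sup>+y\<in>ball x r. ennreal \<bar>f y - s n y\<bar> \<partial>lborel) > ennreal ((1/2)^n) * emeasure lborel (ball x r)} \<subseteq> T n"
    "ennreal ((1/2)^n) * emeasure lborel (T n) \<le> 5 ^ N * (\<integral>\<^sup>+y. ennreal \<bar>f y - s n y\<bar> \<partial>lborel)" for n
    by (rule spec[OF T0, THEN conjunct1], rule spec[OF T0, THEN conjunct2, THEN conjunct1],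
        rule spec[OF T0, THEN conjunct2, THEN conjunct2])
  \<comment> \<open>Dividing the norm 4^-n by the threshold 2^-n leaves 2^-n, which is
    summable.\<close>
  have scale: "e \<le> ennreal (c * (1/2)^n)" if "ennreal ((1/2)^n) * e \<le> ennreal c * ennreal ((1/4)^n)" "c \<ge> 0" for e c and n :: nat
  proof -
    have "ennreal (2^n) * (ennreal ((1/2)^n) * e) \<le> ennreal (2^n) * (ennreal c * ennreal ((1/4)^n))"
      using that(1) by (rule mult_left_mono) simp
    moreover have "ennreal (2^n) * ennreal ((1/2)^n) = 1"
      by (simp add: ennreal_mult[symmetric] power_mult_distrib[symmetric])
    moreover have "ennreal (2^n) * (ennreal c * ennreal ((1/4)^n)) = ennreal (c * (1/2)^n)"
    proof -
      have "(2::real)^n * (1/4)^n = (1/2)^n" by (simp add: power_mult_distrib[symmetric])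
      then have "2^n * (c * (1/4)^n) = c * (1/2)^n" by simp
      then show ?thesis using that(2) by (simp add: ennreal_mult[symmetric] del: ennreal_power)
    qed
    ultimately show ?thesis by (simp add: mult.assoc[symmetric])
  qed
  have Te: "emeasure lborel (T n) \<le> ennreal (5 ^ N * (1/2)^n)" for n
  proof (rule scale)
    have "5 ^ N * (\<integral>\<^sup>+y. ennreal \<bar>f y - s n y\<bar> \<partial>lborel) \<le> 5 ^ N * ennreal ((1/4)^n)" by (intro mult_left_mono nn) auto
    then show "ennreal ((1/2)^n) * emeasure lborel (T n) \<le> ennreal (5 ^ N) * ennreal ((1/4)^n)"
      using T(3)[of n] by (simp add: ennreal_power[symmetric])
  qed simp
  define D where "D n = {x. \<bar>f x - s n x\<bar> \<ge> (1/2)^n}" for n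
  have D: "D n \<in> sets borel" for n unfolding D_def by measurable
  have De: "emeasure lborel (D n) \<le> ennreal (1 * (1/2)^n)" for n
  proof (rule scale)
    have "ennreal ((1/2)^n) * emeasure lborel (D n) = (\<integral>\<^sup>+x. ennreal ((1/2)^n) * indicator (D n) x \<partial>lborel)"
      using D by (simp add: nn_integral_cmult_indicator)
    also have "\<dots> \<le> (\<integral>\<^sup>+x. ennreal \<bar>f x - s n x\<bar> \<partial>lborel)"
      by (intro nn_integral_mono) (auto simp: D_def indicator_def intro!: ennreal_leI)
    finally show "ennreal ((1/2)^n) * emeasure lborel (D n) \<le> ennreal 1 * ennreal ((1/4)^n)" using nn[of n] by simp
  qed simp
  have bc: "AE x in lborel. \<forall>\<^sub>F n in sequentially. x \<in> space lborel - A n"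
    if A: "\<And>n. A n \<in> sets borel" "\<And>n. emeasure lborel (A n) \<le> ennreal (c * (1/2)^n)" and c: "c \<ge> 0" for A :: "nat \<Rightarrow> (real^'n) set" and c
  proof (rule borel_cantelli_AE1)
    show "emeasure lborel (A n) < \<infinity>" for n using A(2)[of n] by (rule le_less_trans) simp
    have le: "norm (measure lborel (A n)) \<le> c * (1/2)^n" for n
    proof -
      have "0 \<le> c * (1/2)^n" using c by (intro mult_nonneg_nonneg) simp_all
      then show ?thesis using A(2)[of n] unfolding measure_def by (simp add: enn2real_leI del: times_divide_eq_right)
    qed
    have "summable (\<lambda>n. c * (1/2::real)^n)" by (intro summable_mult summable_geometric) simp
    then show "summable (\<lambda>n. measure lborel (A n))"
      by (rule summable_comparison_test'[where N=0]) (rule le)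
  qed (use A in auto)
  have b1: "AE x in lborel. \<forall>\<^sub>F n in sequentially. x \<in> space lborel - T n" by (rule bc[OF T(1) Te]) simp
  have b2: "AE x in lborel. \<forall>\<^sub>F n in sequentially. x \<in> space lborel - D n" by (rule bc[OF D De]) simp
  show ?thesis
    using b1 b2 countable_grid_hyperplanes_null[of 0]
  proof eventually_elim
    case (elim x)
    show ?case
    proof (intro allI impI)
      fix \<epsilon> :: real assume e: "\<epsilon> > 0"
      \<comment> \<open>One 2^-n bounds the mean of the error over the ball, the other the error at
        \<open>x\<close> itself.\<close>
      have "(\<lambda>n. 2 * (1/2::real)^n) \<longlonglongrightarrow> 2 * 0" by (intro tendsto_mult tendsto_const LIMSEQ_power_zero) simp
      then have "\<forall>\<^sub>F n in sequentially. 2 * (1/2)^n < \<epsilon>" using e by (intro order_tendstoD(2)) auto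
      then have "\<forall>\<^sub>F n in sequentially. 2 * (1/2)^n < \<epsilon> \<and> x \<notin> T n \<and> x \<notin> D n"
        using elim(1,2) by eventually_elim auto
      then obtain n where n: "2 * (1/2)^n < \<epsilon>" "x \<notin> T n" "x \<notin> D n"
        using eventually_happens trivial_limit_sequentially by blast
      obtain \<delta> where \<delta>: "\<delta> > 0" "\<And>y. dist x y < \<delta> \<Longrightarrow> cell_index 0 (m n) y = cell_index 0 (m n) x"
        using cell_index_locally_constant[of "m n" x 0] elim(3) by auto
      have sc: "s n y = s n x" if "y \<in> ball x \<delta>" for y using \<delta>(2)[of y] that by (simp add: s_def step_def)
      show "\<exists>\<delta>>0. \<forall>r. 0 < r \<and> r < \<delta> \<longrightarrow>
        (\<integral>\<^sup>+y\<in>ball x r. ennreal \<bar>f y - f x\<bar> \<partial>lborel) \<le> ennreal \<epsilon> * emeasure lborel (ball x r)"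
      proof (intro exI[of _ "min 1 \<delta>"] conjI allI impI)
        fix r assume r: "0 < r \<and> r < min 1 \<delta>"
        have "(\<integral>\<^sup>+y\<in>ball x r. ennreal \<bar>f y - f x\<bar> \<partial>lborel) \<le>
          (\<integral>\<^sup>+y. (ennreal \<bar>f y - s n y\<bar> * indicator (ball x r) y + ennreal ((1/2)^n) * indicator (ball x r) y) \<partial>lborel)"
        proof (intro nn_integral_mono)
          fix y
          show "ennreal \<bar>f y - f x\<bar> * indicator (ball x r) y \<le>
             ennreal \<bar>f y - s n y\<bar> * indicator (ball x r) y + ennreal ((1/2)^n) * indicator (ball x r) y"
          proof (cases "y \<in> ball x r")
            case True
            then have "y \<in> ball x \<delta>" using r by simp
            then have "s n y = s n x" by (rule sc)
            then have "\<bar>f y - f x\<bar> \<le> \<bar>f y - s n y\<bar> + (1/2)^n" using n(3) unfolding D_def by auto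
            then show ?thesis using True by (simp add: ennreal_plus[symmetric] ennreal_leI del: ennreal_plus)
          qed simp
        qed
        also have "\<dots> = (\<integral>\<^sup>+y\<in>ball x r. ennreal \<bar>f y - s n y\<bar> \<partial>lborel) + ennreal ((1/2)^n) * emeasure lborel (ball x r)"
        proof -
          have [measurable]: "ball x r \<in> sets borel" by simp
          have "(\<lambda>y. ennreal \<bar>f y - s n y\<bar> * indicator (ball x r) y) \<in> borel_measurable borel"
            "(\<lambda>y. ennreal ((1/2)^n) * indicator (ball x r) y) \<in> borel_measurable borel" by measurable
          then show ?thesis by (subst nn_integral_add) (simp_all add: nn_integral_cmult_indicator)
        qed
        also have "(\<integral>\<^sup>+y\<in>ball x r. ennreal \<bar>f y - s n y\<bar> \<partial>lborel) \<le> ennreal ((1/2)^n) * emeasure lborel (ball x r)"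
        proof (rule ccontr)
          assume "\<not> ?thesis"
          then have "x \<in> T n" using T(2)[of n] r by (intro subsetD[OF T(2)[of n]] CollectI exI[of _ r]) auto
          then show False using n(2) by simp
        qed
        also have "ennreal ((1/2)^n) * emeasure lborel (ball x r) + ennreal ((1/2)^n) * emeasure lborel (ball x r) =
          ennreal (2 * (1/2)^n) * emeasure lborel (ball x r)"
        proof -
          have "(0::real) \<le> (1/2)^n" by simp
          then have "ennreal ((1/2)^n + (1/2)^n) = ennreal ((1/2)^n) + ennreal ((1/2)^n)" by (intro ennreal_plus)
          then show ?thesis unfolding mult_2 distrib_right by (simp only: distrib_right)
        qed
        also have "\<dots> \<le> ennreal \<epsilon> * emeasure lborel (ball x r)"
          using n(1) by (intro mult_right_mono ennreal_leI) auto
        finally show "(\<integral>\<^sup>+y\<in>ball x r. ennreal \<bar>f y - f x\<bar> \<partial>lborel) \<le> ennreal \<epsilon> * emeasure lborel (ball x r)"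
          by (simp add: add_right_mono)
      qed (use \<delta> in auto)
    qed
  qed
qed

lemma L1_measurable:
  assumes "\<Omega> \<in> sets borel" "u \<in> L1 \<Omega>" "A \<in> sets lebesgue" "A \<subseteq> \<Omega>"
  shows "(\<lambda>y. ennreal (norm (u y - a)) * indicator A y) \<in> borel_measurable lebesgue"
proof -
  have [measurable]: "(\<lambda>x. indicator \<Omega> x *\<^sub>R u x) \<in> borel_measurable lebesgue"
    using L1_lebesgue[OF assms(1), of u] assms(2) by auto
  have [measurable]: "A \<in> sets lebesgue" by fact
  have "(\<lambda>y. ennreal (norm (u y - a)) * indicator A y) = (\<lambda>y. ennreal (norm (indicator \<Omega> y *\<^sub>R u y - a)) * indicator A y)"
    using assms(4) by (intro ext) (auto simp: indicator_def)
  also have "\<dots> \<in> borel_measurable lebesgue" by measurable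
  finally show ?thesis .
qed

text \<open>Chosen componentwise; the norm is recorded because the jump bounds are stated for the
  representative.\<close>

lemma borel_representative:
  fixes f :: "'a::euclidean_space \<Rightarrow> 'b::euclidean_space"
  assumes f: "integrable lebesgue f"
  shows "\<exists>F. integrable lborel F \<and> (AE x in lborel. f x = F x) \<and> (LINT x|lborel. norm (F x)) = (LINT x|lebesgue. norm (f x))"
proof -
  have "\<exists>h. integrable lborel h \<and> (AE x in lborel. f x \<bullet> b = h x)" for b
  proof -
    have i: "integrable lebesgue (\<lambda>x. f x \<bullet> b)" by (rule integrable_inner_left[OF f])
    then have "(\<lambda>x. f x \<bullet> b) \<in> borel_measurable lebesgue" by (rule borel_measurable_integrable)
    then obtain h where h: "h \<in> borel_measurable lborel" "AE x in lborel. f x \<bullet> b = h x"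
      using completion_ex_borel_measurable_real by blast
    have "integrable lebesgue h" by (rule integrable_cong_AE_imp[OF i measurable_completion[OF h(1)] AE_completion[OF h(2)]])
    then show ?thesis using h by (auto simp: integrable_completion)
  qed
  then have "\<exists>h. \<forall>b. integrable lborel (h b) \<and> (AE x in lborel. f x \<bullet> b = h b x)" by (intro choice allI)
  then obtain h where h: "\<And>b. integrable lborel (h b)" "\<And>b. AE x in lborel. f x \<bullet> b = h b x" by blast
  define F where "F x = (\<Sum>b\<in>Basis. h b x *\<^sub>R b)" for x
  have F: "integrable lborel F"
    unfolding F_def[abs_def] by (intro Bochner_Integration.integrable_sum integrable_scaleR_left h)
  have "AE x in lborel. \<forall>b\<in>Basis. f x \<bullet> b = h b x" by (intro AE_finite_allI finite_Basis h)
  then have ae: "AE x in lborel. f x = F x"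
  proof eventually_elim
    case (elim x)
    then have "F x = (\<Sum>b\<in>Basis. (f x \<bullet> b) *\<^sub>R b)" unfolding F_def by (intro sum.cong) auto
    then show ?case by (simp add: euclidean_representation)
  qed
  have Fm: "(\<lambda>x. norm (F x)) \<in> borel_measurable lborel" using F by auto
  have "(LINT x|lborel. norm (F x)) = (LINT x|lebesgue. norm (F x))" by (rule integral_completion[OF Fm, symmetric])
  also have "\<dots> = (LINT x|lebesgue. norm (f x))"
    using f AE_completion[OF ae] measurable_completion[OF Fm] by (intro integral_cong_AE) (auto elim: eventually_mono)
  finally show ?thesis using F ae by blast
qed

text \<open>The limit is the value of a Borel representative, which may differ from
  \<open>f x\<close>; hence the existential \<open>a\<close>.\<close>

lemma Lebesgue_points:
  fixes f :: "real^'n \<Rightarrow> 'b::euclidean_space"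
  assumes \<Omega>: "open \<Omega>" and f: "f \<in> L1 \<Omega>"
  shows "\<exists>E\<in>null_sets lborel. \<forall>x\<in>\<Omega> - E. \<exists>a. mean_limit f a (ball x)"
proof -
  have fi: "integrable lebesgue (\<lambda>x. indicator \<Omega> x *\<^sub>R f x)" using L1_lebesgue[of \<Omega> f] f \<Omega> by simp
  obtain h where h: "integrable lborel h" "AE x in lborel. indicator \<Omega> x *\<^sub>R f x = h x"
    using borel_representative[OF fi] by blast
  define F where "F b x = h x \<bullet> b" for b x
  have F: "integrable lborel (F b)" "AE x in lborel. indicator \<Omega> x * (f x \<bullet> b) = F b x" for b
  proof -
    show "integrable lborel (F b)" unfolding F_def[abs_def] by (rule integrable_inner_left[OF h(1)])
    show "AE x in lborel. indicator \<Omega> x * (f x \<bullet> b) = F b x"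
      using h(2) by eventually_elim (simp add: F_def flip: inner_scaleR_left)
  qed
  define P where "P b x = (\<forall>\<epsilon>>0. \<exists>\<delta>>0. \<forall>r. 0 < r \<and> r < \<delta> \<longrightarrow>
    (\<integral>\<^sup>+y\<in>ball x r. ennreal \<bar>F b y - F b x\<bar> \<partial>lborel) \<le> ennreal \<epsilon> * emeasure lborel (ball x r))" for b x
  have "AE x in lborel. P b x" for b unfolding P_def by (rule Lebesgue_points_real[OF F(1)])
  then have "AE x in lborel. \<forall>b\<in>Basis. P b x" by (subst AE_ball_countable) (auto intro: countable_finite)
  then obtain E where E: "E \<in> null_sets lborel" "{x. \<not> (\<forall>b\<in>Basis. P b x)} \<subseteq> E"
    by (auto elim!: AE_E simp: null_sets_def)
  have Fm [measurable]: "F b \<in> borel_measurable borel" for b using F(1)[of b] by auto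
  show ?thesis
  proof (intro bexI[OF _ E(1)] ballI)
    fix x assume x: "x \<in> \<Omega> - E"
    then have Px: "P b x" if "b \<in> Basis" for b using E(2) that by blast
    obtain \<delta>0 where \<delta>0: "\<delta>0 > 0" "ball x \<delta>0 \<subseteq> \<Omega>" using \<Omega> x open_contains_ball by blast
    define a where "a = (\<Sum>b\<in>Basis. F b x *\<^sub>R b)"
    have ab: "a \<bullet> b = F b x" if "b \<in> Basis" for b using that by (simp add: a_def inner_sum_left inner_Basis if_distrib cong: if_cong)
    define v where "v = unit_ball_vol (real CARD('n))"
    have v: "v > 0" by (simp add: v_def)
    define k where "k = real DIM('b)"
    have k: "k > 0" by (simp add: k_def)
    have "mean_limit f a (ball x)"
      unfolding mean_limit_def
    proof (intro allI impI)
      fix \<epsilon> :: real assume e: "\<epsilon> > 0"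
      \<comment> \<open>There are k components, and a ball of radius r has volume v times
        r^N.\<close>
      then have e': "\<epsilon> / (k * v) > 0" using k v by simp
      let ?Q = "\<lambda>b \<delta>. \<delta> > 0 \<and> (\<forall>r. 0 < r \<and> r < \<delta> \<longrightarrow>
        (\<integral>\<^sup>+y\<in>ball x r. ennreal \<bar>F b y - F b x\<bar> \<partial>lborel) \<le> ennreal (\<epsilon> / (k * v)) * emeasure lborel (ball x r))"
      have "\<forall>b\<in>Basis. \<exists>\<delta>. ?Q b \<delta>" using Px e' unfolding P_def by blast
      then have "\<exists>D. \<forall>b\<in>Basis. ?Q b (D b)" by (rule bchoice)
      then obtain D where D0: "\<forall>b\<in>Basis. ?Q b (D b)" by (elim exE) (rule that)
      have D: "b \<in> Basis \<Longrightarrow> D b > 0" "b \<in> Basis \<Longrightarrow> 0 < r \<and> r < D b \<Longrightarrow>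
        (\<integral>\<^sup>+y\<in>ball x r. ennreal \<bar>F b y - F b x\<bar> \<partial>lborel) \<le> ennreal (\<epsilon> / (k * v)) * emeasure lborel (ball x r)" for b r
        using D0 by blast+
      define \<delta> where "\<delta> = min \<delta>0 (Min (D ` Basis))"
      have \<delta>: "\<delta> > 0" "\<And>b. b \<in> Basis \<Longrightarrow> \<delta> \<le> D b" "\<delta> \<le> \<delta>0" using \<delta>0 D(1) by (auto simp: \<delta>_def intro: min.coboundedI2)
      show "\<exists>\<delta>>0. \<forall>r. 0 < r \<and> r < \<delta> \<longrightarrow> (\<integral>\<^sup>+y\<in>ball x r. ennreal (norm (f y - a)) \<partial>lebesgue) \<le> ennreal (\<epsilon> * r ^ DIM(real^'n))"
      proof (intro exI[of _ \<delta>] conjI allI impI \<delta>(1))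
        fix r assume r: "0 < r \<and> r < \<delta>"
        have bO: "ball x r \<subseteq> \<Omega>" using r \<delta>(3) \<delta>0(2) by (auto simp: subset_eq)
        have [measurable]: "ball x r \<in> sets borel" by simp
        have "AE y in lborel. \<forall>b\<in>Basis. indicator \<Omega> y * (f y \<bullet> b) = F b y"
          using F(2) by (subst AE_ball_countable) (auto intro: countable_finite)
        then have AE: "AE y in lborel. ennreal (norm (f y - a)) * indicator (ball x r) y \<le>
          (\<Sum>b\<in>Basis. ennreal \<bar>F b y - F b x\<bar> * indicator (ball x r) y)"
        proof eventually_elim
          case (elim y)
          show ?case
          proof (cases "y \<in> ball x r")
            case True
            then have y: "y \<in> \<Omega>" using bO by blast
            have "norm (f y - a) \<le> (\<Sum>b\<in>Basis. \<bar>(f y - a) \<bullet> b\<bar>)" by (rule norm_le_l1)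
            also have "\<dots> = (\<Sum>b\<in>Basis. \<bar>F b y - F b x\<bar>)" using elim y ab by (intro sum.cong refl) (simp add: inner_diff_left)
            finally show ?thesis using True by (simp add: sum_ennreal ennreal_leI)
          qed simp
        qed
        have "(\<integral>\<^sup>+y\<in>ball x r. ennreal (norm (f y - a)) \<partial>lebesgue) = (\<integral>\<^sup>+y\<in>ball x r. ennreal (norm (f y - a)) \<partial>lborel)"
          by (rule nn_integral_completion)
        also have "\<dots> \<le> (\<integral>\<^sup>+y. (\<Sum>b\<in>Basis. ennreal \<bar>F b y - F b x\<bar> * indicator (ball x r) y) \<partial>lborel)"
          using AE by (rule nn_integral_mono_AE)
        also have "\<dots> = (\<Sum>b\<in>Basis. \<integral>\<^sup>+y\<in>ball x r. ennreal \<bar>F b y - F b x\<bar> \<partial>lborel)"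
          by (rule nn_integral_sum) measurable
        also have "\<dots> \<le> (\<Sum>b\<in>(Basis::'b set). ennreal (\<epsilon> / (k * v)) * emeasure lborel (ball x r))"
        proof (intro sum_mono D(2))
          fix b :: 'b assume "b \<in> Basis" then show "0 < r \<and> r < D b" using r \<delta>(2)[of b] by auto
        qed
        also have "\<dots> = ennreal k * (ennreal (\<epsilon> / (k * v)) * ennreal (v * r ^ CARD('n)))"
          using r by (simp add: k_def emeasure_ball v_def ennreal_of_nat_eq_real_of_nat)
        also have "\<dots> = ennreal (k * (\<epsilon> / (k * v) * (v * r ^ CARD('n))))"
          using r k v e by (subst ennreal_mult[symmetric], simp, simp, subst ennreal_mult[symmetric]) auto
        also have "k * (\<epsilon> / (k * v) * (v * r ^ CARD('n))) = \<epsilon> * r ^ DIM(real^'n)" using k v by simp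
        finally show "(\<integral>\<^sup>+y\<in>ball x r. ennreal (norm (f y - a)) \<partial>lebesgue) \<le> ennreal (\<epsilon> * r ^ DIM(real^'n))" .
      qed
    qed
    then show "\<exists>a. mean_limit f a (ball x)" by blast
  qed
qed

section \<open>Approximate jumps\<close>

lemma half_ball_affine:
  assumes "r > 0" shows "half_ball x r \<nu> = (\<lambda>y. r *\<^sub>R y + x) ` half_ball 0 1 \<nu>"
proof (intro set_eqI iffI)
  fix y assume "y \<in> half_ball x r \<nu>"
  then have "(1/r) *\<^sub>R (y - x) \<in> half_ball 0 1 \<nu>" using assms by (simp add: half_ball_def dist_norm norm_minus_commute)
  moreover have "y = r *\<^sub>R ((1/r) *\<^sub>R (y - x)) + x" using assms by simp
  ultimately show "y \<in> (\<lambda>y. r *\<^sub>R y + x) ` half_ball 0 1 \<nu>" by blast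
next
  fix y assume "y \<in> (\<lambda>y. r *\<^sub>R y + x) ` half_ball 0 1 \<nu>"
  then show "y \<in> half_ball x r \<nu>" using assms by (auto simp: half_ball_def dist_norm)
qed

lemma open_half_ball: "open (half_ball x r \<nu>)"
proof -
  have "half_ball x r \<nu> = ball x r \<inter> {y. (y - x) \<bullet> \<nu> > 0}" by (auto simp: half_ball_def)
  moreover have "open {y. (y - x) \<bullet> \<nu> > 0}" by (intro open_Collect_less continuous_intros)
  ultimately show ?thesis by auto
qed

lemma half_ball_subset: "half_ball x r \<nu> \<subseteq> ball x r"
  by (auto simp: half_ball_def)

lemma measure_affine_image:
  fixes D :: "'a::euclidean_space set"
  assumes "r > 0" shows "measure lebesgue ((\<lambda>y. r *\<^sub>R y + x) ` D) = r ^ DIM('a) * measure lebesgue D"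
  using measure_lebesgue_affine[of r x D] assms by simp

lemma measure_pos:
  fixes D :: "'a::euclidean_space set"
  assumes "open D" "bounded D" "D \<noteq> {}" shows "measure lebesgue D > 0"
proof -
  have "\<not> negligible D" using assms open_not_negligible by blast
  then have "measure lebesgue D \<noteq> 0" using negligible_iff_measure lmeasurable_open[OF assms(2,1)] by blast
  then show ?thesis by (simp add: zero_less_measure_iff)
qed

text \<open>For small radii the half ball lies in \<open>\<Omega>\<close>, where \<open>u\<close> is
  integrable, so the Bochner integral in \<open>approx_jump\<close> equals the nonnegative integral
  in \<open>mean_limit\<close>. The volume of the half ball is a constant times r^N.\<close>

lemma half_ball_average:
  fixes u :: "'a::euclidean_space \<Rightarrow> 'b::euclidean_space"
  assumes \<Omega>: "open \<Omega>" and u: "u \<in> L1 \<Omega>" and x: "x \<in> \<Omega>" and \<nu>: "norm \<nu> = 1"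
  shows "((\<lambda>r. (LINT y:half_ball x r \<nu>|lebesgue. norm (u y - a)) / measure lebesgue (half_ball x r \<nu>)) \<longlongrightarrow> 0) (at_right 0)
    \<longleftrightarrow> mean_limit u a (\<lambda>r. half_ball x r \<nu>)"
proof -
  have \<Omega>b: "\<Omega> \<in> sets borel" using \<Omega> by simp
  define c where "c = measure lebesgue (half_ball 0 1 \<nu>)"
  have "\<nu> \<bullet> \<nu> = 1" using \<nu> by (simp add: norm_eq_1)
  then have "(1/2) *\<^sub>R \<nu> \<in> half_ball 0 1 \<nu>" using \<nu> by (simp add: half_ball_def)
  then have c: "c > 0" unfolding c_def by (intro measure_pos open_half_ball bounded_subset[OF bounded_ball half_ball_subset]) auto
  have mh: "measure lebesgue (half_ball x r \<nu>) = r ^ DIM('a) * c" if "r > 0" for r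
    unfolding c_def half_ball_affine[OF that, of x] by (rule measure_affine_image[OF that])
  obtain \<delta>0 where \<delta>0: "\<delta>0 > 0" "ball x \<delta>0 \<subseteq> \<Omega>" using \<Omega> x open_contains_ball by blast
  define I where "I r = (LINT y:half_ball x r \<nu>|lebesgue. norm (u y - a))" for r
  have I0: "I r \<ge> 0" for r unfolding I_def set_lebesgue_integral_def by (intro Bochner_Integration.integral_nonneg) simp
  have Ie: "(\<integral>\<^sup>+y\<in>half_ball x r \<nu>. ennreal (norm (u y - a)) \<partial>lebesgue) = ennreal (I r)" if r: "0 < r" "r < \<delta>0" for r
  proof -
    let ?H = "half_ball x r \<nu>"
    have sub: "?H \<subseteq> \<Omega>" using half_ball_subset[of x r \<nu>] \<delta>0(2) r by (auto simp: subset_eq)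
    have Hm: "?H \<in> lmeasurable" by (intro lmeasurable_open bounded_subset[OF bounded_ball half_ball_subset] open_half_ball)
    have "integrable lebesgue (\<lambda>y. indicator ?H y *\<^sub>R (indicator \<Omega> y *\<^sub>R u y))"
      by (rule integrable_mult_indicator) (use L1_lebesgue[OF \<Omega>b, of u] u Hm in auto)
    moreover have "(\<lambda>y. indicator ?H y *\<^sub>R (indicator \<Omega> y *\<^sub>R u y)) = (\<lambda>y. indicator ?H y *\<^sub>R u y)"
      using sub by (intro ext) (auto simp: indicator_def)
    ultimately have i1: "integrable lebesgue (\<lambda>y. indicator ?H y *\<^sub>R u y)" by simp
    have i2: "integrable lebesgue (\<lambda>y. indicator ?H y *\<^sub>R a)"
      using Hm by (auto simp: fmeasurable_def intro!: integrable_scaleR_left)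
    have "integrable lebesgue (\<lambda>y. norm (indicator ?H y *\<^sub>R u y - indicator ?H y *\<^sub>R a))" using i1 i2 by auto
    moreover have "norm (indicator ?H y *\<^sub>R u y - indicator ?H y *\<^sub>R a) = indicator ?H y *\<^sub>R norm (u y - a)" for y
      by (auto simp: indicator_def)
    ultimately have i: "integrable lebesgue (\<lambda>y. indicator ?H y *\<^sub>R norm (u y - a))" by simp
    have "(\<integral>\<^sup>+y\<in>?H. ennreal (norm (u y - a)) \<partial>lebesgue) = (\<integral>\<^sup>+y. ennreal (indicator ?H y *\<^sub>R norm (u y - a)) \<partial>lebesgue)"
      by (intro nn_integral_cong) (auto simp: indicator_def)
    also have "\<dots> = ennreal (I r)" unfolding I_def set_lebesgue_integral_def
      using i by (intro nn_integral_eq_integral) (auto simp: indicator_def)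
    finally show ?thesis .
  qed
  have ev: "((\<lambda>r. I r / measure lebesgue (half_ball x r \<nu>)) \<longlongrightarrow> 0) (at_right 0) \<longleftrightarrow>
     (\<forall>\<epsilon>>0. \<exists>\<delta>>0. \<forall>r. 0 < r \<and> r < \<delta> \<longrightarrow> I r / measure lebesgue (half_ball x r \<nu>) < \<epsilon>)"
    unfolding tendsto_iff eventually_at_right_field using I0 by (simp add: dist_real_def abs_of_nonneg imp_conjL)
  show ?thesis
    unfolding I_def[symmetric] ev mean_limit_def
  proof safe
    fix \<epsilon> :: real assume *: "\<forall>\<epsilon>>0. \<exists>\<delta>>0. \<forall>r. 0 < r \<and> r < \<delta> \<longrightarrow> I r / measure lebesgue (half_ball x r \<nu>) < \<epsilon>" and e: "\<epsilon> > 0"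
    obtain \<delta> where \<delta>: "\<delta> > 0" "\<And>r. 0 < r \<and> r < \<delta> \<Longrightarrow> I r / measure lebesgue (half_ball x r \<nu>) < \<epsilon> / c"
      using * e c by (metis divide_pos_pos)
    show "\<exists>\<delta>>0. \<forall>r. 0 < r \<and> r < \<delta> \<longrightarrow> (\<integral>\<^sup>+y\<in>half_ball x r \<nu>. ennreal (norm (u y - a)) \<partial>lebesgue) \<le> ennreal (\<epsilon> * r ^ DIM('a))"
    proof (intro exI[of _ "min \<delta> \<delta>0"] conjI allI impI)
      fix r assume r: "0 < r \<and> r < min \<delta> \<delta>0"
      then have "I r / (r ^ DIM('a) * c) < \<epsilon> / c" using \<delta>(2)[of r] mh by simp
      then have "I r < \<epsilon> * r ^ DIM('a)" using r c by (simp add: field_simps)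
      then show "(\<integral>\<^sup>+y\<in>half_ball x r \<nu>. ennreal (norm (u y - a)) \<partial>lebesgue) \<le> ennreal (\<epsilon> * r ^ DIM('a))"
        using Ie[of r] r by (simp add: ennreal_leI)
    qed (use \<delta> \<delta>0 in auto)
  next
    fix \<epsilon> :: real assume *: "\<forall>\<epsilon>>0. \<exists>\<delta>>0. \<forall>r. 0 < r \<and> r < \<delta> \<longrightarrow>
      (\<integral>\<^sup>+y\<in>half_ball x r \<nu>. ennreal (norm (u y - a)) \<partial>lebesgue) \<le> ennreal (\<epsilon> * r ^ DIM('a))" and e: "\<epsilon> > 0"
    have "\<epsilon> * c / 2 > 0" using e c by simp
    then obtain \<delta> where \<delta>: "\<delta> > 0" "\<And>r. 0 < r \<and> r < \<delta> \<Longrightarrow>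
      (\<integral>\<^sup>+y\<in>half_ball x r \<nu>. ennreal (norm (u y - a)) \<partial>lebesgue) \<le> ennreal (\<epsilon> * c / 2 * r ^ DIM('a))"
      using * by blast
    show "\<exists>\<delta>>0. \<forall>r. 0 < r \<and> r < \<delta> \<longrightarrow> I r / measure lebesgue (half_ball x r \<nu>) < \<epsilon>"
    proof (intro exI[of _ "min \<delta> \<delta>0"] conjI allI impI)
      fix r assume r: "0 < r \<and> r < min \<delta> \<delta>0"
      then have "ennreal (I r) \<le> ennreal (\<epsilon> * c / 2 * r ^ DIM('a))" using \<delta>(2)[of r] Ie[of r] by simp
      then have "I r \<le> \<epsilon> * c / 2 * r ^ DIM('a)" using r e c by (subst (asm) ennreal_le_iff) auto
      also have "\<dots> < \<epsilon> * c * r ^ DIM('a)" using r e c by (intro mult_strict_right_mono) auto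
      finally show "I r / measure lebesgue (half_ball x r \<nu>) < \<epsilon>"
        using r c mh[of r] by (simp add: divide_less_eq mult_ac)
    qed (use \<delta> \<delta>0 in auto)
  qed
qed

lemma approx_jump_iff:
  fixes u :: "'a::euclidean_space \<Rightarrow> 'b::euclidean_space"
  assumes \<Omega>: "open \<Omega>" and u: "u \<in> L1 \<Omega>" and x: "x \<in> \<Omega>"
  shows "approx_jump u x (a, b, \<nu>) \<longleftrightarrow> a \<noteq> b \<and> norm \<nu> = 1 \<and>
     mean_limit u a (\<lambda>r. half_ball x r \<nu>) \<and> mean_limit u b (\<lambda>r. half_ball x r (- \<nu>))"
  using half_ball_average[OF assms, of \<nu> a] half_ball_average[OF assms, of "- \<nu>" b]
  unfolding approx_jump_def by auto

text \<open>Half balls with normals that are not opposite overlap in an open set whose volume is a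
  fixed multiple of r^N, and on the overlap \<open>u\<close> would have to be close to both
  limits.\<close>

lemma mean_limit_unique:
  fixes u :: "'a::euclidean_space \<Rightarrow> 'b::euclidean_space"
  assumes \<Omega>: "open \<Omega>" and u: "u \<in> L1 \<Omega>" and x: "x \<in> \<Omega>"
    and lim: "mean_limit u a (\<lambda>r. half_ball x r \<nu>)" "mean_limit u b (\<lambda>r. half_ball x r \<nu>')"
    and \<nu>: "norm \<nu> = 1" "norm \<nu>' = 1" "\<nu>' \<noteq> - \<nu>"
  shows "a = b"
proof (rule ccontr)
  assume ab: "a \<noteq> b"
  have \<Omega>b: "\<Omega> \<in> sets borel" using \<Omega> by simp
  define D where "D = half_ball 0 1 \<nu> \<inter> half_ball (0::'a) 1 \<nu>'"
  have ip: "1 + \<nu> \<bullet> \<nu>' > 0"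
  proof -
    have "\<nu> + \<nu>' \<noteq> 0" using \<nu>(3) by (metis add_eq_0_iff)
    then have "0 < (\<nu> + \<nu>') \<bullet> (\<nu> + \<nu>')" by simp
    also have "(\<nu> + \<nu>') \<bullet> (\<nu> + \<nu>') = 2 * (1 + \<nu> \<bullet> \<nu>')"
      using \<nu>(1,2) by (simp add: norm_eq_1 inner_add_left inner_add_right inner_commute)
    finally show ?thesis by simp
  qed
  have nn: "norm (\<nu> + \<nu>') \<le> 2" using norm_triangle_ineq[of \<nu> \<nu>'] \<nu> by simp
  \<comment> \<open>The sum of the normals has positive inner product with each of them and norm at
    most 2.\<close>
  have "(1/3) *\<^sub>R (\<nu> + \<nu>') \<in> D"
  proof -
    have "\<nu> \<bullet> \<nu> = 1" "\<nu>' \<bullet> \<nu>' = 1" using \<nu> by (simp_all add: norm_eq_1)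
    then have "(\<nu> + \<nu>') \<bullet> \<nu> > 0" "(\<nu> + \<nu>') \<bullet> \<nu>' > 0" using ip by (simp_all add: inner_add_left inner_commute[of \<nu>' \<nu>])
    then show ?thesis using nn unfolding D_def half_ball_def by (simp del: scaleR_right_distrib)
  qed
  then have Dne: "D \<noteq> {}" by blast
  have Dob: "open D" "bounded D" unfolding D_def
    by (auto intro!: open_half_ball open_Int intro: bounded_subset[OF bounded_ball half_ball_subset])
  define c where "c = measure lebesgue D"
  have c: "c > 0" unfolding c_def by (rule measure_pos[OF Dob Dne])
  \<comment> \<open>Makes the two mean bounds add up to half of the integral of the constant norm (a
    - b) over the overlap.\<close>
  define \<epsilon> where "\<epsilon> = norm (a - b) * c / 4"
  have e: "\<epsilon> > 0" using ab c by (simp add: \<epsilon>_def)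
  obtain \<delta>1 where \<delta>1: "\<delta>1 > 0" "\<And>r. 0 < r \<and> r < \<delta>1 \<Longrightarrow>
      (\<integral>\<^sup>+y\<in>half_ball x r \<nu>. ennreal (norm (u y - a)) \<partial>lebesgue) \<le> ennreal (\<epsilon> * r ^ DIM('a))"
    using lim(1) e unfolding mean_limit_def by blast
  obtain \<delta>2 where \<delta>2: "\<delta>2 > 0" "\<And>r. 0 < r \<and> r < \<delta>2 \<Longrightarrow>
      (\<integral>\<^sup>+y\<in>half_ball x r \<nu>'. ennreal (norm (u y - b)) \<partial>lebesgue) \<le> ennreal (\<epsilon> * r ^ DIM('a))"
    using lim(2) e unfolding mean_limit_def by blast
  obtain \<delta>0 where \<delta>0: "\<delta>0 > 0" "ball x \<delta>0 \<subseteq> \<Omega>" using \<Omega> x open_contains_ball by blast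
  define r where "r = min \<delta>0 (min \<delta>1 \<delta>2) / 2"
  have r: "0 < r" "r < \<delta>0" "r < \<delta>1" "r < \<delta>2" using \<delta>0 \<delta>1 \<delta>2 by (auto simp: r_def)
  define S where "S = (\<lambda>y. r *\<^sub>R y + x) ` D"
  have S1: "S \<subseteq> half_ball x r \<nu>" "S \<subseteq> half_ball x r \<nu>'"
    unfolding S_def half_ball_affine[OF r(1)] by (auto simp: D_def)
  have S\<Omega>: "S \<subseteq> \<Omega>" using S1(1) half_ball_subset[of x r \<nu>] \<delta>0(2) r by (force simp: subset_eq)
  have So: "open S"
  proof -
    have "S = half_ball x r \<nu> \<inter> half_ball x r \<nu>'"
      unfolding S_def D_def half_ball_affine[OF r(1)] using r(1) by (subst image_Int) (auto simp: inj_on_def)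
    then show ?thesis by (simp add: open_half_ball open_Int)
  qed
  have Sl: "S \<in> lmeasurable" using So S1(1) half_ball_subset[of x r \<nu>]
    by (intro lmeasurable_open) (auto intro: bounded_subset[OF bounded_ball])
  then have Sm: "S \<in> sets lebesgue" by auto
  have mS: "measure lebesgue S = r ^ DIM('a) * c" unfolding S_def c_def by (rule measure_affine_image[OF r(1)])
  have "ennreal (norm (a - b) * (r ^ DIM('a) * c)) = ennreal (norm (a - b)) * emeasure lebesgue S"
    using Sl c r by (simp add: emeasure_eq_measure2 mS ennreal_mult)
  also have "\<dots> = (\<integral>\<^sup>+y. ennreal (norm (a - b)) * indicator S y \<partial>lebesgue)"
    using Sm by (simp add: nn_integral_cmult_indicator)
  also have "\<dots> \<le> (\<integral>\<^sup>+y. ennreal (norm (u y - a)) * indicator S y + ennreal (norm (u y - b)) * indicator S y \<partial>lebesgue)"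
  proof (intro nn_integral_mono)
    fix y
    have "norm (a - b) \<le> norm (u y - a) + norm (u y - b)" using norm_triangle_ineq4[of "u y - b" "u y - a"] by simp
    then show "ennreal (norm (a - b)) * indicator S y \<le> ennreal (norm (u y - a)) * indicator S y + ennreal (norm (u y - b)) * indicator S y"
      by (auto simp: indicator_def ennreal_plus[symmetric] simp del: ennreal_plus intro!: ennreal_leI)
  qed
  also have "\<dots> = (\<integral>\<^sup>+y\<in>S. ennreal (norm (u y - a)) \<partial>lebesgue) + (\<integral>\<^sup>+y\<in>S. ennreal (norm (u y - b)) \<partial>lebesgue)"
    by (intro nn_integral_add L1_measurable[OF \<Omega>b u Sm S\<Omega>])
  also have "\<dots> \<le> (\<integral>\<^sup>+y\<in>half_ball x r \<nu>. ennreal (norm (u y - a)) \<partial>lebesgue) + (\<integral>\<^sup>+y\<in>half_ball x r \<nu>'. ennreal (norm (u y - b)) \<partial>lebesgue)"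
    using S1 by (intro add_mono nn_integral_mono mult_left_mono) (auto simp: indicator_def)
  also have "\<dots> \<le> ennreal (\<epsilon> * r ^ DIM('a)) + ennreal (\<epsilon> * r ^ DIM('a))"
    using \<delta>1(2)[of r] \<delta>2(2)[of r] r by (intro add_mono) auto
  also have "\<dots> = ennreal (2 * \<epsilon> * r ^ DIM('a))" using e r by (simp add: ennreal_plus[symmetric] del: ennreal_plus)
  finally have "norm (a - b) * (r ^ DIM('a) * c) \<le> 2 * \<epsilon> * r ^ DIM('a)"
    using e r by (subst (asm) ennreal_le_iff) auto
  then have "norm (a - b) * c * r ^ DIM('a) \<le> 2 * \<epsilon> * r ^ DIM('a)" by (simp add: mult_ac)
  then have "norm (a - b) * c \<le> 2 * \<epsilon>" using r by (simp add: mult_le_cancel_right)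
  then show False using ab c by (simp add: \<epsilon>_def)
qed

lemma unit_neq_minus:
  fixes \<nu> :: "'a::real_inner"
  assumes "norm \<nu> = 1" shows "- \<nu> \<noteq> \<nu>"
proof
  assume "- \<nu> = \<nu>"
  then have "- (\<nu> \<bullet> \<nu>) = \<nu> \<bullet> \<nu>" by (metis inner_minus_left)
  then show False using assms by (simp add: norm_eq_1)
qed

text \<open>If the normals are neither equal nor opposite, each half ball of one triple overlaps
  both half balls of the other, and all limits coincide, contrary to a \<noteq> b.\<close>

lemma approx_jump_unique:
  fixes u :: "'a::euclidean_space \<Rightarrow> 'b::euclidean_space"
  assumes \<Omega>: "open \<Omega>" and u: "u \<in> L1 \<Omega>" and x: "x \<in> \<Omega>"
    and T: "approx_jump u x (a, b, \<nu>)" and T': "approx_jump u x (a', b', \<nu>')"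
  shows "(a', b', \<nu>') = (a, b, \<nu>) \<or> (a', b', \<nu>') = (b, a, - \<nu>)"
proof -
  note 1 = T[unfolded approx_jump_iff[OF \<Omega> u x]] and 2 = T'[unfolded approx_jump_iff[OF \<Omega> u x]]
  note un = mean_limit_unique[OF \<Omega> u x]
  have aa: "a = a'" if "\<nu>' \<noteq> - \<nu>" using un[of a \<nu> a' \<nu>'] 1 2 that by auto
  have ab: "a = b'" if "\<nu>' \<noteq> \<nu>" using un[of a \<nu> b' "- \<nu>'"] 1 2 that by auto
  have ba: "b = a'" if "\<nu>' \<noteq> \<nu>" using un[of b "- \<nu>" a' "\<nu>'"] 1 2 that by auto
  have bb: "b = b'" if "\<nu>' \<noteq> - \<nu>"
  proof -
    have "- \<nu>' \<noteq> - (- \<nu>)" using that by (metis minus_minus)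
    then show ?thesis using un[of b "- \<nu>" b' "- \<nu>'"] 1 2 by auto
  qed
  consider "\<nu>' = - \<nu>" | "\<nu>' = \<nu>" | "\<nu>' \<noteq> - \<nu>" "\<nu>' \<noteq> \<nu>" by blast
  then show ?thesis
  proof cases
    case 1
    then have "\<nu>' \<noteq> \<nu>" using unit_neq_minus[of \<nu>] T by (auto simp: approx_jump_def)
    then show ?thesis using 1 ab ba by simp
  next
    case 2
    then have "\<nu>' \<noteq> - \<nu>" using unit_neq_minus[of \<nu>] T by (auto simp: approx_jump_def)
    then show ?thesis using 2 aa bb by simp
  next
    case 3
    then have "a' = b'" using aa ab by simp
    then show ?thesis using T' by (auto simp: approx_jump_def)
  qed
qed

text \<open>The jump data are picked by \<open>SOME\<close>; evenness of \<psi> makes the density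
  independent of the choice between the two admissible triples.\<close>

lemma jump_density_eq:
  fixes \<psi> :: "real^'d \<Rightarrow> real^'n \<Rightarrow> real"
  assumes \<Omega>: "open \<Omega>" and u: "u \<in> L1 \<Omega>" and x: "x \<in> \<Omega>" and T: "approx_jump u x (a, b, \<nu>)"
    and even: "\<And>v \<nu>. \<nu> \<in> sphere 0 1 \<Longrightarrow> \<psi> (- v) (- \<nu>) = \<psi> v \<nu>"
  shows "\<psi> (jump u x) (jump_normal u x) = \<psi> (a - b) \<nu>"
proof -
  obtain a' b' \<nu>' where s: "(SOME T. approx_jump u x T) = (a', b', \<nu>')" by (metis prod_cases3)
  have "approx_jump u x (SOME T. approx_jump u x T)" using T by (rule someI)
  then have T': "approx_jump u x (a', b', \<nu>')" by (simp add: s)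
  have "\<nu> \<in> sphere 0 1" using T by (simp add: approx_jump_def)
  then show ?thesis using approx_jump_unique[OF \<Omega> u x T T'] even[of \<nu> "a - b"]
    by (auto simp: jump_def jump_normal_def s)
qed

text \<open>The function \<open>v\<close> is uniformly close to \<open>c\<close> on small sets
  \<open>D \<delta>\<close>, which is enough against the volume of the ball, while \<open>u\<close>
  converges only in the mean.\<close>

lemma mean_limit_add:
  fixes u v :: "'a::euclidean_space \<Rightarrow> 'b::euclidean_space"
  assumes \<Omega>: "open \<Omega>" and u: "u \<in> L1 \<Omega>" and x: "x \<in> \<Omega>"
    and lim: "mean_limit u a D" and D: "\<And>r. D r \<subseteq> ball x r" "\<And>r. open (D r)"
    and v: "\<And>\<epsilon>. \<epsilon> > 0 \<Longrightarrow> \<exists>\<delta>>0. \<forall>y\<in>D \<delta>. norm (v y - c) \<le> \<epsilon>" and mono: "\<And>r s. r \<le> s \<Longrightarrow> D r \<subseteq> D s"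
  shows "mean_limit (\<lambda>y. u y + v y) (a + c) D"
  unfolding mean_limit_def
proof (intro allI impI)
  fix \<epsilon> :: real assume e: "\<epsilon> > 0"
  have \<Omega>b: "\<Omega> \<in> sets borel" using \<Omega> by simp
  define w where "w = unit_ball_vol (real DIM('a))"
  have w: "w > 0" by (simp add: w_def)
  obtain \<delta>0 where \<delta>0: "\<delta>0 > 0" "ball x \<delta>0 \<subseteq> \<Omega>" using \<Omega> x open_contains_ball by blast
  have "\<epsilon>/2 > 0" using e by simp
  then obtain \<delta>1 where \<delta>1: "\<delta>1 > 0" "\<And>r. 0 < r \<and> r < \<delta>1 \<Longrightarrow>
      (\<integral>\<^sup>+y\<in>D r. ennreal (norm (u y - a)) \<partial>lebesgue) \<le> ennreal (\<epsilon>/2 * r ^ DIM('a))"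
    using lim unfolding mean_limit_def by blast
  \<comment> \<open>A ball of radius r has volume w times r^N, so this bound on \<open>v\<close>
    contributes at most half of the error allowed.\<close>
  have "\<epsilon>/2/w > 0" using e w by simp
  then obtain \<delta>2 where \<delta>2: "\<delta>2 > 0" "\<And>y. y \<in> D \<delta>2 \<Longrightarrow> norm (v y - c) \<le> \<epsilon>/2/w" using v by blast
  show "\<exists>\<delta>>0. \<forall>r. 0 < r \<and> r < \<delta> \<longrightarrow> (\<integral>\<^sup>+y\<in>D r. ennreal (norm (u y + v y - (a + c))) \<partial>lebesgue) \<le> ennreal (\<epsilon> * r ^ DIM('a))"
  proof (intro exI[of _ "min \<delta>0 (min \<delta>1 \<delta>2)"] conjI allI impI)
    fix r assume r: "0 < r \<and> r < min \<delta>0 (min \<delta>1 \<delta>2)"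
    have D\<Omega>: "D r \<subseteq> \<Omega>" using D(1)[of r] \<delta>0(2) r by (force simp: subset_eq)
    have Dm: "D r \<in> sets lebesgue" using D(2)[of r] by simp
    have "(\<integral>\<^sup>+y\<in>D r. ennreal (norm (u y + v y - (a + c))) \<partial>lebesgue) \<le>
      (\<integral>\<^sup>+y. ennreal (norm (u y - a)) * indicator (D r) y + ennreal (\<epsilon>/2/w) * indicator (ball x r) y \<partial>lebesgue)"
    proof (intro nn_integral_mono)
      fix y
      show "ennreal (norm (u y + v y - (a + c))) * indicator (D r) y \<le> ennreal (norm (u y - a)) * indicator (D r) y + ennreal (\<epsilon>/2/w) * indicator (ball x r) y"
      proof (cases "y \<in> D r")
        case True
        then have yb: "y \<in> ball x r" using D(1) by blast
        have "y \<in> D \<delta>2" using True mono[of r \<delta>2] r by auto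
        then have vy: "norm (v y - c) \<le> \<epsilon>/2/w" by (rule \<delta>2(2))
        have "u y + v y - (a + c) = (u y - a) + (v y - c)" by simp
        then have "norm (u y + v y - (a + c)) \<le> norm (u y - a) + norm (v y - c)" using norm_triangle_ineq by metis
        then have "norm (u y + v y - (a + c)) \<le> norm (u y - a) + \<epsilon>/2/w" using vy by linarith
        then have "ennreal (norm (u y + v y - (a + c))) \<le> ennreal (norm (u y - a) + \<epsilon>/2/w)" by (rule ennreal_leI)
        also have "\<dots> = ennreal (norm (u y - a)) + ennreal (\<epsilon>/2/w)" using e w by (intro ennreal_plus) auto
        finally show ?thesis using True yb by simp
      qed simp
    qed
    also have "\<dots> = (\<integral>\<^sup>+y\<in>D r. ennreal (norm (u y - a)) \<partial>lebesgue) + (\<integral>\<^sup>+y. ennreal (\<epsilon>/2/w) * indicator (ball x r) y \<partial>lebesgue)"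
      by (rule nn_integral_add[OF L1_measurable[OF \<Omega>b u Dm D\<Omega>]]) (intro borel_measurable_times_ennreal borel_measurable_const borel_measurable_indicator, simp)
    also have "(\<integral>\<^sup>+y. ennreal (\<epsilon>/2/w) * indicator (ball x r) y \<partial>lebesgue) = ennreal (\<epsilon>/2/w) * emeasure lborel (ball x r)"
      by (subst nn_integral_cmult_indicator) auto
    also have "\<dots> = ennreal (\<epsilon>/2/w) * ennreal (w * r ^ DIM('a))" using r by (simp add: emeasure_ball w_def)
    also have "\<dots> = ennreal (\<epsilon>/2 * r ^ DIM('a))" using r e w by (subst ennreal_mult[symmetric]) auto
    also have "(\<integral>\<^sup>+y\<in>D r. ennreal (norm (u y - a)) \<partial>lebesgue) \<le> ennreal (\<epsilon>/2 * r ^ DIM('a))" using \<delta>1(2)[of r] r by simp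
    also have "ennreal (\<epsilon>/2 * r ^ DIM('a)) + ennreal (\<epsilon>/2 * r ^ DIM('a)) = ennreal (\<epsilon> * r ^ DIM('a))"
      using r e by (subst ennreal_plus[symmetric]) auto
    finally show "(\<integral>\<^sup>+y\<in>D r. ennreal (norm (u y + v y - (a + c))) \<partial>lebesgue) \<le> ennreal (\<epsilon> * r ^ DIM('a))"
      by (simp add: add_right_mono)
  qed (use \<delta>0 \<delta>1 \<delta>2 in auto)
qed

section \<open>One-sided limits and jumps of a sum\<close>

lemma half_ball_mono: "r \<le> s \<Longrightarrow> half_ball x r \<nu> \<subseteq> half_ball x s \<nu>"
  by (auto simp: half_ball_def)

lemma mean_limit_subset:
  assumes "mean_limit u a D" "\<And>r. D' r \<subseteq> D r" shows "mean_limit u a D'"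
  unfolding mean_limit_def
proof (intro allI impI)
  fix \<epsilon> :: real assume "\<epsilon> > 0"
  then obtain \<delta> where \<delta>: "\<delta> > 0" "\<And>r. 0 < r \<and> r < \<delta> \<Longrightarrow>
      (\<integral>\<^sup>+y\<in>D r. ennreal (norm (u y - a)) \<partial>lebesgue) \<le> ennreal (\<epsilon> * r ^ DIM('a))"
    using assms(1) unfolding mean_limit_def by blast
  have "(\<integral>\<^sup>+y\<in>D' r. ennreal (norm (u y - a)) \<partial>lebesgue) \<le> (\<integral>\<^sup>+y\<in>D r. ennreal (norm (u y - a)) \<partial>lebesgue)" for r
    using assms(2)[of r] by (intro nn_integral_mono mult_left_mono) (auto simp: indicator_def)
  then show "\<exists>\<delta>>0. \<forall>r. 0 < r \<and> r < \<delta> \<longrightarrow> (\<integral>\<^sup>+y\<in>D' r. ennreal (norm (u y - a)) \<partial>lebesgue) \<le> ennreal (\<epsilon> * r ^ DIM('a))"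
    using \<delta> order_trans by blast
qed

text \<open>A pointwise limit from an open half space, stronger than a mean limit on half balls. The
  correctors have such limits on grid faces because they are uniform limits of piecewise affine
  functions.\<close>

definition side_limit :: "('a::euclidean_space \<Rightarrow> 'b::euclidean_space) \<Rightarrow> 'a \<Rightarrow> 'a \<Rightarrow> 'b \<Rightarrow> bool" where
  "side_limit v x \<nu> c \<longleftrightarrow> (\<forall>\<epsilon>>0. \<exists>\<delta>>0. \<forall>y\<in>half_ball x \<delta> \<nu>. norm (v y - c) \<le> \<epsilon>)"

lemma mean_limit_half_add:
  fixes u v :: "'a::euclidean_space \<Rightarrow> 'b::euclidean_space"
  assumes \<Omega>: "open \<Omega>" and u: "u \<in> L1 \<Omega>" and x: "x \<in> \<Omega>"
    and lim: "mean_limit u a (\<lambda>r. half_ball x r \<nu>)" and v: "side_limit v x \<nu> c"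
  shows "mean_limit (\<lambda>y. u y + v y) (a + c) (\<lambda>r. half_ball x r \<nu>)"
  by (rule mean_limit_add[OF \<Omega> u x lim half_ball_subset open_half_ball])
    (use v in \<open>auto simp: side_limit_def intro: subsetD[OF half_ball_mono]\<close>)

lemma isCont_side_limit:
  assumes "isCont v x" shows "side_limit v x \<nu> (v x)"
  unfolding side_limit_def
proof (intro allI impI)
  fix \<epsilon> :: real assume "\<epsilon> > 0"
  then obtain \<delta> where "\<delta> > 0" "\<And>y. dist y x < \<delta> \<Longrightarrow> dist (v y) (v x) < \<epsilon>"
    using assms unfolding continuous_at_eps_delta by blast
  then show "\<exists>\<delta>>0. \<forall>y\<in>half_ball x \<delta> \<nu>. norm (v y - v x) \<le> \<epsilon>"
    by (intro exI[of _ \<delta>]) (auto simp: half_ball_def dist_commute dist_norm[symmetric] less_imp_le)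
qed

lemma approx_jump_add_cont:
  fixes g v :: "'a::euclidean_space \<Rightarrow> 'b::euclidean_space"
  assumes \<Omega>: "open \<Omega>" and g: "g \<in> L1 \<Omega>" and gv: "(\<lambda>y. g y + v y) \<in> L1 \<Omega>" and x: "x \<in> \<Omega>" and v: "isCont v x"
    and T: "approx_jump g x (a, b, \<nu>)"
  shows "approx_jump (\<lambda>y. g y + v y) x (a + v x, b + v x, \<nu>)"
  using T mean_limit_half_add[OF \<Omega> g x, of a \<nu> v] mean_limit_half_add[OF \<Omega> g x, of b "- \<nu>" v]
    isCont_side_limit[OF v] unfolding approx_jump_iff[OF \<Omega> g x] approx_jump_iff[OF \<Omega> gv x] by auto

lemma jump_set_add_cont:
  fixes g v :: "'a::euclidean_space \<Rightarrow> 'b::euclidean_space"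
  assumes \<Omega>: "open \<Omega>" and g: "g \<in> L1 \<Omega>" and gv: "(\<lambda>y. g y + v y) \<in> L1 \<Omega>" and x: "x \<in> \<Omega>" and v: "isCont v x"
    and T: "approx_jump (\<lambda>y. g y + v y) x (a, b, \<nu>)"
  shows "approx_jump g x (a - v x, b - v x, \<nu>)"
proof -
  have "approx_jump (\<lambda>y. (g y + v y) + - v y) x (a + - v x, b + - v x, \<nu>)"
    by (rule approx_jump_add_cont[OF \<Omega> gv _ x _ T, of "\<lambda>y. - v y"]) (use g v in \<open>auto intro: isCont_minus\<close>)
  then show ?thesis by simp
qed

text \<open>At a point where \<open>g\<close> has a full mean limit, both half-ball limits of the
  sum are those of \<open>v\<close> shifted by \<open>a\<close>. If they agree, every half ball
  overlaps one of the two given ones suitably, so any candidate triple would have equal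
  limits.\<close>

lemma approx_jump_add_side_limits:
  fixes g v :: "'a::euclidean_space \<Rightarrow> 'b::euclidean_space"
  assumes \<Omega>: "open \<Omega>" and g: "g \<in> L1 \<Omega>" and gv: "(\<lambda>y. g y + v y) \<in> L1 \<Omega>" and x: "x \<in> \<Omega>"
    and a: "mean_limit g a (ball x)" and v: "side_limit v x e p" "side_limit v x (- e) q" and e: "norm e = 1"
  shows "p \<noteq> q \<Longrightarrow> approx_jump (\<lambda>y. g y + v y) x (a + p, a + q, e)"
    "p = q \<Longrightarrow> \<not> approx_jump (\<lambda>y. g y + v y) x T"
proof -
  have h: "mean_limit g a (\<lambda>r. half_ball x r \<nu>)" for \<nu>
    by (rule mean_limit_subset[OF a half_ball_subset])
  have l1: "mean_limit (\<lambda>y. g y + v y) (a + p) (\<lambda>r. half_ball x r e)"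
    and l2: "mean_limit (\<lambda>y. g y + v y) (a + q) (\<lambda>r. half_ball x r (- e))"
    using mean_limit_half_add[OF \<Omega> g x h v(1)] mean_limit_half_add[OF \<Omega> g x h v(2)] by auto
  then show "p \<noteq> q \<Longrightarrow> approx_jump (\<lambda>y. g y + v y) x (a + p, a + q, e)"
    using e by (simp add: approx_jump_iff[OF \<Omega> gv x])
  assume pq: "p = q"
  show "\<not> approx_jump (\<lambda>y. g y + v y) x T"
  proof
    assume "approx_jump (\<lambda>y. g y + v y) x T"
    moreover obtain a' b' \<nu> where "T = (a', b', \<nu>)" by (metis prod_cases3)
    ultimately have J: "a' \<noteq> b'" "norm \<nu> = 1" "mean_limit (\<lambda>y. g y + v y) a' (\<lambda>r. half_ball x r \<nu>)"
      "mean_limit (\<lambda>y. g y + v y) b' (\<lambda>r. half_ball x r (- \<nu>))" by (auto simp: approx_jump_iff[OF \<Omega> gv x])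
    have *: "c = a + p" if "mean_limit (\<lambda>y. g y + v y) c (\<lambda>r. half_ball x r \<mu>)" "norm \<mu> = 1" for c \<mu>
    proof (cases "e = - \<mu>")
      case True
      then have "- e \<noteq> - \<mu>" using unit_neq_minus[OF that(2)] by simp
      then show ?thesis using mean_limit_unique[OF \<Omega> gv x that(1) l2 that(2)] e pq by auto
    next
      case False
      then show ?thesis using mean_limit_unique[OF \<Omega> gv x that(1) l1 that(2) e] by auto
    qed
    show False using *[OF J(3,2)] *[OF J(4)] J(1,2) by auto
  qed
qed

section \<open>Piecewise affine functions on a dyadic level\<close>

text \<open>All dyadic levels at once, so that a single countable family of hyperplanes serves every
  term of the series.\<close>

definition grid :: "real^'n \<Rightarrow> 'n \<Rightarrow> real set" where
  "grid o' i = range (\<lambda>(z::int, L::nat). o' $ i + of_int z / 2 ^ L)"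

lemma countable_grid: "countable (grid o' i)"
  unfolding grid_def by (intro countable_image countableI_type)

lemma grid_iff: "x $ i \<in> grid o' i \<longleftrightarrow> (\<exists>L::nat. \<exists>z::int. 2 ^ L * (x $ i - o' $ i) = of_int z)"
proof -
  have "x $ i = o' $ i + of_int z / 2 ^ L \<longleftrightarrow> 2 ^ L * (x $ i - o' $ i) = of_int z" for z :: int and L :: nat
    by (auto simp: field_simps)
  then show ?thesis unfolding grid_def by (auto simp: image_iff)
qed

lemma corner_in_grid: "cell_corner o' L z $ i \<in> grid o' i" "cell_corner o' L z $ i + 1 / 2 ^ L \<in> grid o' i"
proof -
  show "cell_corner o' L z $ i \<in> grid o' i"
    unfolding grid_def cell_corner_def by (auto intro!: image_eqI[of _ _ "(z $ i, L)"])
  show "cell_corner o' L z $ i + 1 / 2 ^ L \<in> grid o' i"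
    unfolding grid_def cell_corner_def by (auto intro!: image_eqI[of _ _ "(z $ i + 1, L)"] simp: add_divide_distrib)
qed

definition level_fn :: "real^'n \<Rightarrow> nat \<Rightarrow> (int^'n \<Rightarrow> real) \<Rightarrow> 'n \<Rightarrow> real^'n \<Rightarrow> real" where
  "level_fn o' L h j x = h (cell_index o' L x) * (x $ j - cell_corner o' L (cell_index o' L x) $ j)"

definition level_jump :: "real^'n \<Rightarrow> nat \<Rightarrow> (int^'n \<Rightarrow> real) \<Rightarrow> 'n \<Rightarrow> 'n \<Rightarrow> real^'n \<Rightarrow> real" where
  "level_jump o' L h j m x = (\<Sum>z | h z \<noteq> 0. h z * ramp_jump (cell_corner o' L z) (1 / 2 ^ L) j m x)"

lemma level_fn_bound: "\<bar>h (cell_index o' L x)\<bar> \<le> K \<Longrightarrow> \<bar>level_fn o' L h j x\<bar> \<le> K / 2 ^ L"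
proof -
  assume h: "\<bar>h (cell_index o' L x)\<bar> \<le> K"
  have "\<bar>x $ j - cell_corner o' L (cell_index o' L x) $ j\<bar> \<le> 1 / 2 ^ L"
    using cell_index_iff[of o' L x "cell_index o' L x"] by (smt (verit))
  then have "\<bar>level_fn o' L h j x\<bar> \<le> K * (1 / 2 ^ L)"
    unfolding level_fn_def abs_mult using h by (intro mult_mono) auto
  then show ?thesis by simp
qed

lemma level_fn_sum:
  assumes fin: "finite {z. h z \<noteq> 0}"
  shows "level_fn o' L h j x = (\<Sum>z | h z \<noteq> 0. h z * (indicator (cell o' L z) x * (x $ j - cell_corner o' L z $ j)))"
proof -
  have "(\<Sum>z | h z \<noteq> 0. h z * (indicator (cell o' L z) x * (x $ j - cell_corner o' L z $ j))) =
    (\<Sum>z | h z \<noteq> 0. if z = cell_index o' L x then h z * (x $ j - cell_corner o' L z $ j) else 0)"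
    by (intro sum.cong) (auto simp: cell_def indicator_def)
  also have "\<dots> = level_fn o' L h j x" using fin by (simp add: sum.delta level_fn_def)
  finally show ?thesis by simp
qed

lemma level_fn_measurable:
  assumes "finite {z. h z \<noteq> 0}" shows "level_fn o' L h j \<in> borel_measurable borel"
proof -
  have "level_fn o' L h j = (\<lambda>x. \<Sum>z | h z \<noteq> 0. h z * (indicator (cell o' L z) x * (x $ j - cell_corner o' L z $ j)))"
    using level_fn_sum[OF assms] by (intro ext)
  also have "\<dots> \<in> borel_measurable borel" by measurable
  finally show ?thesis .
qed

lemma level_jump_measurable [measurable]: "level_jump o' L h j m \<in> borel_measurable borel"
  unfolding level_jump_def[abs_def] by measurable

lemma level_fn_local:
  fixes x :: "real^'n"
  assumes "\<And>y. y \<in> D \<Longrightarrow> cell_index o' L y = z"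
  shows "y \<in> D \<Longrightarrow> \<bar>level_fn o' L h j y - h z * (x $ j - cell_corner o' L z $ j)\<bar> \<le> \<bar>h z\<bar> * dist x y"
proof -
  assume "y \<in> D"
  then have "level_fn o' L h j y - h z * (x $ j - cell_corner o' L z $ j) = h z * (y $ j - x $ j)"
    using assms by (simp add: level_fn_def algebra_simps)
  moreover have "\<bar>y $ j - x $ j\<bar> \<le> dist x y"
    using component_le_norm_cart[of "y - x" j] by (simp add: dist_norm norm_minus_commute)
  ultimately show ?thesis by (simp add: abs_mult mult_left_mono)
qed

lemma level_fn_isCont:
  fixes x :: "real^'n"
  assumes x: "\<And>i. x $ i \<notin> grid o' i" shows "isCont (level_fn o' L h j) x"
proof -
  obtain \<delta> where \<delta>: "\<delta> > 0" "\<And>y. dist x y < \<delta> \<Longrightarrow> cell_index o' L y = cell_index o' L x"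
    using cell_index_locally_constant[of L x o'] x unfolding grid_iff by blast
  let ?z = "cell_index o' L x"
  have *: "\<bar>level_fn o' L h j y - level_fn o' L h j x\<bar> \<le> \<bar>h ?z\<bar> * dist x y" if "dist x y < \<delta>" for y
    using level_fn_local[of "ball x \<delta>" o' L ?z y h j x] \<delta>(2) that by (simp add: level_fn_def)
  show ?thesis unfolding continuous_at_eps_delta
  proof (intro allI impI)
    fix e :: real assume e: "e > 0"
    show "\<exists>d>0. \<forall>y. dist y x < d \<longrightarrow> dist (level_fn o' L h j y) (level_fn o' L h j x) < e"
    proof (intro exI[of _ "min \<delta> (e / (\<bar>h ?z\<bar> + 1))"] conjI allI impI)
      show "0 < min \<delta> (e / (\<bar>h ?z\<bar> + 1))" 
      proof -
        have "\<bar>h ?z\<bar> + 1 > 0" by linarith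
        then show ?thesis using \<delta>(1) e by simp
      qed
      fix y assume y: "dist y x < min \<delta> (e / (\<bar>h ?z\<bar> + 1))"
      then have "dist (level_fn o' L h j y) (level_fn o' L h j x) \<le> \<bar>h ?z\<bar> * dist x y"
        using *[of y] by (simp add: dist_real_def dist_commute)
      also have "\<dots> \<le> (\<bar>h ?z\<bar> + 1) * dist x y" by (intro mult_right_mono) auto
      also have "\<dots> < (\<bar>h ?z\<bar> + 1) * (e / (\<bar>h ?z\<bar> + 1))"
        using y by (intro mult_strict_left_mono) (auto simp: dist_commute)
      also have "\<dots> = e" by (simp add: add_nonneg_eq_0_iff)
      finally show "dist (level_fn o' L h j y) (level_fn o' L h j x) < e" .
    qed
  qed
qed

lemma level_fn_side_limit:
  fixes x :: "real^'n"
  assumes \<delta>: "\<delta> > 0" "\<And>y. y \<in> half_ball x \<delta> \<nu> \<Longrightarrow> cell_index o' L y = z"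
  shows "side_limit (level_fn o' L h j) x \<nu> (h z * (x $ j - cell_corner o' L z $ j))"
  unfolding side_limit_def
proof (intro allI impI)
  fix e :: real assume e: "e > 0"
  show "\<exists>\<delta>>0. \<forall>y\<in>half_ball x \<delta> \<nu>. norm (level_fn o' L h j y - h z * (x $ j - cell_corner o' L z $ j)) \<le> e"
  proof (intro exI[of _ "min \<delta> (e / (\<bar>h z\<bar> + 1))"] conjI ballI)
    show "0 < min \<delta> (e / (\<bar>h z\<bar> + 1))" 
      proof -
        have "\<bar>h z\<bar> + 1 > 0" by linarith
        then show ?thesis using \<delta>(1) e by simp
      qed
    fix y assume y: "y \<in> half_ball x (min \<delta> (e / (\<bar>h z\<bar> + 1))) \<nu>"
    then have y': "y \<in> half_ball x \<delta> \<nu>" "dist x y < e / (\<bar>h z\<bar> + 1)" by (auto simp: half_ball_def)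
    have "norm (level_fn o' L h j y - h z * (x $ j - cell_corner o' L z $ j)) \<le> \<bar>h z\<bar> * dist x y"
      using level_fn_local[OF \<delta>(2) y'(1), of h j x] by simp
    also have "\<dots> \<le> (\<bar>h z\<bar> + 1) * dist x y" by (intro mult_right_mono) auto
    also have "\<dots> \<le> (\<bar>h z\<bar> + 1) * (e / (\<bar>h z\<bar> + 1))" using y'(2) by (intro mult_left_mono) auto
    also have "\<dots> = e" by (simp add: add_nonneg_eq_0_iff)
    finally show "norm (level_fn o' L h j y - h z * (x $ j - cell_corner o' L z $ j)) \<le> e" .
  qed
qed

lemma floor_right: "\<exists>\<delta>>0. \<forall>s. t \<le> s \<and> s < t + \<delta> \<longrightarrow> \<lfloor>s\<rfloor> = \<lfloor>t::real\<rfloor>"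
  by (intro exI[of _ "of_int \<lfloor>t\<rfloor> + 1 - t"]) (auto simp: floor_eq_iff, linarith+)

lemma floor_left: "\<exists>\<delta>>0. \<forall>s. t - \<delta> < s \<and> s < t \<longrightarrow> \<lfloor>s\<rfloor> = \<lceil>t::real\<rceil> - 1"
  by (intro exI[of _ "t - (of_int \<lceil>t\<rceil> - 1)"]) (auto simp: floor_eq_iff, linarith+)

lemma floor_nonint: "(\<And>z. t \<noteq> of_int z) \<Longrightarrow> \<lceil>t::real\<rceil> - 1 = \<lfloor>t\<rfloor>"
  by (metis add_diff_cancel_right' ceiling_altdef)

text \<open>The cell entered from \<open>x\<close> in the direction \<open>- e\<^sub>m\<close>.\<close>

definition left_index :: "real^'n \<Rightarrow> nat \<Rightarrow> 'n \<Rightarrow> real^'n \<Rightarrow> int^'n" where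
  "left_index o' L m x = (\<chi> i. if i = m then \<lceil>2 ^ L * (x $ m - o' $ m)\<rceil> - 1 else \<lfloor>2 ^ L * (x $ i - o' $ i)\<rfloor>)"

lemma half_ball_axis:
  fixes x :: "real^'n"
  shows "half_ball x r (axis m 1) = {y \<in> ball x r. x $ m < y $ m}"
  "half_ball x r (- axis m 1) = {y \<in> ball x r. y $ m < x $ m}"
  by (auto simp: half_ball_def inner_axis)

text \<open>Immediately to the left of t the floor is the ceiling of t minus 1. In the coordinates
  other than m the point is off the grid, where both one-sided values equal the floor.\<close>

lemma one_sided_cells:
  fixes x :: "real^'n"
  assumes x: "\<And>i. i \<noteq> m \<Longrightarrow> x $ i \<notin> grid o' i"
  shows "\<exists>\<delta>>0. (\<forall>y\<in>half_ball x \<delta> (axis m 1). cell_index o' L y = cell_index o' L x) \<and>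
     (\<forall>y\<in>half_ball x \<delta> (- axis m 1). cell_index o' L y = left_index o' L m x)"
proof -
  define t where "t i = 2 ^ L * (x $ i - o' $ i)" for i
  have "\<exists>\<delta>>0. (\<forall>s. t i \<le> s \<and> s < t i + \<delta> \<longrightarrow> \<lfloor>s\<rfloor> = \<lfloor>t i\<rfloor>) \<and> (\<forall>s. t i - \<delta> < s \<and> s < t i \<longrightarrow> \<lfloor>s\<rfloor> = \<lceil>t i\<rceil> - 1)" for i
  proof -
    obtain \<delta>1 where 1: "\<delta>1 > 0" "\<forall>s. t i \<le> s \<and> s < t i + \<delta>1 \<longrightarrow> \<lfloor>s\<rfloor> = \<lfloor>t i\<rfloor>" using floor_right by blast
    obtain \<delta>2 where 2: "\<delta>2 > 0" "\<forall>s. t i - \<delta>2 < s \<and> s < t i \<longrightarrow> \<lfloor>s\<rfloor> = \<lceil>t i\<rceil> - 1" using floor_left by blast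
    have "\<lfloor>s\<rfloor> = \<lfloor>t i\<rfloor>" if "t i \<le> s \<and> s < t i + min \<delta>1 \<delta>2" for s
      by (rule 1(2)[rule_format]) (use that in auto)
    moreover have "\<lfloor>s\<rfloor> = \<lceil>t i\<rceil> - 1" if "t i - min \<delta>1 \<delta>2 < s \<and> s < t i" for s
      by (rule 2(2)[rule_format]) (use that in auto)
    moreover have "min \<delta>1 \<delta>2 > 0" using 1(1) 2(1) by simp
    ultimately show ?thesis by blast
  qed
  then have "\<forall>i. \<exists>\<delta>>0. (\<forall>s. t i \<le> s \<and> s < t i + \<delta> \<longrightarrow> \<lfloor>s\<rfloor> = \<lfloor>t i\<rfloor>) \<and> (\<forall>s. t i - \<delta> < s \<and> s < t i \<longrightarrow> \<lfloor>s\<rfloor> = \<lceil>t i\<rceil> - 1)" by (rule allI)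
  then obtain d where d0: "\<forall>i. d i > 0 \<and> (\<forall>s. t i \<le> s \<and> s < t i + d i \<longrightarrow> \<lfloor>s\<rfloor> = \<lfloor>t i\<rfloor>) \<and> (\<forall>s. t i - d i < s \<and> s < t i \<longrightarrow> \<lfloor>s\<rfloor> = \<lceil>t i\<rceil> - 1)"
    using choice[of "\<lambda>i \<delta>. \<delta> > 0 \<and> (\<forall>s. t i \<le> s \<and> s < t i + \<delta> \<longrightarrow> \<lfloor>s\<rfloor> = \<lfloor>t i\<rfloor>) \<and> (\<forall>s. t i - \<delta> < s \<and> s < t i \<longrightarrow> \<lfloor>s\<rfloor> = \<lceil>t i\<rceil> - 1)"] by blast
  have d: "d i > 0" "t i \<le> s \<and> s < t i + d i \<Longrightarrow> \<lfloor>s\<rfloor> = \<lfloor>t i\<rfloor>"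
    "t i - d i < s \<and> s < t i \<Longrightarrow> \<lfloor>s\<rfloor> = \<lceil>t i\<rceil> - 1" for i s using d0 by blast+
  \<comment> \<open>The indices are floors of coordinates stretched by 2^L, so distances are scaled
    back by that factor.\<close>
  define \<delta> where "\<delta> = Min (range d) / 2 ^ L"
  have \<delta>: "\<delta> > 0" using d(1) by (simp add: \<delta>_def)
  have near: "\<bar>2 ^ L * (y $ i - o' $ i) - t i\<bar> < d i" if "y \<in> ball x \<delta>" for y i
  proof -
    have "\<bar>y $ i - x $ i\<bar> \<le> dist x y"
      using component_le_norm_cart[of "y - x" i] by (simp add: dist_norm norm_minus_commute)
    also have "\<dots> < \<delta>" using that by simp
    also have "\<delta> \<le> d i / 2 ^ L" unfolding \<delta>_def by (intro divide_right_mono Min_le) auto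
    finally have "2 ^ L * \<bar>y $ i - x $ i\<bar> < d i" by (simp add: field_simps)
    moreover have "2 ^ L * (y $ i - o' $ i) - t i = 2 ^ L * (y $ i - x $ i)" by (simp add: t_def algebra_simps)
    ultimately show ?thesis by (simp add: abs_mult)
  qed
  have other: "\<lfloor>2 ^ L * (y $ i - o' $ i)\<rfloor> = \<lfloor>t i\<rfloor>" if "y \<in> ball x \<delta>" "i \<noteq> m" for y i
  proof -
    have "\<lceil>t i\<rceil> - 1 = \<lfloor>t i\<rfloor>" using x[OF that(2)] unfolding grid_iff t_def by (intro floor_nonint) blast
    then show ?thesis using near[OF that(1), of i] d(2,3)[of i "2 ^ L * (y $ i - o' $ i)"] by linarith
  qed
  show ?thesis
  proof (intro exI[of _ \<delta>] conjI ballI \<delta>)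
    fix y assume "y \<in> half_ball x \<delta> (axis m 1)"
    then have y: "y \<in> ball x \<delta>" "x $ m < y $ m" by (auto simp: half_ball_axis)
    have "t m \<le> 2 ^ L * (y $ m - o' $ m)" using y(2) by (simp add: t_def)
    then have "\<lfloor>2 ^ L * (y $ m - o' $ m)\<rfloor> = \<lfloor>t m\<rfloor>" using near[OF y(1), of m] by (intro d(2)) linarith
    then show "cell_index o' L y = cell_index o' L x"
      using other[OF y(1)] unfolding cell_index_def vec_eq_iff t_def by (metis vec_lambda_beta)
  next
    fix y assume "y \<in> half_ball x \<delta> (- axis m 1)"
    then have y: "y \<in> ball x \<delta>" "y $ m < x $ m" by (auto simp: half_ball_axis)
    have "2 ^ L * (y $ m - o' $ m) < t m" using y(2) by (simp add: t_def)
    then have "\<lfloor>2 ^ L * (y $ m - o' $ m)\<rfloor> = \<lceil>t m\<rceil> - 1" using near[OF y(1), of m] by (intro d(3)) linarith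
    then show "cell_index o' L y = left_index o' L m x"
      using other[OF y(1)] unfolding cell_index_def left_index_def vec_eq_iff t_def by simp
  qed
qed

text \<open>Off the hyperplanes of the other directions, \<open>x\<close> lies on the lower face of
  a closed cube exactly for the cell on its right and on the upper face exactly for the cell on its
  left. Between the hyperplanes of level L both indices coincide, and the difference is 0.\<close>

lemma ramp_jump_cells:
  fixes x :: "real^'n"
  assumes x: "\<And>i. i \<noteq> m \<Longrightarrow> x $ i \<notin> grid o' i"
  shows "ramp_jump (cell_corner o' L z) (1 / 2 ^ L) j m x =
     (of_bool (z = cell_index o' L x) - of_bool (z = left_index o' L m x)) * (x $ j - cell_corner o' L z $ j)"
proof -
  define t where "t i = 2 ^ L * (x $ i - o' $ i)" for i
  have c1: "cell_corner o' L z $ i \<le> x $ i \<longleftrightarrow> of_int (z $ i) \<le> t i" for i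
    by (simp add: cell_corner_def t_def field_simps)
  have c2: "x $ i \<le> cell_corner o' L z $ i + 1 / 2 ^ L \<longleftrightarrow> t i \<le> of_int (z $ i) + 1" for i
    by (simp add: cell_corner_def t_def field_simps)
  have c3: "x $ m = cell_corner o' L z $ m \<longleftrightarrow> t m = of_int (z $ m)"
    by (auto simp: cell_corner_def t_def field_simps)
  have c4: "x $ m = cell_corner o' L z $ m + 1 / 2 ^ L \<longleftrightarrow> t m = of_int (z $ m) + 1"
    by (auto simp: cell_corner_def t_def field_simps)
  have ni: "t i \<noteq> of_int k" if "i \<noteq> m" for i k using x[OF that] unfolding grid_iff t_def by blast
  have mid: "of_int (z $ i) \<le> t i \<and> t i \<le> of_int (z $ i) + 1 \<longleftrightarrow> z $ i = \<lfloor>t i\<rfloor>" if "i \<noteq> m" for i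
    using ni[OF that, of "z $ i + 1"] by (auto simp: eq_commute[of "z $ i"] floor_eq_iff)
  have cube: "x \<in> cube (cell_corner o' L z) (1 / 2 ^ L) \<longleftrightarrow> (\<forall>i. of_int (z $ i) \<le> t i \<and> t i \<le> of_int (z $ i) + 1)"
    by (simp add: cube_def c1 c2)
  have sp: "(\<forall>i. P i) \<longleftrightarrow> P m \<and> (\<forall>i. i \<noteq> m \<longrightarrow> P i)" for P by metis
  have cp: "z = cell_index o' L x \<longleftrightarrow> z $ m = \<lfloor>t m\<rfloor> \<and> (\<forall>i. i \<noteq> m \<longrightarrow> z $ i = \<lfloor>t i\<rfloor>)"
    unfolding vec_eq_iff by (subst sp) (simp add: cell_index_def t_def)
  have cm: "z = left_index o' L m x \<longleftrightarrow> z $ m = \<lceil>t m\<rceil> - 1 \<and> (\<forall>i. i \<noteq> m \<longrightarrow> z $ i = \<lfloor>t i\<rfloor>)"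
    unfolding vec_eq_iff by (subst sp) (simp add: left_index_def t_def)
  have cub: "x \<in> cube (cell_corner o' L z) (1 / 2 ^ L) \<longleftrightarrow>
     (of_int (z $ m) \<le> t m \<and> t m \<le> of_int (z $ m) + 1) \<and> (\<forall>i. i \<noteq> m \<longrightarrow> z $ i = \<lfloor>t i\<rfloor>)"
    unfolding cube by (subst sp) (simp add: mid)
  show ?thesis
  proof (cases "\<exists>k. t m = of_int k")
    case True
    then obtain k where k: "t m = of_int k" by blast
    have a: "x \<in> cube (cell_corner o' L z) (1 / 2 ^ L) \<and> x $ m = cell_corner o' L z $ m \<longleftrightarrow> z = cell_index o' L x"
      unfolding cub c3 cp using k by auto
    have b: "x \<in> cube (cell_corner o' L z) (1 / 2 ^ L) \<and> x $ m = cell_corner o' L z $ m + 1 / 2 ^ L \<longleftrightarrow> z = left_index o' L m x"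
      unfolding cub c4 cm using k by auto
    have "ramp_jump (cell_corner o' L z) (1 / 2 ^ L) j m x =
      (of_bool (x \<in> cube (cell_corner o' L z) (1 / 2 ^ L) \<and> x $ m = cell_corner o' L z $ m) -
       of_bool (x \<in> cube (cell_corner o' L z) (1 / 2 ^ L) \<and> x $ m = cell_corner o' L z $ m + 1 / 2 ^ L)) * (x $ j - cell_corner o' L z $ j)"
      by (simp add: ramp_jump_def ramp_def indicator_def)
    then show ?thesis unfolding a b .
  next
    case False
    then have "\<lceil>t m\<rceil> - 1 = \<lfloor>t m\<rfloor>" by (intro floor_nonint) blast
    then have "z = cell_index o' L x \<longleftrightarrow> z = left_index o' L m x" unfolding cp cm by simp
    moreover have "t m \<noteq> of_int (z $ m)" "t m \<noteq> of_int (z $ m) + 1" using False by (metis, metis of_int_1 of_int_add)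
    ultimately show ?thesis by (simp add: ramp_jump_def c3 c4)
  qed
qed

text \<open>Half-open cells contain their lower faces, so the value at \<open>x\<close> is the limit
  from the right, and subtracting the jump gives the limit from the left.\<close>

lemma level_side_limits:
  fixes x :: "real^'n"
  assumes fin: "finite {z. h z \<noteq> 0}" and x: "\<And>i. i \<noteq> m \<Longrightarrow> x $ i \<notin> grid o' i"
  shows "side_limit (level_fn o' L h j) x (axis m 1) (level_fn o' L h j x)"
    "side_limit (level_fn o' L h j) x (- axis m 1) (level_fn o' L h j x - level_jump o' L h j m x)"
proof -
  obtain \<delta> where \<delta>: "\<delta> > 0" "\<And>y. y \<in> half_ball x \<delta> (axis m 1) \<Longrightarrow> cell_index o' L y = cell_index o' L x"
    "\<And>y. y \<in> half_ball x \<delta> (- axis m 1) \<Longrightarrow> cell_index o' L y = left_index o' L m x"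
    using one_sided_cells[OF x, where L=L] by blast
  show "side_limit (level_fn o' L h j) x (axis m 1) (level_fn o' L h j x)"
    using level_fn_side_limit[OF \<delta>(1,2), where h=h and j=j] by (simp add: level_fn_def)
  let ?zl = "left_index o' L m x" and ?zr = "cell_index o' L x"
  have "level_jump o' L h j m x = (\<Sum>z | h z \<noteq> 0. (if z = ?zr then h z * (x $ j - cell_corner o' L z $ j) else 0) -
      (if z = ?zl then h z * (x $ j - cell_corner o' L z $ j) else 0))"
    unfolding level_jump_def by (intro sum.cong refl) (simp add: ramp_jump_cells[OF x] algebra_simps)
  also have "\<dots> = h ?zr * (x $ j - cell_corner o' L ?zr $ j) - h ?zl * (x $ j - cell_corner o' L ?zl $ j)"
    using fin by (simp add: sum_subtractf sum.delta)
  finally have "level_fn o' L h j x - level_jump o' L h j m x = h ?zl * (x $ j - cell_corner o' L ?zl $ j)"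
    by (simp add: level_fn_def)
  then show "side_limit (level_fn o' L h j) x (- axis m 1) (level_fn o' L h j x - level_jump o' L h j m x)"
    using level_fn_side_limit[OF \<delta>(1,3), where h=h and j=j] by simp
qed

text \<open>Sums the bound for one cube: cell volumes weighted by the moduli of the slopes add up to
  the L^1 norm of the step function, and the factor 2 counts the two faces.\<close>

lemma level_jump_integrable:
  fixes o' :: "real^'n"
  assumes fin: "finite {z. h z \<noteq> 0}" and C: "countable C"
  shows "integrable (slices m C) (level_jump o' L h j m)"
    "(LINT x|slices m C. \<bar>level_jump o' L h j m x\<bar>) \<le> 2 * (LINT x|lborel. \<bar>step o' L h x\<bar>)"
proof -
  note rj = integrable_ramp_jump[where h="1/2^L" and C=C and m=m and j=j, OF _ C]
  show "integrable (slices m C) (level_jump o' L h j m)"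
    unfolding level_jump_def[abs_def] using rj(1) by (intro Bochner_Integration.integrable_sum integrable_mult_right) auto
  then have "(LINT x|slices m C. \<bar>level_jump o' L h j m x\<bar>) \<le>
     (LINT x|slices m C. (\<Sum>z | h z \<noteq> 0. \<bar>h z\<bar> * \<bar>ramp_jump (cell_corner o' L z) (1 / 2 ^ L) j m x\<bar>))"
    using rj(1) unfolding level_jump_def
    by (intro integral_mono Bochner_Integration.integrable_sum integrable_mult_right integrable_abs)
      (auto simp: abs_mult[symmetric] intro!: sum_abs)
  also have "\<dots> = (\<Sum>z | h z \<noteq> 0. \<bar>h z\<bar> * (LINT x|slices m C. \<bar>ramp_jump (cell_corner o' L z) (1 / 2 ^ L) j m x\<bar>))"
    using rj(1) by (subst Bochner_Integration.integral_sum) auto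
  also have "\<dots> \<le> (\<Sum>z | h z \<noteq> 0. \<bar>h z\<bar> * (2 * (1 / 2 ^ L) ^ CARD('n)))"
    using rj(2) by (intro sum_mono mult_left_mono) auto
  also have "\<dots> = 2 * (LINT x|lborel. \<bar>step o' L h x\<bar>)"
    unfolding integral_abs_step[OF fin] sum_distrib_left by (intro sum.cong) auto
  finally show "(LINT x|slices m C. \<bar>level_jump o' L h j m x\<bar>) \<le> 2 * (LINT x|lborel. \<bar>step o' L h x\<bar>)" .
qed

text \<open>The count of \<open>nn_integral_ramp_jump\<close>, with the area of a face replaced by
  the bound of \<open>hausdorff_outer_face\<close>.\<close>

lemma nn_integral_ramp_jump_hausdorff:
  fixes l :: "real^'n"
  assumes s: "s > 0"
  shows "(\<integral>\<^sup>+x. ennreal \<bar>ramp_jump l s j m x\<bar> \<partial>hausdorff_measure (CARD('n) - 1)) \<le> ennreal (2 * hausdorff_const (CARD('n) - 1) * s ^ CARD('n))"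
proof -
  let ?H = "hausdorff_measure (CARD('n) - 1) :: (real^'n) measure"
  let ?F = "\<lambda>c. {x \<in> cube l s. x $ m = c}"
  have Fb: "?F c \<in> sets borel" for c
  proof -
    have "{x::real^'n. x $ m = c} \<in> sets borel" by measurable
    moreover have "?F c = cube l s \<inter> {x. x $ m = c}" by auto
    ultimately show ?thesis by auto
  qed
  have "(\<integral>\<^sup>+x. ennreal \<bar>ramp_jump l s j m x\<bar> \<partial>?H) \<le>
    (\<integral>\<^sup>+x. ennreal s * indicator (?F (l $ m)) x + ennreal s * indicator (?F (l $ m + s)) x \<partial>?H)"
  proof (intro nn_integral_mono)
    fix x
    show "ennreal \<bar>ramp_jump l s j m x\<bar> \<le> ennreal s * indicator (?F (l $ m)) x + ennreal s * indicator (?F (l $ m + s)) x"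
    proof (cases "x \<in> cube l s")
      case True
      have "0 \<le> ramp l s j x" "ramp l s j x \<le> s" using ramp_bounds[of s l j x] s by auto
      then show ?thesis using True s by (auto simp: ramp_jump_def indicator_def intro!: ennreal_leI)
    qed (simp add: ramp_jump_def ramp_def)
  qed
  also have "\<dots> = ennreal s * emeasure ?H (?F (l $ m)) + ennreal s * emeasure ?H (?F (l $ m + s))"
  proof -
    have Fh: "?F c \<in> sets ?H" for c using Fb by simp
    then have "(\<lambda>x. ennreal s * indicator (?F c) x) \<in> borel_measurable ?H" for c
      by (intro borel_measurable_times_ennreal borel_measurable_const borel_measurable_indicator)
    then show ?thesis using Fh by (subst nn_integral_add) (simp_all add: nn_integral_cmult_indicator del: sets_hausdorff)
  qed
  also have "\<dots> \<le> ennreal s * ennreal (hausdorff_const (CARD('n) - 1) * s ^ (CARD('n) - 1)) +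
      ennreal s * ennreal (hausdorff_const (CARD('n) - 1) * s ^ (CARD('n) - 1))"
  proof -
    have "emeasure ?H (?F c) \<le> ennreal (hausdorff_const (CARD('n) - 1) * s ^ (CARD('n) - 1))" for c
      by (rule order_trans[OF emeasure_hausdorff_le hausdorff_outer_face[OF s]])
    then show ?thesis by (intro add_mono mult_left_mono) auto
  qed
  also have "\<dots> = ennreal (2 * (s * (hausdorff_const (CARD('n) - 1) * s ^ (CARD('n) - 1))))"
  proof -
    let ?X = "hausdorff_const (CARD('n) - 1) * s ^ (CARD('n) - 1)"
    have X: "?X \<ge> 0" using s hausdorff_const_nonneg by (intro mult_nonneg_nonneg) auto
    then have "ennreal s * ennreal ?X = ennreal (s * ?X)" using s by (intro ennreal_mult[symmetric]) auto
    then show ?thesis using X s by (simp add: ennreal_plus[symmetric] del: ennreal_plus)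
  qed
  also have "2 * (s * (hausdorff_const (CARD('n) - 1) * s ^ (CARD('n) - 1))) = 2 * hausdorff_const (CARD('n) - 1) * s ^ CARD('n)"
    using power_minus_mult[of "CARD('n)" s] by (simp add: mult_ac)
  finally show ?thesis .
qed

lemma level_jump_hausdorff:
  fixes o' :: "real^'n"
  assumes fin: "finite {z. h z \<noteq> 0}"
  shows "(\<integral>\<^sup>+x. ennreal \<bar>level_jump o' L h j m x\<bar> \<partial>hausdorff_measure (CARD('n) - 1)) \<le>
     ennreal (2 * hausdorff_const (CARD('n) - 1) * (LINT x|lborel. \<bar>step o' L h x\<bar>))"
proof -
  let ?H = "hausdorff_measure (CARD('n) - 1) :: (real^'n) measure"
  let ?c = "hausdorff_const (CARD('n) - 1)"
  have m: "ramp_jump l s j m \<in> borel_measurable ?H" for l s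
    using ramp_jump_measurable[of l s j m] by (simp cong: measurable_cong_sets)
  have "(\<integral>\<^sup>+x. ennreal \<bar>level_jump o' L h j m x\<bar> \<partial>?H) \<le>
     (\<integral>\<^sup>+x. (\<Sum>z | h z \<noteq> 0. ennreal \<bar>h z\<bar> * ennreal \<bar>ramp_jump (cell_corner o' L z) (1 / 2 ^ L) j m x\<bar>) \<partial>?H)"
  proof (intro nn_integral_mono)
    fix x
    have "\<bar>level_jump o' L h j m x\<bar> \<le> (\<Sum>z | h z \<noteq> 0. \<bar>h z\<bar> * \<bar>ramp_jump (cell_corner o' L z) (1 / 2 ^ L) j m x\<bar>)"
      unfolding level_jump_def abs_mult[symmetric] by (rule sum_abs)
    then have "ennreal \<bar>level_jump o' L h j m x\<bar> \<le> ennreal (\<Sum>z | h z \<noteq> 0. \<bar>h z\<bar> * \<bar>ramp_jump (cell_corner o' L z) (1 / 2 ^ L) j m x\<bar>)"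
      by (rule ennreal_leI)
    also have "\<dots> = (\<Sum>z | h z \<noteq> 0. ennreal \<bar>h z\<bar> * ennreal \<bar>ramp_jump (cell_corner o' L z) (1 / 2 ^ L) j m x\<bar>)"
      by (subst sum_ennreal[symmetric]) (auto simp: ennreal_mult)
    finally show "ennreal \<bar>level_jump o' L h j m x\<bar> \<le> (\<Sum>z | h z \<noteq> 0. ennreal \<bar>h z\<bar> * ennreal \<bar>ramp_jump (cell_corner o' L z) (1 / 2 ^ L) j m x\<bar>)" .
  qed
  also have "\<dots> = (\<Sum>z | h z \<noteq> 0. ennreal \<bar>h z\<bar> * (\<integral>\<^sup>+x. ennreal \<bar>ramp_jump (cell_corner o' L z) (1 / 2 ^ L) j m x\<bar> \<partial>?H))"
    using m by (subst nn_integral_sum) (auto simp: nn_integral_cmult)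
  also have "\<dots> \<le> (\<Sum>z | h z \<noteq> 0. ennreal \<bar>h z\<bar> * ennreal (2 * ?c * (1 / 2 ^ L) ^ CARD('n)))"
    by (intro sum_mono mult_left_mono nn_integral_ramp_jump_hausdorff) auto
  also have "\<dots> = (\<Sum>z | h z \<noteq> 0. ennreal (\<bar>h z\<bar> * (2 * ?c * (1 / 2 ^ L) ^ CARD('n))))"
    using hausdorff_const_nonneg[of "CARD('n) - 1"] by (intro sum.cong refl ennreal_mult[symmetric]) auto
  also have "\<dots> = ennreal (\<Sum>z | h z \<noteq> 0. \<bar>h z\<bar> * (2 * ?c * (1 / 2 ^ L) ^ CARD('n)))"
    using hausdorff_const_nonneg[of "CARD('n) - 1"] by (intro sum_ennreal) auto
  also have "(\<Sum>z | h z \<noteq> 0. \<bar>h z\<bar> * (2 * ?c * (1 / 2 ^ L) ^ CARD('n))) = 2 * ?c * (LINT x|lborel. \<bar>step o' L h x\<bar>)"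
    unfolding integral_abs_step[OF fin] sum_distrib_left by (intro sum.cong) auto
  finally show ?thesis .
qed

text \<open>The compact support may lie anywhere: the correctors live on the whole space and are
  restricted to \<open>\<Omega>\<close> only afterwards.\<close>

definition test_fn :: "('a::euclidean_space \<Rightarrow> real) \<Rightarrow> ('a \<Rightarrow> 'a) \<Rightarrow> bool" where
  "test_fn \<phi> \<phi>' \<longleftrightarrow> (\<forall>x. GDERIV \<phi> x :> \<phi>' x) \<and> continuous_on UNIV \<phi>' \<and> compact (closure {x. \<phi> x \<noteq> 0})"

section \<open>Integration by parts and refinement on one dyadic level\<close>

lemma test_fn_props:
  assumes t: "test_fn \<phi> \<phi>'"
  shows "continuous_on UNIV \<phi>" "\<phi> \<in> borel_measurable borel" "\<exists>K\<ge>0. \<forall>x. \<bar>\<phi> x\<bar> \<le> K \<and> norm (\<phi>' x) \<le> K"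
    "x \<notin> closure {x. \<phi> x \<noteq> 0} \<Longrightarrow> \<phi> x = 0 \<and> \<phi>' x = 0"
proof -
  let ?S = "closure {x. \<phi> x \<noteq> 0}"
  have gd: "\<And>x. GDERIV \<phi> x :> \<phi>' x" and c': "continuous_on UNIV \<phi>'" and k: "compact ?S" using t by (auto simp: test_fn_def)
  show c: "continuous_on UNIV \<phi>" using gd c' by (intro C1_continuous C1I)
  then show "\<phi> \<in> borel_measurable borel" by (rule borel_measurable_continuous_onI)
  show z: "\<phi> x = 0 \<and> \<phi>' x = 0" if x: "x \<notin> closure {x. \<phi> x \<noteq> 0}" for x
  proof
    show "\<phi> x = 0" using x closure_subset[of "{x. \<phi> x \<noteq> 0}"] by blast
    have "(\<phi> has_derivative (\<lambda>h. h \<bullet> \<phi>' x)) (at x)" using gd[of x] by (simp add: gderiv_def)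
    moreover have "(\<phi> has_derivative (\<lambda>h. 0)) (at x)"
    proof (rule has_derivative_transform_within_open[where f="\<lambda>_. 0" and s="- ?S"])
      show "x \<in> - ?S" using x by simp
      show "\<And>y. y \<in> - ?S \<Longrightarrow> 0 = \<phi> y" using closure_subset[of "{x. \<phi> x \<noteq> 0}"] by auto
    qed auto
    ultimately have "(\<lambda>h. h \<bullet> \<phi>' x) = (\<lambda>h. 0)" by (rule has_derivative_unique)
    then have "\<phi>' x \<bullet> \<phi>' x = 0" by metis
    then show "\<phi>' x = 0" by simp
  qed
  have "compact (\<phi> ` ?S)" "compact (\<phi>' ` ?S)"
    by (auto intro!: compact_continuous_image k intro: continuous_on_subset[OF c] continuous_on_subset[OF c'])
  then have "bounded (\<phi> ` ?S)" "bounded (\<phi>' ` ?S)" by (auto intro: compact_imp_bounded)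
  then obtain K1 K2 where "\<forall>y\<in>\<phi> ` ?S. norm y \<le> K1" "\<forall>y\<in>\<phi>' ` ?S. norm y \<le> K2" unfolding bounded_iff by blast
  then have K: "x \<in> ?S \<Longrightarrow> \<bar>\<phi> x\<bar> \<le> K1" "x \<in> ?S \<Longrightarrow> norm (\<phi>' x) \<le> K2" for x by auto
  show "\<exists>K\<ge>0. \<forall>x. \<bar>\<phi> x\<bar> \<le> K \<and> norm (\<phi>' x) \<le> K"
  proof (intro exI[of _ "max 0 (max K1 K2)"] conjI allI)
    fix x show "\<bar>\<phi> x\<bar> \<le> max 0 (max K1 K2)" "norm (\<phi>' x) \<le> max 0 (max K1 K2)"
      using K[of x] z[of x] by (cases "x \<in> ?S"; force)+
  qed simp
qed

lemma integrable_bounded_mult: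
  fixes f g :: "'a \<Rightarrow> real"
  assumes f: "integrable M f" and g: "g \<in> borel_measurable M" "\<And>x. \<bar>g x\<bar> \<le> K"
  shows "integrable M (\<lambda>x. g x * f x)"
proof (rule Bochner_Integration.integrable_bound[where f="\<lambda>x. K * f x"])
  show "integrable M (\<lambda>x. K * f x)" using f by simp
  show "(\<lambda>x. g x * f x) \<in> borel_measurable M" using f g by auto
  show "AE x in M. norm (g x * f x) \<le> norm (K * f x)"
  proof (intro AE_I2)
    fix x have "\<bar>g x\<bar> \<le> \<bar>K\<bar>" using g(2)[of x] by linarith
    then show "norm (g x * f x) \<le> norm (K * f x)" by (simp add: abs_mult mult_right_mono)
  qed
qed

lemma test_fn_integrable:
  fixes \<phi> :: "real^'n \<Rightarrow> real"
  assumes t: "test_fn \<phi> \<phi>'" shows "integrable lborel (\<lambda>x. \<phi>' x $ m)"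
proof -
  let ?S = "closure {x. \<phi> x \<noteq> 0}"
  have c': "continuous_on UNIV (\<lambda>x. \<phi>' x $ m)" and k: "compact ?S" using t by (auto simp: test_fn_def intro!: continuous_intros)
  have "integrable lborel (\<lambda>x. indicator ?S x *\<^sub>R \<phi>' x $ m)"
    by (rule borel_integrable_compact[OF k continuous_on_subset[OF c']]) simp
  moreover have "(\<lambda>x. indicator ?S x *\<^sub>R \<phi>' x $ m) = (\<lambda>x. \<phi>' x $ m)"
  proof
    fix x show "indicator ?S x *\<^sub>R \<phi>' x $ m = \<phi>' x $ m"
      using test_fn_props(4)[OF t, of x] by (cases "x \<in> ?S") auto
  qed
  ultimately show ?thesis by (simp only:)
qed

text \<open>The formula for a single ramp, summed over the cells. The slopes combine to the step
  function because half-open cells and closed cubes differ only by parts of grid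
  hyperplanes.\<close>

lemma level_integration_by_parts:
  fixes o' :: "real^'n"
  assumes fin: "finite {z. h z \<noteq> 0}" and t: "test_fn \<phi> \<phi>'"
  shows "(LINT x|lborel. level_fn o' L h j x * \<phi>' x $ m) =
     - (of_bool (j = m) * (LINT x|lborel. step o' L h x * \<phi> x) + (LINT x|slices m (grid o' m). \<phi> x * level_jump o' L h j m x))"
proof -
  let ?C = "grid o' m" and ?s = "1 / 2 ^ L :: real" and ?c = "cell_corner o' L"
  obtain K where K: "K \<ge> 0" "\<And>x. \<bar>\<phi> x\<bar> \<le> K" "\<And>x. norm (\<phi>' x) \<le> K" using test_fn_props(3)[OF t] by blast
  have \<phi>m [measurable]: "\<phi> \<in> borel_measurable borel" by (rule test_fn_props(2)[OF t])
  have gd: "\<And>x. GDERIV \<phi> x :> \<phi>' x" and c': "continuous_on UNIV \<phi>'" using t by (auto simp: test_fn_def)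
  have ae: "AE x in lborel. \<forall>z. x \<in> cell o' L z \<longleftrightarrow> x \<in> cube (?c z) ?s"
    using countable_grid_hyperplanes_null[of o']
  proof eventually_elim
    case (elim x)
    show ?case
    proof
      fix z
      have "x $ i \<noteq> ?c z $ i + ?s" for i
        using elim[rule_format, of L i "z $ i + 1"] by (auto simp: cell_corner_def field_simps)
      then show "x \<in> cell o' L z \<longleftrightarrow> x \<in> cube (?c z) ?s"
        unfolding cell_def mem_Collect_eq cell_index_iff cube_def by (auto simp: less_le)
    qed
  qed
  have i1: "integrable lborel (\<lambda>x. ramp (?c z) ?s j x * \<phi>' x $ m)" for z
    by (rule integrable_bounded_mult[OF test_fn_integrable[OF t], where K="?s"])
      (use ramp_bounds[of ?s "?c z" j] in \<open>auto simp: abs_le_iff intro: order_trans[of _ 0]\<close>)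
  have "integrable lborel (\<lambda>x. indicator (cube (?c z) ?s) x * 1 :: real)" for z by (simp add: emeasure_cube)
  then have i2: "integrable lborel (\<lambda>x. \<phi> x * indicator (cube (?c z) ?s) x)" for z
    by (intro integrable_bounded_mult[where K=K]) (use K in auto)
  have i3: "integrable (slices m ?C) (\<lambda>x. \<phi> x * ramp_jump (?c z) ?s j m x)" for z
    by (rule integrable_bounded_mult[where K=K, OF integrable_ramp_jump(1)]) (use K countable_grid in auto)
  have "(LINT x|lborel. level_fn o' L h j x * \<phi>' x $ m) = (LINT x|lborel. (\<Sum>z | h z \<noteq> 0. h z * (ramp (?c z) ?s j x * \<phi>' x $ m)))"
  proof (rule integral_cong_AE)
    show "AE x in lborel. level_fn o' L h j x * \<phi>' x $ m = (\<Sum>z | h z \<noteq> 0. h z * (ramp (?c z) ?s j x * \<phi>' x $ m))"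
      using ae by eventually_elim (simp add: level_fn_sum[OF fin] ramp_def indicator_def sum_distrib_right mult.assoc)
    have "(\<lambda>x. \<phi>' x $ m) \<in> borel_measurable borel"
      using c' by (intro borel_measurable_continuous_onI continuous_intros)
    then show "(\<lambda>x. level_fn o' L h j x * \<phi>' x $ m) \<in> borel_measurable lborel"
      using level_fn_measurable[OF fin, of o' L j] by simp
    show "(\<lambda>x. \<Sum>z | h z \<noteq> 0. h z * (ramp (?c z) ?s j x * \<phi>' x $ m)) \<in> borel_measurable lborel"
      by (rule borel_measurable_integrable) (use i1 in auto)
  qed
  also have "\<dots> = (\<Sum>z | h z \<noteq> 0. h z * (LINT x|lborel. ramp (?c z) ?s j x * \<phi>' x $ m))"
    using i1 by (subst Bochner_Integration.integral_sum) auto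
  also have "\<dots> = (\<Sum>z | h z \<noteq> 0. h z * - (of_bool (j = m) * (LINT x|lborel. indicator (cube (?c z) ?s) x * \<phi> x) +
       (LINT x|slices m ?C. \<phi> x * ramp_jump (?c z) ?s j m x)))"
    by (intro sum.cong refl arg_cong2[where f="(*)"] ramp_integration_by_parts gd c' countable_grid corner_in_grid) simp
  also have "\<dots> = - (of_bool (j = m) * (\<Sum>z | h z \<noteq> 0. h z * (LINT x|lborel. \<phi> x * indicator (cube (?c z) ?s) x)) +
       (\<Sum>z | h z \<noteq> 0. h z * (LINT x|slices m ?C. \<phi> x * ramp_jump (?c z) ?s j m x)))"
  proof -
    have alg: "(\<Sum>z\<in>Z. h z * - (b * A z + B z)) = - (b * (\<Sum>z\<in>Z. h z * A z) + (\<Sum>z\<in>Z. h z * B z))"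
      for Z :: "(int^'n) set" and b and A B :: "int^'n \<Rightarrow> real"
      by (simp add: sum_distrib_left sum.distrib[symmetric] sum_negf[symmetric] algebra_simps)
    show ?thesis by (subst alg) (simp add: mult.commute)
  qed
  also have "(\<Sum>z | h z \<noteq> 0. h z * (LINT x|lborel. \<phi> x * indicator (cube (?c z) ?s) x)) =
     (LINT x|lborel. (\<Sum>z | h z \<noteq> 0. h z * (\<phi> x * indicator (cube (?c z) ?s) x)))"
    using i2 by (subst Bochner_Integration.integral_sum) auto
  also have "\<dots> = (LINT x|lborel. step o' L h x * \<phi> x)"
  proof (rule integral_cong_AE)
    show "AE x in lborel. (\<Sum>z | h z \<noteq> 0. h z * (\<phi> x * indicator (cube (?c z) ?s) x)) = step o' L h x * \<phi> x"
    proof -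
      have ss: "step o' L h x = (\<Sum>z | h z \<noteq> 0. h z * indicator (cell o' L z) x)" for x
        by (rule step_sum[OF fin]) simp
      show ?thesis using ae by eventually_elim (simp add: ss indicator_def sum_distrib_left mult_ac)
    qed
    show "(\<lambda>x. step o' L h x * \<phi> x) \<in> borel_measurable lborel"
      using borel_measurable_integrable[OF integrable_step[OF fin, of o' L]] by simp
    show "(\<lambda>x. \<Sum>z | h z \<noteq> 0. h z * (\<phi> x * indicator (cube (?c z) ?s) x)) \<in> borel_measurable lborel"
      by (rule borel_measurable_integrable) (use i2 in auto)
  qed
  also have "(\<Sum>z | h z \<noteq> 0. h z * (LINT x|slices m ?C. \<phi> x * ramp_jump (?c z) ?s j m x)) =
     (LINT x|slices m ?C. (\<Sum>z | h z \<noteq> 0. h z * (\<phi> x * ramp_jump (?c z) ?s j m x)))"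
    using i3 by (subst Bochner_Integration.integral_sum) auto
  also have "\<dots> = (LINT x|slices m ?C. \<phi> x * level_jump o' L h j m x)"
    by (simp add: level_jump_def sum_distrib_left mult_ac)
  finally show ?thesis .
qed

text \<open>Dividing an index by 2^d leads from a fine cell to the coarse cell containing it. The
  range condition records that refinement creates no new slopes.\<close>

lemma step_refine:
  fixes o' :: "real^'n"
  assumes fin: "finite {z. h z \<noteq> 0}"
  shows "\<exists>h'. finite {z. h' z \<noteq> 0} \<and> range h' \<subseteq> range h \<and> step o' (m + d) h' = step o' m h"
proof -
  define p where "p z = (\<chi> i. (z::int^'n) $ i div 2 ^ d)" for z
  have "p (cell_index o' (m + d) x) = cell_index o' m x" for x
  proof -
    have "\<lfloor>2 ^ (m + d) * (x $ i - o' $ i)\<rfloor> div 2 ^ d = \<lfloor>2 ^ m * (x $ i - o' $ i)\<rfloor>" for i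
      using floor_divide_real_eq_div[of "2 ^ d" "2 ^ (m + d) * (x $ i - o' $ i)"] by (simp add: power_add)
    then show ?thesis by (simp add: p_def cell_index_def)
  qed
  then have "step o' (m + d) (\<lambda>z. h (p z)) = step o' m h" by (auto simp: step_def)
  moreover have "finite {z. h (p z) \<noteq> 0}"
  proof (rule finite_subset)
    show "{z. h (p z) \<noteq> 0} \<subseteq> (\<Union>w\<in>{w. h w \<noteq> 0}. {z. \<forall>i. z $ i \<in> {w $ i * 2 ^ d..(w $ i + 1) * 2 ^ d}})"
    proof
      fix z assume z: "z \<in> {z. h (p z) \<noteq> 0}"
      have "p z $ i * 2 ^ d \<le> z $ i \<and> z $ i \<le> (p z $ i + 1) * 2 ^ d" for i
      proof -
        have "z $ i = p z $ i * 2 ^ d + z $ i mod 2 ^ d" unfolding p_def vec_lambda_beta by (rule div_mult_mod_eq[symmetric])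
        moreover have "0 \<le> z $ i mod 2 ^ d" "z $ i mod 2 ^ d < 2 ^ d" by simp_all
        ultimately show ?thesis unfolding distrib_right by linarith
      qed
      then show "z \<in> (\<Union>w\<in>{w. h w \<noteq> 0}. {z. \<forall>i. z $ i \<in> {w $ i * 2 ^ d..(w $ i + 1) * 2 ^ d}})"
        using z by (intro UN_I[of "p z"]) auto
    qed
    show "finite (\<Union>w\<in>{w. h w \<noteq> 0}. {z. \<forall>i. z $ i \<in> {w $ i * 2 ^ d..(w $ i + 1) * 2 ^ d}})"
      using fin by (intro finite_UN_I finite_vec_set) auto
  qed
  ultimately show ?thesis by (intro exI[of _ "\<lambda>z. h (p z)"]) auto
qed

section \<open>A small function with prescribed diffuse partial derivative\<close>

text \<open>Refining an approximant leaves its values alone while 2^L grows, so the slope bound can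
  always be met. With that bound the level function of the approximant is at most
  \<open>\<eta>\<close>.\<close>

lemma step_halving:
  fixes g :: "real^'n \<Rightarrow> real"
  assumes g: "integrable lborel g" and \<eta>: "\<eta> > 0"
  shows "\<exists>L h. finite {z. h z \<noteq> 0} \<and> (\<forall>z. \<bar>h z\<bar> \<le> \<eta> * 2 ^ L) \<and>
     (LINT x|lborel. \<bar>g x - step o' L h x\<bar>) \<le> (LINT x|lborel. \<bar>g x\<bar>) / 2"
proof (cases "(LINT x|lborel. \<bar>g x\<bar>) = 0")
  \<comment> \<open>The strict approximation bound below requires a positive norm; for norm 0 the
    zero step function does.\<close>
  case True
  then show ?thesis using \<eta> by (intro exI[of _ 0] exI[of _ "\<lambda>_. 0"]) (simp add: step_def)
next
  case False
  moreover have "(LINT x|lborel. \<bar>g x\<bar>) \<ge> 0" by (intro Bochner_Integration.integral_nonneg) simp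
  ultimately have "(LINT x|lborel. \<bar>g x\<bar>) / 2 > 0" by linarith
  then obtain m h where h: "finite {z. h z \<noteq> 0}" "(LINT x|lborel. \<bar>g x - step o' m h x\<bar>) < (LINT x|lborel. \<bar>g x\<bar>) / 2"
    using step_approximable[OF g, of o'] unfolding step_approximable_def by blast
  obtain K where K: "\<And>z. \<bar>h z\<bar> \<le> K"
  proof -
    have "finite (h ` {z. h z \<noteq> 0} \<union> {0})" using h(1) by simp
    then have "bounded (h ` {z. h z \<noteq> 0} \<union> {0})" by (rule finite_imp_bounded)
    then obtain K where "\<forall>y\<in>h ` {z. h z \<noteq> 0} \<union> {0}. norm y \<le> K" unfolding bounded_iff by blast
    then have "\<bar>h z\<bar> \<le> K" for z by (cases "h z = 0") auto
    then show ?thesis by (rule that)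
  qed
  obtain d where d: "K / \<eta> < 2 ^ d" using real_arch_pow[of 2 "K / \<eta>"] by auto
  obtain h' where h': "finite {z. h' z \<noteq> 0}" "range h' \<subseteq> range h" "step o' (m + d) h' = step o' m h"
    using step_refine[OF h(1), of o' m d] by blast
  have "\<bar>h' z\<bar> \<le> \<eta> * 2 ^ (m + d)" for z
  proof -
    obtain w where "h' z = h w" using h'(2) by blast
    then have "\<bar>h' z\<bar> \<le> K" using K by simp
    also have "\<dots> \<le> \<eta> * 2 ^ d" using d \<eta> by (simp add: field_simps)
    also have "\<dots> \<le> \<eta> * 2 ^ (m + d)" using \<eta> by (intro mult_left_mono power_increasing) auto
    finally show ?thesis .
  qed
  then show ?thesis using h h' by (intro exI[of _ "m + d"] exI[of _ h']) auto
qed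

text \<open>The halving is iterated on the remainder. Each term is the difference of two consecutive
  remainders, hence of norm at most twice the earlier one. The tolerances \<epsilon> / 2^(k+1) are
  chosen to sum to \<epsilon>.\<close>

lemma step_series:
  fixes f :: "real^'n \<Rightarrow> real"
  assumes f: "integrable lborel f" and \<epsilon>: "\<epsilon> > 0"
  shows "\<exists>L h. (\<forall>k. finite {z. h k z \<noteq> 0} \<and> (\<forall>z. \<bar>h k z\<bar> \<le> \<epsilon> / 2 ^ (k + 1) * 2 ^ L k) \<and>
      (LINT x|lborel. \<bar>step o' (L k) (h k) x\<bar>) \<le> 2 * (LINT x|lborel. \<bar>f x\<bar>) / 2 ^ k \<and>
      (LINT x|lborel. \<bar>f x - (\<Sum>i<k. step o' (L i) (h i) x)\<bar>) \<le> (LINT x|lborel. \<bar>f x\<bar>) / 2 ^ k)"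
proof -
  define Q where "Q n g g' p \<longleftrightarrow> finite {z. snd p z \<noteq> 0} \<and> (\<forall>z. \<bar>snd p z\<bar> \<le> \<epsilon> / 2 ^ (n + 1) * 2 ^ fst p) \<and>
      g' = (\<lambda>x. g x - step o' (fst p) (snd p) x) \<and> (LINT x|lborel. \<bar>g' x\<bar>) \<le> (LINT x|lborel. \<bar>g x\<bar>) / 2"
    for n g g' and p :: "nat \<times> (int^'n \<Rightarrow> real)"
  have "\<exists>F. \<forall>n. (integrable lborel (F n) \<and> (n = 0 \<longrightarrow> F n = f)) \<and> (\<exists>p. Q n (F n) (F (Suc n)) p)"
  proof (rule dependent_nat_choice)
    show "\<exists>g. integrable lborel g \<and> ((0::nat) = 0 \<longrightarrow> g = f)" using f by blast
    fix g :: "real^'n \<Rightarrow> real" and n :: nat assume "integrable lborel g \<and> (n = 0 \<longrightarrow> g = f)"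
    then have g: "integrable lborel g" by simp
    have "\<epsilon> / 2 ^ (n + 1) > 0" using \<epsilon> by simp
    then obtain L h where Lh: "finite {z. h z \<noteq> 0}" "\<forall>z. \<bar>h z\<bar> \<le> \<epsilon> / 2 ^ (n + 1) * 2 ^ L"
       "(LINT x|lborel. \<bar>g x - step o' L h x\<bar>) \<le> (LINT x|lborel. \<bar>g x\<bar>) / 2"
      using step_halving[OF g, of "\<epsilon> / 2 ^ (n + 1)" o'] by blast
    have "integrable lborel (\<lambda>x. g x - step o' L h x)" using g integrable_step[OF Lh(1), of o' L] by simp
    moreover have "Q n g (\<lambda>x. g x - step o' L h x) (L, h)" unfolding Q_def using Lh by simp
    ultimately show "\<exists>g'. (integrable lborel g' \<and> (Suc n = 0 \<longrightarrow> g' = f)) \<and> (\<exists>p. Q n g g' p)" by blast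
  qed
  then obtain F where F: "\<And>n. integrable lborel (F n)" "F 0 = f" "\<And>n. \<exists>p. Q n (F n) (F (Suc n)) p" by blast
  have "\<exists>p. \<forall>n. Q n (F n) (F (Suc n)) (p n)" by (rule choice) (use F(3) in blast)
  then obtain p where p: "\<And>n. Q n (F n) (F (Suc n)) (p n)" by blast
  define L where "L n = fst (p n)" for n
  define h where "h n = snd (p n)" for n
  have Q: "finite {z. h n z \<noteq> 0}" "\<bar>h n z\<bar> \<le> \<epsilon> / 2 ^ (n + 1) * 2 ^ L n"
    "F (Suc n) x = F n x - step o' (L n) (h n) x" "(LINT x|lborel. \<bar>F (Suc n) x\<bar>) \<le> (LINT x|lborel. \<bar>F n x\<bar>) / 2" for n z x
    using p[of n] unfolding Q_def L_def h_def by auto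
  have nF: "(LINT x|lborel. \<bar>F n x\<bar>) \<le> (LINT x|lborel. \<bar>f x\<bar>) / 2 ^ n" for n
  proof (induction n)
    case (Suc n)
    then have "(LINT x|lborel. \<bar>F n x\<bar>) / 2 \<le> (LINT x|lborel. \<bar>f x\<bar>) / 2 ^ Suc n" by simp
    then show ?case using Q(4)[of n] by linarith
  qed (simp add: F(2))
  have Fs: "F n x = f x - (\<Sum>i<n. step o' (L i) (h i) x)" for n x
    by (induction n) (auto simp: F(2) Q(3))
  have "(LINT x|lborel. \<bar>step o' (L k) (h k) x\<bar>) \<le> 2 * (LINT x|lborel. \<bar>f x\<bar>) / 2 ^ k" for k
  proof -
    have "(LINT x|lborel. \<bar>step o' (L k) (h k) x\<bar>) \<le> (LINT x|lborel. \<bar>F k x\<bar> + \<bar>F (Suc k) x\<bar>)"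
    proof (rule integral_mono)
      show "integrable lborel (\<lambda>x. \<bar>step o' (L k) (h k) x\<bar>)" using integrable_step[OF Q(1)] by (rule integrable_abs)
      show "integrable lborel (\<lambda>x. \<bar>F k x\<bar> + \<bar>F (Suc k) x\<bar>)" by (intro Bochner_Integration.integrable_add integrable_abs F(1))
      show "\<bar>step o' (L k) (h k) x\<bar> \<le> \<bar>F k x\<bar> + \<bar>F (Suc k) x\<bar>" for x using Q(3)[of k x] by linarith
    qed
    also have "\<dots> = (LINT x|lborel. \<bar>F k x\<bar>) + (LINT x|lborel. \<bar>F (Suc k) x\<bar>)"
      by (intro Bochner_Integration.integral_add integrable_abs F(1))
    also have "\<dots> \<le> 2 * (LINT x|lborel. \<bar>F k x\<bar>)"
    proof -
      have "(LINT x|lborel. \<bar>F k x\<bar>) \<ge> 0" by (intro Bochner_Integration.integral_nonneg) simp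
      then show ?thesis using Q(4)[of k] by linarith
    qed
    also have "\<dots> \<le> 2 * (LINT x|lborel. \<bar>f x\<bar>) / 2 ^ k" using nF[of k] by simp
    finally show ?thesis .
  qed
  then show ?thesis using Q(1,2) nF unfolding Fs by (intro exI[of _ L] exI[of _ h]) simp
qed

section \<open>One-sided limits of series and the regular points of grid faces\<close>

lemma side_limit_tendsto:
  "side_limit v x \<nu> c \<longleftrightarrow> (v \<longlongrightarrow> c) (at x within {y. (y - x) \<bullet> \<nu> > 0})"
proof
  assume s: "side_limit v x \<nu> c"
  show "(v \<longlongrightarrow> c) (at x within {y. (y - x) \<bullet> \<nu> > 0})"
    unfolding tendsto_iff eventually_at
  proof (intro allI impI)
    fix e :: real assume "e > 0"
    then obtain \<delta> where \<delta>: "\<delta> > 0" "\<And>y. y \<in> half_ball x \<delta> \<nu> \<Longrightarrow> norm (v y - c) \<le> e / 2"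
      using s unfolding side_limit_def by (metis half_gt_zero)
    show "\<exists>d>0. \<forall>y\<in>{y. 0 < (y - x) \<bullet> \<nu>}. y \<noteq> x \<and> dist y x < d \<longrightarrow> dist (v y) c < e"
    proof (intro exI[of _ \<delta>] conjI ballI impI \<delta>(1))
      fix y assume "y \<in> {y. 0 < (y - x) \<bullet> \<nu>}" "y \<noteq> x \<and> dist y x < \<delta>"
      then have "y \<in> half_ball x \<delta> \<nu>" by (auto simp: half_ball_def dist_commute)
      then show "dist (v y) c < e" using \<delta>(2)[of y] \<open>e > 0\<close> by (simp add: dist_norm)
    qed
  qed
next
  assume l: "(v \<longlongrightarrow> c) (at x within {y. (y - x) \<bullet> \<nu> > 0})"
  show "side_limit v x \<nu> c" unfolding side_limit_def
  proof (intro allI impI)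
    fix e :: real assume "e > 0"
    then obtain d where d: "d > 0" "\<And>y. (y - x) \<bullet> \<nu> > 0 \<Longrightarrow> y \<noteq> x \<Longrightarrow> dist y x < d \<Longrightarrow> dist (v y) c < e"
      using l unfolding tendsto_iff eventually_at by blast
    show "\<exists>\<delta>>0. \<forall>y\<in>half_ball x \<delta> \<nu>. norm (v y - c) \<le> e"
    proof (intro exI[of _ d] conjI ballI d(1))
      fix y assume "y \<in> half_ball x d \<nu>"
      then have "dist (v y) c < e" by (intro d(2)) (auto simp: half_ball_def dist_commute)
      then show "norm (v y - c) \<le> e" by (simp add: dist_norm)
    qed
  qed
qed

lemma half_space_nontrivial:
  assumes "norm \<nu> = 1" shows "at x within {y. (y - x) \<bullet> \<nu> > 0} \<noteq> bot"
proof -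
  have "x islimpt {y. (y - x) \<bullet> \<nu> > 0}" unfolding islimpt_approachable
  proof (intro allI impI)
    fix e :: real assume "e > 0"
    then show "\<exists>y\<in>{y. (y - x) \<bullet> \<nu> > 0}. y \<noteq> x \<and> dist y x < e"
      using assms by (intro bexI[of _ "x + (e / 2) *\<^sub>R \<nu>"]) (auto simp: dist_norm dot_square_norm)
  qed
  then show ?thesis by (simp add: trivial_limit_within)
qed

lemma side_limit_bound:
  fixes v :: "'a::euclidean_space \<Rightarrow> real"
  assumes "side_limit v x \<nu> c" "norm \<nu> = 1" "\<And>y. \<bar>v y\<bar> \<le> K" shows "\<bar>c\<bar> \<le> K"
proof -
  have "((\<lambda>y. \<bar>v y\<bar>) \<longlongrightarrow> \<bar>c\<bar>) (at x within {y. (y - x) \<bullet> \<nu> > 0})"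
    using assms(1) unfolding side_limit_tendsto by (rule tendsto_rabs)
  then show ?thesis by (rule tendsto_upperbound) (use assms half_space_nontrivial in auto)
qed

lemma side_limit_sum:
  "(\<And>i. i \<in> I \<Longrightarrow> side_limit (v i) x \<nu> (c i)) \<Longrightarrow> side_limit (\<lambda>y. \<Sum>i\<in>I. v i y) x \<nu> (\<Sum>i\<in>I. c i)"
  unfolding side_limit_tendsto by (rule tendsto_sum)

text \<open>Exchange of limits under uniform convergence. The limits \<open>c k\<close> inherit the
  bounds \<open>K k\<close>, which makes them summable.\<close>

lemma side_limit_suminf:
  fixes w :: "nat \<Rightarrow> 'a::euclidean_space \<Rightarrow> real"
  assumes w: "\<And>k y. \<bar>w k y\<bar> \<le> K k" and K: "summable K" and \<nu>: "norm \<nu> = 1"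
    and c: "\<And>k. side_limit (w k) x \<nu> (c k)"
  shows "side_limit (\<lambda>y. \<Sum>k. w k y) x \<nu> (\<Sum>k. c k)"
  unfolding side_limit_tendsto
proof (rule swap_uniform_limit[where f="\<lambda>n y. \<Sum>k<n. w k y" and g="\<lambda>n. \<Sum>k<n. c k" and F=sequentially])
  let ?S = "{y. (y - x) \<bullet> \<nu> > 0}"
  show "\<forall>\<^sub>F n in sequentially. ((\<lambda>y. \<Sum>k<n. w k y) \<longlongrightarrow> (\<Sum>k<n. c k)) (at x within ?S)"
    using c unfolding side_limit_tendsto by (intro always_eventually allI tendsto_sum) auto
  have "\<bar>c k\<bar> \<le> K k" for k using side_limit_bound[OF c \<nu>] w by blast
  then have "summable c" by (intro summable_comparison_test[OF _ K]) auto
  then show "(\<lambda>n. \<Sum>k<n. c k) \<longlonglongrightarrow> (\<Sum>k. c k)" by (rule summable_LIMSEQ)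
  show "uniform_limit ?S (\<lambda>n y. \<Sum>k<n. w k y) (\<lambda>y. \<Sum>k. w k y) sequentially"
    using w K by (intro Weierstrass_m_test) auto
qed simp

text \<open>Points off all hyperplanes are included; there the jumps of every level vanish.
  Excluding hyperplanes of the other directions leaves one cell on either side of the point at every
  level.\<close>

definition single_face :: "real^'n \<Rightarrow> 'n \<Rightarrow> (real^'n) set" where
  "single_face o' m = {x. \<forall>i. i \<noteq> m \<longrightarrow> x $ i \<notin> grid o' i}"

lemma grid_borel: "{x::real^'n. x $ i \<in> grid o' i} \<in> sets borel"
proof -
  have "grid o' i \<in> sets borel" by (rule sets.countable[OF _ countable_grid]) simp
  then show ?thesis using measurable_sets[OF vec_nth_measurable[of i], of "grid o' i"] by (simp add: vimage_def)
qed

lemma single_face_borel [measurable]: "single_face o' m \<in> sets borel"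
proof -
  have "single_face o' m = UNIV - (\<Union>i\<in>{i. i \<noteq> m}. {x. x $ i \<in> grid o' i})" by (auto simp: single_face_def)
  moreover have "(\<Union>i\<in>{i. i \<noteq> m}. {x. x $ i \<in> grid o' i}) \<in> sets borel"
    using grid_borel by (intro sets.finite_UN) auto
  ultimately show ?thesis by (simp add: sets.Diff)
qed

text \<open>Points on hyperplanes of two directions have codimension two and are null for the
  measure on the faces.\<close>

lemma AE_single_face: "AE x in slices m (grid o' m). x \<in> single_face o' m"
proof -
  have "AE x in slab m. \<forall>i\<in>UNIV. \<forall>c\<in>grid o' i. x $ i \<noteq> c"
  proof (rule AE_finite_allI[OF finite])
    fix i show "AE x in slab m. \<forall>c\<in>grid o' i. x $ i \<noteq> c"
      unfolding AE_ball_countable[OF countable_grid] by (intro ballI slab_hyperplane_null)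
  qed
  then have "AE x in slab m. \<forall>c\<in>grid o' m. upd x m c \<in> single_face o' m"
    by eventually_elim (auto simp: single_face_def upd_nth)
  then show ?thesis using single_face_borel[of o' m] by (subst AE_slices_iff[OF countable_grid]) auto
qed

text \<open>The last conjunct says that the distributional gradient of \<open>v\<close> is \<open>f e\<^sub>j\<close> plus the jumps \<open>J m\<close> across
  the grid hyperplanes orthogonal to \<open>e\<^sub>m\<close>.\<close>

definition corrector ::
    "real^'n \<Rightarrow> real \<Rightarrow> 'n \<Rightarrow> (real^'n \<Rightarrow> real) \<Rightarrow> (real^'n \<Rightarrow> real) \<Rightarrow> ('n \<Rightarrow> real^'n \<Rightarrow> real) \<Rightarrow> bool" where
  "corrector o' \<epsilon> j f v J \<longleftrightarrow> v \<in> borel_measurable borel \<and> (\<forall>x. \<bar>v x\<bar> \<le> \<epsilon>) \<and>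
     (\<forall>x. (\<forall>i. x $ i \<notin> grid o' i) \<longrightarrow> isCont v x) \<and>
     (\<forall>m. J m \<in> borel_measurable borel \<and>
        (\<forall>x\<in>single_face o' m. side_limit v x (axis m 1) (v x) \<and> side_limit v x (- axis m 1) (v x - J m x)) \<and>
        integrable (slices m (grid o' m)) (J m) \<and>
        (LINT x|slices m (grid o' m). \<bar>J m x\<bar>) \<le> 8 * (LINT x|lborel. \<bar>f x\<bar>) \<and>
        (\<integral>\<^sup>+x. ennreal \<bar>J m x\<bar> \<partial>hausdorff_measure (CARD('n) - 1)) \<le>
           ennreal (8 * hausdorff_const (CARD('n) - 1) * (LINT x|lborel. \<bar>f x\<bar>)) \<and>
        (\<forall>\<phi> \<phi>'. test_fn \<phi> \<phi>' \<longrightarrow> (LINT x|lborel. v x * \<phi>' x $ m) =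
           - (of_bool (j = m) * (LINT x|lborel. f x * \<phi> x) + (LINT x|slices m (grid o' m). \<phi> x * J m x))))"

text \<open>The factor 8 is the sum of the geometric series with terms 4 / 2^k: two faces per cube,
  and step functions of norm at most 2 / 2^k times that of \<open>f\<close>. Bounds, continuity off
  the grid and side limits pass to the sum by uniform convergence, the jump measures by absolute
  convergence of their masses.\<close>

theorem corrector_exists:
  fixes f :: "real^'n \<Rightarrow> real"
  assumes f: "integrable lborel f" and \<epsilon>: "\<epsilon> > 0"
  shows "\<exists>v J. corrector o' \<epsilon> j f v J"
proof -
  let ?f = "LINT x|lborel. \<bar>f x\<bar>" and ?H = "hausdorff_measure (CARD('n) - 1) :: (real^'n) measure"
  let ?c = "hausdorff_const (CARD('n) - 1)"
  obtain L h where Lh: "\<forall>k. finite {z. h k z \<noteq> 0} \<and> (\<forall>z. \<bar>h k z\<bar> \<le> \<epsilon> / 2 ^ (k + 1) * 2 ^ L k) \<and>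
      (LINT x|lborel. \<bar>step o' (L k) (h k) x\<bar>) \<le> 2 * ?f / 2 ^ k \<and>
      (LINT x|lborel. \<bar>f x - (\<Sum>i<k. step o' (L i) (h i) x)\<bar>) \<le> ?f / 2 ^ k"
    using step_series[OF f \<epsilon>, of o'] by (elim exE) (rule that)
  have fin: "finite {z. h k z \<noteq> 0}" and hb: "\<bar>h k z\<bar> \<le> \<epsilon> / 2 ^ (k + 1) * 2 ^ L k"
    and s1: "(LINT x|lborel. \<bar>step o' (L k) (h k) x\<bar>) \<le> 2 * ?f / 2 ^ k"
    and s2: "(LINT x|lborel. \<bar>f x - (\<Sum>i<k. step o' (L i) (h i) x)\<bar>) \<le> ?f / 2 ^ k" for k z
    using Lh by auto
  have f0: "?f \<ge> 0" by (intro Bochner_Integration.integral_nonneg) simp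
  define w where "w k = level_fn o' (L k) (h k) j" for k
  define q where "q k m = level_jump o' (L k) (h k) j m" for k m
  define K where "K k = \<epsilon> / 2 ^ (k + 1)" for k :: nat
  have Ks: "K sums \<epsilon>" using sums_mult[OF power_half_series, of \<epsilon>] by (simp add: K_def[abs_def] power_one_over field_simps)
  have Ksm: "summable K" using Ks by (rule sums_summable)
  have wb: "\<bar>w k x\<bar> \<le> K k" for k x
    using level_fn_bound[of "h k" o' "L k" x "\<epsilon> / 2 ^ (k + 1) * 2 ^ L k" j, OF hb] by (simp add: w_def K_def)
  have wm [measurable]: "w k \<in> borel_measurable borel" for k unfolding w_def by (rule level_fn_measurable[OF fin])
  have qm [measurable]: "q k m \<in> borel_measurable borel" for k m unfolding q_def by measurable
  have wsum: "summable (\<lambda>k. w k x)" for x by (rule summable_comparison_test[OF _ Ksm]) (use wb in auto)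
  define v where "v x = (\<Sum>k. w k x)" for x
  define J where "J m x = (if x \<in> single_face o' m then \<Sum>k. q k m x else 0)" for m x
  have vm: "v \<in> borel_measurable borel" unfolding v_def[abs_def] by measurable
  have Jm: "J m \<in> borel_measurable borel" for m unfolding J_def[abs_def] by measurable
  have vb: "\<bar>v x\<bar> \<le> \<epsilon>" for x
  proof -
    have "\<bar>v x\<bar> \<le> (\<Sum>k. \<bar>w k x\<bar>)" unfolding v_def
      by (intro summable_rabs summable_comparison_test[OF _ Ksm]) (use wb in auto)
    also have "\<dots> \<le> (\<Sum>k. K k)" by (intro suminf_le summable_comparison_test[OF _ Ksm] wb Ksm) (use wb in auto)
    finally show ?thesis using Ks by (simp add: sums_iff)
  qed
  have vc: "isCont v x" if "\<forall>i. x $ i \<notin> grid o' i" for x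
  proof -
    have "(v \<longlongrightarrow> v x) (at x within UNIV)"
    proof (rule swap_uniform_limit[where f="\<lambda>n y. \<Sum>k<n. w k y" and g="\<lambda>n. \<Sum>k<n. w k x" and F=sequentially])
      have "isCont (w k) x" for k unfolding w_def using that by (intro level_fn_isCont) auto
      then show "\<forall>\<^sub>F n in sequentially. ((\<lambda>y. \<Sum>k<n. w k y) \<longlongrightarrow> (\<Sum>k<n. w k x)) (at x)"
        by (intro always_eventually allI tendsto_sum) (auto simp: isCont_def)
      show "(\<lambda>n. \<Sum>k<n. w k x) \<longlonglongrightarrow> v x" unfolding v_def by (rule summable_LIMSEQ[OF wsum])
      show "uniform_limit UNIV (\<lambda>n y. \<Sum>k<n. w k y) v sequentially"
        unfolding v_def[abs_def] using wb Ksm by (intro Weierstrass_m_test) auto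
    qed simp
    then show ?thesis by (simp add: isCont_def)
  qed
  have ax: "norm (axis m 1 :: real^'n) = 1" "norm (- axis m 1 :: real^'n) = 1" for m by simp_all
  have sl: "side_limit (w k) x (axis m 1) (w k x)" "side_limit (w k) x (- axis m 1) (w k x - q k m x)"
    if "x \<in> single_face o' m" for k m x
    using that level_side_limits[OF fin[of k], of m x o' "L k" j] unfolding w_def q_def single_face_def by auto
  \<comment> \<open>A jump is the difference of two one-sided limits, each bounded by
    \<open>K k\<close>.\<close>
  have qb: "\<bar>q k m x\<bar> \<le> 2 * K k" if "x \<in> single_face o' m" for k m x
  proof -
    have "\<bar>w k x - q k m x\<bar> \<le> K k" by (rule side_limit_bound[OF sl(2)[OF that] ax(2) wb])
    then show ?thesis using wb[of k x] by linarith
  qed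
  have qs: "summable (\<lambda>k. \<bar>q k m x\<bar>)" if "x \<in> single_face o' m" for m x
    by (rule summable_comparison_test[of _ "\<lambda>k. 2 * K k"]) (use qb[OF that] Ksm in auto)
  have sides: "side_limit v x (axis m 1) (v x)" "side_limit v x (- axis m 1) (v x - J m x)" if x: "x \<in> single_face o' m" for m x
  proof -
    show "side_limit v x (axis m 1) (v x)"
      unfolding v_def by (rule side_limit_suminf[OF wb Ksm ax(1) sl(1)[OF x]])
    have "v x - J m x = (\<Sum>k. w k x - q k m x)"
      unfolding v_def J_def using x by (simp add: suminf_diff[OF wsum summable_rabs_cancel[OF qs[OF x]]])
    then show "side_limit v x (- axis m 1) (v x - J m x)"
      unfolding v_def using side_limit_suminf[OF wb Ksm ax(2) sl(2)[OF x]] by simp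
  qed
  have geo: "(\<lambda>k. 2 * (2 * ?f / 2 ^ k)) sums (8 * ?f)"
    using sums_mult[OF geometric_sums[of "1/2::real"], of "4 * ?f"] by (simp add: power_one_over field_simps)
  have qi: "integrable (slices m (grid o' m)) (q k m)"
    "(LINT x|slices m (grid o' m). \<bar>q k m x\<bar>) \<le> 2 * (2 * ?f / 2 ^ k)" for k m
  proof -
    note a = level_jump_integrable[OF fin[of k] countable_grid[of o' m], where m=m and j=j and o'=o' and L="L k"]
    show "integrable (slices m (grid o' m)) (q k m)" unfolding q_def by (rule a)
    show "(LINT x|slices m (grid o' m). \<bar>q k m x\<bar>) \<le> 2 * (2 * ?f / 2 ^ k)"
      unfolding q_def using a(2) s1[of k] by linarith
  qed
  have sumq: "summable (\<lambda>k. LINT x|slices m (grid o' m). \<bar>q k m x\<bar>)" for m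
    by (rule summable_comparison_test[OF _ sums_summable[OF geo]]) (use qi(2) in auto)
  have AEqs: "AE x in slices m (grid o' m). summable (\<lambda>k. norm (q k m x))" for m
    using AE_single_face[of o' m] by eventually_elim (use qs in simp)
  have AEJ: "AE x in slices m (grid o' m). (\<Sum>k. q k m x) = J m x" for m
    using AE_single_face[of o' m] by eventually_elim (simp add: J_def)
  have Ji: "integrable (slices m (grid o' m)) (J m)" for m
  proof (rule integrable_cong_AE_imp[OF integrable_suminf[OF qi(1) AEqs]])
    show "summable (\<lambda>k. LINT x|slices m (grid o' m). norm (q k m x))" using sumq by simp
    show "AE x in slices m (grid o' m). (\<Sum>k. q k m x) = J m x" by (rule AEJ)
  qed (use Jm in simp)
  have Jn: "(LINT x|slices m (grid o' m). \<bar>J m x\<bar>) \<le> 8 * ?f" for m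
  proof -
    have A: "integrable (slices m (grid o' m)) (\<lambda>x. \<bar>q k m x\<bar>)" for k using qi(1) by (rule integrable_abs)
    have B: "AE x in slices m (grid o' m). summable (\<lambda>k. norm \<bar>q k m x\<bar>)" using AEqs[of m] by simp
    have C: "summable (\<lambda>k. LINT x|slices m (grid o' m). norm \<bar>q k m x\<bar>)" using sumq[of m] by simp
    have "(LINT x|slices m (grid o' m). \<bar>J m x\<bar>) \<le> (LINT x|slices m (grid o' m). (\<Sum>k. \<bar>q k m x\<bar>))"
    proof (rule integral_mono_AE)
      show "AE x in slices m (grid o' m). \<bar>J m x\<bar> \<le> (\<Sum>k. \<bar>q k m x\<bar>)"
        using AE_single_face[of o' m] by eventually_elim (simp add: J_def summable_rabs qs)
    qed (use integrable_suminf[OF A B C] Ji in auto)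
    also have "\<dots> = (\<Sum>k. LINT x|slices m (grid o' m). \<bar>q k m x\<bar>)" by (rule integral_suminf[OF A B C])
    also have "\<dots> \<le> (\<Sum>k. 2 * (2 * ?f / 2 ^ k))" by (intro suminf_le qi(2) sumq sums_summable[OF geo])
    finally show ?thesis using geo by (simp add: sums_iff)
  qed
  have JH: "(\<integral>\<^sup>+x. ennreal \<bar>J m x\<bar> \<partial>?H) \<le> ennreal (8 * ?c * ?f)" for m
  proof -
    have c0: "?c \<ge> 0" by (rule hausdorff_const_nonneg)
    have qH: "q k m \<in> borel_measurable ?H" for k using qm[of k m] by (simp cong: measurable_cong_sets)
    have "(\<integral>\<^sup>+x. ennreal \<bar>J m x\<bar> \<partial>?H) \<le> (\<integral>\<^sup>+x. (\<Sum>k. ennreal \<bar>q k m x\<bar>) \<partial>?H)"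
    proof (rule nn_integral_mono)
      fix x show "ennreal \<bar>J m x\<bar> \<le> (\<Sum>k. ennreal \<bar>q k m x\<bar>)"
      proof (cases "x \<in> single_face o' m")
        case True
        then have "\<bar>J m x\<bar> \<le> (\<Sum>k. \<bar>q k m x\<bar>)" by (simp add: J_def summable_rabs qs)
        then show ?thesis by (subst suminf_ennreal2) (auto simp: qs[OF True] ennreal_leI)
      qed (simp add: J_def)
    qed
    also have "\<dots> = (\<Sum>k. \<integral>\<^sup>+x. ennreal \<bar>q k m x\<bar> \<partial>?H)" using qH by (intro nn_integral_suminf) auto
    also have "\<dots> \<le> (\<Sum>k. ennreal (?c * (2 * (2 * ?f / 2 ^ k))))"
    proof (intro suminf_le summableI)
      fix k
      have "(\<integral>\<^sup>+x. ennreal \<bar>q k m x\<bar> \<partial>?H) \<le> ennreal (2 * ?c * (LINT x|lborel. \<bar>step o' (L k) (h k) x\<bar>))"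
        unfolding q_def by (rule level_jump_hausdorff[OF fin])
      also have "\<dots> \<le> ennreal (?c * (2 * (2 * ?f / 2 ^ k)))"
        using mult_left_mono[OF s1[of k], of "2 * ?c"] c0 by (intro ennreal_leI) (simp add: mult_ac)
      finally show "(\<integral>\<^sup>+x. ennreal \<bar>q k m x\<bar> \<partial>?H) \<le> ennreal (?c * (2 * (2 * ?f / 2 ^ k)))" .
    qed
    also have "\<dots> = ennreal (\<Sum>k. ?c * (2 * (2 * ?f / 2 ^ k)))"
      using c0 f0 sums_summable[OF sums_mult[OF geo]] by (intro suminf_ennreal2) auto
    also have "(\<Sum>k. ?c * (2 * (2 * ?f / 2 ^ k))) = 8 * ?c * ?f"
      using sums_mult[OF geo, of ?c] by (simp add: sums_iff)
    finally show ?thesis .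
  qed
  have ibp: "(LINT x|lborel. v x * \<phi>' x $ m) =
      - (of_bool (j = m) * (LINT x|lborel. f x * \<phi> x) + (LINT x|slices m (grid o' m). \<phi> x * J m x))"
    if t: "test_fn \<phi> \<phi>'" for \<phi> \<phi>' m
  proof -
    obtain M where M: "M \<ge> 0" "\<And>x. \<bar>\<phi> x\<bar> \<le> M" using test_fn_props(3)[OF t] by blast
    have \<phi>m [measurable]: "\<phi> \<in> borel_measurable borel" by (rule test_fn_props(2)[OF t])
    have \<phi>i: "integrable lborel (\<lambda>x. \<phi>' x $ m)" by (rule test_fn_integrable[OF t])
    let ?S = "\<lambda>n x. \<Sum>k<n. step o' (L k) (h k) x"
    have Si: "integrable lborel (?S n)" for n by (intro Bochner_Integration.integrable_sum integrable_step fin)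
    have wi: "integrable lborel (\<lambda>x. w k x * \<phi>' x $ m)" for k
      by (rule integrable_bounded_mult[OF \<phi>i _ wb]) (use wm in simp)
    have si: "integrable lborel (\<lambda>x. step o' (L k) (h k) x * \<phi> x)" for k
    proof -
      have "integrable lborel (\<lambda>x. \<phi> x * step o' (L k) (h k) x)"
        by (rule integrable_bounded_mult[OF integrable_step[OF fin] _ M(2)]) simp
      then show ?thesis by (simp add: mult.commute)
    qed
    have fi: "integrable lborel (\<lambda>x. f x * \<phi> x)"
    proof -
      have "integrable lborel (\<lambda>x. \<phi> x * f x)" by (rule integrable_bounded_mult[OF f _ M(2)]) simp
      then show ?thesis by (simp add: mult.commute)
    qed
    have vi: "integrable lborel (\<lambda>x. v x * \<phi>' x $ m)"
      by (rule integrable_bounded_mult[OF \<phi>i _ vb]) (use vm in simp)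
    have qi': "integrable (slices m (grid o' m)) (\<lambda>x. \<phi> x * q k m x)" for k
      by (rule integrable_bounded_mult[OF qi(1) _ M(2)]) simp
    \<comment> \<open>The terms are dominated by \<open>K k\<close> times the modulus of an
      integrable derivative of \<phi>.\<close>
    have 1: "(\<lambda>n. \<Sum>k<n. LINT x|lborel. w k x * \<phi>' x $ m) \<longlonglongrightarrow> (LINT x|lborel. v x * \<phi>' x $ m)"
    proof -
      have "(\<lambda>k. LINT x|lborel. w k x * \<phi>' x $ m) sums (LINT x|lborel. (\<Sum>k. w k x * \<phi>' x $ m))"
      proof (rule sums_integral[OF wi])
        show "AE x in lborel. summable (\<lambda>k. norm (w k x * \<phi>' x $ m))"
        proof (intro AE_I2)
          fix x
          have "summable (\<lambda>k. \<bar>w k x\<bar>)" by (rule summable_comparison_test[OF _ Ksm]) (use wb in auto)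
          then show "summable (\<lambda>k. norm (w k x * \<phi>' x $ m))" by (simp add: abs_mult summable_mult2)
        qed
        show "summable (\<lambda>k. LINT x|lborel. norm (w k x * \<phi>' x $ m))"
        proof (rule summable_comparison_test[OF _ summable_mult2[OF Ksm, of "LINT x|lborel. \<bar>\<phi>' x $ m\<bar>"]], intro exI allI impI)
          fix k
          have "(LINT x|lborel. norm (w k x * \<phi>' x $ m)) \<le> (LINT x|lborel. K k * \<bar>\<phi>' x $ m\<bar>)"
            using wb by (intro integral_mono integrable_norm wi integrable_mult_right integrable_abs \<phi>i)
              (auto simp: abs_mult intro!: mult_right_mono)
          then show "norm (LINT x|lborel. norm (w k x * \<phi>' x $ m)) \<le> K k * (LINT x|lborel. \<bar>\<phi>' x $ m\<bar>)"
            by (simp add: Bochner_Integration.integral_nonneg)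
        qed
      qed
      moreover have "(\<Sum>k. w k x * \<phi>' x $ m) = v x * \<phi>' x $ m" for x
        unfolding v_def by (rule suminf_mult2[OF wsum, symmetric])
      ultimately show ?thesis by (simp add: sums_def)
    qed
    have 2: "(\<lambda>n. \<Sum>k<n. LINT x|slices m (grid o' m). \<phi> x * q k m x) \<longlonglongrightarrow> (LINT x|slices m (grid o' m). \<phi> x * J m x)"
    proof -
      have "(\<lambda>k. LINT x|slices m (grid o' m). \<phi> x * q k m x) sums (LINT x|slices m (grid o' m). (\<Sum>k. \<phi> x * q k m x))"
      proof (rule sums_integral[OF qi'])
        show "AE x in slices m (grid o' m). summable (\<lambda>k. norm (\<phi> x * q k m x))"
          using AEqs[of m] by eventually_elim (simp add: abs_mult summable_mult)
        show "summable (\<lambda>k. LINT x|slices m (grid o' m). norm (\<phi> x * q k m x))"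
        proof (rule summable_comparison_test[OF _ summable_mult[OF sumq, of M]], intro exI allI impI)
          fix k
          have "(LINT x|slices m (grid o' m). norm (\<phi> x * q k m x)) \<le> (LINT x|slices m (grid o' m). M * \<bar>q k m x\<bar>)"
            using M(2) by (intro integral_mono integrable_norm qi' integrable_mult_right integrable_abs qi)
              (auto simp: abs_mult intro!: mult_right_mono)
          then show "norm (LINT x|slices m (grid o' m). norm (\<phi> x * q k m x)) \<le> M * (LINT x|slices m (grid o' m). \<bar>q k m x\<bar>)"
            by (simp add: Bochner_Integration.integral_nonneg)
        qed
      qed
      moreover have "(LINT x|slices m (grid o' m). (\<Sum>k. \<phi> x * q k m x)) = (LINT x|slices m (grid o' m). \<phi> x * J m x)"
      proof (rule integral_cong_AE)
        show "AE x in slices m (grid o' m). (\<Sum>k. \<phi> x * q k m x) = \<phi> x * J m x"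
          using AE_single_face[of o' m]
          by eventually_elim (simp add: J_def suminf_mult[OF summable_rabs_cancel[OF qs]])
      qed (use Jm[of m] in measurable)
      ultimately show ?thesis by (simp add: sums_def)
    qed
    \<comment> \<open>The remainders of the step series tend to 0 in L^1, and \<phi> is
      bounded.\<close>
    have 3: "(\<lambda>n. \<Sum>k<n. LINT x|lborel. step o' (L k) (h k) x * \<phi> x) \<longlonglongrightarrow> (LINT x|lborel. f x * \<phi> x)"
    proof -
      have b: "\<bar>(LINT x|lborel. f x * \<phi> x) - (\<Sum>k<n. LINT x|lborel. step o' (L k) (h k) x * \<phi> x)\<bar> \<le> M * ?f * (1/2) ^ n" for n
      proof -
        have i1: "integrable lborel (\<lambda>x. \<phi> x * (f x - ?S n x))"
          by (rule integrable_bounded_mult[OF _ _ M(2)]) (use f Si in simp_all)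
        have "(LINT x|lborel. f x * \<phi> x) - (\<Sum>k<n. LINT x|lborel. step o' (L k) (h k) x * \<phi> x) =
           (LINT x|lborel. f x * \<phi> x) - (LINT x|lborel. (\<Sum>k<n. step o' (L k) (h k) x * \<phi> x))"
          using si by (subst Bochner_Integration.integral_sum) auto
        also have "\<dots> = (LINT x|lborel. f x * \<phi> x - (\<Sum>k<n. step o' (L k) (h k) x * \<phi> x))"
          using si by (intro Bochner_Integration.integral_diff[symmetric] fi Bochner_Integration.integrable_sum)
        also have "\<dots> = (LINT x|lborel. \<phi> x * (f x - ?S n x))" by (simp add: algebra_simps sum_distrib_left)
        finally have "\<bar>(LINT x|lborel. f x * \<phi> x) - (\<Sum>k<n. LINT x|lborel. step o' (L k) (h k) x * \<phi> x)\<bar> =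
          \<bar>LINT x|lborel. \<phi> x * (f x - ?S n x)\<bar>" by simp
        also have "\<dots> \<le> (LINT x|lborel. \<bar>\<phi> x * (f x - ?S n x)\<bar>)" by (rule integral_abs_bound)
        also have "\<dots> \<le> (LINT x|lborel. M * \<bar>f x - ?S n x\<bar>)"
          using M(2) f Si by (intro integral_mono integrable_abs i1 integrable_mult_right Bochner_Integration.integrable_diff)
            (auto simp: abs_mult intro!: mult_right_mono)
        also have "\<dots> \<le> M * (?f / 2 ^ n)" using mult_left_mono[OF s2 M(1), of n] by simp
        finally show ?thesis by (simp add: power_one_over)
      qed
      have "(\<lambda>n. M * ?f * (1/2) ^ n) \<longlonglongrightarrow> M * ?f * 0" by (intro tendsto_mult tendsto_const LIMSEQ_power_zero) simp
      then have z: "(\<lambda>n. M * ?f * (1/2) ^ n) \<longlonglongrightarrow> 0" by simp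
      have "(\<lambda>n. (LINT x|lborel. f x * \<phi> x) - (\<Sum>k<n. LINT x|lborel. step o' (L k) (h k) x * \<phi> x)) \<longlonglongrightarrow> 0"
        by (rule tendsto_0_le[OF z, where K=1]) (use b in \<open>auto intro!: always_eventually order_trans[OF _ abs_ge_self]\<close>)
      from tendsto_diff[OF tendsto_const this, of "LINT x|lborel. f x * \<phi> x"] show ?thesis by simp
    qed
    have "(\<lambda>n. \<Sum>k<n. LINT x|lborel. w k x * \<phi>' x $ m) =
       (\<lambda>n. - (of_bool (j = m) * (\<Sum>k<n. LINT x|lborel. step o' (L k) (h k) x * \<phi> x) +
          (\<Sum>k<n. LINT x|slices m (grid o' m). \<phi> x * q k m x)))"
      unfolding w_def q_def
      by (simp add: level_integration_by_parts[OF fin t] sum_negf sum.distrib sum_distrib_left sum_subtractf)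
    moreover have "\<dots> \<longlonglongrightarrow> - (of_bool (j = m) * (LINT x|lborel. f x * \<phi> x) + (LINT x|slices m (grid o' m). \<phi> x * J m x))"
      by (intro tendsto_minus tendsto_add tendsto_mult tendsto_const 2 3)
    ultimately show ?thesis by (intro LIMSEQ_unique[OF 1]) (simp only:)
  qed
  show ?thesis
    unfolding corrector_def
    by (intro exI[of _ v] exI[of _ J] conjI allI impI ballI vm vb vc Jm sides Ji Jn JH ibp) auto
qed

section \<open>Generic grids\<close>

text \<open>The image of a finite measure under a coordinate has at most countably many atoms. The
  Jordan parts are treated separately, because a signed measure may vanish on a hyperplane by
  cancellation and still charge its subsets.\<close>

lemma AE_hyperplane_not_charged:
  fixes \<mu> :: "(real^'n) set \<Rightarrow> 'b::euclidean_space" and m :: 'n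
  assumes \<Omega>: "\<Omega> \<in> sets borel" and \<mu>: "\<mu> \<in> radon_measures \<Omega>"
  shows "AE c in lborel. \<forall>B\<in>borel_on \<Omega>. B \<subseteq> {x. x $ m = c} \<longrightarrow> \<mu> B = 0"
proof -
  have fin: "AE c in lborel. \<forall>B\<in>borel_on \<Omega>. B \<subseteq> {x. x $ m = c} \<longrightarrow> measure M B = 0"
    if M: "finite_measure M" "sets M = borel_on \<Omega>" for M
  proof -
    interpret M: finite_measure M by (rule M)
    have sp: "space M = \<Omega>" using sets_eq_imp_space_eq[OF M(2)] by (simp add: space_restrict_space)
    have X: "(\<lambda>x. x $ m) \<in> borel_measurable M"
      unfolding measurable_cong_sets[OF M(2) refl] by (intro measurable_restrict_space1 vec_nth_measurable)
    have "finite_measure (distr M borel (\<lambda>x. x $ m))" by (rule M.finite_measure_distr[OF X])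
    then have "countable {c. measure (distr M borel (\<lambda>x. x $ m)) {c} \<noteq> 0}" by (rule finite_measure.countable_support)
    then have "{c. measure (distr M borel (\<lambda>x. x $ m)) {c} \<noteq> 0} \<in> null_sets lborel" by (rule countable_imp_null_set_lborel)
    from AE_not_in[OF this] show ?thesis
    proof eventually_elim
      case (elim c)
      show ?case
      proof (intro ballI impI)
        fix B assume B: "B \<in> borel_on \<Omega>" "B \<subseteq> {x. x $ m = c}"
        have "measure M B \<le> measure M ((\<lambda>x. x $ m) -` {c} \<inter> space M)"
          using B M(2) sets.sets_into_space[of B M] by (intro M.finite_measure_mono) (auto intro!: measurable_sets[OF X])
        also have "\<dots> = 0" using elim measure_distr[OF X, of "{c}"] by simp
        finally show "measure M B = 0" using measure_nonneg[of M B] by linarith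
      qed
    qed
  qed
  have "AE c in lborel. \<forall>B\<in>borel_on \<Omega>. B \<subseteq> {x. x $ m = c} \<longrightarrow> \<mu> B \<bullet> b = 0" for b
  proof -
    note J = Jordan_decomposition[OF radon_measures_restrict_inner[OF \<mu>, of b]]
    show ?thesis using fin[OF J(3,1)] fin[OF J(4,2)]
      by eventually_elim (use J(5) in auto)
  qed
  then have "AE c in lborel. \<forall>b\<in>Basis. \<forall>B\<in>borel_on \<Omega>. B \<subseteq> {x. x $ m = c} \<longrightarrow> \<mu> B \<bullet> b = 0"
    by (subst AE_ball_countable) (auto intro: countable_finite)
  then show ?thesis
  proof eventually_elim
    case (elim c)
    show ?case
    proof (intro ballI impI)
      fix B assume B: "B \<in> borel_on \<Omega>" "B \<subseteq> {x. x $ m = c}"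
      show "\<mu> B = 0"
      proof (rule euclidean_eqI)
        fix b :: 'b assume "b \<in> Basis"
        then show "\<mu> B \<bullet> b = 0 \<bullet> b" using elim[THEN bspec, THEN bspec, OF _ B(1)] B(2) by simp
      qed
    qed
  qed
qed

text \<open>Every grid level is s plus a dyadic number, so a single real s has to avoid only
  countably many translates of null sets.\<close>

lemma generic_offset:
  fixes P :: "'n::finite \<Rightarrow> real \<Rightarrow> bool"
  assumes P: "\<And>m. AE c in lborel. P m c"
  shows "\<exists>s. \<forall>m. \<forall>c\<in>grid (vec s) m. P m c"
proof -
  have tr: "AE s in lborel. P m (s + t)" for m t
  proof -
    obtain N where N: "{c. \<not> P m c} \<subseteq> N" "N \<in> null_sets lborel" using AE_E[OF P[of m]] by (auto simp: null_sets_def)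
    have "{s. s - (- t) \<in> N} \<in> null_sets lborel" by (rule null_sets_translation[OF N(2)])
    from AE_not_in[OF this] show ?thesis by eventually_elim (use N(1) in auto)
  qed
  have "AE s in lborel. \<forall>m\<in>UNIV. \<forall>p\<in>UNIV. P m (s + of_int (fst (p::int \<times> nat)) / 2 ^ snd p)"
  proof (rule AE_finite_allI[OF finite])
    fix m
    show "AE s in lborel. \<forall>p\<in>UNIV. P m (s + of_int (fst (p::int \<times> nat)) / 2 ^ snd p)"
      using tr by (subst AE_ball_countable) auto
  qed
  moreover have "ae_filter (lborel :: real measure) \<noteq> bot" by (simp add: ae_filter_eq_bot_iff)
  ultimately obtain s where "\<forall>m\<in>UNIV. \<forall>p\<in>UNIV. P m (s + of_int (fst (p::int \<times> nat)) / 2 ^ snd p)"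
    using eventually_happens' by blast
  then have "\<forall>m. \<forall>c\<in>grid (vec s) m. P m c" unfolding grid_def by force
  then show ?thesis ..
qed

text \<open>If all coordinates of the offset agree, then the points with two grid coordinates lie in a
  null set that does not depend on the offset.\<close>

definition diagonals :: "(real^'n) set" where
  "diagonals = (\<Union>i. \<Union>m\<in>-{i}. \<Union>p::int \<times> nat. {x. x $ i - x $ m = of_int (fst p) / 2 ^ snd p})"

lemma diagonals_null: "diagonals \<in> null_sets (lborel :: (real^'n) measure)"
proof -
  have "{x::real^'n. x $ i - x $ m = t} \<in> null_sets lborel" if "m \<noteq> i" for i m t
  proof -
    have "axis i 1 - axis m 1 \<noteq> (0::real^'n)" using that by (auto simp: vec_eq_iff axis_def)
    from null_sets_hyperplane[OF this, of t] show ?thesis by (simp add: inner_diff_left inner_axis')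
  qed
  then show ?thesis unfolding diagonals_def
    by (intro null_sets_UN' countableI_type) auto
qed

lemma not_diagonals_single_face:
  assumes x: "x \<notin> diagonals" "x $ m \<in> grid (vec s) m" shows "x \<in> single_face (vec s) m"
proof (rule ccontr)
  assume "x \<notin> single_face (vec s) m"
  then obtain i where i: "i \<noteq> m" "x $ i \<in> grid (vec s) i" by (auto simp: single_face_def)
  obtain z L where 1: "x $ i = s + of_int z / 2 ^ L" using i(2) by (auto simp: grid_def)
  obtain w M where 2: "x $ m = s + of_int w / 2 ^ M" using x(2) by (auto simp: grid_def)
  have "x $ i - x $ m = of_int (z * 2 ^ M - w * 2 ^ L) / 2 ^ (L + M)" unfolding 1 2 by (simp add: field_simps power_add)
  then have "x \<in> {x. x $ i - x $ m = of_int (fst (z * 2 ^ M - w * 2 ^ L, L + M)) / 2 ^ snd (z * 2 ^ M - w * 2 ^ L, L + M)}" by simp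
  then have "x \<in> diagonals" unfolding diagonals_def using i(1)
    by (intro UN_I[of i] UN_I[of m] UN_I[of "(z * 2 ^ M - w * 2 ^ L, L + M)"]) auto
  with x(1) show False ..
qed

section \<open>Vector-valued correctors\<close>

definition vector_corrector ::
    "real^'n \<Rightarrow> real \<Rightarrow> (real^'n \<Rightarrow> real^'n^'d) \<Rightarrow> (real^'n \<Rightarrow> real^'d) \<Rightarrow> ('n \<Rightarrow> real^'n \<Rightarrow> real^'d) \<Rightarrow> bool" where
  "vector_corrector o' \<epsilon> F v J \<longleftrightarrow> v \<in> borel_measurable borel \<and> (\<forall>x. norm (v x) \<le> \<epsilon>) \<and>
     (\<forall>x. (\<forall>i. x $ i \<notin> grid o' i) \<longrightarrow> isCont v x) \<and>
     (\<forall>m. J m \<in> borel_measurable borel \<and>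
        (\<forall>x\<in>single_face o' m. side_limit v x (axis m 1) (v x) \<and> side_limit v x (- axis m 1) (v x - J m x)) \<and>
        integrable (slices m (grid o' m)) (J m) \<and>
        (LINT x|slices m (grid o' m). norm (J m x)) \<le> 8 * CARD('n) * CARD('d) * (LINT x|lborel. norm (F x)) \<and>
        (\<integral>\<^sup>+x. ennreal (norm (J m x)) \<partial>hausdorff_measure (CARD('n) - 1)) \<le>
           ennreal (8 * CARD('n) * CARD('d) * hausdorff_const (CARD('n) - 1) * (LINT x|lborel. norm (F x))) \<and>
        (\<forall>\<phi> \<phi>' i. test_fn \<phi> \<phi>' \<longrightarrow> (LINT x|lborel. v x $ i * \<phi>' x $ m) =
           - ((LINT x|lborel. F x $ i $ m * \<phi> x) + (LINT x|slices m (grid o' m). \<phi> x * J m x $ i))))"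

lemma side_limit_vecI:
  fixes v :: "'a::euclidean_space \<Rightarrow> real^'d"
  shows "(\<And>i. side_limit (\<lambda>y. v y $ i) x \<nu> (c $ i)) \<Longrightarrow> side_limit v x \<nu> c"
  unfolding side_limit_tendsto by (rule vec_tendstoI)

lemma integrable_vecI:
  fixes f :: "'a \<Rightarrow> 'b::euclidean_space^'d"
  assumes "\<And>i. integrable M (\<lambda>x. f x $ i)" shows "integrable M f"
proof -
  have "linear (axis i :: 'b \<Rightarrow> 'b^'d)" for i by (simp add: linear_iff axis_def vec_eq_iff)
  then have bl: "bounded_linear (axis i :: 'b \<Rightarrow> 'b^'d)" for i by (simp add: linear_conv_bounded_linear)
  have "integrable M (\<lambda>x. axis i (f x $ i) :: 'b^'d)" for i by (rule integrable_bounded_linear[OF bl assms])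
  then have "integrable M (\<lambda>x. \<Sum>i\<in>UNIV. axis i (f x $ i) :: 'b^'d)" by (rule Bochner_Integration.integrable_sum)
  moreover have "(\<lambda>x. \<Sum>i\<in>UNIV. axis i (f x $ i)) = f"
    by (intro ext) (simp add: vec_eq_iff axis_def if_distrib cong: if_cong)
  ultimately show ?thesis by (simp only:)
qed

lemma borel_measurable_vecI:
  fixes f :: "'a \<Rightarrow> real^'d"
  assumes "\<And>i. (\<lambda>x. f x $ i) \<in> borel_measurable M" shows "f \<in> borel_measurable M"
  unfolding borel_measurable_euclidean_space[of f] using assms by (auto simp: Basis_vec_def inner_axis)

text \<open>One scalar corrector per entry, with \<epsilon> divided by the number of entries. Entry
  (i, j) has a diffuse derivative in direction j only, so summing over j gives row i of
  \<open>F\<close>. Each entry is bounded by the norm of \<open>F\<close>, and adding them all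
  yields the factor \<open>CARD('n) * CARD('d)\<close>.\<close>

lemma vector_corrector_exists:
  fixes F :: "real^'n \<Rightarrow> real^'n^'d"
  assumes F: "integrable lborel F" and \<epsilon>: "\<epsilon> > 0"
  shows "\<exists>v J. vector_corrector o' \<epsilon> F v J"
proof -
  let ?H = "hausdorff_measure (CARD('n) - 1) :: (real^'n) measure" and ?c = "hausdorff_const (CARD('n) - 1)"
  let ?N = "real CARD('n)" and ?D = "real CARD('d)" and ?F = "LINT x|lborel. norm (F x)"
  have N: "?N > 0" "?D > 0" by simp_all
  have bl: "bounded_linear (\<lambda>A::real^'n^'d. A $ i $ j)" for i j
    by (intro bounded_linear_compose[OF bounded_linear_vec_nth bounded_linear_vec_nth])
  have Fi: "integrable lborel (\<lambda>x. F x $ i $ j)" for i j by (rule integrable_bounded_linear[OF bl F])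
  have Fn: "(LINT x|lborel. \<bar>F x $ i $ j\<bar>) \<le> ?F" for i j
  proof (intro integral_mono integrable_abs Fi integrable_norm F)
    fix x show "\<bar>F x $ i $ j\<bar> \<le> norm (F x)"
      using component_le_norm_cart[of "F x $ i" j] Finite_Cartesian_Product.norm_nth_le[of "F x" i] by linarith
  qed
  have F0: "?F \<ge> 0" by (intro Bochner_Integration.integral_nonneg) simp
  have "\<epsilon> / (?N * ?D) > 0" using \<epsilon> by simp
  then have "\<forall>i j. \<exists>p. corrector o' (\<epsilon> / (?N * ?D)) j (\<lambda>x. F x $ i $ j) (fst p) (snd p)"
    using corrector_exists[OF Fi] by fastforce
  then have "\<exists>p. \<forall>i j. corrector o' (\<epsilon> / (?N * ?D)) j (\<lambda>x. F x $ i $ j) (fst (p i j)) (snd (p i j))"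
    by (intro choice allI) (auto intro: choice)
  then obtain p where p: "\<forall>i j. corrector o' (\<epsilon> / (?N * ?D)) j (\<lambda>x. F x $ i $ j) (fst (p i j)) (snd (p i j))" by (elim exE) (rule that)
  define V where "V i j = fst (p i j)" for i j
  define Q where "Q i j = snd (p i j)" for i j
  have "corrector o' (\<epsilon> / (?N * ?D)) j (\<lambda>x. F x $ i $ j) (V i j) (Q i j)" for i j using p by (simp add: V_def Q_def)
  then have Vm [measurable]: "V i j \<in> borel_measurable borel" and Vb: "\<bar>V i j x\<bar> \<le> \<epsilon> / (?N * ?D)"
    and Vc: "(\<forall>i. x $ i \<notin> grid o' i) \<Longrightarrow> isCont (V i j) x"
    and Qm [measurable]: "Q i j m \<in> borel_measurable borel"
    and Qs: "x \<in> single_face o' m \<Longrightarrow> side_limit (V i j) x (axis m 1) (V i j x)"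
      "x \<in> single_face o' m \<Longrightarrow> side_limit (V i j) x (- axis m 1) (V i j x - Q i j m x)"
    and Qi: "integrable (slices m (grid o' m)) (Q i j m)"
    and Qn: "(LINT x|slices m (grid o' m). \<bar>Q i j m x\<bar>) \<le> 8 * (LINT x|lborel. \<bar>F x $ i $ j\<bar>)"
    and QH: "(\<integral>\<^sup>+x. ennreal \<bar>Q i j m x\<bar> \<partial>?H) \<le> ennreal (8 * ?c * (LINT x|lborel. \<bar>F x $ i $ j\<bar>))"
    and ibp: "test_fn \<phi> \<phi>' \<Longrightarrow> (LINT x|lborel. V i j x * \<phi>' x $ m) =
           - (of_bool (j = m) * (LINT x|lborel. F x $ i $ j * \<phi> x) + (LINT x|slices m (grid o' m). \<phi> x * Q i j m x))"
    for i j m x \<phi> \<phi>'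
    unfolding corrector_def by blast+
  define v where "v x = (\<chi> i. \<Sum>j\<in>UNIV. V i j x)" for x
  define J where "J m x = (\<chi> i. \<Sum>j\<in>UNIV. Q i j m x)" for m x
  have vi: "v x $ i = (\<Sum>j\<in>UNIV. V i j x)" and Ji: "J m x $ i = (\<Sum>j\<in>UNIV. Q i j m x)" for x m i
    by (simp_all add: v_def J_def)
  have vm: "v \<in> borel_measurable borel" by (rule borel_measurable_vecI) (simp add: vi)
  have Jm: "J m \<in> borel_measurable borel" for m by (rule borel_measurable_vecI) (simp add: Ji)
  have vb: "norm (v x) \<le> \<epsilon>" for x
  proof -
    have "norm (v x) \<le> (\<Sum>i\<in>UNIV. \<bar>v x $ i\<bar>)" by (rule norm_le_l1_cart)
    also have "\<dots> \<le> (\<Sum>i\<in>(UNIV::'d set). \<Sum>j\<in>(UNIV::'n set). \<epsilon> / (?N * ?D))"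
      unfolding vi by (intro sum_mono order_trans[OF sum_abs] Vb)
    also have "\<dots> = \<epsilon>" using N by simp
    finally show ?thesis .
  qed
  have vc: "isCont v x" if "\<forall>i. x $ i \<notin> grid o' i" for x
    unfolding isCont_def using Vc[OF that]
    by (intro vec_tendstoI) (auto simp: vi isCont_def intro!: tendsto_sum)
  have sides: "side_limit v x (axis m 1) (v x)" "side_limit v x (- axis m 1) (v x - J m x)" if "x \<in> single_face o' m" for x m
  proof -
    show "side_limit v x (axis m 1) (v x)" by (intro side_limit_vecI) (simp add: vi side_limit_sum Qs that)
    show "side_limit v x (- axis m 1) (v x - J m x)"
    proof (intro side_limit_vecI)
      fix i
      have "side_limit (\<lambda>y. \<Sum>j\<in>UNIV. V i j y) x (- axis m 1) (\<Sum>j\<in>UNIV. V i j x - Q i j m x)"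
        by (intro side_limit_sum Qs(2) that)
      then show "side_limit (\<lambda>y. v y $ i) x (- axis m 1) ((v x - J m x) $ i)" by (simp add: vi Ji sum_subtractf)
    qed
  qed
  have Jint: "integrable (slices m (grid o' m)) (J m)" for m
    by (intro integrable_vecI) (simp add: Ji Qi)
  have nJ: "norm (J m x) \<le> (\<Sum>i\<in>UNIV. \<Sum>j\<in>UNIV. \<bar>Q i j m x\<bar>)" for m x
    by (rule order_trans[OF norm_le_l1_cart]) (auto simp: Ji intro!: sum_mono sum_abs)
  have Jn: "(LINT x|slices m (grid o' m). norm (J m x)) \<le> 8 * CARD('n) * CARD('d) * ?F" for m
  proof -
    have "(LINT x|slices m (grid o' m). norm (J m x)) \<le> (LINT x|slices m (grid o' m). (\<Sum>i\<in>UNIV. \<Sum>j\<in>UNIV. \<bar>Q i j m x\<bar>))"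
      by (intro integral_mono integrable_norm Jint Bochner_Integration.integrable_sum integrable_abs Qi nJ)
    also have "\<dots> = (\<Sum>i\<in>UNIV. \<Sum>j\<in>UNIV. LINT x|slices m (grid o' m). \<bar>Q i j m x\<bar>)"
      using Qi by (simp add: Bochner_Integration.integral_sum)
    also have "\<dots> \<le> (\<Sum>i\<in>(UNIV::'d set). \<Sum>j\<in>(UNIV::'n set). 8 * ?F)"
      using Fn by (intro sum_mono order_trans[OF Qn] mult_left_mono) auto
    finally show ?thesis by (simp add: mult_ac)
  qed
  have JH: "(\<integral>\<^sup>+x. ennreal (norm (J m x)) \<partial>?H) \<le> ennreal (8 * CARD('n) * CARD('d) * ?c * ?F)" for m
  proof -
    have c0: "?c \<ge> 0" by (rule hausdorff_const_nonneg)
    have qH: "Q i j m \<in> borel_measurable ?H" for i j using Qm[of i j m] by (simp cong: measurable_cong_sets)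
    have "(\<integral>\<^sup>+x. ennreal (norm (J m x)) \<partial>?H) \<le> (\<integral>\<^sup>+x. (\<Sum>i\<in>UNIV. \<Sum>j\<in>UNIV. ennreal \<bar>Q i j m x\<bar>) \<partial>?H)"
    proof (rule nn_integral_mono)
      fix x
      have "(\<Sum>i\<in>UNIV. \<Sum>j\<in>UNIV. ennreal \<bar>Q i j m x\<bar>) = ennreal (\<Sum>i\<in>UNIV. \<Sum>j\<in>UNIV. \<bar>Q i j m x\<bar>)"
        by (simp add: sum_nonneg)
      then show "ennreal (norm (J m x)) \<le> (\<Sum>i\<in>UNIV. \<Sum>j\<in>UNIV. ennreal \<bar>Q i j m x\<bar>)"
        using nJ[of m x] by (simp add: ennreal_leI)
    qed
    also have "\<dots> = (\<Sum>i\<in>UNIV. \<Sum>j\<in>UNIV. \<integral>\<^sup>+x. ennreal \<bar>Q i j m x\<bar> \<partial>?H)"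
      using qH by (simp add: nn_integral_sum del: sum_ennreal)
    also have "\<dots> \<le> (\<Sum>i\<in>(UNIV::'d set). \<Sum>j\<in>(UNIV::'n set). ennreal (8 * ?c * ?F))"
      using Fn c0 by (intro sum_mono order_trans[OF QH] ennreal_leI mult_left_mono) auto
    also have "\<dots> = ennreal (\<Sum>i\<in>(UNIV::'d set). \<Sum>j\<in>(UNIV::'n set). 8 * ?c * ?F)"
      using c0 F0 by (simp add: sum_nonneg del: sum_constant)
    finally show ?thesis by (simp add: mult_ac)
  qed
  have vibp: "(LINT x|lborel. v x $ i * \<phi>' x $ m) =
      - ((LINT x|lborel. F x $ i $ m * \<phi> x) + (LINT x|slices m (grid o' m). \<phi> x * J m x $ i))"
    if t: "test_fn \<phi> \<phi>'" for \<phi> \<phi>' i m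
  proof -
    obtain M where M: "\<And>x. \<bar>\<phi> x\<bar> \<le> M" using test_fn_props(3)[OF t] by blast
    have [measurable]: "\<phi> \<in> borel_measurable borel" by (rule test_fn_props(2)[OF t])
    have a: "integrable lborel (\<lambda>x. V i j x * \<phi>' x $ m)" for j
      by (rule integrable_bounded_mult[OF test_fn_integrable[OF t] _ Vb]) simp
    have b: "integrable (slices m (grid o' m)) (\<lambda>x. \<phi> x * Q i j m x)" for j
      by (rule integrable_bounded_mult[OF Qi _ M]) simp
    have "(LINT x|lborel. v x $ i * \<phi>' x $ m) = (\<Sum>j\<in>UNIV. LINT x|lborel. V i j x * \<phi>' x $ m)"
      using a by (simp add: vi sum_distrib_right Bochner_Integration.integral_sum)
    also have "\<dots> = - ((\<Sum>j\<in>UNIV. of_bool (j = m) * (LINT x|lborel. F x $ i $ j * \<phi> x)) +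
        (\<Sum>j\<in>UNIV. LINT x|slices m (grid o' m). \<phi> x * Q i j m x))"
      by (simp only: ibp[OF t] sum_negf sum.distrib)
    also have "(\<Sum>j\<in>UNIV. of_bool (j = m) * (LINT x|lborel. F x $ i $ j * \<phi> x)) = (LINT x|lborel. F x $ i $ m * \<phi> x)"
      by (simp add: of_bool_def if_distrib[where f="\<lambda>c. c * _"] cong: if_cong)
    also have "(\<Sum>j\<in>UNIV. LINT x|slices m (grid o' m). \<phi> x * Q i j m x) = (LINT x|slices m (grid o' m). \<phi> x * J m x $ i)"
      using b by (simp add: Ji sum_distrib_left Bochner_Integration.integral_sum)
    finally show ?thesis .
  qed
  show ?thesis
    unfolding vector_corrector_def
    by (intro exI[of _ v] exI[of _ J] conjI allI impI ballI vm vb vc Jm sides Jint Jn JH vibp) auto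
qed

text \<open>Subadditivity for an arbitrary first summand, which will be the jump energy density of
  \<open>g\<close>. A finite simple function below f + h, diminished by h, lies below f, and the
  integral is a supremum over such simple functions.\<close>

lemma nn_integral_add_le:
  assumes h: "h \<in> borel_measurable M"
  shows "(\<integral>\<^sup>+x. f x + h x \<partial>M) \<le> (\<integral>\<^sup>+x. f x \<partial>M) + (\<integral>\<^sup>+x. h x \<partial>M)"
  unfolding nn_integral_def_finite[of M "\<lambda>x. f x + h x"]
proof (intro SUP_least)
  fix s assume "s \<in> {g. simple_function M g \<and> g \<le> (\<lambda>x. f x + h x) \<and> (\<forall>x. g x < top)}"
  then have s: "simple_function M s" "\<And>x. s x \<le> f x + h x" "\<And>x. s x < top" by (auto simp: le_fun_def)
  have sm: "s \<in> borel_measurable M" using s(1) by (rule borel_measurable_simple_function)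
  have "integral\<^sup>S M s = integral\<^sup>N M s" using s(1) by (rule nn_integral_eq_simple_integral[symmetric])
  also have "\<dots> \<le> (\<integral>\<^sup>+x. (s x - h x) + h x \<partial>M)" 
  proof (intro nn_integral_mono)
    fix x show "s x \<le> (s x - h x) + h x"
      by (cases "h x \<le> s x") (auto simp: diff_add_cancel_ennreal intro: add_increasing)
  qed
  also have "\<dots> = (\<integral>\<^sup>+x. s x - h x \<partial>M) + (\<integral>\<^sup>+x. h x \<partial>M)" using sm h by (intro nn_integral_add) auto
  also have "(\<integral>\<^sup>+x. s x - h x \<partial>M) \<le> (\<integral>\<^sup>+x. f x \<partial>M)"
  proof (intro nn_integral_mono)
    fix x show "s x - h x \<le> f x" using s(2,3)[of x] by (auto simp: ennreal_minus_le_iff add.commute)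
  qed
  finally show "integral\<^sup>S M s \<le> (\<integral>\<^sup>+x. f x \<partial>M) + (\<integral>\<^sup>+x. h x \<partial>M)" by (simp add: add_right_mono)
qed

section \<open>Correcting the absolutely continuous gradient\<close>

lemma radon_measures_vecI:
  fixes \<mu> :: "'a::euclidean_space set \<Rightarrow> 'b::euclidean_space^'d"
  assumes "\<And>i. (\<lambda>B. \<mu> B $ i) \<in> radon_measures \<Omega>" shows "\<mu> \<in> radon_measures \<Omega>"
proof (rule radon_measuresI)
  show "\<mu> B = 0" if "B \<notin> borel_on \<Omega>" for B
    using radon_measuresD(1)[OF assms that] by (simp add: vec_eq_iff)
  show "(\<lambda>i. \<mu> (A i)) sums \<mu> (\<Union>i. A i)" if "range A \<subseteq> borel_on \<Omega>" "disjoint_family A" for A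
    using radon_measuresD(2)[OF assms that] unfolding sums_def by (intro vec_tendstoI) simp
qed

lemma L1_set_integrable:
  assumes \<Omega>: "\<Omega> \<in> sets borel" and f: "f \<in> L1 \<Omega>" and B: "B \<in> borel_on \<Omega>"
  shows "set_integrable lebesgue B f"
proof -
  have "B \<in> sets lebesgue" "B \<subseteq> \<Omega>" using B by (auto simp: borel_on_iff[OF \<Omega>])
  moreover have "set_integrable lebesgue \<Omega> f" using f by (simp add: L1_lebesgue[OF \<Omega>] set_integrable_def)
  ultimately show ?thesis by (meson set_integrable_subset)
qed

lemma L1_measure_add:
  assumes \<Omega>: "\<Omega> \<in> sets borel" and f: "f \<in> L1 \<Omega>" and h: "h \<in> L1 \<Omega>"
  shows "L1_measure \<Omega> (\<lambda>x. f x + h x) B = L1_measure \<Omega> f B + L1_measure \<Omega> h B"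
  using set_integral_add(2)[OF L1_set_integrable[OF \<Omega> f] L1_set_integrable[OF \<Omega> h]]
  by (simp add: L1_measure_def)

lemma L1_measure_cong_AE:
  assumes \<Omega>: "\<Omega> \<in> sets borel" and f: "f \<in> L1 \<Omega>" and h: "h \<in> L1 \<Omega>"
    and eq: "AE x in lebesgue. x \<in> \<Omega> \<longrightarrow> f x = h x"
  shows "L1_measure \<Omega> f = L1_measure \<Omega> h"
proof
  fix B
  show "L1_measure \<Omega> f B = L1_measure \<Omega> h B"
  proof (cases "B \<in> borel_on \<Omega>")
    case True
    have B: "B \<subseteq> \<Omega>" using True by (auto simp: borel_on_iff[OF \<Omega>])
    have ae: "AE x in lebesgue. indicator B x *\<^sub>R f x = indicator B x *\<^sub>R h x"
      using eq by eventually_elim (use B in \<open>auto simp: indicator_def\<close>)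
    show ?thesis
      using L1_set_integrable[OF \<Omega> f True] L1_set_integrable[OF \<Omega> h True] True
      unfolding L1_measure_def set_lebesgue_integral_def set_integrable_def
      by (auto intro!: integral_cong_AE ae borel_measurable_integrable)
  qed (simp add: L1_measure_def)
qed

lemma L1_add:
  assumes "\<Omega> \<in> sets borel" "f \<in> L1 \<Omega>" "h \<in> L1 \<Omega>" shows "(\<lambda>x. f x + h x) \<in> L1 \<Omega>"
  using assms by (simp add: L1_def)

lemma deriv_measure_BV: "open \<Omega> \<Longrightarrow> u \<in> BV \<Omega> \<Longrightarrow> is_deriv_measure \<Omega> u (deriv_measure \<Omega> u)"
  using deriv_measure_eq unfolding BV_def by force

lemma radon_measures_comp:
  fixes \<mu> :: "'a::euclidean_space set \<Rightarrow> real^'n^'d"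
  assumes "\<mu> \<in> radon_measures \<Omega>" shows "(\<lambda>B. \<mu> B $ i $ j) \<in> radon_measures \<Omega>"
  by (rule radon_measures_linear[where T="\<lambda>A. A $ i $ j", OF assms])
    (intro bounded_linear_compose[OF bounded_linear_vec_nth bounded_linear_vec_nth])

text \<open>\<open>E\<close> contains the diagonals and all points of \<open>\<Omega>\<close> where
  \<open>g\<close> has no mean limit. The conditions \<open>gen\<close> express genericity of the
  grid for three measures: Hausdorff measure for the energy, slice measure for the jumps of
  \<open>v\<close>, and the derivative of \<open>g\<close>.\<close>

locale correction =
  fixes \<Omega> :: "(real^'n) set" and g :: "real^'n \<Rightarrow> real^'d" and F :: "real^'n \<Rightarrow> real^'n^'d"
    and \<epsilon> s :: real and v :: "real^'n \<Rightarrow> real^'d" and J :: "'n \<Rightarrow> real^'n \<Rightarrow> real^'d" and E :: "(real^'n) set"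
  assumes \<Omega>: "open \<Omega>" and bdd: "bounded \<Omega>" and g: "g \<in> SBV \<Omega>" and F: "integrable lborel F"
    and corr: "vector_corrector (vec s) \<epsilon> F v J"
    and E: "E \<in> null_sets lborel" "diagonals \<subseteq> E" "\<And>x. x \<in> \<Omega> \<Longrightarrow> x \<notin> E \<Longrightarrow> \<exists>a. mean_limit g a (ball x)"
    and gen: "\<And>m c. c \<in> grid (vec s) m \<Longrightarrow> {x\<in>E. x $ m = c} \<in> null_sets (hausdorff_measure (CARD('n) - 1))"
      "\<And>m c. c \<in> grid (vec s) m \<Longrightarrow> AE x in slab m. upd x m c \<notin> E"
      "\<And>m c B. c \<in> grid (vec s) m \<Longrightarrow> B \<in> borel_on \<Omega> \<Longrightarrow> B \<subseteq> {x. x $ m = c} \<Longrightarrow> deriv_measure \<Omega> g B = 0"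
begin

abbreviation "S m \<equiv> slices m (grid (vec s) m)"

abbreviation "u \<equiv> (\<lambda>x. g x + v x)"

abbreviation "faces \<equiv> (\<Union>m. {x::real^'n. x $ m \<in> grid (vec s) m})"

lemma v_measurable [measurable]: "v \<in> borel_measurable borel"
  and v_bound: "norm (v x) \<le> \<epsilon>"
  and v_cont: "x \<notin> faces \<Longrightarrow> isCont v x"
  and J_measurable [measurable]: "J m \<in> borel_measurable borel"
  and v_sides: "x \<in> single_face (vec s) m \<Longrightarrow> side_limit v x (axis m 1) (v x)"
    "x \<in> single_face (vec s) m \<Longrightarrow> side_limit v x (- axis m 1) (v x - J m x)"
  and J_integrable: "integrable (S m) (J m)"
  and J_slices: "(LINT x|S m. norm (J m x)) \<le> 8 * CARD('n) * CARD('d) * (LINT x|lborel. norm (F x))"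
  and J_hausdorff: "(\<integral>\<^sup>+x. ennreal (norm (J m x)) \<partial>hausdorff_measure (CARD('n) - 1)) \<le>
           ennreal (8 * CARD('n) * CARD('d) * hausdorff_const (CARD('n) - 1) * (LINT x|lborel. norm (F x)))"
  and integration_by_parts: "test_fn \<phi> \<phi>' \<Longrightarrow> (LINT x|lborel. v x $ i * \<phi>' x $ m) =
           - ((LINT x|lborel. F x $ i $ m * \<phi> x) + (LINT x|S m. \<phi> x * J m x $ i))"
  using corr unfolding vector_corrector_def by auto

lemma \<Omega>_borel: "\<Omega> \<in> sets borel" using \<Omega> by simp

lemma g_BV: "g \<in> BV \<Omega>" and g_L1: "g \<in> L1 \<Omega>" using g by (auto simp: SBV_def BV_def)

lemma Dg: "is_deriv_measure \<Omega> g (deriv_measure \<Omega> g)" by (rule deriv_measure_BV[OF \<Omega> g_BV])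

lemma Dg_radon: "deriv_measure \<Omega> g \<in> radon_measures \<Omega>" using Dg by (simp add: is_deriv_measure_def)

lemma Dg_signed: "signed_measure (restrict_space borel \<Omega>) (deriv_measure \<Omega> g)"
  using Dg_radon by (simp add: radon_measures_signed)

section \<open>Derivative measure of the corrected function\<close>

lemma u_L1: "u \<in> L1 \<Omega>"
proof (rule L1_add[OF \<Omega>_borel g_L1])
  have "emeasure lborel \<Omega> < \<infinity>" using bdd by (rule emeasure_bounded_finite)
  then have "integrable lborel (\<lambda>x. indicator \<Omega> x *\<^sub>R v x)"
    using \<Omega>_borel v_bound by (intro integrableI_bounded_set_indicator[where B=\<epsilon>]) auto
  then show "v \<in> L1 \<Omega>" using \<Omega>_borel by (simp add: L1_lebesgue integrable_completion)
qed

text \<open>The derivative of \<open>v\<close> inside \<open>\<Omega>\<close>. Column m receives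
  only the jumps across hyperplanes orthogonal to direction m, whose normal is the m-th unit
  vector.\<close>

definition D :: "(real^'n) set \<Rightarrow> real^'n^'d" where
  "D B = (\<chi> i m. (if B \<in> borel_on \<Omega> then LINT x:B|lborel. F x $ i $ m else 0) +
     (if B \<in> borel_on \<Omega> then LINT x:B|S m. J m x $ i else 0))"

lemma F_comp: "integrable lborel (\<lambda>x. F x $ i $ m)"
  by (rule integrable_bounded_linear[OF _ F]) (intro bounded_linear_compose[OF bounded_linear_vec_nth bounded_linear_vec_nth])

lemma J_comp: "integrable (S m) (\<lambda>x. J m x $ i)"
  by (rule integrable_bounded_linear[OF bounded_linear_vec_nth J_integrable])

lemma D_comp: "(\<lambda>B. D B $ i $ m) = (\<lambda>B. (if B \<in> borel_on \<Omega> then LINT x:B|lborel. F x $ i $ m else 0) +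
     (if B \<in> borel_on \<Omega> then LINT x:B|S m. J m x $ i else 0))"
  unfolding D_def by (simp add: fun_eq_iff)

lemma D_comp_radon: "(\<lambda>B. D B $ i $ m) \<in> radon_measures \<Omega>"
  unfolding D_comp by (intro radon_measures_add radon_measures_density \<Omega>_borel F_comp J_comp) auto

lemma D_radon: "D \<in> radon_measures \<Omega>"
  by (intro radon_measures_vecI D_comp_radon)

lemma D_integral:
  assumes \<phi>: "\<phi> \<in> bdd_borel \<Omega>"
  shows "signed_integral \<Omega> (\<lambda>B. D B $ i $ m) \<phi> = (LINT x:\<Omega>|lborel. \<phi> x * F x $ i $ m) + (LINT x:\<Omega>|S m. \<phi> x * J m x $ i)"
proof -
  have r: "(\<lambda>B. if B \<in> borel_on \<Omega> then LINT x:B|lborel. F x $ i $ m else 0) \<in> radon_measures \<Omega>"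
    "(\<lambda>B. if B \<in> borel_on \<Omega> then LINT x:B|S m. J m x $ i else 0) \<in> radon_measures \<Omega>"
    by (intro radon_measures_density \<Omega>_borel F_comp J_comp; simp)+
  have "signed_integral \<Omega> (\<lambda>B. if B \<in> borel_on \<Omega> then LINT x:B|lborel. F x $ i $ m else 0) \<phi> = (LINT x:\<Omega>|lborel. \<phi> x * F x $ i $ m)"
    by (rule signed_integral_density(1)) (auto intro: \<Omega>_borel F_comp \<phi>)
  moreover have "signed_integral \<Omega> (\<lambda>B. if B \<in> borel_on \<Omega> then LINT x:B|S m. J m x $ i else 0) \<phi> = (LINT x:\<Omega>|S m. \<phi> x * J m x $ i)"
    by (rule signed_integral_density(1)) (auto intro: \<Omega>_borel J_comp \<phi>)
  ultimately show ?thesis unfolding D_comp signed_integral_add[OF r \<phi>] by simp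
qed

text \<open>The summand 1 stems from the diffuse part, \<open>8 * CARD('n) * CARD('d)\<close> from
  the jumps.\<close>

lemma D_bound:
  assumes \<phi>: "\<phi> \<in> bdd_borel \<Omega>" and K: "\<And>x. x \<in> \<Omega> \<Longrightarrow> \<bar>\<phi> x\<bar> \<le> K" "K \<ge> 0"
  shows "\<bar>signed_integral \<Omega> (\<lambda>B. D B $ i $ m) \<phi>\<bar> \<le> (1 + 8 * CARD('n) * CARD('d)) * (LINT x|lborel. norm (F x)) * K"
proof -
  have b: "\<bar>LINT x:\<Omega>|M. \<phi> x * f x\<bar> \<le> K * (LINT x|M. norm (h x))"
    if M: "sets M = sets borel" "space M = UNIV" and f: "integrable M f" and h: "integrable M h" "\<And>x. \<bar>f x\<bar> \<le> norm (h x)"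
    for M and f :: "real^'n \<Rightarrow> real" and h :: "real^'n \<Rightarrow> 'z::{banach,second_countable_topology}"
  proof -
    have i: "set_integrable M \<Omega> (\<lambda>x. \<phi> x * f x)"
      using M by (intro signed_integral_density(2)[OF _ _ \<Omega>_borel f \<phi>]) auto
    then have "\<bar>LINT x:\<Omega>|M. \<phi> x * f x\<bar> \<le> (LINT x|M. \<bar>indicator \<Omega> x *\<^sub>R (\<phi> x * f x)\<bar>)"
      unfolding set_lebesgue_integral_def by (intro integral_abs_bound)
    also have "\<dots> \<le> (LINT x|M. K * norm (h x))"
    proof (intro integral_mono integrable_abs integrable_mult_right integrable_norm h)
      show "integrable M (\<lambda>x. indicator \<Omega> x *\<^sub>R (\<phi> x * f x))" using i by (simp add: set_integrable_def)
      fix x show "\<bar>indicator \<Omega> x *\<^sub>R (\<phi> x * f x)\<bar> \<le> K * norm (h x)"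
        using K h(2)[of x] by (cases "x \<in> \<Omega>") (auto simp: abs_mult intro!: mult_mono)
    qed
    finally show ?thesis by simp
  qed
  have "\<bar>F x $ i $ m\<bar> \<le> norm (F x)" for x
    using component_le_norm_cart[of "F x $ i" m] Finite_Cartesian_Product.norm_nth_le[of "F x" i] by linarith
  then have 1: "\<bar>LINT x:\<Omega>|lborel. \<phi> x * F x $ i $ m\<bar> \<le> K * (LINT x|lborel. norm (F x))"
    by (intro b F_comp F) auto
  have 2: "\<bar>LINT x:\<Omega>|S m. \<phi> x * J m x $ i\<bar> \<le> K * (LINT x|S m. norm (J m x))"
    by (intro b J_comp J_integrable) (auto simp: component_le_norm_cart)
  show ?thesis unfolding D_integral[OF \<phi>]
    using 1 2 mult_left_mono[OF J_slices[of m] K(2)] by (simp add: algebra_simps)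
qed

lemma is_deriv_measure_u: "is_deriv_measure \<Omega> u (\<lambda>B. deriv_measure \<Omega> g B + D B)"
  unfolding is_deriv_measure_def
proof (intro conjI allI impI)
  show "(\<lambda>B. deriv_measure \<Omega> g B + D B) \<in> radon_measures \<Omega>" by (rule radon_measures_add[OF Dg_radon D_radon])
  fix \<phi> \<phi>' i j
  assume t0: "\<forall>x. GDERIV \<phi> x :> \<phi>' x" "continuous_on UNIV \<phi>'" "compact (closure {x. \<phi> x \<noteq> 0})" and sub: "closure {x. \<phi> x \<noteq> 0} \<subseteq> \<Omega>"
  then have t: "test_fn \<phi> \<phi>'" by (simp add: test_fn_def)
  \<comment> \<open>A test function supported in \<open>\<Omega>\<close> vanishes outside together
    with its gradient, so the formula for \<open>v\<close> on the whole space becomes one on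
    \<open>\<Omega>\<close>.\<close>
  have off: "\<phi> x = 0" "\<phi>' x = 0" if "x \<notin> \<Omega>" for x using test_fn_props(4)[OF t, of x] that sub by auto
  obtain K where K: "\<And>x. \<bar>\<phi> x\<bar> \<le> K" "\<And>x. norm (\<phi>' x) \<le> K" using test_fn_props(3)[OF t] by blast
  have \<phi>m: "\<phi> \<in> borel_measurable borel" by (rule test_fn_props(2)[OF t])
  have \<phi>b: "\<phi> \<in> bdd_borel \<Omega>" using K \<phi>m by (auto simp: bdd_borel_def intro: measurable_restrict_space1)
  have \<phi>'m: "(\<lambda>x. \<phi>' x $ j) \<in> borel_measurable borel"
    using borel_measurable_integrable[OF test_fn_integrable[OF t, of j]] by simp
  have \<phi>'b: "\<bar>\<phi>' x $ j\<bar> \<le> K" for x using component_le_norm_cart[of "\<phi>' x" j] K(2)[of x] by linarith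
  have ig: "integrable lebesgue (\<lambda>x. \<phi>' x $ j * (indicator \<Omega> x *\<^sub>R g x) $ i)"
  proof (rule integrable_bounded_mult[OF _ _ \<phi>'b])
    show "integrable lebesgue (\<lambda>x. (indicator \<Omega> x *\<^sub>R g x) $ i)"
      using g_L1 unfolding L1_lebesgue[OF \<Omega>_borel] by (rule integrable_bounded_linear[OF bounded_linear_vec_nth])
    show "(\<lambda>x. \<phi>' x $ j) \<in> borel_measurable lebesgue" using \<phi>'m by (intro measurable_completion) simp
  qed
  have iv: "integrable lborel (\<lambda>x. v x $ i * \<phi>' x $ j)"
  proof (rule integrable_bounded_mult[OF test_fn_integrable[OF t]])
    show "\<bar>v x $ i\<bar> \<le> \<epsilon>" for x using component_le_norm_cart[of "v x" i] v_bound[of x] by linarith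
  qed simp
  have "(LINT x:\<Omega>|lebesgue. (g x + v x) $ i * \<phi>' x $ j) = (LINT x|lebesgue. \<phi>' x $ j * (indicator \<Omega> x *\<^sub>R g x) $ i + v x $ i * \<phi>' x $ j)"
    unfolding set_lebesgue_integral_def by (intro Bochner_Integration.integral_cong refl) (auto simp: indicator_def off algebra_simps)
  also have "\<dots> = (LINT x|lebesgue. \<phi>' x $ j * (indicator \<Omega> x *\<^sub>R g x) $ i) + (LINT x|lborel. v x $ i * \<phi>' x $ j)"
    using ig iv by (simp add: integrable_completion integral_completion)
  also have "(LINT x|lebesgue. \<phi>' x $ j * (indicator \<Omega> x *\<^sub>R g x) $ i) = (LINT x:\<Omega>|lebesgue. g x $ i * \<phi>' x $ j)"
    unfolding set_lebesgue_integral_def by (intro Bochner_Integration.integral_cong refl) (auto simp: indicator_def)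
  also have "\<dots> = - signed_integral \<Omega> (\<lambda>B. deriv_measure \<Omega> g B $ i $ j) \<phi>"
    using Dg t0 sub unfolding is_deriv_measure_def by blast
  also have "(LINT x|lborel. v x $ i * \<phi>' x $ j) = - signed_integral \<Omega> (\<lambda>B. D B $ i $ j) \<phi>"
  proof -
    have e: "(LINT x:\<Omega>|M. \<phi> x * f x) = (LINT x|M. \<phi> x * f x)" for M and f :: "real^'n \<Rightarrow> real"
      unfolding set_lebesgue_integral_def by (intro Bochner_Integration.integral_cong refl) (auto simp: indicator_def off)
    show ?thesis unfolding D_integral[OF \<phi>b] integration_by_parts[OF t] e by (simp add: mult.commute)
  qed
  finally show "(LINT x:\<Omega>|lebesgue. (g x + v x) $ i * \<phi>' x $ j) = - signed_integral \<Omega> (\<lambda>B. (deriv_measure \<Omega> g B + D B) $ i $ j) \<phi>"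
    using signed_integral_add[OF radon_measures_comp[OF Dg_radon] radon_measures_comp[OF D_radon] \<phi>b] by simp
qed

lemma deriv_measure_u: "deriv_measure \<Omega> u = (\<lambda>B. deriv_measure \<Omega> g B + D B)"
  by (rule deriv_measure_eq[OF \<Omega> is_deriv_measure_u])

lemma F_L1: "F \<in> L1 \<Omega>" by (rule integrable_lborel_lebesgue_on(2)[OF F \<Omega>_borel])

text \<open>Used twice: off the faces to find the density, and off the jump set of \<open>u\<close>
  to find the Cantor part.\<close>

lemma D_jump_free:
  assumes B: "B \<in> borel_on \<Omega>" and J0: "\<And>m. AE x in S m. x \<in> B \<longrightarrow> J m x = 0"
  shows "D B = L1_measure \<Omega> F B"
proof -
  have "(LINT x:B|S m. J m x $ i) = 0" for i m
  proof -
    have "(LINT x:B|S m. J m x $ i) = (LINT x|S m. 0 * J m x $ i)"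
      unfolding set_lebesgue_integral_def
    proof (rule integral_cong_AE)
      have [measurable]: "B \<in> sets borel" using B by (simp add: borel_on_iff[OF \<Omega>_borel])
      show "(\<lambda>x. indicator B x *\<^sub>R J m x $ i) \<in> borel_measurable (S m)" by measurable
      show "AE x in S m. indicator B x *\<^sub>R J m x $ i = 0 * J m x $ i"
        using J0[of m] by eventually_elim (auto simp: indicator_def)
    qed simp
    then show ?thesis by simp
  qed
  moreover have "(LINT x:B|lborel. F x) $ i $ m = (LINT x:B|lborel. F x $ i $ m)" for i m
  proof -
    have "integrable lborel (\<lambda>x. indicator B x *\<^sub>R F x)"
      using B F by (intro integrable_mult_indicator) (auto simp: borel_on_iff[OF \<Omega>_borel])
    then have "(LINT x|lborel. (indicator B x *\<^sub>R F x) $ i $ m) = (LINT x|lborel. indicator B x *\<^sub>R F x) $ i $ m"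
      by (intro integral_bounded_linear bounded_linear_compose[OF bounded_linear_vec_nth bounded_linear_vec_nth])
    then show ?thesis by (simp add: set_lebesgue_integral_def)
  qed
  ultimately show ?thesis
    using B F \<Omega>_borel by (simp add: D_def vec_eq_iff L1_measure_lborel)
qed

section \<open>Gradient, jump set and energy of the corrected function\<close>

lemma faces_borel: "faces \<in> sets borel"
  by (intro sets.finite_UN finite grid_borel)

lemma faces_null: "faces \<in> null_sets lborel"
proof -
  have "{x::real^'n. x $ m \<in> grid (vec s) m} \<in> null_sets lborel" for m
  proof -
    have "(\<Union>c\<in>grid (vec s) m. {x::real^'n. x $ m = c}) \<in> null_sets lborel"
      by (intro null_sets_UN' countable_grid null_sets_coordinate)
    moreover have "(\<Union>c\<in>grid (vec s) m. {x::real^'n. x $ m = c}) = {x. x $ m \<in> grid (vec s) m}" by auto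
    ultimately show ?thesis by simp
  qed
  then show ?thesis by (intro null_sets_UN' countable_finite) auto
qed

lemma AE_S_faces: "AE x in S m. x \<in> faces"
  using slices_AE_mem[OF countable_grid, of m "vec s" m] by eventually_elim auto

text \<open>The jump part lives on \<open>faces\<close>, a Lebesgue null set, which is added to the
  exceptional set of the decomposition for \<open>g\<close>.\<close>

lemma ac_grad_u: "AE x in lebesgue. x \<in> \<Omega> \<longrightarrow> ac_grad \<Omega> u x = ac_grad \<Omega> g x + F x"
proof -
  obtain Z where Z: "Z \<in> null_sets lborel" "\<And>B. B \<in> borel_on \<Omega> \<Longrightarrow> deriv_measure \<Omega> g (B - Z) = L1_measure \<Omega> (ac_grad \<Omega> g) B"
    using ac_density(2)[OF \<Omega>_borel Dg_radon] unfolding ac_grad_def by blast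
  have ac: "ac_grad \<Omega> g \<in> L1 \<Omega>" unfolding ac_grad_def by (rule ac_density(1)[OF \<Omega>_borel Dg_radon])
  show ?thesis unfolding ac_grad_def[of \<Omega> u]
  proof (rule ac_density_unique[OF \<Omega>_borel _ _ null_sets.Un[OF Z(1) faces_null]])
    show "deriv_measure \<Omega> u \<in> radon_measures \<Omega>" unfolding deriv_measure_u by (rule radon_measures_add[OF Dg_radon D_radon])
    show "(\<lambda>x. ac_grad \<Omega> g x + F x) \<in> L1 \<Omega>" by (rule L1_add[OF \<Omega>_borel ac F_L1])
    fix B assume B: "B \<in> borel_on \<Omega>"
    have Zb: "Z \<in> sets borel" using Z(1) by auto
    have Bf: "B - faces \<in> borel_on \<Omega>" "B - (Z \<union> faces) \<in> borel_on \<Omega>" using B faces_borel Zb by (auto simp: borel_on_iff[OF \<Omega>_borel])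
    have "deriv_measure \<Omega> g (B - (Z \<union> faces)) = deriv_measure \<Omega> g ((B - faces) - Z)" by (rule arg_cong[where f="deriv_measure \<Omega> g"]) auto
    also have "\<dots> = L1_measure \<Omega> (ac_grad \<Omega> g) B" unfolding Z(2)[OF Bf(1)] by (rule L1_measure_diff_null[OF ac B faces_null \<Omega>_borel])
    finally have 1: "deriv_measure \<Omega> g (B - (Z \<union> faces)) = L1_measure \<Omega> (ac_grad \<Omega> g) B" .
    have "D (B - (Z \<union> faces)) = L1_measure \<Omega> F (B - (Z \<union> faces))"
    proof (rule D_jump_free[OF Bf(2)])
      show "AE x in S m. x \<in> B - (Z \<union> faces) \<longrightarrow> J m x = 0" for m using AE_S_faces by eventually_elim auto
    qed
    also have "\<dots> = L1_measure \<Omega> F B" by (rule L1_measure_diff_null[OF F_L1 B null_sets.Un[OF Z(1) faces_null] \<Omega>_borel])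
    finally show "deriv_measure \<Omega> u (B - (Z \<union> faces)) = L1_measure \<Omega> (\<lambda>x. ac_grad \<Omega> g x + F x) B"
      unfolding deriv_measure_u L1_measure_add[OF \<Omega>_borel ac F_L1] 1 by simp
  qed
qed

text \<open>Away from \<open>E\<close> a face point lies on hyperplanes of one direction only, and
  \<open>g\<close> has a full mean limit there; whether \<open>u\<close> jumps is then decided by
  \<open>J m\<close>.\<close>

lemma face_point:
  assumes x: "x \<in> \<Omega>" "x \<notin> E" "x $ m \<in> grid (vec s) m"
  shows "J m x \<noteq> 0 \<Longrightarrow> \<exists>a. approx_jump u x (a + v x, a + (v x - J m x), axis m 1)"
    "J m x = 0 \<Longrightarrow> \<not> approx_jump u x T"
proof -
  have sf: "x \<in> single_face (vec s) m" using x E(2) by (intro not_diagonals_single_face) auto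
  obtain a where a: "mean_limit g a (ball x)" using E(3) x by blast
  note j = approx_jump_add_side_limits[OF \<Omega> g_L1 u_L1 x(1) a v_sides[OF sf] norm_axis_1]
  show "J m x \<noteq> 0 \<Longrightarrow> \<exists>a. approx_jump u x (a + v x, a + (v x - J m x), axis m 1)"
    by (intro exI[of _ a] j(1)) simp
  show "J m x = 0 \<Longrightarrow> \<not> approx_jump u x T" by (rule j(2)) simp
qed

text \<open>The faces are a countable union of hyperplanes, made disjoint in order to apply
  additivity of a signed measure.\<close>

lemma Dg_faces:
  assumes B: "B \<in> borel_on \<Omega>" "B \<subseteq> faces" shows "deriv_measure \<Omega> g B = 0"
proof -
  define P where "P = (\<Union>m. (\<lambda>c. {x::real^'n. x $ m = c}) ` grid (vec s) m)"
  have Pc: "countable P" unfolding P_def by (intro countable_UN countable_image countable_grid) (auto intro: countable_finite)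
  have Pn: "P \<noteq> {}" unfolding P_def grid_def by auto
  define H where "H = from_nat_into P"
  have HP: "H n \<in> P" for n unfolding H_def by (rule from_nat_into[OF Pn])
  have UH: "(\<Union>n. H n) = faces"
  proof -
    have "range H = P" unfolding H_def by (rule range_from_nat_into[OF Pn Pc])
    then have "(\<Union>n. H n) = \<Union>P" by simp
    also have "\<dots> = faces" unfolding P_def by auto
    finally show ?thesis .
  qed
  have Hb: "H n \<in> sets borel" for n
  proof -
    obtain m c where "H n = {x. x $ m = c}" using HP[of n] unfolding P_def by blast
    then show ?thesis by simp
  qed
  let ?A = "\<lambda>n. B \<inter> disjointed H n"
  have dH: "disjointed H n \<in> sets borel" for n using sets.range_disjointed_sets[of H borel] Hb by blast
  have A: "range ?A \<subseteq> borel_on \<Omega>" using B dH by (auto simp: borel_on_iff[OF \<Omega>_borel])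
  have dj: "disjoint_family ?A" using disjoint_family_disjointed[of H] by (auto simp: disjoint_family_on_def)
  have "deriv_measure \<Omega> g (?A n) = 0" for n
  proof -
    obtain m c where mc: "c \<in> grid (vec s) m" "H n = {x. x $ m = c}" using HP[of n] unfolding P_def by blast
    show ?thesis by (rule gen(3)[OF mc(1)]) (use A mc(2) disjointed_subset[of H n] in auto)
  qed
  then have "(\<lambda>n. 0) sums deriv_measure \<Omega> g (\<Union>n. ?A n)" using radon_measuresD(2)[OF Dg_radon A dj] by simp
  moreover have "(\<Union>n. ?A n) = B" using B(2) UN_disjointed_eq[of H] UH by auto
  ultimately show ?thesis using sums_unique2[OF sums_zero] by metis
qed

lemma AE_S_E: "AE x in S m. x \<notin> E"
proof -
  have "E \<in> null_sets (S m)" using E(1) gen(2) by (intro slices_null countable_grid) auto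
  then show ?thesis by (rule AE_not_in)
qed

text \<open>On a set \<open>M\<close> without jump points of \<open>u\<close>, \<open>J m\<close>
  vanishes almost everywhere, as almost every face point with nonzero \<open>J m\<close> is a jump
  point. Off the faces \<open>u\<close> and \<open>g\<close> jump at the same points, so the
  vanishing Cantor part of \<open>g\<close> identifies its derivative there; on the faces the
  derivative of \<open>g\<close> vanishes.\<close>

lemma u_SBV: "u \<in> SBV \<Omega>"
proof -
  have ac: "ac_grad \<Omega> g \<in> L1 \<Omega>" unfolding ac_grad_def by (rule ac_density(1)[OF \<Omega>_borel Dg_radon])
  have Du: "deriv_measure \<Omega> u \<in> radon_measures \<Omega>" unfolding deriv_measure_u by (rule radon_measures_add[OF Dg_radon D_radon])
  have acu: "ac_grad \<Omega> u \<in> L1 \<Omega>" unfolding ac_grad_def by (rule ac_density(1)[OF \<Omega>_borel Du])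
  have "cantor_part \<Omega> u B = 0" if "B \<in> borel_on \<Omega>" for B
  proof (cases "B - jump_set \<Omega> u \<in> borel_on \<Omega>")
    \<comment> \<open>Both set functions are 0 off the Borel sets, which settles a remainder that is
      not Borel.\<close>
    case False
    then show ?thesis by (simp add: cantor_part_def L1_measure_def radon_measuresD(1)[OF Du])
  next
    case True
    define M where "M = B - jump_set \<Omega> u"
    have M: "M \<in> borel_on \<Omega>" "M \<subseteq> \<Omega>" "M \<inter> jump_set \<Omega> u = {}" using True by (auto simp: M_def borel_on_iff[OF \<Omega>_borel])
    have "D M = L1_measure \<Omega> F M"
    proof (rule D_jump_free[OF M(1)])
      fix m show "AE x in S m. x \<in> M \<longrightarrow> J m x = 0"
        using AE_S_E slices_AE_mem[OF countable_grid, of m "vec s" m]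
      proof eventually_elim
        case (elim x)
        show ?case
        proof
          assume x: "x \<in> M"
          show "J m x = 0"
          proof (rule ccontr)
            assume "J m x \<noteq> 0"
            then have "x \<in> jump_set \<Omega> u" using face_point(1)[of x m] elim x M(2) by (auto simp: jump_set_def)
            then show False using x M(3) by blast
          qed
        qed
      qed
    qed
    moreover have "deriv_measure \<Omega> g M = L1_measure \<Omega> (ac_grad \<Omega> g) M"
    proof -
      have Mf: "M - faces \<in> borel_on \<Omega>" "M \<inter> faces \<in> borel_on \<Omega>" using M faces_borel by (auto simp: borel_on_iff[OF \<Omega>_borel])
      have "x \<notin> jump_set \<Omega> g" if "x \<in> M - faces" for x
      proof
        assume "x \<in> jump_set \<Omega> g"
        then obtain a b \<nu> where T: "approx_jump g x (a, b, \<nu>)" by (auto simp: jump_set_def)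
        have "approx_jump u x (a + v x, b + v x, \<nu>)"
          by (rule approx_jump_add_cont[OF \<Omega> g_L1 u_L1 _ v_cont T]) (use that M(2) in auto)
        then have "x \<in> jump_set \<Omega> u" unfolding jump_set_def using that M(2) by blast
        then show False using that M(3) by blast
      qed
      \<comment> \<open>Removing the jump set of \<open>g\<close> from this set removes nothing, so
        the Cantor part of \<open>g\<close> is evaluated on a set known to be Borel.\<close>
      then have e: "M - faces - jump_set \<Omega> g = M - faces" by blast
      have "cantor_part \<Omega> g (M - faces) = 0" using g Mf by (simp add: SBV_def)
      then have "deriv_measure \<Omega> g (M - faces) = L1_measure \<Omega> (ac_grad \<Omega> g) (M - faces)" unfolding cantor_part_def e by simp
      also have "\<dots> = L1_measure \<Omega> (ac_grad \<Omega> g) M" by (rule L1_measure_diff_null[OF ac M(1) faces_null \<Omega>_borel])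
      finally have "deriv_measure \<Omega> g (M - faces) = L1_measure \<Omega> (ac_grad \<Omega> g) M" .
      moreover have "deriv_measure \<Omega> g (M \<inter> faces) = 0" by (rule Dg_faces[OF Mf(2)]) simp
      moreover have "deriv_measure \<Omega> g M = deriv_measure \<Omega> g (M \<inter> faces) + deriv_measure \<Omega> g (M - faces)"
      proof -
        have "M \<inter> faces \<inter> (M - faces) = {}" by blast
        from signed_measure_Un[OF Dg_signed Mf(2,1) this] show ?thesis by (simp add: Int_Diff_Un)
      qed
      ultimately show ?thesis by simp
    qed
    moreover have "L1_measure \<Omega> (ac_grad \<Omega> u) = L1_measure \<Omega> (\<lambda>x. ac_grad \<Omega> g x + F x)"
      by (rule L1_measure_cong_AE[OF \<Omega>_borel acu L1_add[OF \<Omega>_borel ac F_L1] ac_grad_u])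
    ultimately show ?thesis
      unfolding cantor_part_def M_def[symmetric] deriv_measure_u by (simp add: L1_measure_add[OF \<Omega>_borel ac F_L1])
  qed
  moreover have "u \<in> BV \<Omega>" using u_L1 is_deriv_measure_u by (auto simp: BV_def)
  ultimately show ?thesis by (simp add: SBV_def)
qed

text \<open>Hausdorff-almost every face point avoids \<open>E\<close>. At such a point the jump of
  \<open>u\<close> is \<open>J m\<close>, of cost at most C times its norm; off the faces
  \<open>v\<close> is continuous, and the density is that of \<open>g\<close>. The additional factor
  N comes from adding the N directions.\<close>

lemma surface_energy_u:
  fixes C :: real
  assumes even: "\<And>w \<nu>. \<nu> \<in> sphere 0 1 \<Longrightarrow> \<psi> (- w) (- \<nu>) = \<psi> w \<nu>"
    and C: "C \<ge> 0" "\<And>w \<nu>. \<nu> \<in> sphere 0 1 \<Longrightarrow> \<psi> w \<nu> \<le> C * norm w"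
  shows "surface_energy \<psi> \<Omega> u \<le> surface_energy \<psi> \<Omega> g +
     ennreal (C * CARD('n) * (8 * CARD('n) * CARD('d) * hausdorff_const (CARD('n) - 1)) * (LINT x|lborel. norm (F x)))"
proof -
  let ?H = "hausdorff_measure (CARD('n) - 1) :: (real^'n) measure" and ?c = "hausdorff_const (CARD('n) - 1)"
  let ?h = "\<lambda>x. ennreal C * (\<Sum>m\<in>UNIV. ennreal (norm (J m x)))"
  let ?f = "\<lambda>x. ennreal (\<psi> (jump g x) (jump_normal g x)) * indicator (jump_set \<Omega> g) x"
  have "AE x in ?H. \<forall>m\<in>UNIV. \<forall>c\<in>grid (vec s) m. x \<notin> {x\<in>E. x $ m = c}"
  proof (rule AE_finite_allI[OF finite])
    fix m :: 'n
    show "AE x in ?H. \<forall>c\<in>grid (vec s) m. x \<notin> {x\<in>E. x $ m = c}"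
      unfolding AE_ball_countable[OF countable_grid] by (intro ballI AE_not_in gen(1))
  qed
  \<comment> \<open>The genericity for Hausdorff measure enters here.\<close>
  then have ae: "AE x in ?H. x \<in> faces \<longrightarrow> x \<notin> E" by eventually_elim auto
  have "surface_energy \<psi> \<Omega> u \<le> (\<integral>\<^sup>+x. ?f x + ?h x \<partial>?H)"
    unfolding surface_energy_def
  proof (rule nn_integral_mono_AE)
    show "AE x in ?H. ennreal (\<psi> (jump u x) (jump_normal u x)) * indicator (jump_set \<Omega> u) x \<le> ?f x + ?h x"
      using ae
    proof eventually_elim
      case (elim x)
      show ?case
      proof (cases "x \<in> jump_set \<Omega> u")
        case True
        then obtain a b \<nu> where x: "x \<in> \<Omega>" and T: "approx_jump u x (a, b, \<nu>)" by (auto simp: jump_set_def)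
        show ?thesis
        proof (cases "x \<in> faces")
          case False
          have Tg: "approx_jump g x (a - v x, b - v x, \<nu>)" by (rule jump_set_add_cont[OF \<Omega> g_L1 u_L1 x v_cont[OF False] T])
          then have "x \<in> jump_set \<Omega> g" using x by (auto simp: jump_set_def)
          moreover have "\<psi> (jump u x) (jump_normal u x) = \<psi> (jump g x) (jump_normal g x)"
            using jump_density_eq[where \<psi>=\<psi>, OF \<Omega> u_L1 x T even] jump_density_eq[where \<psi>=\<psi>, OF \<Omega> g_L1 x Tg even] by simp
          ultimately show ?thesis using True by (simp add: add_increasing2)
        next
          case f: True
          then obtain m where m: "x $ m \<in> grid (vec s) m" by auto
          have xE: "x \<notin> E" using elim f by simp
          have "J m x \<noteq> 0" using face_point(2)[OF x xE m] T by blast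
          then obtain a' where T': "approx_jump u x (a' + v x, a' + (v x - J m x), axis m 1)" using face_point(1)[OF x xE m] by blast
          have "\<psi> (jump u x) (jump_normal u x) = \<psi> (J m x) (axis m 1)"
            using jump_density_eq[where \<psi>=\<psi>, OF \<Omega> u_L1 x T' even] by simp
          also have "\<dots> \<le> C * norm (J m x)" by (intro C(2)) simp
          finally have "ennreal (\<psi> (jump u x) (jump_normal u x)) \<le> ennreal C * ennreal (norm (J m x))"
            using C(1) by (simp add: ennreal_mult[symmetric] ennreal_leI)
          also have "\<dots> \<le> ?h x" by (intro mult_left_mono member_le_sum) auto
          finally show ?thesis using True by (simp add: add_increasing)
        qed
      qed simp
    qed
  qed
  also have "\<dots> \<le> (\<integral>\<^sup>+x. ?f x \<partial>?H) + (\<integral>\<^sup>+x. ?h x \<partial>?H)"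
  proof (rule nn_integral_add_le)
    have "J m \<in> borel_measurable ?H" for m using J_measurable[of m] by (simp cong: measurable_cong_sets)
    then show "?h \<in> borel_measurable ?H" by simp
  qed
  also have "(\<integral>\<^sup>+x. ?f x \<partial>?H) = surface_energy \<psi> \<Omega> g" by (simp add: surface_energy_def)
  also have "(\<integral>\<^sup>+x. ?h x \<partial>?H) \<le> ennreal (C * CARD('n) * (8 * CARD('n) * CARD('d) * ?c) * (LINT x|lborel. norm (F x)))"
  proof -
    let ?B = "8 * CARD('n) * CARD('d) * ?c * (LINT x|lborel. norm (F x))"
    have B0: "?B \<ge> 0" using hausdorff_const_nonneg by (intro mult_nonneg_nonneg Bochner_Integration.integral_nonneg) auto
    have Jh: "J m \<in> borel_measurable ?H" for m using J_measurable[of m] by (simp cong: measurable_cong_sets)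
    have "(\<integral>\<^sup>+x. ?h x \<partial>?H) = ennreal C * (\<Sum>m\<in>UNIV. \<integral>\<^sup>+x. ennreal (norm (J m x)) \<partial>?H)"
      using Jh by (simp add: nn_integral_cmult nn_integral_sum del: sum_ennreal)
    also have "\<dots> \<le> ennreal C * (\<Sum>m\<in>(UNIV::'n set). ennreal ?B)"
      by (intro mult_left_mono sum_mono J_hausdorff) auto
    also have "\<dots> = ennreal C * ennreal (\<Sum>m\<in>(UNIV::'n set). ?B)"
      using B0 by (subst sum_ennreal) auto
    also have "\<dots> = ennreal (C * (\<Sum>m\<in>(UNIV::'n set). ?B))" using C(1) B0 by (intro ennreal_mult[symmetric] sum_nonneg)
    also have "C * (\<Sum>m\<in>(UNIV::'n set). ?B) = C * CARD('n) * (8 * CARD('n) * CARD('d) * ?c) * (LINT x|lborel. norm (F x))"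
      by (simp add: mult_ac)
    finally show ?thesis .
  qed
  finally show ?thesis by (simp add: add_left_mono)
qed

lemma u_distance: "(LINT x:\<Omega>|lebesgue. norm (u x - g x)) \<le> \<epsilon> * measure lebesgue \<Omega>"
proof -
  have f: "emeasure lebesgue \<Omega> < \<infinity>" using emeasure_bounded_finite[OF bdd] \<Omega>_borel by simp
  have i1: "integrable lebesgue (\<lambda>x. indicator \<Omega> x *\<^sub>R norm (v x))"
    using f \<Omega>_borel v_bound by (intro integrableI_bounded_set_indicator[where B=\<epsilon>]) (auto intro!: measurable_completion)
  have "(LINT x:\<Omega>|lebesgue. norm (u x - g x)) \<le> (LINT x|lebesgue. indicator \<Omega> x *\<^sub>R \<epsilon>)"
    unfolding set_lebesgue_integral_def
  proof (rule integral_mono)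
    show "integrable lebesgue (\<lambda>x. indicator \<Omega> x *\<^sub>R norm (u x - g x))" using i1 by simp
    show "integrable lebesgue (\<lambda>x. indicator \<Omega> x *\<^sub>R \<epsilon>)" using f \<Omega>_borel by (intro integrable_scaleR_left integrable_real_indicator) auto
  qed (use v_bound in \<open>auto simp: indicator_def\<close>)
  also have "\<dots> = \<epsilon> * measure lebesgue \<Omega>" by simp
  finally show ?thesis .
qed

end

section \<open>The relaxation theorem\<close>

text \<open>N directions, each with Hausdorff jump mass at most the factor in parentheses times the
  norm of \<open>F\<close>. The value depends on the dimensions only, hence the type
  arguments.\<close>

definition face_const :: "'n::finite itself \<Rightarrow> 'd::finite itself \<Rightarrow> real" where
  "face_const _ _ = CARD('n) * (8 * CARD('n) * CARD('d) * hausdorff_const (CARD('n) - 1))"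

text \<open>One \<open>u\<close> serves for all admissible \<open>\<psi>\<close> and
  \<open>C\<close>, because its construction does not involve the energy. The bound on
  \<open>D\<close> is what makes the derivatives of a sequence of correctors converge weakly* to
  zero.\<close>

theorem approximation:
  fixes g :: "real^'n \<Rightarrow> real^'d" and G :: "real^'n \<Rightarrow> real^'n^'d" and N :: real
  assumes \<Omega>: "open \<Omega>" "bounded \<Omega>" and g: "g \<in> SBV \<Omega>" and G: "G \<in> L1 \<Omega>" and \<epsilon>: "\<epsilon> > 0"
  defines "N \<equiv> LINT x:\<Omega>|lebesgue. norm (ac_grad \<Omega> g x - G x)"
  shows "\<exists>u D. u \<in> SBV \<Omega> \<and> (AE x in lebesgue. x \<in> \<Omega> \<longrightarrow> ac_grad \<Omega> u x = G x) \<and>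
     (LINT x:\<Omega>|lebesgue. norm (u x - g x)) \<le> \<epsilon> * measure lebesgue \<Omega> \<and>
     (\<forall>\<psi> C. (\<forall>w. \<forall>\<nu>\<in>sphere 0 1. \<psi> (- w) (- \<nu>) = \<psi> w \<nu>) \<longrightarrow> C \<ge> 0 \<longrightarrow> (\<forall>w. \<forall>\<nu>\<in>sphere 0 1. \<psi> w \<nu> \<le> C * norm w) \<longrightarrow>
        surface_energy \<psi> \<Omega> u \<le> surface_energy \<psi> \<Omega> g + ennreal (C * face_const TYPE('n) TYPE('d) * N)) \<and>
     D \<in> radon_measures \<Omega> \<and> deriv_measure \<Omega> u = (\<lambda>B. deriv_measure \<Omega> g B + D B) \<and>
     (\<forall>\<phi>\<in>bdd_borel \<Omega>. \<forall>K\<ge>0. (\<forall>x\<in>\<Omega>. \<bar>\<phi> x\<bar> \<le> K) \<longrightarrow>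
        (\<forall>i m. \<bar>signed_integral \<Omega> (\<lambda>B. D B $ i $ m) \<phi>\<bar> \<le> (1 + 8 * CARD('n) * CARD('d)) * N * K))"
proof -
  have \<Omega>b: "\<Omega> \<in> sets borel" using \<Omega> by simp
  have gL: "g \<in> L1 \<Omega>" and gBV: "g \<in> BV \<Omega>" using g by (auto simp: SBV_def BV_def)
  have Dr: "deriv_measure \<Omega> g \<in> radon_measures \<Omega>" using deriv_measure_BV[OF \<Omega>(1) gBV] by (simp add: is_deriv_measure_def)
  have ac: "ac_grad \<Omega> g \<in> L1 \<Omega>" unfolding ac_grad_def by (rule ac_density(1)[OF \<Omega>b Dr])
  \<comment> \<open>The prescribed change of the gradient, extended by zero outside
    \<open>\<Omega>\<close>.\<close>
  have "integrable lebesgue (\<lambda>x. indicator \<Omega> x *\<^sub>R G x - indicator \<Omega> x *\<^sub>R ac_grad \<Omega> g x)"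
    using G ac by (intro Bochner_Integration.integrable_diff) (simp_all add: L1_lebesgue[OF \<Omega>b])
  from borel_representative[OF this] obtain F where rep: "integrable lborel F"
    "AE x in lborel. indicator \<Omega> x *\<^sub>R G x - indicator \<Omega> x *\<^sub>R ac_grad \<Omega> g x = F x"
    "(LINT x|lborel. norm (F x)) = (LINT x|lebesgue. norm (indicator \<Omega> x *\<^sub>R G x - indicator \<Omega> x *\<^sub>R ac_grad \<Omega> g x))"
    by blast
  have N: "(LINT x|lborel. norm (F x)) = N" unfolding rep(3) N_def set_lebesgue_integral_def
    by (intro Bochner_Integration.integral_cong refl) (auto simp: indicator_def norm_minus_commute)
  obtain E0 where E0: "E0 \<in> null_sets lborel" "\<forall>x\<in>\<Omega> - E0. \<exists>a. mean_limit g a (ball x)"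
    using Lebesgue_points[OF \<Omega>(1) gL] by blast
  \<comment> \<open>With the diagonals included, a face point outside \<open>E\<close> automatically
    lies in \<open>single_face\<close>.\<close>
  define E where "E = E0 \<union> diagonals"
  have E: "E \<in> null_sets lborel" unfolding E_def by (intro null_sets.Un E0 diagonals_null)
  have "\<exists>s. \<forall>m. \<forall>c\<in>grid (vec s) m. {x\<in>E. x $ m = c} \<in> null_sets (hausdorff_measure (CARD('n) - 1)) \<and>
      (AE x in slab m. upd x m c \<notin> E) \<and> (\<forall>B\<in>borel_on \<Omega>. B \<subseteq> {x. x $ m = c} \<longrightarrow> deriv_measure \<Omega> g B = 0)"
  proof (rule generic_offset)
    fix m :: 'n
    show "AE c in lborel. {x\<in>E. x $ m = c} \<in> null_sets (hausdorff_measure (CARD('n) - 1)) \<and>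
      (AE x in slab m. upd x m c \<notin> E) \<and> (\<forall>B\<in>borel_on \<Omega>. B \<subseteq> {x. x $ m = c} \<longrightarrow> deriv_measure \<Omega> g B = 0)"
      by (intro AE_conjI hausdorff_null_slices[OF E] AE_slices[OF E] AE_hyperplane_not_charged[OF \<Omega>b Dr])
  qed
  then obtain s where s: "\<And>m c. c \<in> grid (vec s) m \<Longrightarrow> {x\<in>E. x $ m = c} \<in> null_sets (hausdorff_measure (CARD('n) - 1))"
      "\<And>m c. c \<in> grid (vec s) m \<Longrightarrow> AE x in slab m. upd x m c \<notin> E"
      "\<And>m c B. c \<in> grid (vec s) m \<Longrightarrow> B \<in> borel_on \<Omega> \<Longrightarrow> B \<subseteq> {x. x $ m = c} \<Longrightarrow> deriv_measure \<Omega> g B = 0"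
    by blast
  obtain v J where vJ: "vector_corrector (vec s) \<epsilon> F v J" using vector_corrector_exists[OF rep(1) \<epsilon>] by blast
  interpret correction \<Omega> g F \<epsilon> s v J E
    by unfold_locales (use \<Omega> g rep(1) vJ E E0 s in \<open>auto simp: E_def\<close>)
  show ?thesis
  proof (intro exI[of _ "\<lambda>x. g x + v x"] exI[of _ D] conjI allI impI ballI)
    show "(\<lambda>x. g x + v x) \<in> SBV \<Omega>" by (rule u_SBV)
    show "AE x in lebesgue. x \<in> \<Omega> \<longrightarrow> ac_grad \<Omega> (\<lambda>x. g x + v x) x = G x"
      using ac_grad_u AE_completion[OF rep(2)] by eventually_elim (force simp: indicator_def diff_eq_eq)
    show "(LINT x:\<Omega>|lebesgue. norm (g x + v x - g x)) \<le> \<epsilon> * measure lebesgue \<Omega>" by (rule u_distance)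
    show "D \<in> radon_measures \<Omega>" by (rule D_radon)
    show "deriv_measure \<Omega> (\<lambda>x. g x + v x) = (\<lambda>B. deriv_measure \<Omega> g B + D B)" by (rule deriv_measure_u)
  next
    fix \<psi> :: "real^'d \<Rightarrow> real^'n \<Rightarrow> real" and C :: real
    assume "\<forall>w. \<forall>\<nu>\<in>sphere 0 1. \<psi> (- w) (- \<nu>) = \<psi> w \<nu>" "C \<ge> 0" "\<forall>w. \<forall>\<nu>\<in>sphere 0 1. \<psi> w \<nu> \<le> C * norm w"
    then show "surface_energy \<psi> \<Omega> (\<lambda>x. g x + v x) \<le> surface_energy \<psi> \<Omega> g + ennreal (C * face_const TYPE('n) TYPE('d) * N)"
      using surface_energy_u[of \<psi> C] by (simp add: N face_const_def mult.assoc)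
  next
    fix \<phi> K i m assume "\<phi> \<in> bdd_borel \<Omega>" "(0::real) \<le> K" "\<forall>x\<in>\<Omega>. \<bar>\<phi> x\<bar> \<le> K"
    then show "\<bar>signed_integral \<Omega> (\<lambda>B. D B $ i $ m) \<phi>\<bar> \<le> (1 + 8 * CARD('n) * CARD('d)) * N * K"
      using D_bound[of \<phi> K i m] by (simp add: N)
  qed
qed

section \<open>Comparison of energies and stability of weak* convergence\<close>

lemma set_nn_integral_eq_integral:
  fixes f :: "'a::euclidean_space \<Rightarrow> 'b::euclidean_space"
  assumes \<Omega>: "\<Omega> \<in> sets borel" and f: "f \<in> L1 \<Omega>" and r: "r \<ge> 0"
  shows "(\<integral>\<^sup>+x\<in>\<Omega>. ennreal (r * norm (f x)) \<partial>lebesgue) = ennreal (r * (LINT x:\<Omega>|lebesgue. norm (f x)))"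
proof -
  have i: "integrable lebesgue (\<lambda>x. norm (indicator \<Omega> x *\<^sub>R f x))" using f L1_lebesgue[OF \<Omega>] by (intro integrable_norm) auto
  have "(\<integral>\<^sup>+x\<in>\<Omega>. ennreal (r * norm (f x)) \<partial>lebesgue) = (\<integral>\<^sup>+x. ennreal (r * norm (indicator \<Omega> x *\<^sub>R f x)) \<partial>lebesgue)"
    by (intro nn_integral_cong) (auto simp: indicator_def)
  also have "\<dots> = ennreal (LINT x|lebesgue. r * norm (indicator \<Omega> x *\<^sub>R f x))"
    using i r by (intro nn_integral_eq_integral integrable_mult_right) auto
  also have "(LINT x|lebesgue. r * norm (indicator \<Omega> x *\<^sub>R f x)) = r * (LINT x:\<Omega>|lebesgue. norm (f x))"
    by (simp add: set_lebesgue_integral_def)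
  finally show ?thesis .
qed

text \<open>R is spent in two portions: the Lipschitz constant pays for replacing the gradient of g
  by G inside W, and C pays for the additional surface energy.\<close>

lemma energy_le_energy_hat:
  fixes W :: "real^'n^'d \<Rightarrow> real"
  assumes \<Omega>: "\<Omega> \<in> sets borel" and W: "L-lipschitz_on UNIV W" "\<And>A. W A \<ge> 0"
    and ac: "ac_grad \<Omega> g \<in> L1 \<Omega>" and G: "G \<in> L1 \<Omega>" and R: "R \<ge> L + C" "C \<ge> 0"
    and uG: "AE x in lebesgue. x \<in> \<Omega> \<longrightarrow> ac_grad \<Omega> u x = G x"
    and surf: "surface_energy \<psi> \<Omega> u \<le> surface_energy \<psi> \<Omega> g + ennreal (C * (LINT x:\<Omega>|lebesgue. norm (ac_grad \<Omega> g x - G x)))"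
  shows "energy W \<psi> \<Omega> u \<le> energy_hat W \<psi> R \<Omega> g G"
proof -
  let ?d = "\<lambda>x. ac_grad \<Omega> g x - G x"
  have L0: "L \<ge> 0" by (rule lipschitz_on_nonneg[OF W(1)])
  have dL: "?d \<in> L1 \<Omega>" using ac G by (simp add: L1_def)
  have "(\<integral>\<^sup>+x\<in>\<Omega>. ennreal (W (ac_grad \<Omega> u x)) \<partial>lebesgue) + ennreal (C * (LINT x:\<Omega>|lebesgue. norm (?d x))) =
     (\<integral>\<^sup>+x\<in>\<Omega>. ennreal (W (ac_grad \<Omega> u x)) \<partial>lebesgue) + (\<integral>\<^sup>+x\<in>\<Omega>. ennreal (C * norm (?d x)) \<partial>lebesgue)"
    by (simp only: set_nn_integral_eq_integral[OF \<Omega> dL R(2)])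
  also have "\<dots> = (\<integral>\<^sup>+x\<in>\<Omega>. ennreal (W (G x)) \<partial>lebesgue) + (\<integral>\<^sup>+x\<in>\<Omega>. ennreal (C * norm (?d x)) \<partial>lebesgue)"
    using uG by (intro arg_cong2[where f="(+)"] refl nn_integral_cong_AE) (auto elim!: eventually_mono simp: indicator_def)
  also have "\<dots> = (\<integral>\<^sup>+x. ennreal (W (G x)) * indicator \<Omega> x + ennreal (C * norm (?d x)) * indicator \<Omega> x \<partial>lebesgue)"
  proof (rule nn_integral_add[symmetric])
    have Om: "\<Omega> \<in> sets lebesgue" using \<Omega> by simp
    have Gm: "(\<lambda>x. indicator \<Omega> x *\<^sub>R G x) \<in> borel_measurable lebesgue" and dm: "(\<lambda>x. indicator \<Omega> x *\<^sub>R ?d x) \<in> borel_measurable lebesgue"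
      using G dL unfolding L1_lebesgue[OF \<Omega>] by (auto intro: borel_measurable_integrable)
    have "W \<in> borel_measurable borel"
      by (intro borel_measurable_continuous_onI lipschitz_on_continuous_on[OF W(1)])
    then have "(\<lambda>x. ennreal (W (indicator \<Omega> x *\<^sub>R G x)) * indicator \<Omega> x) \<in> borel_measurable lebesgue"
      using Gm Om by (auto intro: measurable_compose)
    moreover have "(\<lambda>x. ennreal (W (indicator \<Omega> x *\<^sub>R G x)) * indicator \<Omega> x) = (\<lambda>x. ennreal (W (G x)) * indicator \<Omega> x)"
      by (auto simp: indicator_def)
    ultimately show "(\<lambda>x. ennreal (W (G x)) * indicator \<Omega> x) \<in> borel_measurable lebesgue" by (simp only:)
    have "(\<lambda>x. ennreal (C * norm (indicator \<Omega> x *\<^sub>R ?d x))) \<in> borel_measurable lebesgue"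
      using dm by measurable
    moreover have "(\<lambda>x. ennreal (C * norm (indicator \<Omega> x *\<^sub>R ?d x))) = (\<lambda>x. ennreal (C * norm (?d x)) * indicator \<Omega> x)"
      by (auto simp: indicator_def)
    ultimately show "(\<lambda>x. ennreal (C * norm (?d x)) * indicator \<Omega> x) \<in> borel_measurable lebesgue" by (simp only:)
  qed
  also have "\<dots> \<le> (\<integral>\<^sup>+x\<in>\<Omega>. ennreal (W (ac_grad \<Omega> g x) + R * norm (?d x)) \<partial>lebesgue)"
  proof (rule nn_integral_mono)
    fix x
    have "W (G x) \<le> W (ac_grad \<Omega> g x) + L * norm (?d x)"
      using lipschitz_onD[OF W(1), of "G x" "ac_grad \<Omega> g x"] by (simp add: dist_norm norm_minus_commute)
    moreover have "(L + C) * norm (?d x) \<le> R * norm (?d x)" using R(1) by (intro mult_right_mono) auto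
    ultimately have "W (G x) + C * norm (?d x) \<le> W (ac_grad \<Omega> g x) + R * norm (?d x)" by (simp add: distrib_right)
    then have "ennreal (W (G x)) + ennreal (C * norm (?d x)) \<le> ennreal (W (ac_grad \<Omega> g x) + R * norm (?d x))"
      using W(2) R(2) by (simp add: ennreal_plus[symmetric] ennreal_leI del: ennreal_plus)
    then show "ennreal (W (G x)) * indicator \<Omega> x + ennreal (C * norm (?d x)) * indicator \<Omega> x \<le>
        ennreal (W (ac_grad \<Omega> g x) + R * norm (?d x)) * indicator \<Omega> x"
      by (auto simp: indicator_def)
  qed
  finally have 1: "(\<integral>\<^sup>+x\<in>\<Omega>. ennreal (W (ac_grad \<Omega> u x)) \<partial>lebesgue) + ennreal (C * (LINT x:\<Omega>|lebesgue. norm (?d x))) \<le>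
     (\<integral>\<^sup>+x\<in>\<Omega>. ennreal (W (ac_grad \<Omega> g x) + R * norm (?d x)) \<partial>lebesgue)" .
  have "energy W \<psi> \<Omega> u \<le> ((\<integral>\<^sup>+x\<in>\<Omega>. ennreal (W (ac_grad \<Omega> u x)) \<partial>lebesgue) +
     ennreal (C * (LINT x:\<Omega>|lebesgue. norm (?d x)))) + surface_energy \<psi> \<Omega> g"
    unfolding energy_def using add_left_mono[OF surf] by (simp add: add_ac)
  also have "\<dots> \<le> energy_hat W \<psi> R \<Omega> g G" unfolding energy_hat_def by (rule add_right_mono[OF 1])
  finally show ?thesis .
qed

lemma vector_integral_add:
  fixes \<mu> \<nu> :: "'a::euclidean_space set \<Rightarrow> 'b::euclidean_space"
  assumes "\<mu> \<in> radon_measures \<Omega>" "\<nu> \<in> radon_measures \<Omega>" "\<phi> \<in> bdd_borel \<Omega>"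
  shows "vector_integral \<Omega> (\<lambda>B. \<mu> B + \<nu> B) \<phi> = vector_integral \<Omega> \<mu> \<phi> + vector_integral \<Omega> \<nu> \<phi>"
  unfolding vector_integral_def inner_add_left
  using signed_integral_add[OF radon_measures_restrict_inner[OF assms(1)] radon_measures_restrict_inner[OF assms(2)] assms(3)]
  by (simp add: scaleR_add_left sum.distrib)

text \<open>Tested against \<phi> of class C^1, \<open>D n\<close> is the integral of gs n - us n
  times the derivative of \<phi>, which tends to 0 by L^1 convergence. The uniform bound on
  \<open>D n\<close> extends this to \<open>C0\<close> through
  \<open>signed_integral_null\<close>.\<close>

lemma weak_star_BV_perturb:
  fixes us gs :: "nat \<Rightarrow> real^'n \<Rightarrow> real^'d"
  assumes \<Omega>: "open \<Omega>" and us: "\<And>n. us n \<in> BV \<Omega>" and gs: "\<And>n. gs n \<in> BV \<Omega>" and g: "g \<in> BV \<Omega>"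
    and lim: "weak_star_BV \<Omega> gs g" and L1: "(\<lambda>n. LINT x:\<Omega>|lebesgue. norm (us n x - gs n x)) \<longlonglongrightarrow> 0"
    and D: "\<And>n. D n \<in> radon_measures \<Omega>" "\<And>n. deriv_measure \<Omega> (us n) = (\<lambda>B. deriv_measure \<Omega> (gs n) B + D n B)"
    and bound: "\<And>n i j \<phi> K. \<phi> \<in> bdd_borel \<Omega> \<Longrightarrow> (\<And>x. x \<in> \<Omega> \<Longrightarrow> \<bar>\<phi> x\<bar> \<le> K) \<Longrightarrow> K \<ge> 0 \<Longrightarrow>
       \<bar>signed_integral \<Omega> (\<lambda>B. D n B $ i $ j) \<phi>\<bar> \<le> C * K"
  shows "weak_star_BV \<Omega> us g"
  unfolding weak_star_BV_def
proof
  have \<Omega>b: "\<Omega> \<in> sets borel" using \<Omega> by simp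
  have uL: "us n \<in> L1 \<Omega>" and gL: "gs n \<in> L1 \<Omega>" "g \<in> L1 \<Omega>" for n using us gs g by (auto simp: BV_def)
  have i: "integrable lebesgue (\<lambda>x. indicator \<Omega> x *\<^sub>R f x)" if "f \<in> L1 \<Omega>" for f :: "real^'n \<Rightarrow> real^'d"
    using that L1_lebesgue[OF \<Omega>b] by blast
  have id: "integrable lebesgue (\<lambda>x. indicator \<Omega> x *\<^sub>R norm (f x - h x))" if "f \<in> L1 \<Omega>" "h \<in> L1 \<Omega>" for f h :: "real^'n \<Rightarrow> real^'d"
  proof -
    have "integrable lebesgue (\<lambda>x. norm (indicator \<Omega> x *\<^sub>R f x - indicator \<Omega> x *\<^sub>R h x))"
      by (intro integrable_norm Bochner_Integration.integrable_diff i that)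
    moreover have "(\<lambda>x. norm (indicator \<Omega> x *\<^sub>R f x - indicator \<Omega> x *\<^sub>R h x)) = (\<lambda>x. indicator \<Omega> x *\<^sub>R norm (f x - h x))"
      by (auto simp: indicator_def)
    ultimately show ?thesis by (simp only:)
  qed
  have tri: "(LINT x:\<Omega>|lebesgue. norm (us n x - g x)) \<le> (LINT x:\<Omega>|lebesgue. norm (us n x - gs n x)) + (LINT x:\<Omega>|lebesgue. norm (gs n x - g x))" for n
  proof -
    have "(LINT x:\<Omega>|lebesgue. norm (us n x - g x)) \<le>
       (LINT x|lebesgue. indicator \<Omega> x *\<^sub>R norm (us n x - gs n x) + indicator \<Omega> x *\<^sub>R norm (gs n x - g x))"
      unfolding set_lebesgue_integral_def
    proof (intro integral_mono Bochner_Integration.integrable_add id uL gL)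
      fix x show "indicator \<Omega> x *\<^sub>R norm (us n x - g x) \<le> indicator \<Omega> x *\<^sub>R norm (us n x - gs n x) + indicator \<Omega> x *\<^sub>R norm (gs n x - g x)"
        using norm_triangle_ineq[of "us n x - gs n x" "gs n x - g x"] by (auto simp: indicator_def)
    qed
    also have "\<dots> = (LINT x:\<Omega>|lebesgue. norm (us n x - gs n x)) + (LINT x:\<Omega>|lebesgue. norm (gs n x - g x))"
      unfolding set_lebesgue_integral_def by (intro Bochner_Integration.integral_add id uL gL)
    finally show ?thesis .
  qed
  have gl: "(\<lambda>n. LINT x:\<Omega>|lebesgue. norm (gs n x - g x)) \<longlonglongrightarrow> 0" and
    gw: "weak_star_M \<Omega> (\<lambda>n. deriv_measure \<Omega> (gs n)) (deriv_measure \<Omega> g)" using lim by (auto simp: weak_star_BV_def)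
  show "(\<lambda>n. LINT x:\<Omega>|lebesgue. norm (us n x - g x)) \<longlonglongrightarrow> 0"
  proof (rule tendsto_sandwich[OF _ _ tendsto_const])
    show "(\<lambda>n. (LINT x:\<Omega>|lebesgue. norm (us n x - gs n x)) + (LINT x:\<Omega>|lebesgue. norm (gs n x - g x))) \<longlonglongrightarrow> 0"
      using tendsto_add[OF L1 gl] by simp
    show "\<forall>\<^sub>F n in sequentially. 0 \<le> (LINT x:\<Omega>|lebesgue. norm (us n x - g x))"
      unfolding set_lebesgue_integral_def by (intro always_eventually allI Bochner_Integration.integral_nonneg) simp
  qed (use tri in simp)
  have Dnull: "(\<lambda>n. signed_integral \<Omega> (\<lambda>B. D n B $ i $ j) \<phi>) \<longlonglongrightarrow> 0" if \<phi>: "\<phi> \<in> C0 \<Omega>" for i j \<phi>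
  proof (rule signed_integral_null[OF \<Omega> _ bound _ \<phi>])
    show "(\<lambda>B. D n B $ i $ j) \<in> radon_measures \<Omega>" for n by (rule radon_measures_comp[OF D(1)])
    fix \<phi> assume \<phi>: "\<phi> \<in> C1_compact \<Omega>"
    then obtain \<phi>' where t: "\<forall>x. GDERIV \<phi> x :> \<phi>' x" "continuous_on UNIV \<phi>'" "compact (closure {x. \<phi> x \<noteq> 0})" "closure {x. \<phi> x \<noteq> 0} \<subseteq> \<Omega>"
      by (auto simp: C1_compact_def C1_def)
    then have tf: "test_fn \<phi> \<phi>'" by (simp add: test_fn_def)
    obtain K where K: "K \<ge> 0" "\<And>x. norm (\<phi>' x) \<le> K" using test_fn_props(3)[OF tf] by blast
    have \<phi>'b: "\<bar>\<phi>' x $ j\<bar> \<le> K" for x using component_le_norm_cart[of "\<phi>' x" j] K(2)[of x] by linarith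
    have \<phi>'m: "(\<lambda>x. \<phi>' x $ j) \<in> borel_measurable lebesgue"
      using borel_measurable_integrable[OF test_fn_integrable[OF tf, of j]] by (intro measurable_completion)
    have ii: "integrable lebesgue (\<lambda>x. \<phi>' x $ j * (indicator \<Omega> x *\<^sub>R f x) $ i)" if "f \<in> L1 \<Omega>" for f :: "real^'n \<Rightarrow> real^'d"
      by (rule integrable_bounded_mult[OF integrable_bounded_linear[OF bounded_linear_vec_nth i[OF that]] \<phi>'m \<phi>'b])
    have ie: "(LINT x:\<Omega>|lebesgue. f x $ i * \<phi>' x $ j) = (LINT x|lebesgue. \<phi>' x $ j * (indicator \<Omega> x *\<^sub>R f x) $ i)" for f :: "real^'n \<Rightarrow> real^'d"
      unfolding set_lebesgue_integral_def by (intro Bochner_Integration.integral_cong refl) (auto simp: indicator_def)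
    have "\<bar>signed_integral \<Omega> (\<lambda>B. D n B $ i $ j) \<phi>\<bar> \<le> K * (LINT x:\<Omega>|lebesgue. norm (us n x - gs n x))" for n
    proof -
      have Dg: "deriv_measure \<Omega> (gs n) \<in> radon_measures \<Omega>" using deriv_measure_BV[OF \<Omega> gs[of n]] by (simp add: is_deriv_measure_def)
      have "(LINT x:\<Omega>|lebesgue. us n x $ i * \<phi>' x $ j) = - signed_integral \<Omega> (\<lambda>B. deriv_measure \<Omega> (us n) B $ i $ j) \<phi>"
        using deriv_measure_BV[OF \<Omega> us[of n]] t unfolding is_deriv_measure_def by blast
      also have "\<dots> = - signed_integral \<Omega> (\<lambda>B. deriv_measure \<Omega> (gs n) B $ i $ j) \<phi> - signed_integral \<Omega> (\<lambda>B. D n B $ i $ j) \<phi>"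
        unfolding D(2) using signed_integral_add[OF radon_measures_comp[OF Dg] radon_measures_comp[OF D(1)] C1_compact_bdd_borel[OF \<phi>]] by simp
      also have "- signed_integral \<Omega> (\<lambda>B. deriv_measure \<Omega> (gs n) B $ i $ j) \<phi> = (LINT x:\<Omega>|lebesgue. gs n x $ i * \<phi>' x $ j)"
        using deriv_measure_BV[OF \<Omega> gs[of n]] t unfolding is_deriv_measure_def by simp
      finally have "signed_integral \<Omega> (\<lambda>B. D n B $ i $ j) \<phi> = (LINT x:\<Omega>|lebesgue. gs n x $ i * \<phi>' x $ j) - (LINT x:\<Omega>|lebesgue. us n x $ i * \<phi>' x $ j)"
        by simp
      also have "\<dots> = (LINT x|lebesgue. \<phi>' x $ j * (indicator \<Omega> x *\<^sub>R gs n x) $ i - \<phi>' x $ j * (indicator \<Omega> x *\<^sub>R us n x) $ i)"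
        unfolding ie by (intro Bochner_Integration.integral_diff[symmetric] ii gL uL)
      also have "\<bar>\<dots>\<bar> \<le> (LINT x|lebesgue. \<bar>\<phi>' x $ j * (indicator \<Omega> x *\<^sub>R gs n x) $ i - \<phi>' x $ j * (indicator \<Omega> x *\<^sub>R us n x) $ i\<bar>)"
        by (rule integral_abs_bound)
      also have "\<dots> \<le> (LINT x|lebesgue. K * (indicator \<Omega> x *\<^sub>R norm (us n x - gs n x)))"
      proof (intro integral_mono integrable_abs Bochner_Integration.integrable_diff ii gL uL integrable_mult_right id)
        fix x
        have "\<bar>\<phi>' x $ j * (gs n x $ i - us n x $ i)\<bar> \<le> K * norm (us n x - gs n x)"
          unfolding abs_mult using \<phi>'b K(1) component_le_norm_cart[of "us n x - gs n x" i] by (intro mult_mono) auto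
        then show "\<bar>\<phi>' x $ j * (indicator \<Omega> x *\<^sub>R gs n x) $ i - \<phi>' x $ j * (indicator \<Omega> x *\<^sub>R us n x) $ i\<bar> \<le>
            K * (indicator \<Omega> x *\<^sub>R norm (us n x - gs n x))"
          by (auto simp: indicator_def right_diff_distrib)
      qed
      finally show ?thesis by (simp add: set_lebesgue_integral_def)
    qed
    then show "(\<lambda>n. signed_integral \<Omega> (\<lambda>B. D n B $ i $ j) \<phi>) \<longlonglongrightarrow> 0"
      by (intro tendsto_0_le[OF L1, where K=K] always_eventually allI)
        (auto simp: mult.commute intro!: order_trans[OF _ mult_left_mono[OF abs_ge_self K(1)]])
  qed
  show "weak_star_M \<Omega> (\<lambda>n. deriv_measure \<Omega> (us n)) (deriv_measure \<Omega> g)"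
    unfolding weak_star_M_def
  proof
    fix \<phi> assume \<phi>: "\<phi> \<in> C0 \<Omega>"
    have "vector_integral \<Omega> (deriv_measure \<Omega> (us n)) \<phi> = vector_integral \<Omega> (deriv_measure \<Omega> (gs n)) \<phi> + vector_integral \<Omega> (D n) \<phi>" for n
    proof -
      have "deriv_measure \<Omega> (gs n) \<in> radon_measures \<Omega>" using deriv_measure_BV[OF \<Omega> gs[of n]] by (simp add: is_deriv_measure_def)
      then show ?thesis unfolding D(2) by (rule vector_integral_add[OF _ D(1) C0_bdd_borel[OF \<Omega> \<phi>]])
    qed
    moreover have "(\<lambda>n. vector_integral \<Omega> (D n) \<phi>) \<longlonglongrightarrow> (\<Sum>b\<in>Basis. 0 *\<^sub>R b)"
      unfolding vector_integral_def
    proof (intro tendsto_sum tendsto_scaleR tendsto_const)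
      fix b :: "real^'n^'d" assume "b \<in> Basis"
      then obtain i j where "b = axis i (axis j 1)" by (auto simp: Basis_vec_def)
      then have "A \<bullet> b = A $ i $ j" for A by (simp add: inner_axis)
      then show "(\<lambda>n. signed_integral \<Omega> (\<lambda>B. D n B \<bullet> b) \<phi>) \<longlonglongrightarrow> 0" using Dnull[OF \<phi>] by simp
    qed
    ultimately show "(\<lambda>n. vector_integral \<Omega> (deriv_measure \<Omega> (us n)) \<phi>) \<longlonglongrightarrow> vector_integral \<Omega> (deriv_measure \<Omega> g) \<phi>"
      using tendsto_add[OF gw[unfolded weak_star_M_def, rule_format, OF \<phi>]] by fastforce
  qed
qed


theorem theorem6p1:
  fixes W :: "real^'n^'d \<Rightarrow> real"
    and \<psi> :: "real^'d \<Rightarrow> real^'n \<Rightarrow> real"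
  assumes W_nonneg: "\<And>A. W A \<ge> 0"
    and W_cont: "continuous_on UNIV W"
    and psi_nonneg: "\<And>v \<nu>. \<nu> \<in> sphere 0 1 \<Longrightarrow> \<psi> v \<nu> \<ge> 0"
    and psi_cont: "continuous_on (UNIV \<times> sphere 0 1) (\<lambda>(v, \<nu>). \<psi> v \<nu>)"
    and W1: "\<exists>c_W>0. \<exists>C_W>0. \<forall>A. c_W * norm A \<le> W A \<and> W A \<le> C_W * (1 + norm A)"
    and W2: "\<exists>L. L-lipschitz_on UNIV W"
    and W3: "\<exists>c>0. \<exists>\<alpha>. 0 < \<alpha> \<and> \<alpha> < 1 \<and>
               (\<forall>A. \<forall>t>0. t * norm A \<ge> 1 \<longrightarrow>
                  \<bar>recession W A - W (t *\<^sub>R A) / t\<bar> \<le> c * norm A powr (1 - \<alpha>) / t powr \<alpha>)"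
    and psi1: "\<exists>c_psi>0. \<exists>C_psi>0. \<forall>v. \<forall>\<nu>\<in>sphere 0 1.
                 c_psi * norm v \<le> \<psi> v \<nu> \<and> \<psi> v \<nu> \<le> C_psi * norm v"
    and psi2_hom: "\<And>v \<nu> t. \<nu> \<in> sphere 0 1 \<Longrightarrow> t > 0 \<Longrightarrow> \<psi> (t *\<^sub>R v) \<nu> = t * \<psi> v \<nu>"
    and psi2_even: "\<And>v \<nu>. \<nu> \<in> sphere 0 1 \<Longrightarrow> \<psi> (- v) (- \<nu>) = \<psi> v \<nu>"
    and psi3: "\<And>v1 v2 \<nu>. \<nu> \<in> sphere 0 1 \<Longrightarrow> \<psi> (v1 + v2) \<nu> \<le> \<psi> v1 \<nu> + \<psi> v2 \<nu>"
  shows "\<exists>R0>0. \<forall>\<Omega>::(real^'n) set. bounded_lipschitz_domain \<Omega> \<longrightarrow>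
           (\<forall>R\<ge>R0. \<forall>g\<in>BV \<Omega>. \<forall>G\<in>radon_measures \<Omega>.
              relaxed_energy_hat W \<psi> R \<Omega> g G = relaxed_energy W \<psi> \<Omega> g G)"
proof -
  obtain L where L: "L-lipschitz_on UNIV W" using W2 by blast
  obtain C where C: "C > 0" "\<And>w \<nu>. \<nu> \<in> sphere 0 1 \<Longrightarrow> \<psi> w \<nu> \<le> C * norm w" using psi1 by blast
  let ?k = "face_const TYPE('n) TYPE('d)"
  have k: "?k \<ge> 0" unfolding face_const_def using hausdorff_const_nonneg by (intro mult_nonneg_nonneg) auto
  have L0: "L \<ge> 0" by (rule lipschitz_on_nonneg[OF L])
  show ?thesis
  \<comment> \<open>L covers the change of the bulk energy, \<open>C * ?k\<close> the added jumps,
    and 1 makes the threshold positive.\<close>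
  proof (intro exI[of _ "L + C * ?k + 1"] conjI allI impI ballI antisym)
    show "0 < L + C * ?k + 1" using L0 C(1) k by (intro add_nonneg_pos add_nonneg_nonneg mult_nonneg_nonneg) auto
    fix \<Omega> :: "(real^'n) set" and R and g :: "real^'n \<Rightarrow> real^'d" and G :: "(real^'n) set \<Rightarrow> real^'n^'d"
    assume "bounded_lipschitz_domain \<Omega>" and R: "L + C * ?k + 1 \<le> R" and g: "g \<in> BV \<Omega>" and "G \<in> radon_measures \<Omega>"
    then have \<Omega>: "open \<Omega>" "bounded \<Omega>" by (auto simp: bounded_lipschitz_domain_def)
    have \<Omega>b: "\<Omega> \<in> sets borel" using \<Omega> by simp
    have Rp: "R > 0" "R \<ge> L + C * ?k" using R L0 C(1) k by (auto intro!: less_le_trans[OF add_nonneg_pos R] add_nonneg_nonneg mult_nonneg_nonneg)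
    have ac: "ac_grad \<Omega> u \<in> L1 \<Omega>" if "u \<in> SBV \<Omega>" for u :: "real^'n \<Rightarrow> real^'d"
    proof -
      have "deriv_measure \<Omega> u \<in> radon_measures \<Omega>" using that deriv_measure_BV[OF \<Omega>(1), of u] by (auto simp: SBV_def is_deriv_measure_def)
      then show ?thesis unfolding ac_grad_def by (rule ac_density(1)[OF \<Omega>b])
    qed
    show "relaxed_energy_hat W \<psi> R \<Omega> g G \<le> relaxed_energy W \<psi> \<Omega> g G"
      unfolding relaxed_energy_hat_def relaxed_energy_def
    proof (intro Inf_superset_mono subsetI, elim CollectE exE conjE, intro CollectI)
      fix e us
      assume e: "e = liminf (\<lambda>n. energy W \<psi> \<Omega> (us n))" and us: "\<forall>n. us n \<in> SBV \<Omega>" "weak_star_BV \<Omega> us g"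
        "weak_star_M \<Omega> (\<lambda>n. L1_measure \<Omega> (ac_grad \<Omega> (us n))) G"
      \<comment> \<open>A competitor paired with its own gradient has zero penalty, so every
        competitor for the constrained problem is one for the penalised problem.\<close>
      have "energy_hat W \<psi> R \<Omega> u (ac_grad \<Omega> u) = energy W \<psi> \<Omega> u" for u :: "real^'n \<Rightarrow> real^'d"
        by (simp add: energy_hat_def energy_def)
      then show "\<exists>gs Gs. e = liminf (\<lambda>n. energy_hat W \<psi> R \<Omega> (gs n) (Gs n)) \<and> (\<forall>n. gs n \<in> SBV \<Omega> \<and> Gs n \<in> L1 \<Omega>) \<and>
          weak_star_BV \<Omega> gs g \<and> weak_star_M \<Omega> (\<lambda>n. L1_measure \<Omega> (Gs n)) G"
        using e us ac by (intro exI[of _ us] exI[of _ "\<lambda>n. ac_grad \<Omega> (us n)"]) simp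
    qed
    show "relaxed_energy W \<psi> \<Omega> g G \<le> relaxed_energy_hat W \<psi> R \<Omega> g G"
      unfolding relaxed_energy_hat_def
    proof (intro Inf_greatest, elim CollectE exE conjE)
      fix e gs Gs
      assume e: "e = liminf (\<lambda>n. energy_hat W \<psi> R \<Omega> (gs n) (Gs n))" and gG: "\<forall>n. gs n \<in> SBV \<Omega> \<and> Gs n \<in> L1 \<Omega>"
        and wg: "weak_star_BV \<Omega> gs g" and wG: "weak_star_M \<Omega> (\<lambda>n. L1_measure \<Omega> (Gs n)) G"
      show "relaxed_energy W \<psi> \<Omega> g G \<le> e"
      proof (cases "e = top")
        case False
        \<comment> \<open>Along a subsequence realising the lower limit the energies are eventually
          bounded, and with them the penalties.\<close>
        obtain r0 :: "nat \<Rightarrow> nat" where r0: "strict_mono r0" "((\<lambda>n. energy_hat W \<psi> R \<Omega> (gs n) (Gs n)) \<circ> r0) \<longlonglongrightarrow> e"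
          using liminf_subseq_lim[of "\<lambda>n. energy_hat W \<psi> R \<Omega> (gs n) (Gs n)"] e by blast
        obtain M :: real where M: "M \<ge> 0" "e < ennreal M"
        proof -
          obtain y where y: "e < y" "y < top" using False dense top.not_eq_extremum by blast
          then show ?thesis using that[of "enn2real y"] by simp
        qed
        have "\<forall>\<^sub>F n in sequentially. ((\<lambda>n. energy_hat W \<psi> R \<Omega> (gs n) (Gs n)) \<circ> r0) n < ennreal M"
          by (rule order_tendstoD(2)[OF r0(2) M(2)])
        then obtain n0 where n0: "\<And>n. n \<ge> n0 \<Longrightarrow> energy_hat W \<psi> R \<Omega> (gs (r0 n)) (Gs (r0 n)) < ennreal M"
          by (auto simp: eventually_sequentially)
        define r where "r n = r0 (n + n0)" for n
        have r: "strict_mono r" using r0(1) by (auto simp: r_def strict_mono_def)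
        have rl: "(\<lambda>n. energy_hat W \<psi> R \<Omega> (gs (r n)) (Gs (r n))) \<longlonglongrightarrow> e"
          using LIMSEQ_ignore_initial_segment[OF r0(2), of n0] by (simp add: r_def o_def)
        define N where "N n = (LINT x:\<Omega>|lebesgue. norm (ac_grad \<Omega> (gs (r n)) x - Gs (r n) x))" for n
        have N0: "N n \<ge> 0" for n unfolding N_def set_lebesgue_integral_def by (intro Bochner_Integration.integral_nonneg) simp
        \<comment> \<open>Bulk and surface energy are nonnegative, so the penalty alone is below the
          energy bound \<open>M\<close>.\<close>
        have NM: "N n \<le> M / R" for n
        proof -
          have d: "(\<lambda>x. ac_grad \<Omega> (gs (r n)) x - Gs (r n) x) \<in> L1 \<Omega>" using ac[of "gs (r n)"] gG by (simp add: L1_def)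
          have "ennreal (R * N n) = (\<integral>\<^sup>+x\<in>\<Omega>. ennreal (R * norm (ac_grad \<Omega> (gs (r n)) x - Gs (r n) x)) \<partial>lebesgue)"
            unfolding N_def using set_nn_integral_eq_integral[OF \<Omega>b d, of R] Rp by simp
          also have "\<dots> \<le> (\<integral>\<^sup>+x\<in>\<Omega>. ennreal (W (ac_grad \<Omega> (gs (r n)) x) + R * norm (ac_grad \<Omega> (gs (r n)) x - Gs (r n) x)) \<partial>lebesgue)"
            using W_nonneg by (intro nn_integral_mono mult_right_mono ennreal_leI) auto
          also have "\<dots> \<le> energy_hat W \<psi> R \<Omega> (gs (r n)) (Gs (r n))"
            unfolding energy_hat_def by simp
          also have "\<dots> \<le> ennreal M" using n0[of "n + n0"] by (simp add: r_def)
          finally have "R * N n \<le> M" using M(1) by (simp add: ennreal_le_iff)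
          then show ?thesis using Rp(1) by (simp add: field_simps)
        qed
        \<comment> \<open>The tolerance \<open>inverse (real (Suc n))\<close> forces the correctors
          to 0 in L^1.\<close>
        let ?P = "\<lambda>n u D. u \<in> SBV \<Omega> \<and> (AE x in lebesgue. x \<in> \<Omega> \<longrightarrow> ac_grad \<Omega> u x = Gs (r n) x) \<and>
           (LINT x:\<Omega>|lebesgue. norm (u x - gs (r n) x)) \<le> inverse (real (Suc n)) * measure lebesgue \<Omega> \<and>
           (\<forall>\<psi> C. (\<forall>w. \<forall>\<nu>\<in>sphere 0 1. \<psi> (- w) (- \<nu>) = \<psi> w \<nu>) \<longrightarrow> C \<ge> 0 \<longrightarrow> (\<forall>w. \<forall>\<nu>\<in>sphere 0 1. \<psi> w \<nu> \<le> C * norm w) \<longrightarrow>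
             surface_energy \<psi> \<Omega> u \<le> surface_energy \<psi> \<Omega> (gs (r n)) + ennreal (C * ?k * N n)) \<and>
           D \<in> radon_measures \<Omega> \<and> deriv_measure \<Omega> u = (\<lambda>B. deriv_measure \<Omega> (gs (r n)) B + D B) \<and>
           (\<forall>\<phi>\<in>bdd_borel \<Omega>. \<forall>K\<ge>0. (\<forall>x\<in>\<Omega>. \<bar>\<phi> x\<bar> \<le> K) \<longrightarrow>
             (\<forall>i m. \<bar>signed_integral \<Omega> (\<lambda>B. D B $ i $ m) \<phi>\<bar> \<le> (1 + 8 * CARD('n) * CARD('d)) * N n * K))"
        have "\<exists>u D. ?P n u D" for n
          unfolding N_def by (rule approximation[OF \<Omega>]) (use gG in auto)
        then have "\<exists>p. ?P n (fst p) (snd p)" for n by simp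
        then have "\<exists>p. \<forall>n. ?P n (fst (p n)) (snd (p n))" by (intro choice allI)
        then obtain p where p: "\<forall>n. ?P n (fst (p n)) (snd (p n))" by (elim exE) (rule that)
        define us where "us n = fst (p n)" for n
        define D where "D n = snd (p n)" for n
        have P: "?P n (us n) (D n)" for n using p unfolding us_def D_def by (rule spec)
        have usS: "us n \<in> SBV \<Omega>" for n using P by blast
        have acG: "AE x in lebesgue. x \<in> \<Omega> \<longrightarrow> ac_grad \<Omega> (us n) x = Gs (r n) x" for n using P by blast
        have surf: "surface_energy \<psi> \<Omega> (us n) \<le> surface_energy \<psi> \<Omega> (gs (r n)) + ennreal (C * ?k * N n)" for n
          using P[of n] psi2_even C by simp
        have "energy W \<psi> \<Omega> (us n) \<le> energy_hat W \<psi> R \<Omega> (gs (r n)) (Gs (r n))" for n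
          by (rule energy_le_energy_hat[OF \<Omega>b L W_nonneg ac _ Rp(2) _ acG])
            (use gG surf[of n] C(1) k in \<open>auto simp: N_def intro: mult_nonneg_nonneg\<close>)
        then have "liminf (\<lambda>n. energy W \<psi> \<Omega> (us n)) \<le> liminf (\<lambda>n. energy_hat W \<psi> R \<Omega> (gs (r n)) (Gs (r n)))"
          by (intro Liminf_mono always_eventually allI)
        also have "\<dots> = e" by (rule lim_imp_Liminf[OF _ rl]) simp
        finally have le: "liminf (\<lambda>n. energy W \<psi> \<Omega> (us n)) \<le> e" .
        have wr: "weak_star_M \<Omega> (\<lambda>n. \<mu> (r n)) \<nu>" if "weak_star_M \<Omega> \<mu> \<nu>" for \<mu> and \<nu> :: "(real^'n) set \<Rightarrow> real^'n^'d"
          using that LIMSEQ_subseq_LIMSEQ[OF _ r] unfolding weak_star_M_def o_def by blast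
        have wgr: "weak_star_BV \<Omega> (\<lambda>n. gs (r n)) g"
          using wg wr[of "\<lambda>n. deriv_measure \<Omega> (gs n)"] LIMSEQ_subseq_LIMSEQ[OF _ r] unfolding weak_star_BV_def o_def by blast
        have "weak_star_BV \<Omega> us g"
        proof (rule weak_star_BV_perturb[OF \<Omega>(1) _ _ g wgr])
          show "us n \<in> BV \<Omega>" "gs (r n) \<in> BV \<Omega>" for n using usS gG by (auto simp: SBV_def)
          show "D n \<in> radon_measures \<Omega>" "deriv_measure \<Omega> (us n) = (\<lambda>B. deriv_measure \<Omega> (gs (r n)) B + D n B)" for n
            using P[of n] by blast+
          show "(\<lambda>n. LINT x:\<Omega>|lebesgue. norm (us n x - gs (r n) x)) \<longlonglongrightarrow> 0"
          proof (rule tendsto_sandwich[OF _ _ tendsto_const])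
            show "(\<lambda>n. inverse (real (Suc n)) * measure lebesgue \<Omega>) \<longlonglongrightarrow> 0"
              using tendsto_mult_right[OF LIMSEQ_inverse_real_of_nat, of "measure lebesgue \<Omega>"] by simp
            show "\<forall>\<^sub>F n in sequentially. 0 \<le> (LINT x:\<Omega>|lebesgue. norm (us n x - gs (r n) x))"
              unfolding set_lebesgue_integral_def by (intro always_eventually allI Bochner_Integration.integral_nonneg) simp
            show "\<forall>\<^sub>F n in sequentially. (LINT x:\<Omega>|lebesgue. norm (us n x - gs (r n) x)) \<le> inverse (real (Suc n)) * measure lebesgue \<Omega>"
              using P by (intro always_eventually allI) blast
          qed
          fix n i j and \<phi> :: "real^'n \<Rightarrow> real" and K :: real
          assume \<phi>: "\<phi> \<in> bdd_borel \<Omega>" "\<And>x. x \<in> \<Omega> \<Longrightarrow> \<bar>\<phi> x\<bar> \<le> K" "K \<ge> 0"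
          then have "\<bar>signed_integral \<Omega> (\<lambda>B. D n B $ i $ j) \<phi>\<bar> \<le> (1 + 8 * CARD('n) * CARD('d)) * N n * K"
            using P[of n] by blast
          also have "\<dots> \<le> (1 + 8 * CARD('n) * CARD('d)) * (M / R) * K"
            using NM[of n] \<phi>(3) by (intro mult_right_mono mult_left_mono) auto
          finally show "\<bar>signed_integral \<Omega> (\<lambda>B. D n B $ i $ j) \<phi>\<bar> \<le> (1 + 8 * CARD('n) * CARD('d)) * (M / R) * K" .
        qed
        \<comment> \<open>The gradients now equal \<open>Gs (r n)\<close> almost everywhere, so the
          constraint on their weak* limit holds exactly.\<close>
        moreover have "L1_measure \<Omega> (ac_grad \<Omega> (us n)) = L1_measure \<Omega> (Gs (r n))" for n
          using gG by (intro L1_measure_cong_AE[OF \<Omega>b ac[OF usS] _ acG]) auto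
        then have "weak_star_M \<Omega> (\<lambda>n. L1_measure \<Omega> (ac_grad \<Omega> (us n))) G" using wr[OF wG] by simp
        ultimately have "relaxed_energy W \<psi> \<Omega> g G \<le> liminf (\<lambda>n. energy W \<psi> \<Omega> (us n))"
          unfolding relaxed_energy_def using usS by (intro Inf_lower) blast
        then show ?thesis using le by (rule order_trans)
      qed simp
    qed
  qed
qed

end
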